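(* Let $\beta\in\{1,2,4\}$, $N\ge1$, $\sigma>0$, $c>0$. Let $X$ be an $N\times N$ random matrix with independent real ($\beta=1$), complex ($\beta=2$) or quaternion ($\beta=4$) entries whose $\beta$ real components are independent normal random variables with mean $0$ and standard deviation $\sigma$. Let $\mu_1\ge\cdots\ge\mu_N$ be the Lyapunov exponents of the product of independent copies of the random matrix $Y=I_N+\frac1cX$, let $Y_k$ be the matrix formed by the first $k$ columns of $Y$, and let $W_k=Y_k^\dagger Y_k$. Then for each $k=1,\dots,N$, as $c\to\infty$ with $N,k,\sigma,\beta$ fixed, $$\mu_1+\cdots+\mu_k=\frac12\Big\langle\log\det W_k\Big\rangle=\frac{\sigma^2k\,(\beta(N-k+1)/2-1)}{c^2}+o\Big(\frac1{c^2}\Big).$$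
   Context: $\langle\cdot\rangle$ denotes expectation. The Lyapunov exponents of a product $P_m=Y^{(m)}Y^{(m-1)}\cdots Y^{(1)}$ of i.i.d. $N\times N$ random matrices are the almost surely constant numbers $\mu_1\ge\cdots\ge\mu_N$ determined by $$\mu_1+\cdots+\mu_k=\sup\lim_{m\to\infty}\frac1m\log{\rm Vol}_k\{P_my_1,\dots,P_my_k\},\qquad k=1,\dots,N,$$ the supremum being over sets of linearly independent column vectors $y_1,\dots,y_k$ over the corresponding number system, and ${\rm Vol}_k\{v_1,\dots,v_k\}=(\det V^\dagger V)^{1/2}$ with $V=[v_1\cdots v_k]$. Equivalently $\{e^{\mu_k}\}$ is the spectrum of $\lim_{m\to\infty}(P_m^\dagger P_m)^{1/2m}$. In the quaternion case, with quaternions represented as $2\times2$ complex blocks, determinants such as $\det V^\dagger V$ and $\det W_k$ are the product of the $k$ doubly degenerate eigenvalues, each counted once. *)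

theory Defs
  imports
    "HOL-Probability.Probability"
    "HOL-Library.Landau_Symbols"
    "Jordan_Normal_Form.Char_Poly"
    "Jordan_Normal_Form.Schur_Decomposition"
begin

text \<open>
  The number systems are indexed by the Dyson index \<open>\<beta>\<close>: real (\<open>\<beta> = 1\<close>), complex (\<open>\<beta> = 2\<close>) and
  quaternion (\<open>\<beta> = 4\<close>). A number is given by its real components \<open>q 0, \<dots>, q (\<beta> - 1)\<close> and is
  represented by a complex block of size \<open>block_dim \<beta>\<close>; a quaternion is a \<open>2 \<times> 2\<close> block.
\<close>

definition block_dim :: "nat \<Rightarrow> nat" where
  "block_dim \<beta> = (if \<beta> = 4 then 2 else 1)"

definition number_block :: "nat \<Rightarrow> (nat \<Rightarrow> real) \<Rightarrow> complex mat" where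
  "number_block \<beta> q =
     (if \<beta> = 1 then mat_of_rows_list 1 [[complex_of_real (q 0)]]
      else if \<beta> = 2 then mat_of_rows_list 1 [[Complex (q 0) (q 1)]]
      else mat_of_rows_list 2
        [[Complex (q 0) (q 1), Complex (q 2) (q 3)],
         [Complex (- q 2) (q 3), Complex (q 0) (- q 1)]])"

definition number_matrix ::
  "nat \<Rightarrow> nat \<Rightarrow> nat \<Rightarrow> (nat \<Rightarrow> nat \<Rightarrow> nat \<Rightarrow> real) \<Rightarrow> complex mat" where
  "number_matrix \<beta> n m x =
     (let d = block_dim \<beta> in
      mat (d * n) (d * m)
        (\<lambda>(r, s). number_block \<beta> (x (r div d) (s div d)) $$ (r mod d, s mod d)))"

definition number_carrier :: "nat \<Rightarrow> nat \<Rightarrow> nat \<Rightarrow> complex mat set" where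
  "number_carrier \<beta> n m = range (number_matrix \<beta> n m)"

definition first_columns :: "nat \<Rightarrow> nat \<Rightarrow> complex mat \<Rightarrow> complex mat" where
  "first_columns \<beta> k A = mat (dim_row A) (block_dim \<beta> * k) (\<lambda>(i, j). A $$ (i, j))"

text \<open>
  In the quaternion case this is used for self-dual Hermitian matrices, whose eigenvalues have even
  multiplicity; each doubly degenerate eigenvalue enters the product once.
\<close>

definition number_det :: "nat \<Rightarrow> complex mat \<Rightarrow> complex" where
  "number_det \<beta> A =
     (if \<beta> = 4
      then \<Prod>z | eigenvalue A z. z ^ (Polynomial.order z (char_poly A) div 2)
      else Determinant.det A)"

text \<open>The determinant of the matrix \<open>V\<^sup>\<dagger> V\<close> is a nonnegative real number.\<close>

definition gram_det :: "nat \<Rightarrow> complex mat \<Rightarrow> real" where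
  "gram_det \<beta> V = Re (number_det \<beta> (mat_adjoint V * V))"

definition Vol :: "nat \<Rightarrow> complex mat \<Rightarrow> real" where
  "Vol \<beta> V = sqrt (gram_det \<beta> V)"

text \<open>
  Linear independence of the \<open>k\<close> columns of \<open>V\<close> over the number system; quaternion scalars act on
  column vectors from the right.
\<close>

definition independent_columns :: "nat \<Rightarrow> nat \<Rightarrow> complex mat \<Rightarrow> bool" where
  "independent_columns \<beta> k V \<longleftrightarrow>
     (\<forall>a \<in> number_carrier \<beta> k 1.
        V * a = 0\<^sub>m (dim_row V) (block_dim \<beta>) \<longrightarrow> a = 0\<^sub>m (block_dim \<beta> * k) (block_dim \<beta>))"

fun left_product :: "nat \<Rightarrow> (nat \<Rightarrow> complex mat) \<Rightarrow> nat \<Rightarrow> complex mat" where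
  "left_product n A 0 = 1\<^sub>m n"
| "left_product n A (Suc m) = A m * left_product n A m"

definition ext_ln :: "real \<Rightarrow> ereal" where
  "ext_ln x = (if x = 0 then - \<infinity> else ereal (ln x))"

text \<open>
  The limits of \<open>(1/m) log Vol\<^sub>k {P\<^sub>m y\<^sub>1, \<dots>, P\<^sub>m y\<^sub>k}\<close>, one for each linearly independent
  \<open>y\<^sub>1, \<dots>, y\<^sub>k\<close> (the columns of \<open>V\<close>) for which it exists in the extended reals.
\<close>

definition growth_rates :: "nat \<Rightarrow> nat \<Rightarrow> (nat \<Rightarrow> complex mat) \<Rightarrow> nat \<Rightarrow> ereal set" where
  "growth_rates \<beta> N A k =
     {L. \<exists>V \<in> number_carrier \<beta> N k. independent_columns \<beta> k V \<and>
         (\<lambda>m. ext_ln (Vol \<beta> (left_product (block_dim \<beta> * N) A m * V)) / ereal (real m))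
           \<longlonglongrightarrow> L}"

text \<open>
  \<open>lyapunov_sum\<close> is the almost surely constant value of \<open>\<mu>\<^sub>1 + \<dots> + \<mu>\<^sub>k\<close>; it is \<open>0\<close> for
  \<open>k = 0\<close>, where the only volume is that of the empty family. These sums determine the exponents.
\<close>

definition lyapunov_sum ::
  "'w measure \<Rightarrow> nat \<Rightarrow> nat \<Rightarrow> (nat \<Rightarrow> 'w \<Rightarrow> complex mat) \<Rightarrow> nat \<Rightarrow> real" where
  "lyapunov_sum M \<beta> N Y k =
     (THE l::real. AE \<omega> in M. Sup (growth_rates \<beta> N (\<lambda>m. Y m \<omega>) k) = ereal l)"

definition lyapunov_exponent ::
  "'w measure \<Rightarrow> nat \<Rightarrow> nat \<Rightarrow> (nat \<Rightarrow> 'w \<Rightarrow> complex mat) \<Rightarrow> nat \<Rightarrow> real" where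
  "lyapunov_exponent M \<beta> N Y k = lyapunov_sum M \<beta> N Y k - lyapunov_sum M \<beta> N Y (k - 1)"

text \<open>
  \<open>X m \<omega> i j a\<close> is the real component \<open>a\<close> of the entry \<open>(i, j)\<close> of the \<open>m\<close>-th copy. That the
  copies are independent and have independent entries with independent components is the joint
  independence of the whole family of components.
\<close>

definition iid_gaussian_matrices ::
  "'w measure \<Rightarrow> nat \<Rightarrow> nat \<Rightarrow> real \<Rightarrow> (nat \<Rightarrow> 'w \<Rightarrow> nat \<Rightarrow> nat \<Rightarrow> nat \<Rightarrow> real) \<Rightarrow> bool" where
  "iid_gaussian_matrices M \<beta> N \<sigma> X \<longleftrightarrow>
     prob_space M \<and>
     prob_space.indep_vars M (\<lambda>_. borel) (\<lambda>(m, i, j, a) \<omega>. X m \<omega> i j a)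
       (UNIV \<times> {..<N} \<times> {..<N} \<times> {..<\<beta>}) \<and>
     (\<forall>m. \<forall>i<N. \<forall>j<N. \<forall>a<\<beta>.
        distributed M lborel (\<lambda>\<omega>. X m \<omega> i j a) (\<lambda>x. ennreal (normal_density 0 \<sigma> x)))"

definition perturbed_identity ::
  "nat \<Rightarrow> nat \<Rightarrow> real \<Rightarrow> (nat \<Rightarrow> nat \<Rightarrow> nat \<Rightarrow> real) \<Rightarrow> complex mat" where
  "perturbed_identity \<beta> N c x =
     1\<^sub>m (block_dim \<beta> * N) + complex_of_real (1 / c) \<cdot>\<^sub>m number_matrix \<beta> N N x"

end

theory Submission
  imports Defs
begin

text \<open>Write \<open>D V\<close> for the determinant of \<open>V\<^sup>\<dagger> V\<close> as a complex matrix. A Gaussian matrix is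
  invariant under unitary conjugation, so the law of \<open>D (Y V) / D V\<close> does not depend on \<open>V\<close>.
  Hence the expectation of the \<open>t\<close>-th power of \<open>D (P\<^sub>m V)\<close> is \<open>\<phi>(t)\<^sup>m\<close> times that of \<open>D V\<close>, also
  for small negative \<open>t\<close>, and Markov's inequality with \<open>t \<rightarrow> 0\<close> and the Borel-Cantelli lemma show that
  \<open>ln (D (P\<^sub>m V)) / m\<close> tends almost surely to the expectation of \<open>ln (D (Y E))\<close>, where \<open>E\<close> is the
  standard frame. The exceptional null set depends on \<open>V\<close>; but \<open>D (P\<^sub>m V)\<close> is a polynomial in the real
  components of \<open>V\<close>, of a degree independent of \<open>m\<close>, so interpolation on an integer grid extends
  the upper bound to all frames outside one null set.

  For the asymptotics, \<open>ln (D ((1 + \<epsilon> X) E))\<close> is expanded to second order where \<open>\<epsilon> X\<close> is small. The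
  complement is negligible because \<open>D ((1 + \<epsilon> X) E)\<close> has a negative moment: along the segments
  \<open>X + t 1\<close> it is the modulus of a polynomial in \<open>t\<close>.\<close>

section \<open>Block matrices over the three number systems\<close>

text \<open>Three obstacles shape the proof. First, a quaternion determinant is awkward to compute
  with, so all estimates concern the complex determinant \<open>D\<close>, which is
  \<open>gram_det\<close> to the power \<open>d\<close>; a factor 1 / (2 d) returns in the logarithm
  of the volume, the 2 coming from the square root in \<open>Vol\<close>. Second, the Gaussian law
  is invariant only under unitaries that respect the number system, so reflections, QR factorization
  and diagonalization are carried out on whole block columns. Third, \<open>D\<close> can vanish,
  where \<open>ln\<close> and \<open>powr\<close> take default values that hide the singularity;
  moments are therefore taken in the extended nonnegative reals, and a finite negative moment shows
  that the zero set is null.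

  The supremum in \<open>growth_rates\<close> makes the two bounds asymmetric: the upper bound is
  needed for all frames at once, the lower bound for the standard frame alone.

  In the expansion the negative moment may grow like \<epsilon> to the power - 1 / 2. It enters with
  the weight \<epsilon>^4, and the price of this weight is a seventh moment of the Gaussian
  radius.\<close>

lemma dim_mat_adjoint [simp]: "dim_row (mat_adjoint A) = dim_col A" "dim_col (mat_adjoint A) = dim_row A"
  by (auto simp: mat_adjoint_def)

lemma index_mat_adjoint [simp]:
  fixes A :: "complex mat"
  assumes "i < dim_col A" "j < dim_row A"
  shows "mat_adjoint A $$ (i, j) = cnj (A $$ (j, i))"
  using assms by (simp add: mat_adjoint_def mat_of_rows_index)

lemma mat_adjoint_carrier [simp, intro]:
  "A \<in> carrier_mat n m \<Longrightarrow> mat_adjoint A \<in> carrier_mat m n"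
  by auto

lemma index_mult_mat_sum:
  assumes "A \<in> carrier_mat n m" "B \<in> carrier_mat m l" "i < n" "j < l"
  shows "(A * B) $$ (i, j) = (\<Sum>p<m. A $$ (i, p) * B $$ (p, j))"
  using assms by (auto simp: scalar_prod_def atLeast0LessThan intro!: sum.cong)

lemma mat_adjoint_mult:
  fixes A B :: "complex mat"
  assumes "A \<in> carrier_mat n m" "B \<in> carrier_mat m l"
  shows "mat_adjoint (A * B) = mat_adjoint B * mat_adjoint A"
proof (rule eq_matI)
  fix i j assume "i < dim_row (mat_adjoint B * mat_adjoint A)" "j < dim_col (mat_adjoint B * mat_adjoint A)"
  with assms have ij: "i < l" "j < n" by auto
  have "mat_adjoint (A * B) $$ (i, j) = cnj ((A * B) $$ (j, i))"
    using assms ij by (intro index_mat_adjoint) auto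
  also have "\<dots> = (\<Sum>p<m. cnj (A $$ (j, p)) * cnj (B $$ (p, i)))"
    using ij by (subst index_mult_mat_sum[OF assms]) auto
  also have "\<dots> = (mat_adjoint B * mat_adjoint A) $$ (i, j)"
    using assms ij by (subst index_mult_mat_sum[of _ l m _ n]) (auto simp: mult.commute intro!: sum.cong)
  finally show "mat_adjoint (A * B) $$ (i, j) = (mat_adjoint B * mat_adjoint A) $$ (i, j)" .
qed (use assms in auto)

lemma mat_adjoint_adjoint [simp]: "mat_adjoint (mat_adjoint A) = (A :: complex mat)"
  by (rule eq_matI) auto

lemma mat_adjoint_one [simp]: "mat_adjoint (1\<^sub>m n) = (1\<^sub>m n :: complex mat)"
  by (rule eq_matI) auto

lemma mat_adjoint_add:
  fixes A B :: "complex mat"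
  assumes "A \<in> carrier_mat n m" "B \<in> carrier_mat n m"
  shows "mat_adjoint (A + B) = mat_adjoint A + mat_adjoint B"
  using assms by (intro eq_matI) auto

lemma mat_adjoint_smult: "mat_adjoint (c \<cdot>\<^sub>m A) = cnj c \<cdot>\<^sub>m mat_adjoint (A :: complex mat)"
  by (intro eq_matI) auto

lemma det_mat_adjoint:
  fixes A :: "complex mat"
  assumes A: "A \<in> carrier_mat n n"
  shows "Determinant.det (mat_adjoint A) = cnj (Determinant.det A)"
proof -
  interpret cnj_hom: comm_ring_hom cnj by unfold_locales auto
  have "mat_adjoint A = transpose_mat (map_mat cnj A)"
    using A by (intro eq_matI) auto
  thus ?thesis using det_transpose[of "map_mat cnj A" n] A cnj_hom.hom_det[of A] by auto
qed

section \<open>Squared Frobenius norm and trace\<close>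

definition frob2 :: "complex mat \<Rightarrow> real" where
  "frob2 A = (\<Sum>i<dim_row A. \<Sum>j<dim_col A. (cmod (A $$ (i, j)))\<^sup>2)"

definition mtrace :: "complex mat \<Rightarrow> complex" where
  "mtrace A = (\<Sum>i<dim_row A. A $$ (i, i))"

lemma mtrace_mult_commute:
  assumes "A \<in> carrier_mat n m" "B \<in> carrier_mat m n"
  shows "mtrace (A * B) = mtrace (B * A)"
proof -
  have "mtrace (A * B) = (\<Sum>i<n. \<Sum>p<m. A $$ (i, p) * B $$ (p, i))"
    unfolding mtrace_def using assms by (auto simp: index_mult_mat_sum[OF assms] intro!: sum.cong simp del: index_mult_mat(1))
  also have "\<dots> = (\<Sum>p<m. \<Sum>i<n. B $$ (p, i) * A $$ (i, p))"
    by (subst sum.swap) (simp add: mult.commute)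
  also have "\<dots> = mtrace (B * A)"
    unfolding mtrace_def using assms by (auto simp: index_mult_mat_sum[OF assms(2,1)] intro!: sum.cong simp del: index_mult_mat(1))
  finally show ?thesis .
qed

lemma frob2_eq_trace: "complex_of_real (frob2 A) = mtrace (mat_adjoint A * A)"
proof -
  have c: "mat_adjoint A \<in> carrier_mat (dim_col A) (dim_row A)" "A \<in> carrier_mat (dim_row A) (dim_col A)"
    by auto
  have "mtrace (mat_adjoint A * A) = (\<Sum>i<dim_col A. \<Sum>p<dim_row A. cnj (A $$ (p, i)) * A $$ (p, i))"
    unfolding mtrace_def by (simp add: index_mult_mat_sum[OF c] del: index_mult_mat(1))
  also have "\<dots> = complex_of_real (frob2 A)"
    unfolding frob2_def of_real_sum complex_norm_square by (subst sum.swap) (simp add: mult.commute)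
  finally show ?thesis by simp
qed

lemma frob2_nonneg [simp]: "0 \<le> frob2 A"
  by (simp add: frob2_def sum_nonneg)

text \<open>The squared norm is a trace, and cyclicity of the trace cancels the unitary factors. In
  real coordinates this makes conjugation an isometry of the Gaussian space.\<close>

lemma frob2_unitary_conj:
  assumes A: "A \<in> carrier_mat n n" and S: "S \<in> carrier_mat n n" and "mat_adjoint S * S = 1\<^sub>m n"
  shows "frob2 (S * A * mat_adjoint S) = frob2 A"
proof -
  let ?S = "mat_adjoint S"
  have S': "?S \<in> carrier_mat n n" using S by auto
  have A': "mat_adjoint A \<in> carrier_mat n n" using A by auto
  have "mat_adjoint (S * A * ?S) = S * mat_adjoint A * ?S"
    using A S by (simp add: mat_adjoint_mult[of _ n n _ n] assoc_mult_mat[of _ n n _ n _ n])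
  hence "mat_adjoint (S * A * ?S) * (S * A * ?S) = S * mat_adjoint A * (?S * S) * A * ?S"
    using A S S' A' by (simp add: assoc_mult_mat[of _ n n _ n _ n] mult_carrier_mat[of _ n n _ n])
  also have "\<dots> = S * (mat_adjoint A * A * ?S)"
    using A S S' A' assms(3) by (simp add: assoc_mult_mat[of _ n n _ n _ n] mult_carrier_mat[of _ n n _ n])
  finally have "complex_of_real (frob2 (S * A * ?S)) = mtrace (S * (mat_adjoint A * A * ?S))"
    by (simp add: frob2_eq_trace)
  also have "\<dots> = mtrace (mat_adjoint A * A * ?S * S)"
    using A S S' A' by (intro mtrace_mult_commute[of _ n n]) auto
  also have "mat_adjoint A * A * ?S * S = mat_adjoint A * A"
    using A S S' A' assms(3) by (simp add: assoc_mult_mat[of _ n n _ n _ n] mult_carrier_mat[of _ n n _ n])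
  finally show ?thesis by (simp flip: frob2_eq_trace)
qed

section \<open>The three number systems as fixed points of an antilinear symmetry\<close>

locale number_system =
  fixes \<beta> :: nat
  assumes dyson_index: "\<beta> \<in> {1, 2, 4}"
begin

abbreviation d where "d \<equiv> block_dim \<beta>"

definition \<tau> :: "nat \<Rightarrow> nat" where
  "\<tau> i = (if \<beta> = 4 then (if even i then i + 1 else i - 1) else i)"

definition sg :: "nat \<Rightarrow> complex" where
  "sg i = (if \<beta> = 4 \<and> odd i then -1 else 1)"

text \<open>The fixed-point condition of an antilinear involution: complex conjugation for \<beta> =
  1, and complex conjugation followed by conjugation with the standard symplectic form for \<beta> =
  4, where \<open>\<tau>\<close> swaps the two indices of a block and \<open>sg\<close> carries the
  sign. Complex matrices satisfy no condition.\<close>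

definition real_structure :: "complex mat \<Rightarrow> bool" where
  "real_structure A \<longleftrightarrow> \<beta> = 2 \<or>
     (\<forall>i<dim_row A. \<forall>j<dim_col A. A $$ (i, j) = sg i * sg j * cnj (A $$ (\<tau> i, \<tau> j)))"

abbreviation NC where "NC \<equiv> number_carrier \<beta>"

text \<open>Only the first row of each block is read: in a quaternion block it already contains all
  four components. On the number carrier this inverts \<open>number_matrix\<close>.\<close>

definition comps :: "complex mat \<Rightarrow> nat \<Rightarrow> nat \<Rightarrow> nat \<Rightarrow> real" where
  "comps A i j a =
     (if a = 0 then Re (A $$ (d * i, d * j)) else if a = 1 then Im (A $$ (d * i, d * j))
      else if a = 2 then Re (A $$ (d * i, d * j + 1)) else Im (A $$ (d * i, d * j + 1)))"

lemma d_pos [simp]: "0 < d" by (simp add: block_dim_def)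

lemma \<tau>_less: "i < d * n \<Longrightarrow> \<tau> i < d * n"
  by (auto simp: \<tau>_def block_dim_def elim!: evenE)

lemma \<tau>_\<tau> [simp]: "\<tau> (\<tau> i) = i"
  by (auto simp: \<tau>_def)

lemma sg_sg [simp]: "sg i * sg i = 1" "sg i * (sg i * z) = z"
  by (auto simp: sg_def)

lemma cnj_sg [simp]: "cnj (sg i) = sg i" by (auto simp: sg_def)

lemma sum_\<tau>: "(\<Sum>i<d * n. f (\<tau> i)) = (\<Sum>i<d * n. f i)"
proof (rule sum.reindex_bij_betw)
  show "bij_betw \<tau> {..<d * n} {..<d * n}"
    by (rule bij_betwI[of _ _ _ \<tau>]) (auto simp: \<tau>_less)
qed

lemma dim_number_matrix [simp]:
  "dim_row (number_matrix \<beta> n m x) = d * n" "dim_col (number_matrix \<beta> n m x) = d * m"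
  by (auto simp: number_matrix_def Let_def)

lemma number_matrix_carrier [simp, intro]: "number_matrix \<beta> n m x \<in> carrier_mat (d * n) (d * m)"
  by auto

lemma index_number_matrix:
  "r < d * n \<Longrightarrow> s < d * m \<Longrightarrow> number_matrix \<beta> n m x $$ (r, s) =
    number_block \<beta> (x (r div d) (s div d)) $$ (r mod d, s mod d)"
  by (simp add: number_matrix_def Let_def)

lemma number_block_cases:
  obtains "\<beta> = 1" "d = 1" "\<And>q. number_block \<beta> q = mat_of_rows_list 1 [[complex_of_real (q 0)]]"
  | "\<beta> = 2" "d = 1" "\<And>q. number_block \<beta> q = mat_of_rows_list 1 [[Complex (q 0) (q 1)]]"
  | "\<beta> = 4" "d = 2" "\<And>q. number_block \<beta> q = mat_of_rows_list 2
        [[Complex (q 0) (q 1), Complex (q 2) (q 3)], [Complex (- q 2) (q 3), Complex (q 0) (- q 1)]]"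
proof -
  consider "\<beta> = 1" | "\<beta> = 2" | "\<beta> = 4" using dyson_index by auto
  thus ?thesis by cases (auto simp: number_block_def block_dim_def intro: that)
qed

lemma \<tau>_sg_simple: "\<beta> \<noteq> 4 \<Longrightarrow> \<tau> i = i" "\<beta> \<noteq> 4 \<Longrightarrow> sg i = 1"
  unfolding \<tau>_def sg_def by auto

lemma \<tau>_sg_quaternion:
  assumes "\<beta> = 4"
  shows "\<tau> (2 * p) = Suc (2 * p)" "\<tau> (Suc (2 * p)) = 2 * p" "sg (2 * p) = 1" "sg (Suc (2 * p)) = -1"
  using assms unfolding \<tau>_def sg_def by auto

lemma parity_cases:
  fixes i :: nat
  obtains p where "i = 2 * p" | p where "i = Suc (2 * p)"
  by (metis evenE oddE Suc_eq_plus1)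

lemma index_number_matrix_quaternion:
  assumes "d = 2" "\<And>q. number_block \<beta> q = mat_of_rows_list 2
        [[Complex (q 0) (q 1), Complex (q 2) (q 3)], [Complex (- q 2) (q 3), Complex (q 0) (- q 1)]]"
    and "p < n" "q < m"
  shows "number_matrix \<beta> n m x $$ (2 * p, 2 * q) = Complex (x p q 0) (x p q 1)"
    "number_matrix \<beta> n m x $$ (2 * p, Suc (2 * q)) = Complex (x p q 2) (x p q 3)"
    "number_matrix \<beta> n m x $$ (Suc (2 * p), 2 * q) = Complex (- x p q 2) (x p q 3)"
    "number_matrix \<beta> n m x $$ (Suc (2 * p), Suc (2 * q)) = Complex (x p q 0) (- x p q 1)"
  using assms(3,4) by (simp_all add: index_number_matrix assms(1,2) mat_of_rows_list_def)

lemma real_structure_number_matrix: "real_structure (number_matrix \<beta> n m x)"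
proof (cases rule: number_block_cases)
  case 1
  have "\<tau> i = i" "sg i = 1" for i using \<tau>_sg_simple 1(1) by auto
  thus ?thesis unfolding real_structure_def by (intro disjI2) (simp add: index_number_matrix 1(2,3) mat_of_rows_list_def del: One_nat_def)
next
  case 2
  show ?thesis unfolding real_structure_def using 2(1) by blast
next
  case 3
  note \<tau>2 = \<tau>_sg_quaternion[OF 3(1)]
  show ?thesis unfolding real_structure_def
  proof (intro disjI2 allI impI)
    fix i j assume ij: "i < dim_row (number_matrix \<beta> n m x)" "j < dim_col (number_matrix \<beta> n m x)"
    note ix = index_number_matrix_quaternion[OF 3(2,3)]
    show "number_matrix \<beta> n m x $$ (i, j) = sg i * sg j * cnj (number_matrix \<beta> n m x $$ (\<tau> i, \<tau> j))"
      using ij by (cases i rule: parity_cases; cases j rule: parity_cases)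
        (simp_all add: \<tau>2 ix 3(2) complex_eq_iff)
  qed
qed

lemma number_matrix_comps:
  assumes A: "A \<in> carrier_mat (d * n) (d * m)" "real_structure A"
  shows "number_matrix \<beta> n m (comps A) = A"
proof (rule eq_matI)
  fix i j assume "i < dim_row A" "j < dim_col A"
  hence ij: "i < d * n" "j < d * m" using A by auto
  show "number_matrix \<beta> n m (comps A) $$ (i, j) = A $$ (i, j)"
  proof (cases rule: number_block_cases)
    case 1
    hence "A $$ (i, j) = cnj (A $$ (i, j))"
      using A(2) ij A(1) unfolding real_structure_def sg_def \<tau>_def by auto
    hence "Im (A $$ (i, j)) = 0" by (simp add: complex_eq_iff)
    thus ?thesis using ij
      by (simp add: index_number_matrix 1(2,3) mat_of_rows_list_def comps_def complex_eq_iff)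
  next
    case 2
    show ?thesis using ij
      by (simp add: index_number_matrix 2(2,3) mat_of_rows_list_def comps_def complex_eq_iff)
  next
    case 3
    note \<tau>2 = \<tau>_sg_quaternion[OF 3(1)]
    have "\<beta> \<noteq> 2" using 3(1) by simp
    hence e: "A $$ (i, j) = sg i * sg j * cnj (A $$ (\<tau> i, \<tau> j))"
      using A ij \<open>\<beta> \<noteq> 2\<close> unfolding real_structure_def by auto
    note ix = index_number_matrix_quaternion[OF 3(2,3)]
    show ?thesis
      using ij e by (cases i rule: parity_cases; cases j rule: parity_cases)
        (simp_all add: \<tau>2 ix 3(2) complex_eq_iff comps_def)
  qed
qed (use A in auto)

text \<open>Membership becomes an entrywise symmetry, so closure under sums, products and adjoints
  is checked on complex entries, without multiplying quaternions by components.\<close>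

lemma number_carrier_iff: "A \<in> NC n m \<longleftrightarrow> A \<in> carrier_mat (d * n) (d * m) \<and> real_structure A"
proof
  assume "A \<in> NC n m"
  thus "A \<in> carrier_mat (d * n) (d * m) \<and> real_structure A"
    by (auto simp: number_carrier_def real_structure_number_matrix)
next
  assume "A \<in> carrier_mat (d * n) (d * m) \<and> real_structure A"
  hence "A = number_matrix \<beta> n m (comps A)" by (simp add: number_matrix_comps)
  thus "A \<in> NC n m" unfolding number_carrier_def by blast
qed

lemma NC_carrier: "A \<in> NC n m \<Longrightarrow> A \<in> carrier_mat (d * n) (d * m)"
  by (simp add: number_carrier_iff)

lemma NC_number_matrix_comps: "A \<in> NC n m \<Longrightarrow> number_matrix \<beta> n m (comps A) = A"
  by (simp add: number_carrier_iff number_matrix_comps)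

lemma number_matrix_NC [simp, intro]: "number_matrix \<beta> n m x \<in> NC n m"
  by (simp add: number_carrier_def)

lemma NC_I:
  assumes "A \<in> carrier_mat (d * n) (d * m)"
    and "\<And>i j. i < d * n \<Longrightarrow> j < d * m \<Longrightarrow> \<beta> \<noteq> 2 \<Longrightarrow> A $$ (i, j) = sg i * sg j * cnj (A $$ (\<tau> i, \<tau> j))"
  shows "A \<in> NC n m"
  using assms by (auto simp: number_carrier_iff real_structure_def)

lemma NC_D:
  assumes "A \<in> NC n m" "i < d * n" "j < d * m" "\<beta> \<noteq> 2"
  shows "A $$ (i, j) = sg i * sg j * cnj (A $$ (\<tau> i, \<tau> j))"
  using assms by (auto simp: number_carrier_iff real_structure_def)

lemma NC_mult [intro]:
  assumes A: "A \<in> NC n m" and B: "B \<in> NC m l"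
  shows "A * B \<in> NC n l"
proof (rule NC_I)
  note c = NC_carrier[OF A] NC_carrier[OF B]
  fix i j assume ij: "i < d * n" "j < d * l" and b: "\<beta> \<noteq> 2"
  have "sg i * sg j * cnj ((A * B) $$ (\<tau> i, \<tau> j)) =
        (\<Sum>p<d * m. sg i * sg j * cnj (A $$ (\<tau> i, p)) * cnj (B $$ (p, \<tau> j)))"
    by (simp only: index_mult_mat_sum[OF c \<tau>_less[OF ij(1)] \<tau>_less[OF ij(2)]] cnj_sum sum_distrib_left complex_cnj_mult mult.assoc)
  \<comment> \<open>The summation index is moved by the bijection \<open>\<tau>\<close>; afterwards
    the symmetry of \<open>A\<close> and that of \<open>B\<close> each contribute a factor
    \<open>sg p\<close>, and these cancel.\<close>
  also have "\<dots> = (\<Sum>p<d * m. sg i * sg j * cnj (A $$ (\<tau> i, \<tau> p)) * cnj (B $$ (\<tau> p, \<tau> j)))"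
    by (rule sum_\<tau>[symmetric])
  also have "\<dots> = (\<Sum>p<d * m. A $$ (i, p) * B $$ (p, j))"
  proof (rule sum.cong)
    fix p assume p: "p \<in> {..<d * m}"
    have "A $$ (i, p) * B $$ (p, j) = sg i * sg p * cnj (A $$ (\<tau> i, \<tau> p)) * (sg p * sg j * cnj (B $$ (\<tau> p, \<tau> j)))"
      using NC_D[OF A ij(1) _ b, of p] NC_D[OF B _ ij(2) b, of p] p by auto
    also have "\<dots> = (sg p * sg p) * (sg i * sg j * cnj (A $$ (\<tau> i, \<tau> p)) * cnj (B $$ (\<tau> p, \<tau> j)))"
      by (simp only: mult_ac)
    finally show "sg i * sg j * cnj (A $$ (\<tau> i, \<tau> p)) * cnj (B $$ (\<tau> p, \<tau> j)) = A $$ (i, p) * B $$ (p, j)"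
      by simp
  qed simp
  also have "\<dots> = (A * B) $$ (i, j)" using ij by (subst index_mult_mat_sum[OF c]) auto
  finally show "(A * B) $$ (i, j) = sg i * sg j * cnj ((A * B) $$ (\<tau> i, \<tau> j))" by simp
qed (use NC_carrier[OF A] NC_carrier[OF B] in auto)

lemma NC_add [intro]:
  assumes A: "A \<in> NC n m" and B: "B \<in> NC n m"
  shows "A + B \<in> NC n m"
proof (rule NC_I)
  fix i j assume ij: "i < d * n" "j < d * m" and b: "\<beta> \<noteq> 2"
  note c = NC_carrier[OF A] NC_carrier[OF B]
  have "(A + B) $$ (i, j) = A $$ (i, j) + B $$ (i, j)" using c ij by auto
  also have "\<dots> = sg i * sg j * cnj (A $$ (\<tau> i, \<tau> j)) + sg i * sg j * cnj (B $$ (\<tau> i, \<tau> j))"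
    using NC_D[OF A ij b] NC_D[OF B ij b] by simp
  also have "\<dots> = sg i * sg j * cnj ((A + B) $$ (\<tau> i, \<tau> j))"
    using c \<tau>_less[OF ij(1)] \<tau>_less[OF ij(2)] by (auto simp: algebra_simps)
  finally show "(A + B) $$ (i, j) = sg i * sg j * cnj ((A + B) $$ (\<tau> i, \<tau> j))" .
qed (use NC_carrier[OF A] NC_carrier[OF B] in auto)

lemma NC_smult [intro]:
  assumes A: "A \<in> NC n m"
  shows "complex_of_real c \<cdot>\<^sub>m A \<in> NC n m"
proof (rule NC_I)
  fix i j assume ij: "i < d * n" "j < d * m" and b: "\<beta> \<noteq> 2"
  note C = NC_carrier[OF A]
  have "(complex_of_real c \<cdot>\<^sub>m A) $$ (i, j) = complex_of_real c * A $$ (i, j)" using C ij by auto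
  also have "\<dots> = complex_of_real c * (sg i * sg j * cnj (A $$ (\<tau> i, \<tau> j)))"
    using NC_D[OF A ij b] by simp
  also have "\<dots> = sg i * sg j * cnj ((complex_of_real c \<cdot>\<^sub>m A) $$ (\<tau> i, \<tau> j))"
    using C \<tau>_less[OF ij(1)] \<tau>_less[OF ij(2)] by (auto simp: algebra_simps)
  finally show "(complex_of_real c \<cdot>\<^sub>m A) $$ (i, j) = sg i * sg j * cnj ((complex_of_real c \<cdot>\<^sub>m A) $$ (\<tau> i, \<tau> j))" .
qed (use NC_carrier[OF A] in auto)

lemma NC_adjoint [intro]:
  assumes A: "A \<in> NC n m"
  shows "mat_adjoint A \<in> NC m n"
proof (rule NC_I)
  fix i j assume ij: "i < d * m" "j < d * n" and b: "\<beta> \<noteq> 2"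
  note C = NC_carrier[OF A]
  have "mat_adjoint A $$ (i, j) = cnj (A $$ (j, i))" using C ij by auto
  also have "\<dots> = cnj (sg j * sg i * cnj (A $$ (\<tau> j, \<tau> i)))"
    using NC_D[OF A ij(2,1) b] by simp
  also have "\<dots> = sg i * sg j * cnj (mat_adjoint A $$ (\<tau> i, \<tau> j))"
    using C \<tau>_less[OF ij(1)] \<tau>_less[OF ij(2)] by (auto simp: algebra_simps)
  finally show "mat_adjoint A $$ (i, j) = sg i * sg j * cnj (mat_adjoint A $$ (\<tau> i, \<tau> j))" .
qed (use NC_carrier[OF A] in auto)

lemma \<tau>_eq_iff [simp]: "\<tau> i = \<tau> j \<longleftrightarrow> i = j"
  by (metis \<tau>_\<tau>)

lemma NC_one [simp, intro]: "1\<^sub>m (d * n) \<in> NC n n"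
  by (rule NC_I) (auto simp: \<tau>_less)

lemma NC_zero [simp, intro]: "0\<^sub>m (d * n) (d * m) \<in> NC n m"
  by (rule NC_I) (auto simp: \<tau>_less)

lemma mult_block_less: "k \<le> n \<Longrightarrow> i < d * k \<Longrightarrow> i < d * n"
  by (meson mult_le_mono2 order_less_le_trans)

lemma \<tau>_less_iff: "\<tau> i < d * n \<longleftrightarrow> i < d * n"
  by (metis \<tau>_less \<tau>_\<tau>)

lemma first_columns_NC [intro]:
  assumes A: "A \<in> NC n m" "k \<le> m"
  shows "first_columns \<beta> k A \<in> NC n k"
  using A(2) NC_carrier[OF A(1)]
  by (intro NC_I) (auto simp: first_columns_def \<tau>_less mult_block_less intro!: NC_D[OF A(1)])

abbreviation E where "E n k \<equiv> first_columns \<beta> k (1\<^sub>m (d * n))"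

lemma E_NC [intro]: "k \<le> n \<Longrightarrow> E n k \<in> NC n k"
  by (rule first_columns_NC[OF NC_one])

lemma first_columns_eq_mult:
  assumes A: "A \<in> carrier_mat q (d * m)" and "k \<le> m"
  shows "first_columns \<beta> k A = A * E m k"
proof (rule eq_matI)
  fix i j assume "i < dim_row (A * E m k)" "j < dim_col (A * E m k)"
  hence ij: "i < q" "j < d * k" using A by (auto simp: first_columns_def)
  have j: "j < d * m" using ij assms(2) mult_block_less by blast
  have c: "E m k \<in> carrier_mat (d * m) (d * k)" by (auto simp: first_columns_def)
  have "(A * E m k) $$ (i, j) = (\<Sum>p<d * m. A $$ (i, p) * E m k $$ (p, j))"
    by (rule index_mult_mat_sum[OF A c ij])
  also have "\<dots> = (\<Sum>p<d * m. if p = j then A $$ (i, p) else 0)"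
    using ij j by (intro sum.cong) (auto simp: first_columns_def)
  also have "\<dots> = A $$ (i, j)" using j by simp
  finally show "first_columns \<beta> k A $$ (i, j) = (A * E m k) $$ (i, j)"
    using A ij by (auto simp: first_columns_def)
qed (auto simp: first_columns_def)

lemma sum_blocks: "(\<Sum>r<d * n. f r) = (\<Sum>i<n. \<Sum>p<d. f (d * i + p))"
proof (induction n)
  case (Suc n)
  have "{..<d * Suc n} = {..<d * n} \<union> {d * n..<d * n + d}" by auto
  hence "(\<Sum>r<d * Suc n. f r) = (\<Sum>r<d * n. f r) + sum f {d * n..<d * n + d}"
    by (simp add: sum.union_disjoint ivl_disj_int)
  also have "sum f {d * n..<d * n + d} = (\<Sum>p<d. f (d * n + p))"
    using sum.shift_bounds_nat_ivl[of f 0 "d * n" d] by (simp add: atLeast0LessThan add.commute)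
  finally show ?case using Suc by simp
qed simp

lemma frob2_number_matrix:
  "frob2 (number_matrix \<beta> n m x) = real d * (\<Sum>i<n. \<Sum>j<m. \<Sum>a<\<beta>. (x i j a)\<^sup>2)"
proof -
  have "(\<Sum>p<d. \<Sum>q<d. (cmod (number_matrix \<beta> n m x $$ (d * i + p, d * j + q)))\<^sup>2)
      = real d * (\<Sum>a<\<beta>. (x i j a)\<^sup>2)" if ij: "i < n" "j < m" for i j
  proof -
    have l: "d * i + p < d * n" "d * j + p < d * m" if "p < d" for p
      using ij that by (metis Suc_leI add_less_cancel_left less_le_trans mult_Suc_right add.commute mult_le_mono2)+
    have "(\<Sum>p<d. \<Sum>q<d. (cmod (number_matrix \<beta> n m x $$ (d * i + p, d * j + q)))\<^sup>2)
       = (\<Sum>p<d. \<Sum>q<d. (cmod (number_block \<beta> (x i j) $$ (p, q)))\<^sup>2)"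
      by (intro sum.cong refl) (simp add: index_number_matrix l)
    also have "\<dots> = real d * (\<Sum>a<\<beta>. (x i j a)\<^sup>2)"
    proof -
      consider "\<beta> = 1" | "\<beta> = 2" | "\<beta> = 4" using dyson_index by auto
      thus ?thesis
        by cases (auto simp: block_dim_def number_block_def mat_of_rows_list_def cmod_def numeral_eq_Suc lessThan_Suc)
    qed
    finally show ?thesis .
  qed
  hence "(\<Sum>i<n. \<Sum>j<m. \<Sum>p<d. \<Sum>q<d. (cmod (number_matrix \<beta> n m x $$ (d * i + p, d * j + q)))\<^sup>2)
      = (\<Sum>i<n. \<Sum>j<m. real d * (\<Sum>a<\<beta>. (x i j a)\<^sup>2))"
    by (intro sum.cong) auto
  also have "(\<Sum>i<n. \<Sum>j<m. \<Sum>p<d. \<Sum>q<d. (cmod (number_matrix \<beta> n m x $$ (d * i + p, d * j + q)))\<^sup>2)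
      = frob2 (number_matrix \<beta> n m x)"
    unfolding frob2_def dim_number_matrix sum_blocks
    by (rule sum.cong[OF refl], rule sum.swap)
  finally show ?thesis by (simp add: sum_distrib_left)
qed

section \<open>Unitary reduction and diagonalization\<close>

text \<open>The orthogonal, unitary or compact symplectic group, according to \<beta>.\<close>

definition NU :: "nat \<Rightarrow> complex mat set" where
  "NU n = {S \<in> NC n n. mat_adjoint S * S = 1\<^sub>m (d * n) \<and> S * mat_adjoint S = 1\<^sub>m (d * n)}"

lemma NU_D:
  assumes "S \<in> NU n"
  shows "S \<in> NC n n" "S \<in> carrier_mat (d * n) (d * n)"
    "mat_adjoint S * S = 1\<^sub>m (d * n)" "S * mat_adjoint S = 1\<^sub>m (d * n)"
  using assms NC_carrier by (auto simp: NU_def)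

lemma NU_one [simp]: "1\<^sub>m (d * n) \<in> NU n"
  by (auto simp: NU_def)

lemma NU_adjoint: "S \<in> NU n \<Longrightarrow> mat_adjoint S \<in> NU n"
  by (auto simp: NU_def)

lemma NU_mult:
  assumes S: "S \<in> NU n" and T: "T \<in> NU n"
  shows "S * T \<in> NU n"
proof -
  note c = NU_D(2)[OF S] NU_D(2)[OF T]
  have c': "mat_adjoint S \<in> carrier_mat (d * n) (d * n)" "mat_adjoint T \<in> carrier_mat (d * n) (d * n)"
    using c by auto
  have "mat_adjoint (S * T) * (S * T) = mat_adjoint T * (mat_adjoint S * S) * T"
    using c c' by (simp add: mat_adjoint_mult[OF c] assoc_mult_mat[of _ "d*n" "d*n" _ "d*n" _ "d*n"] mult_carrier_mat[of _ "d*n" "d*n" _ "d*n"])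
  moreover have "S * T * mat_adjoint (S * T) = S * (T * mat_adjoint T) * mat_adjoint S"
    using c c' by (simp add: mat_adjoint_mult[OF c] assoc_mult_mat[of _ "d*n" "d*n" _ "d*n" _ "d*n"] mult_carrier_mat[of _ "d*n" "d*n" _ "d*n"])
  ultimately show ?thesis
    using c c' NU_D[OF S] NU_D[OF T] by (auto simp: NU_def)
qed

lemma frob2_eq_0: "frob2 A = 0 \<Longrightarrow> i < dim_row A \<Longrightarrow> j < dim_col A \<Longrightarrow> A $$ (i, j) = 0"
  unfolding frob2_def by (subst (asm) sum_nonneg_eq_0_iff) (auto simp: sum_nonneg_eq_0_iff sum_nonneg)

text \<open>For quaternions, Hermitian symmetry and block symmetry give opposite values for the
  off-diagonal entry, which therefore vanishes. As a consequence the Gram block of a block column is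
  a central scalar, and reflections can be computed as over the reals.\<close>

lemma hermitian_scalar:
  assumes H: "H \<in> NC 1 1" and "mat_adjoint H = H"
  shows "\<exists>r. H = complex_of_real r \<cdot>\<^sub>m 1\<^sub>m d"
proof -
  have c: "H \<in> carrier_mat d d" using NC_carrier[OF H] by simp
  have h: "H $$ (i, j) = cnj (H $$ (j, i))" if "i < d" "j < d" for i j
    using index_mat_adjoint[of i H j] c that assms(2) by auto
  have real: "H $$ (0, 0) = complex_of_real (Re (H $$ (0, 0)))"
    using h[of 0 0] by (auto simp: complex_eq_iff)
  have "H = complex_of_real (Re (H $$ (0, 0))) \<cdot>\<^sub>m 1\<^sub>m d"
  proof (rule eq_matI)
    fix i j assume "i < dim_row (complex_of_real (Re (H $$ (0, 0))) \<cdot>\<^sub>m 1\<^sub>m d)"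
      "j < dim_col (complex_of_real (Re (H $$ (0, 0))) \<cdot>\<^sub>m 1\<^sub>m d)"
    hence ij: "i < d" "j < d" by auto
    show "H $$ (i, j) = (complex_of_real (Re (H $$ (0, 0))) \<cdot>\<^sub>m 1\<^sub>m d) $$ (i, j)"
    proof (cases "\<beta> = 4")
      case False
      hence "d = 1" by (simp add: block_dim_def)
      thus ?thesis using ij real by simp
    next
      case True
      hence d: "d = 2" and b: "\<beta> \<noteq> 2" by (simp_all add: block_dim_def)
      note t = \<tau>_sg_quaternion[OF True, of 0, simplified]
      have "H $$ (1, 1) = cnj (H $$ (0, 0))" "H $$ (0, 1) = - cnj (H $$ (1, 0))"
        using NC_D[OF H _ _ b, of 1 1] NC_D[OF H _ _ b, of 0 1] t d by auto
      moreover have "H $$ (0, 1) = cnj (H $$ (1, 0))" using h[of 0 1] d by simp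
      moreover have "i = 0 \<or> i = 1" "j = 0 \<or> j = 1" using ij d by auto
      ultimately show ?thesis using ij real d h[of 1 0]
        by (auto simp: complex_eq_iff)
    qed
  qed (use c in auto)
  thus ?thesis by blast
qed

lemma gram_scalar:
  assumes u: "u \<in> NC n 1"
  shows "mat_adjoint u * u = complex_of_real (frob2 u / d) \<cdot>\<^sub>m 1\<^sub>m d"
proof -
  have c: "u \<in> carrier_mat (d * n) d" using NC_carrier[OF u] by simp
  have "mat_adjoint u * u \<in> NC 1 1" using u by auto
  moreover have "mat_adjoint (mat_adjoint u * u) = mat_adjoint u * u"
    using mat_adjoint_mult[OF mat_adjoint_carrier[OF c] c] by simp
  ultimately obtain r where r: "mat_adjoint u * u = complex_of_real r \<cdot>\<^sub>m 1\<^sub>m d"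
    using hermitian_scalar by blast
  have "complex_of_real (frob2 u) = mtrace (complex_of_real r \<cdot>\<^sub>m 1\<^sub>m d)"
    by (simp add: frob2_eq_trace r)
  also have "\<dots> = complex_of_real (d * r)" by (simp add: mtrace_def)
  finally have "frob2 u = d * r" by (simp only: of_real_eq_iff)
  hence "r = frob2 u / d" by simp
  with r show ?thesis by simp
qed

definition mask :: "(nat \<Rightarrow> bool) \<Rightarrow> complex mat \<Rightarrow> complex mat" where
  "mask P A = mat (dim_row A) (dim_col A) (\<lambda>(i, j). if P i then A $$ (i, j) else 0)"

lemma mask_NC:
  assumes A: "A \<in> NC n m" and P: "\<And>i. P (\<tau> i) = P i"
  shows "mask P A \<in> NC n m"
  using NC_carrier[OF A] by (intro NC_I) (auto simp: mask_def P \<tau>_less intro!: NC_D[OF A])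

lemma mult_disjoint_support:
  fixes A B :: "complex mat"
  assumes A: "A \<in> carrier_mat q n" "B \<in> carrier_mat q m"
    and "\<And>p i j. p < q \<Longrightarrow> i < n \<Longrightarrow> j < m \<Longrightarrow> A $$ (p, i) = 0 \<or> B $$ (p, j) = 0"
  shows "mat_adjoint A * B = 0\<^sub>m n m"
proof (rule eq_matI)
  fix i j assume "i < dim_row (0\<^sub>m n m)" "j < dim_col (0\<^sub>m n m)"
  hence ij: "i < n" "j < m" by auto
  have "(mat_adjoint A * B) $$ (i, j) = (\<Sum>p<q. mat_adjoint A $$ (i, p) * B $$ (p, j))"
    by (rule index_mult_mat_sum) (use A ij in auto)
  also have "\<dots> = (\<Sum>p<q. cnj (A $$ (p, i)) * B $$ (p, j))"
    using A ij by (intro sum.cong) auto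
  also have "\<dots> = 0" by (rule sum.neutral) (use assms(3) ij in auto)
  finally show "(mat_adjoint A * B) $$ (i, j) = 0\<^sub>m n m $$ (i, j)" using ij by simp
qed (use A in auto)

text \<open>The k-th standard basis vector, as a block column.\<close>

definition block_unit :: "nat \<Rightarrow> nat \<Rightarrow> complex mat" where
  "block_unit n k = mat (d * n) d (\<lambda>(i, j). if i = d * k + j then 1 else 0)"

lemma block_unit_NC: "block_unit n k \<in> NC n 1"
proof (rule NC_I)
  fix i j assume ij: "i < d * n" "j < d * 1" "\<beta> \<noteq> 2"
  have "\<tau> (d * k + j) = d * k + \<tau> j" "sg (d * k + j) = sg j"
    unfolding \<tau>_def sg_def block_dim_def by (auto elim!: oddE)
  hence "\<tau> i = d * k + \<tau> j \<longleftrightarrow> i = d * k + j" "i = d * k + j \<Longrightarrow> sg i = sg j" by (metis \<tau>_\<tau>)+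
  thus "block_unit n k $$ (i, j) = sg i * sg j * cnj (block_unit n k $$ (\<tau> i, \<tau> j))"
    using ij \<tau>_less[of j 1] by (auto simp: block_unit_def \<tau>_less)
qed (auto simp: block_unit_def)

text \<open>As the Gram block of \<open>u\<close> is the central scalar 2 r, the orthogonal
  projection onto \<open>u\<close> is \<open>u * mat_adjoint u\<close> divided by 2 r. So
  \<open>S\<close> is the identity minus twice a projection, a self-adjoint involution.\<close>

lemma householder_reflection:
  assumes u: "u \<in> NC n 1" and r: "mat_adjoint u * u = complex_of_real (2 * r) \<cdot>\<^sub>m 1\<^sub>m d" "r \<noteq> 0"
  defines "S \<equiv> 1\<^sub>m (d * n) + complex_of_real (- 1 / r) \<cdot>\<^sub>m (u * mat_adjoint u)"
  shows "S \<in> NU n"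
    and "\<And>W. W \<in> carrier_mat (d * n) l \<Longrightarrow>
           S * W = W + complex_of_real (- 1 / r) \<cdot>\<^sub>m (u * (mat_adjoint u * W))"
proof -
  have c: "u \<in> carrier_mat (d * n) d" using NC_carrier[OF u] by simp
  have c': "mat_adjoint u \<in> carrier_mat d (d * n)" using c by auto
  let ?P = "u * mat_adjoint u"
  let ?a = "complex_of_real (- 1 / r)"
  have P: "?P \<in> carrier_mat (d * n) (d * n)" "?P \<in> NC n n" using c u by auto
  have S: "S \<in> NC n n" unfolding S_def using P by (intro NC_add NC_smult) auto
  have adjP: "mat_adjoint ?P = ?P" using mat_adjoint_mult[OF c c'] by simp
  have adjS: "mat_adjoint S = S"
    unfolding S_def using P(1) by (subst mat_adjoint_add[of _ "d*n" "d*n"]) (auto simp: adjP mat_adjoint_smult)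
  show act: "S * W = W + ?a \<cdot>\<^sub>m (u * (mat_adjoint u * W))" if W: "W \<in> carrier_mat (d * n) l" for W l
  proof -
    have "S * W = 1\<^sub>m (d * n) * W + (?a \<cdot>\<^sub>m ?P) * W"
      unfolding S_def using W P(1) by (intro add_mult_distrib_mat[of _ "d*n" "d*n"]) auto
    also have "(?a \<cdot>\<^sub>m ?P) * W = ?a \<cdot>\<^sub>m (?P * W)" using W P(1) by (intro mult_smult_assoc_mat[of _ "d*n" "d*n"]) auto
    also have "?P * W = u * (mat_adjoint u * W)" using c c' W by (rule assoc_mult_mat)
    finally show ?thesis using W by simp
  qed
  have "mat_adjoint u * S = - mat_adjoint u"
  proof -
    have "mat_adjoint u * S = mat_adjoint u * 1\<^sub>m (d * n) + mat_adjoint u * (?a \<cdot>\<^sub>m ?P)"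
      unfolding S_def using P(1) c' by (intro mult_add_distrib_mat[of _ d "d*n"]) auto
    also have "mat_adjoint u * (?a \<cdot>\<^sub>m ?P) = ?a \<cdot>\<^sub>m (mat_adjoint u * ?P)"
      using P(1) c' by (intro mult_smult_distrib[of _ d "d*n"]) auto
    also have "mat_adjoint u * ?P = (mat_adjoint u * u) * mat_adjoint u"
      using c c' by (metis assoc_mult_mat)
    also have "\<dots> = complex_of_real (2 * r) \<cdot>\<^sub>m mat_adjoint u"
      unfolding r(1) using c' by (subst mult_smult_assoc_mat[of _ d d]) auto
    finally show ?thesis using c' r(2) by (intro eq_matI) (auto simp: field_simps)
  qed
  hence "S * S = S + ?a \<cdot>\<^sub>m (u * (- mat_adjoint u))"
    using act[of S] NC_carrier[OF S] by simp
  also have "u * (- mat_adjoint u) = - ?P" using c c' by simp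
  also have "S + ?a \<cdot>\<^sub>m (- ?P) = 1\<^sub>m (d * n)"
    unfolding S_def using P(1) by (intro eq_matI) auto
  finally have "S * S = 1\<^sub>m (d * n)" .
  thus "S \<in> NU n" using S adjS by (auto simp: NU_def)
qed

text \<open>The reflection exchanges the part \<open>v1\<close> of \<open>v\<close> from block k on
  with \<open>- w\<close>, where \<open>w\<close> lives in block k and has the same Gram scalar. The
  mirror direction vanishes above block k, so everything supported there is fixed; this lets
  reflections be composed column by column.\<close>

lemma householder:
  assumes v: "v \<in> NC n 1" and k: "k < n"
  obtains S where "S \<in> NU n"
    and "\<And>l W. W \<in> carrier_mat (d * n) l \<Longrightarrow> (\<And>i j. d * k \<le> i \<Longrightarrow> i < d * n \<Longrightarrow> j < l \<Longrightarrow> W $$ (i, j) = 0) \<Longrightarrow> S * W = W"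
    and "\<And>i j. i < d * k \<Longrightarrow> j < d \<Longrightarrow> (S * v) $$ (i, j) = v $$ (i, j)"
    and "\<And>i j. d * Suc k \<le> i \<Longrightarrow> i < d * n \<Longrightarrow> j < d \<Longrightarrow> (S * v) $$ (i, j) = 0"
proof -
  have c: "v \<in> carrier_mat (d * n) d" using NC_carrier[OF v] by simp
  define v1 where "v1 = mask (\<lambda>i. d * k \<le> i) v"
  define v0 where "v0 = mask (\<lambda>i. i < d * k) v"
  have v1: "v1 \<in> NC n 1" unfolding v1_def using \<tau>_less_iff by (intro mask_NC[OF v]) (metis linorder_not_less)
  have c1: "v1 \<in> carrier_mat (d * n) d" "v0 \<in> carrier_mat (d * n) d" using c by (auto simp: v1_def v0_def mask_def)
  have vsum: "v = v0 + v1" using c by (intro eq_matI) (auto simp: v0_def v1_def mask_def)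
  define r where "r = frob2 v1 / d"
  have r: "mat_adjoint v1 * v1 = complex_of_real r \<cdot>\<^sub>m 1\<^sub>m d" "0 \<le> r"
    unfolding r_def using gram_scalar[OF v1] by auto
  show ?thesis
  proof (cases "r = 0")
    case True
    hence "frob2 v1 = 0" using d_pos by (simp add: r_def del: d_pos)
    hence z: "v $$ (i, j) = 0" if "d * k \<le> i" "i < d * n" "j < d" for i j
      using frob2_eq_0[of v1 i j] that c by (auto simp: v1_def mask_def)
    show ?thesis by (rule that[of "1\<^sub>m (d * n)"]) (use c z in auto)
  next
    case False
    hence rp: "0 < r" using r by simp
    define q where "q = mask (\<lambda>i. d * k \<le> i \<and> i < d * Suc k) v"
    have q: "q \<in> NC n 1" unfolding q_def using \<tau>_less_iff by (intro mask_NC[OF v]) (metis linorder_not_less)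
    \<comment> \<open>The direction of the image in block k. Its product with \<open>v1\<close> must
      be a nonnegative real scalar. Block k of \<open>v\<close> itself achieves this, since it pairs
      with \<open>v1\<close> to its own Gram scalar; if that block vanishes, the basis column is
      orthogonal to \<open>v1\<close>.\<close>
    have "\<exists>b t s. b \<in> NC n 1 \<and> mat_adjoint b * b = complex_of_real t \<cdot>\<^sub>m 1\<^sub>m d \<and> 0 < t \<and> 0 \<le> s \<and>
        mat_adjoint b * v1 = complex_of_real s \<cdot>\<^sub>m 1\<^sub>m d \<and>
        (\<forall>i<d * n. \<forall>j<d. i < d * k \<or> d * Suc k \<le> i \<longrightarrow> b $$ (i, j) = 0)"
    proof (cases "frob2 q = 0")
      case True
      let ?b = "block_unit n k"
      have dk: "d * k < d * n" using k by simp
      have cb: "?b \<in> carrier_mat (d * n) d" by (simp add: block_unit_def)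
      have "?b $$ (d * k, 0) = 1" using dk by (simp add: block_unit_def)
      hence "frob2 ?b \<noteq> 0" using frob2_eq_0[of ?b "d * k" 0] dk cb by (metis carrier_matD d_pos zero_neq_one)
      hence "0 < frob2 ?b" using frob2_nonneg[of ?b] by linarith
      hence "0 < frob2 ?b / d" by simp
      moreover have "mat_adjoint ?b * v1 = 0\<^sub>m d d"
      proof (rule mult_disjoint_support)
        fix p i j assume p: "p < d * n" "i < d" "j < d"
        have "v1 $$ (p, j) = 0" if "p = d * k + i"
          using frob2_eq_0[OF True, of p j] p that c by (auto simp: v1_def q_def mask_def)
        thus "?b $$ (p, i) = 0 \<or> v1 $$ (p, j) = 0" using p by (auto simp: block_unit_def)
      qed (use c1 in \<open>auto simp: block_unit_def\<close>)
      moreover have "0\<^sub>m d d = complex_of_real 0 \<cdot>\<^sub>m 1\<^sub>m d" by (intro eq_matI) auto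
      moreover have "\<forall>i<d * n. \<forall>j<d. i < d * k \<or> d * Suc k \<le> i \<longrightarrow> ?b $$ (i, j) = 0"
        by (auto simp: block_unit_def)
      ultimately show ?thesis using block_unit_NC gram_scalar[OF block_unit_NC] by (metis order_refl)
    next
      case False
      have cq: "q \<in> carrier_mat (d * n) d" using c by (auto simp: q_def mask_def)
      have "mat_adjoint q * v1 = mat_adjoint q * q + mat_adjoint q * mask (\<lambda>i. d * Suc k \<le> i) v"
      proof -
        have "v1 = q + mask (\<lambda>i. d * Suc k \<le> i) v"
          using c by (intro eq_matI) (auto simp: v1_def q_def mask_def)
        thus ?thesis using cq c by (simp add: mult_add_distrib_mat[of _ d "d*n"] mask_def)
      qed
      also have "mat_adjoint q * mask (\<lambda>i. d * Suc k \<le> i) v = 0\<^sub>m d d"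
        by (rule mult_disjoint_support[of _ "d * n"]) (use cq c in \<open>auto simp: q_def mask_def\<close>)
      also have "mat_adjoint q * q + 0\<^sub>m d d = mat_adjoint q * q" using cq by auto
      finally have e: "mat_adjoint q * v1 = mat_adjoint q * q" .
      have "0 < frob2 q" using False frob2_nonneg[of q] by linarith
      hence "0 < frob2 q / d" by simp
      moreover have "\<forall>i<d * n. \<forall>j<d. i < d * k \<or> d * Suc k \<le> i \<longrightarrow> q $$ (i, j) = 0"
        using c by (auto simp: q_def mask_def)
      ultimately show ?thesis using e gram_scalar[OF q] q by (metis less_imp_le)
    qed
    then obtain b t s where b: "b \<in> NC n 1" "mat_adjoint b * b = complex_of_real t \<cdot>\<^sub>m 1\<^sub>m d" "0 < t" "0 \<le> s"
        "mat_adjoint b * v1 = complex_of_real s \<cdot>\<^sub>m 1\<^sub>m d"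
        and bz: "\<And>i j. i < d * n \<Longrightarrow> j < d \<Longrightarrow> i < d * k \<or> d * Suc k \<le> i \<Longrightarrow> b $$ (i, j) = 0"
      by blast
    have cb: "b \<in> carrier_mat (d * n) d" using NC_carrier[OF b(1)] by simp
    \<comment> \<open>The scaling gives \<open>w\<close> the Gram scalar of \<open>v1\<close>. With
      \<open>u = v1 + w\<close> the Gram scalar of \<open>u\<close> is 2 (r + g s), twice its
      product with \<open>v1\<close>, so the reflection sends \<open>v1\<close> to
      \<open>v1 - u = - w\<close>. The sign of s keeps r + g s positive.\<close>
    define g where "g = sqrt (r / t)"
    have g: "0 \<le> g" "g * g * t = r" using b rp by (auto simp: g_def simp flip: power2_eq_square)
    define w where "w = complex_of_real g \<cdot>\<^sub>m b"
    have cw: "w \<in> carrier_mat (d * n) d" using cb by (simp add: w_def)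
    have wNC: "w \<in> NC n 1" unfolding w_def using b by (intro NC_smult) auto
    have adjw: "mat_adjoint w = complex_of_real g \<cdot>\<^sub>m mat_adjoint b" by (simp add: w_def mat_adjoint_smult)
    have ww: "mat_adjoint w * w = complex_of_real r \<cdot>\<^sub>m 1\<^sub>m d"
    proof -
      have "mat_adjoint w * w = complex_of_real g \<cdot>\<^sub>m (complex_of_real g \<cdot>\<^sub>m (mat_adjoint b * b))"
        unfolding adjw unfolding w_def using cb
        by (simp add: mult_smult_assoc_mat[of _ d "d*n" _ d] mult_smult_distrib[of _ d "d*n" _ d])
      also have "\<dots> = complex_of_real r \<cdot>\<^sub>m 1\<^sub>m d" unfolding b(2) using g(2)
        by (intro eq_matI) (auto simp flip: of_real_mult simp: mult.assoc)
      finally show ?thesis .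
    qed
    have wv: "mat_adjoint w * v1 = complex_of_real (g * s) \<cdot>\<^sub>m 1\<^sub>m d"
    proof -
      have "(complex_of_real g \<cdot>\<^sub>m mat_adjoint b) * v1 = complex_of_real g \<cdot>\<^sub>m (mat_adjoint b * v1)"
        by (rule mult_smult_assoc_mat[of _ d "d * n" _ d]) (use cb c1 in auto)
      thus ?thesis unfolding adjw b(5) by (auto intro!: eq_matI)
    qed
    have vw: "mat_adjoint v1 * w = complex_of_real (g * s) \<cdot>\<^sub>m 1\<^sub>m d"
    proof -
      have "mat_adjoint v1 * w = mat_adjoint (mat_adjoint w * v1)"
        using mat_adjoint_mult[of "mat_adjoint w" d "d*n" v1 d] cw c1 by simp
      thus ?thesis unfolding wv by (simp add: mat_adjoint_smult)
    qed
    define u where "u = v1 + w"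
    have u: "u \<in> NC n 1" unfolding u_def using v1 wNC by auto
    have cu: "u \<in> carrier_mat (d * n) d" using NC_carrier[OF u] by simp
    have uv: "mat_adjoint u * v1 = complex_of_real (r + g * s) \<cdot>\<^sub>m 1\<^sub>m d"
    proof -
      have "mat_adjoint u * v1 = mat_adjoint v1 * v1 + mat_adjoint w * v1"
        unfolding u_def using c1 cw by (simp add: mat_adjoint_add add_mult_distrib_mat[of _ d "d*n"])
      thus ?thesis unfolding r wv by (intro eq_matI) auto
    qed
    have uw: "mat_adjoint u * w = complex_of_real (r + g * s) \<cdot>\<^sub>m 1\<^sub>m d"
    proof -
      have "mat_adjoint u * w = mat_adjoint v1 * w + mat_adjoint w * w"
        unfolding u_def using c1 cw by (simp add: mat_adjoint_add add_mult_distrib_mat[of _ d "d*n"])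
      thus ?thesis unfolding ww vw by (intro eq_matI) auto
    qed
    have "mat_adjoint u * u = mat_adjoint u * v1 + mat_adjoint u * w"
      using cu c1 cw by (subst (2) u_def) (simp add: mult_add_distrib_mat[of _ d "d*n"])
    hence uu: "mat_adjoint u * u = complex_of_real (2 * (r + g * s)) \<cdot>\<^sub>m 1\<^sub>m d"
      unfolding uv uw by (intro eq_matI) (auto simp: algebra_simps)
    have pos: "r + g * s \<noteq> 0" using rp g b by (smt (verit) mult_nonneg_nonneg)
    define S where "S = 1\<^sub>m (d * n) + complex_of_real (- 1 / (r + g * s)) \<cdot>\<^sub>m (u * mat_adjoint u)"
    note hh = householder_reflection[OF u uu pos, folded S_def]
    have fix_W: "S * W = W" if W: "W \<in> carrier_mat (d * n) l"
      and z: "\<And>i j. d * k \<le> i \<Longrightarrow> i < d * n \<Longrightarrow> j < l \<Longrightarrow> W $$ (i, j) = 0" for l W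
    proof -
      have "u $$ (p, i) = 0 \<or> W $$ (p, j) = 0" if "p < d * n" "i < d" "j < l" for p i j
        using z[of p j] bz[of p i] that c cb by (cases "d * k \<le> p") (auto simp: u_def w_def v1_def mask_def)
      hence "mat_adjoint u * W = 0\<^sub>m d l" by (intro mult_disjoint_support[of _ "d * n"]) (use cu W in auto)
      thus ?thesis using hh(2)[OF W] cu W by (auto intro!: eq_matI)
    qed
    have "S * v1 = v1 + complex_of_real (- 1 / (r + g * s)) \<cdot>\<^sub>m (u * (complex_of_real (r + g * s) \<cdot>\<^sub>m 1\<^sub>m d))"
      using hh(2)[OF c1(1)] by (simp only: uv)
    also have "u * (complex_of_real (r + g * s) \<cdot>\<^sub>m 1\<^sub>m d) = complex_of_real (r + g * s) \<cdot>\<^sub>m u"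
      using cu by (subst mult_smult_distrib[of _ "d*n" d]) auto
    also have "v1 + complex_of_real (- 1 / (r + g * s)) \<cdot>\<^sub>m (complex_of_real (r + g * s) \<cdot>\<^sub>m u) = - w"
    proof -
      have gen: "v1 + a \<cdot>\<^sub>m (b \<cdot>\<^sub>m u) = - w" if "a * b = -1" for a b :: complex
      proof (rule eq_matI)
        fix i j assume "i < dim_row (- w)" "j < dim_col (- w)"
        hence "i < d * n" "j < d" using cw by auto
        thus "(v1 + a \<cdot>\<^sub>m (b \<cdot>\<^sub>m u)) $$ (i, j) = (- w) $$ (i, j)"
          using c1 cw cu that by (simp add: u_def flip: mult.assoc)
      qed (use c1 cw cu in auto)
      have "(- 1 / (r + g * s)) * (r + g * s) = -1" using pos by simp
      hence "complex_of_real (- 1 / (r + g * s)) * complex_of_real (r + g * s) = -1"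
        by (metis of_real_mult of_real_minus of_real_1)
      thus ?thesis by (rule gen)
    qed
    finally have "S * v1 = - w" .
    moreover have "S * v0 = v0" by (rule fix_W[OF c1(2)]) (use c in \<open>auto simp: v0_def mask_def\<close>)
    moreover have "S * v = S * v0 + S * v1"
      unfolding vsum using c1 NU_D(2)[OF hh(1)] by (intro mult_add_distrib_mat[of _ "d*n" "d*n"]) auto
    ultimately have Sv: "S * v = v0 + - w" by simp
    show ?thesis
    proof (rule that[OF hh(1) fix_W])
      fix i j assume ij: "i < d * k" "j < d"
      have "i < d * n" using ij k by (metis mult_block_less less_imp_le)
      thus "(S * v) $$ (i, j) = v $$ (i, j)"
        unfolding Sv using c cw cb ij bz[of i j] by (auto simp: v0_def mask_def w_def)
    next
      fix i j assume ij: "d * Suc k \<le> i" "i < d * n" "j < d"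
      thus "(S * v) $$ (i, j) = 0"
        unfolding Sv using c cw cb ij bz[of i j] by (auto simp: v0_def mask_def w_def)
    qed
  qed
qed

lemma mult_first_columns:
  assumes A: "A \<in> carrier_mat p q" and V: "V \<in> carrier_mat q (d * m)" and k: "k \<le> m"
    and ij: "i < p" "j < d * k"
  shows "(A * V) $$ (i, j) = (A * first_columns \<beta> k V) $$ (i, j)"
proof -
  have c: "first_columns \<beta> k V \<in> carrier_mat q (d * k)" using V by (auto simp: first_columns_def)
  have j: "j < d * m" using mult_block_less k ij by blast
  show ?thesis unfolding index_mult_mat_sum[OF A V ij(1) j] index_mult_mat_sum[OF A c ij]
    using V ij by (intro sum.cong) (auto simp: first_columns_def)
qed

text \<open>Induction on the number of block columns: once the first k columns are reduced, they
  vanish from block k on, so the reflection chosen for the next column fixes them.\<close>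

lemma unitary_reduction:
  assumes "V \<in> NC n k" "k \<le> n"
  shows "\<exists>S\<in>NU n. \<forall>i j. d * k \<le> i \<longrightarrow> i < d * n \<longrightarrow> j < d * k \<longrightarrow> (S * V) $$ (i, j) = 0"
  using assms
proof (induction k arbitrary: V)
  case 0
  show ?case by (rule bexI[OF _ NU_one]) auto
next
  case (Suc k)
  have cV: "V \<in> carrier_mat (d * n) (d * Suc k)" using NC_carrier[OF Suc.prems(1)] .
  define V0 where "V0 = first_columns \<beta> k V"
  have V0: "V0 \<in> NC n k" unfolding V0_def using Suc.prems by (intro first_columns_NC) auto
  then obtain S where S: "S \<in> NU n" "\<And>i j. d * k \<le> i \<Longrightarrow> i < d * n \<Longrightarrow> j < d * k \<Longrightarrow> (S * V0) $$ (i, j) = 0"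
    using Suc by (metis Suc_leD)
  define v where "v = mat (d * n) d (\<lambda>(i, j). V $$ (i, d * k + j))"
  have \<tau>k: "\<tau> (d * k + j) = d * k + \<tau> j" "sg (d * k + j) = sg j" for j
    unfolding \<tau>_def sg_def block_dim_def by (auto elim!: oddE)
  have cv: "v \<in> carrier_mat (d * n) d" by (simp add: v_def)
  have v: "v \<in> NC n 1"
  proof (rule NC_I)
    fix i j assume ij: "i < d * n" "j < d * 1" "\<beta> \<noteq> 2"
    thus "v $$ (i, j) = sg i * sg j * cnj (v $$ (\<tau> i, \<tau> j))"
      using NC_D[OF Suc.prems(1) ij(1) _ ij(3), of "d * k + j"] \<tau>_less[of j 1] by (simp add: v_def \<tau>_less \<tau>k)
  qed (simp add: cv)
  note cS = NU_D(2)[OF S(1)]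
  have Sv: "S * v \<in> NC n 1" using v NU_D(1)[OF S(1)] by blast
  from Suc.prems have "k < n" by simp
  then obtain T where T: "T \<in> NU n"
    "\<And>l W. W \<in> carrier_mat (d * n) l \<Longrightarrow> (\<And>i j. d * k \<le> i \<Longrightarrow> i < d * n \<Longrightarrow> j < l \<Longrightarrow> W $$ (i, j) = 0) \<Longrightarrow> T * W = W"
    "\<And>i j. d * Suc k \<le> i \<Longrightarrow> i < d * n \<Longrightarrow> j < d \<Longrightarrow> (T * (S * v)) $$ (i, j) = 0"
    using householder[OF Sv] by metis
  note cT = NU_D(2)[OF T(1)]
  have cV0: "V0 \<in> carrier_mat (d * n) (d * k)" using NC_carrier[OF V0] .
  have "(T * S * V) $$ (i, j) = 0" if ij: "d * Suc k \<le> i" "i < d * n" "j < d * Suc k" for i j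
  proof (cases "j < d * k")
    case True
    have "(T * S * V) $$ (i, j) = (T * S * V0) $$ (i, j)"
      unfolding V0_def using cT cS cV True ij by (intro mult_first_columns[of _ "d*n" "d*n" _ "Suc k"]) auto
    also have "T * S * V0 = T * (S * V0)" using cT cS cV0 by (rule assoc_mult_mat)
    also have "\<dots> = S * V0" using cS cV0 S(2) by (intro T(2)[of _ "d * k"]) auto
    also have "\<dots> $$ (i, j) = 0" using S(2)[OF _ ij(2) True] ij by simp
    finally show ?thesis .
  next
    case False
    define j' where "j' = j - d * k"
    have j: "j = d * k + j'" "j' < d" using False ij by (auto simp: j'_def)
    have cTS: "T * S \<in> carrier_mat (d * n) (d * n)" using cT cS by simp
    have "(T * S * V) $$ (i, j) = (T * S * v) $$ (i, j')"
      unfolding index_mult_mat_sum[OF cTS cV ij(2,3)] index_mult_mat_sum[OF cTS cv ij(2) j(2)]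
      using j by (intro sum.cong) (auto simp: v_def)
    also have "T * S * v = T * (S * v)" using cT cS cv by (rule assoc_mult_mat)
    also have "\<dots> $$ (i, j') = 0" by (rule T(3)) (use ij j in auto)
    finally show ?thesis .
  qed
  thus ?case using NU_mult[OF T(1) S(1)] by blast
qed

section \<open>QR factorization and the complex Gram determinant\<close>

lemma adjoint_E_E: "k \<le> n \<Longrightarrow> mat_adjoint (E n k) * E n k = 1\<^sub>m (d * k)"
proof (rule eq_matI)
  fix i j assume k: "k \<le> n" and "i < dim_row (1\<^sub>m (d * k) :: complex mat)" "j < dim_col (1\<^sub>m (d * k) :: complex mat)"
  hence ij: "i < d * k" "j < d * k" "i < d * n" "j < d * n" using mult_block_less by auto
  have c: "E n k \<in> carrier_mat (d * n) (d * k)" "mat_adjoint (E n k) \<in> carrier_mat (d * k) (d * n)"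
    by (auto simp: first_columns_def)
  have "(mat_adjoint (E n k) * E n k) $$ (i, j) = (\<Sum>p<d * n. if p = i then if i = j then 1 else 0 else 0)"
    unfolding index_mult_mat_sum[OF c(2,1) ij(1,2)] using ij
    by (intro sum.cong) (auto simp: first_columns_def)
  also have "\<dots> = (if i = j then 1 else 0)" using ij by simp
  finally show "(mat_adjoint (E n k) * E n k) $$ (i, j) = 1\<^sub>m (d * k) $$ (i, j)" using ij by simp
qed (auto simp: first_columns_def)

lemma E_mult_top:
  assumes W: "W \<in> carrier_mat (d * n) m" and k: "k \<le> n"
    and z: "\<And>i j. d * k \<le> i \<Longrightarrow> i < d * n \<Longrightarrow> j < m \<Longrightarrow> W $$ (i, j) = 0"
  shows "E n k * (mat_adjoint (E n k) * W) = W"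
proof (rule eq_matI)
  have c: "E n k \<in> carrier_mat (d * n) (d * k)" "mat_adjoint (E n k) \<in> carrier_mat (d * k) (d * n)"
    by (auto simp: first_columns_def)
  have top: "(mat_adjoint (E n k) * W) $$ (i, j) = W $$ (i, j)" if "i < d * k" "j < m" for i j
  proof -
    have i: "i < d * n" using that k mult_block_less by blast
    have "(mat_adjoint (E n k) * W) $$ (i, j) = (\<Sum>p<d * n. if p = i then W $$ (i, j) else 0)"
      unfolding index_mult_mat_sum[OF c(2) W that] using that i
      by (intro sum.cong) (auto simp: first_columns_def)
    thus ?thesis using i by simp
  qed
  fix i j assume "i < dim_row W" "j < dim_col W"
  hence ij: "i < d * n" "j < m" using W by auto
  have cW: "mat_adjoint (E n k) * W \<in> carrier_mat (d * k) m" using c W by auto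
  have "(E n k * (mat_adjoint (E n k) * W)) $$ (i, j) = (\<Sum>p<d * k. if p = i then W $$ (i, j) else 0)"
    unfolding index_mult_mat_sum[OF c(1) cW ij]
    using ij top mult_block_less[OF k] by (intro sum.cong) (auto simp: first_columns_def)
  also have "\<dots> = W $$ (i, j)" using z[OF _ ij] by auto
  finally show "(E n k * (mat_adjoint (E n k) * W)) $$ (i, j) = W $$ (i, j)" .
qed (use W in \<open>auto simp: first_columns_def\<close>)

lemma QR:
  assumes V: "V \<in> NC n k" and k: "k \<le> n"
  obtains S R where "S \<in> NU n" "R \<in> NC k k" "V = mat_adjoint S * (E n k * R)"
proof -
  obtain S where S: "S \<in> NU n" "\<And>i j. d * k \<le> i \<Longrightarrow> i < d * n \<Longrightarrow> j < d * k \<Longrightarrow> (S * V) $$ (i, j) = 0"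
    using unitary_reduction[OF assms] by blast
  note cS = NU_D[OF S(1)] and cV = NC_carrier[OF V]
  have SV: "S * V \<in> NC n k" using cS(1) V by blast
  define R where "R = mat_adjoint (E n k) * (S * V)"
  have R: "R \<in> NC k k" unfolding R_def using SV E_NC[OF k] by blast
  have "E n k * R = S * V" unfolding R_def
    by (rule E_mult_top[OF NC_carrier[OF SV] k S(2)])
  hence "mat_adjoint S * (E n k * R) = mat_adjoint S * S * V"
    using cS(2) cV by (simp add: assoc_mult_mat[of _ "d*n" "d*n" _ "d*n" _ "d*k"])
  also have "\<dots> = V" using cS(3) cV by simp
  finally show ?thesis using that[OF S(1) R] by simp
qed

text \<open>The ordinary complex determinant is polynomial in the entries and compatible with
  products. In the quaternion case each doubly degenerate eigenvalue enters it twice, so on frames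
  it is the square of \<open>gram_det\<close>.\<close>

definition D :: "complex mat \<Rightarrow> real" where
  "D V = Re (Determinant.det (mat_adjoint V * V))"

lemma det_gram_mult_right:
  assumes Z: "Z \<in> carrier_mat n k" and R: "R \<in> carrier_mat k k"
  shows "Determinant.det (mat_adjoint (Z * R) * (Z * R))
    = complex_of_real ((cmod (Determinant.det R))\<^sup>2) * Determinant.det (mat_adjoint Z * Z)"
proof -
  have c: "mat_adjoint Z \<in> carrier_mat k n" "mat_adjoint R \<in> carrier_mat k k" using Z R by auto
  have "mat_adjoint (Z * R) * (Z * R) = mat_adjoint R * (mat_adjoint Z * Z * R)"
    unfolding mat_adjoint_mult[OF Z R] using Z R c
    by (simp add: assoc_mult_mat[of _ k k _ n _ k] assoc_mult_mat[of _ k n _ k _ k])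
  moreover have "mat_adjoint Z * Z \<in> carrier_mat k k" using c Z by auto
  ultimately have "Determinant.det (mat_adjoint (Z * R) * (Z * R))
      = Determinant.det (mat_adjoint R) * (Determinant.det (mat_adjoint Z * Z) * Determinant.det R)"
    using R c by (simp add: det_mult[of _ k])
  also have "\<dots> = (Determinant.det R * cnj (Determinant.det R)) * Determinant.det (mat_adjoint Z * Z)"
    unfolding det_mat_adjoint[OF R] by simp
  finally show ?thesis by (simp only: complex_norm_square)
qed

lemma gram_unitary:
  assumes S: "S \<in> NU n" and Z: "Z \<in> carrier_mat (d * n) m"
  shows "mat_adjoint (S * Z) * (S * Z) = mat_adjoint Z * Z"
proof -
  note cS = NU_D[OF S]
  have c: "mat_adjoint Z \<in> carrier_mat m (d * n)" "mat_adjoint S \<in> carrier_mat (d * n) (d * n)" using Z cS by auto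
  have "mat_adjoint (S * Z) * (S * Z) = mat_adjoint Z * (mat_adjoint S * (S * Z))"
    unfolding mat_adjoint_mult[OF cS(2) Z] using Z cS c by (intro assoc_mult_mat[of _ m "d*n" _ "d*n" _ m]) auto
  also have "mat_adjoint S * (S * Z) = mat_adjoint S * S * Z"
    using Z cS c by (intro assoc_mult_mat[symmetric, of _ "d*n" "d*n" _ "d*n" _ m]) auto
  finally show ?thesis using cS Z by simp
qed

text \<open>By the QR factorization the determinant is the squared modulus of the determinant of
  \<open>R\<close>.\<close>

lemma D_real_nonneg:
  assumes V: "V \<in> NC n k" and k: "k \<le> n"
  shows "Determinant.det (mat_adjoint V * V) = complex_of_real (D V)" "0 \<le> D V"
proof -
  obtain S R where *: "S \<in> NU n" "R \<in> NC k k" "V = mat_adjoint S * (E n k * R)"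
    using QR[OF assms] by blast
  have cE: "E n k \<in> carrier_mat (d * n) (d * k)" by (auto simp: first_columns_def)
  have "mat_adjoint V * V = mat_adjoint (E n k * R) * (E n k * R)"
    unfolding *(3) using cE NC_carrier[OF *(2)] by (intro gram_unitary[OF NU_adjoint[OF *(1)]]) auto
  hence "Determinant.det (mat_adjoint V * V) = complex_of_real ((cmod (Determinant.det R))\<^sup>2)"
    using det_gram_mult_right[OF cE NC_carrier[OF *(2)]] adjoint_E_E[OF k] by simp
  thus "Determinant.det (mat_adjoint V * V) = complex_of_real (D V)" "0 \<le> D V"
    by (simp_all add: D_def)
qed

text \<open>Writing \<open>V\<close> through its QR factorization, the square factor
  \<open>R\<close> contributes exactly \<open>D V\<close>, and a unitary on the far left does not
  change a Gram matrix, so \<open>S\<close> may be inserted there. What remains is the standard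
  frame moved by a conjugate of \<open>Y\<close>, with \<open>S\<close> independent of
  \<open>Y\<close>.\<close>

lemma D_conjugation:
  assumes V: "V \<in> NC n k" and k: "k \<le> n"
  obtains S where "S \<in> NU n" "\<And>Y. Y \<in> NC n n \<Longrightarrow> D (Y * V) = D (S * Y * mat_adjoint S * E n k) * D V"
proof -
  obtain S R where *: "S \<in> NU n" "R \<in> NC k k" "V = mat_adjoint S * (E n k * R)"
    using QR[OF assms] by blast
  have cE: "E n k \<in> carrier_mat (d * n) (d * k)" by (auto simp: first_columns_def)
  note cR = NC_carrier[OF *(2)] and cS = NU_D[OF *(1)]
  have cS': "mat_adjoint S \<in> carrier_mat (d * n) (d * n)" using cS by auto
  have "mat_adjoint V * V = mat_adjoint (E n k * R) * (E n k * R)"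
    unfolding *(3) using cE cR by (intro gram_unitary[OF NU_adjoint[OF *(1)]]) auto
  hence DV: "D V = (cmod (Determinant.det R))\<^sup>2"
    using det_gram_mult_right[OF cE cR] adjoint_E_E[OF k] by (simp add: D_def)
  have "D (Y * V) = D (S * Y * mat_adjoint S * E n k) * D V" if Y: "Y \<in> NC n n" for Y
  proof -
    note cY = NC_carrier[OF Y]
    let ?Z = "Y * mat_adjoint S * E n k"
    have cZ: "?Z \<in> carrier_mat (d * n) (d * k)" using cY cS' cE by auto
    have "Y * V = ?Z * R"
      unfolding *(3) using cY cS' cE cR
      by (simp add: assoc_mult_mat[of _ "d*n" "d*n" _ "d*n" _ "d*k"] assoc_mult_mat[of _ "d*n" "d*k" _ "d*k" _ "d*k"]
           assoc_mult_mat[of _ "d*n" "d*n" _ "d*k" _ "d*k"] mult_carrier_mat[of _ "d*n" "d*n" _ "d*n"] mult_carrier_mat[of _ "d*n" "d*n" _ "d*k"])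
    hence "D (Y * V) = (cmod (Determinant.det R))\<^sup>2 * Re (Determinant.det (mat_adjoint ?Z * ?Z))"
      unfolding D_def by (simp add: det_gram_mult_right[OF cZ cR])
    also have "mat_adjoint ?Z * ?Z = mat_adjoint (S * ?Z) * (S * ?Z)"
      using gram_unitary[OF *(1) cZ] by simp
    also have "S * ?Z = S * Y * mat_adjoint S * E n k"
      using cY cS' cE cS
      by (simp add: assoc_mult_mat[of _ "d*n" "d*n" _ "d*n" _ "d*k"] assoc_mult_mat[of _ "d*n" "d*n" _ "d*n" _ "d*n"]
            mult_carrier_mat[of _ "d*n" "d*n" _ "d*n"])
    finally show ?thesis unfolding DV by (simp add: D_def)
  qed
  thus ?thesis using that *(1) by blast
qed

section \<open>Eigencolumns and unitary diagonalization\<close>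

lemma block_eigencolumn:
  assumes \<beta>: "\<beta> \<noteq> 1" and G: "G \<in> NC n n" "mat_adjoint G = G" and k: "k < n"
    and diag: "\<And>i j. i < d * n \<Longrightarrow> j < d * k \<Longrightarrow> i \<noteq> j \<Longrightarrow> G $$ (i, j) = 0"
  obtains v ev where "v \<in> NC n 1" "frob2 v > 0" "G * v = complex_of_real ev \<cdot>\<^sub>m v"
    "\<And>i j. i < d * k \<Longrightarrow> j < d \<Longrightarrow> v $$ (i, j) = 0"
proof -
  note cG = NC_carrier[OF G(1)]
  \<comment> \<open>\<open>G\<close> is Hermitian and diagonal on the first k block columns, so its
    trailing block \<open>B\<close> of size m splits off. An eigenvector of \<open>B\<close>,
    extended by zeros, is an eigenvector \<open>x\<close> of \<open>G\<close>.\<close>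
  define m where "m = d * n - d * k"
  have m: "0 < m" "d * n = d * k + m" using k by (auto simp: m_def)
  have herm: "G $$ (i, j) = cnj (G $$ (j, i))" if "i < d * n" "j < d * n" for i j
    using index_mat_adjoint[of i G j] cG that G(2) by auto
  define B where "B = mat m m (\<lambda>(i, j). G $$ (d * k + i, d * k + j))"
  have cB: "B \<in> carrier_mat m m" by (simp add: B_def)
  obtain as where as: "char_poly B = (\<Prod>a\<leftarrow>as. [:- a, 1:])" "length as = m"
    using char_poly_factorized[OF cB] by blast
  then obtain a as' where "as = a # as'" using m by (cases as) auto
  hence "poly (char_poly B) a = 0" by (simp add: as)
  hence "eigenvalue B a" using eigenvalue_root_char_poly[OF cB] by simp
  then obtain y where y: "y \<in> carrier_vec m" "y \<noteq> 0\<^sub>v m" "B *\<^sub>v y = a \<cdot>\<^sub>v y"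
    unfolding eigenvalue_def eigenvector_def using cB by auto
  define x where "x i = (if i < d * k then 0 else y $ (i - d * k))" for i
  have Gx: "(\<Sum>p<d * n. G $$ (i, p) * x p) = a * x i" if i: "i < d * n" for i
  proof -
    have "(\<Sum>p<d * n. G $$ (i, p) * x p) = (\<Sum>p\<in>{..<d * k} \<union> {d * k..<d * k + m}. G $$ (i, p) * x p)"
      using m by (intro sum.cong) auto
    also have "\<dots> = (\<Sum>p<d * k. G $$ (i, p) * x p) + (\<Sum>p\<in>{d * k..<d * k + m}. G $$ (i, p) * x p)"
      by (rule sum.union_disjoint) auto
    also have "(\<Sum>p<d * k. G $$ (i, p) * x p) = 0" by (simp add: x_def)
    also have "(\<Sum>p\<in>{d * k..<d * k + m}. G $$ (i, p) * x p) = (\<Sum>q<m. G $$ (i, d * k + q) * y $ q)"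
      using sum.shift_bounds_nat_ivl[of "\<lambda>p. G $$ (i, p) * x p" 0 "d * k" m]
      by (simp add: atLeast0LessThan add.commute x_def)
    finally have e: "(\<Sum>p<d * n. G $$ (i, p) * x p) = (\<Sum>q<m. G $$ (i, d * k + q) * y $ q)" by simp
    show ?thesis
    proof (cases "i < d * k")
      case True
      have "G $$ (i, d * k + q) = 0" if "q < m" for q
        using herm[of i "d * k + q"] diag[of "d * k + q" i] True i that m by auto
      thus ?thesis using e True by (simp add: x_def)
    next
      case False
      then obtain i' where i': "i = d * k + i'" "i' < m" using i m by (metis add_less_cancel_left le_Suc_ex not_less)
      have "(\<Sum>q<m. G $$ (i, d * k + q) * y $ q) = (B *\<^sub>v y) $ i'"
        using i' cB y(1) by (auto simp: scalar_prod_def B_def atLeast0LessThan intro!: sum.cong)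
      thus ?thesis using e i' y by (simp add: x_def)
    qed
  qed
  obtain q where q: "q < m" "y $ q \<noteq> 0" using y(1,2) by (metis carrier_vecD eq_vecI index_zero_vec(1,2))
  have xq: "d * k + q < d * n" "x (d * k + q) \<noteq> 0" using q m by (auto simp: x_def)
  have a_real: "cnj a = a"
  proof -
    let ?s = "(\<Sum>i<d * n. \<Sum>p<d * n. cnj (x i) * G $$ (i, p) * x p)"
    let ?r = "\<Sum>i<d * n. x i * cnj (x i)"
    have s: "?s = a * ?r"
    proof -
      have "?s = (\<Sum>i<d * n. cnj (x i) * (\<Sum>p<d * n. G $$ (i, p) * x p))"
        by (simp add: sum_distrib_left mult.assoc)
      also have "\<dots> = (\<Sum>i<d * n. a * (x i * cnj (x i)))" by (rule sum.cong) (simp_all add: Gx)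
      finally show ?thesis by (simp add: sum_distrib_left)
    qed
    have "cnj ?s = (\<Sum>i<d * n. \<Sum>p<d * n. cnj (x p) * G $$ (p, i) * x i)"
      unfolding cnj_sum by (intro sum.cong refl) (subst herm, auto)
    also have "\<dots> = ?s" by (rule sum.swap)
    finally have "cnj (a * ?r) = a * ?r" by (simp only: s)
    moreover have "?r = complex_of_real (\<Sum>i<d * n. (cmod (x i))\<^sup>2)"
      by (simp only: of_real_sum complex_norm_square)
    moreover have "(\<Sum>i<d * n. (cmod (x i))\<^sup>2) > 0"
      using xq by (intro sum_pos2[of _ "d * k + q"]) auto
    ultimately show ?thesis by (metis complex_cnj_mult complex_cnj_complex_of_real mult_cancel_right of_real_eq_0_iff less_irrefl)
  qed
  define ev where "ev = Re a"
  have a: "a = complex_of_real ev" using a_real by (auto simp: ev_def complex_eq_iff)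
  have x0: "x i = 0" if "i < d * k" for i using that by (simp add: x_def)
  \<comment> \<open>For quaternions the second column is the image of \<open>x\<close> under the
    antilinear symmetry. It is an eigenvector for the conjugate eigenvalue, which is the same one
    because \<open>a\<close> is real. For \<beta> = 1 a complex eigenvector would not give a real
    column; real matrices are treated as complex ones instead.\<close>
  define v where "v = mat (d * n) d (\<lambda>(i, j). if j = 0 then x i else sg i * sg j * cnj (x (\<tau> i)))"
  have cv: "v \<in> carrier_mat (d * n) d" by (simp add: v_def)
  have v: "v \<in> NC n 1"
  proof (rule NC_I)
    fix i j assume ij: "i < d * n" "j < d * 1" "\<beta> \<noteq> 2"
    have b4: "\<beta> = 4" using dyson_index \<beta> ij by auto
    hence d: "d = 2" by (simp add: block_dim_def)
    note t = \<tau>_sg_quaternion[OF b4, of 0, simplified]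
    have st: "sg i * sg (\<tau> i) = -1" unfolding sg_def \<tau>_def using b4 by auto
    have "j = 0 \<or> j = 1" using ij d by auto
    thus "v $$ (i, j) = sg i * sg j * cnj (v $$ (\<tau> i, \<tau> j))"
    proof
      assume j: "j = 0"
      have "v $$ (\<tau> i, 1) = - sg (\<tau> i) * cnj (x i)"
        using \<tau>_less[OF ij(1)] d t by (simp add: v_def)
      hence "sg i * sg j * cnj (v $$ (\<tau> i, \<tau> j)) = - (sg i * sg (\<tau> i)) * x i" using j t by simp
      thus ?thesis unfolding st using ij j by (simp add: v_def)
    next
      assume j: "j = 1"
      have "v $$ (\<tau> i, 0) = x (\<tau> i)" using \<tau>_less[OF ij(1)] d by (simp add: v_def)
      thus ?thesis using j ij t d by (simp add: v_def)
    qed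
  qed (simp add: cv)
  have "G * v = complex_of_real ev \<cdot>\<^sub>m v"
  proof (rule eq_matI)
    fix i j assume "i < dim_row (complex_of_real ev \<cdot>\<^sub>m v)" "j < dim_col (complex_of_real ev \<cdot>\<^sub>m v)"
    hence ij: "i < d * n" "j < d" using cv by auto
    show "(G * v) $$ (i, j) = (complex_of_real ev \<cdot>\<^sub>m v) $$ (i, j)"
    proof (cases "j = 0")
      case True
      thus ?thesis unfolding index_mult_mat_sum[OF cG cv ij] using ij Gx[OF ij(1)] by (simp add: v_def a)
    next
      case False
      hence d: "d \<noteq> 1" using ij by auto
      hence b: "\<beta> \<noteq> 2" by (auto simp: block_dim_def)
      have "(G * v) $$ (i, j) = (\<Sum>p<d * n. G $$ (i, p) * (sg p * sg j * cnj (x (\<tau> p))))"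
        unfolding index_mult_mat_sum[OF cG cv ij] using ij False by (intro sum.cong) (auto simp: v_def)
      also have "\<dots> = (\<Sum>p<d * n. sg i * sg j * cnj (G $$ (\<tau> i, \<tau> p) * x (\<tau> p)))"
      proof (rule sum.cong)
        fix p assume "p \<in> {..<d * n}"
        hence "G $$ (i, p) = sg i * sg p * cnj (G $$ (\<tau> i, \<tau> p))" using NC_D[OF G(1) ij(1) _ b] by simp
        hence "G $$ (i, p) * (sg p * sg j * cnj (x (\<tau> p)))
           = sg p * sg p * (sg i * sg j * cnj (G $$ (\<tau> i, \<tau> p) * x (\<tau> p)))" by simp
        thus "G $$ (i, p) * (sg p * sg j * cnj (x (\<tau> p))) = sg i * sg j * cnj (G $$ (\<tau> i, \<tau> p) * x (\<tau> p))"
          by (simp only: sg_sg mult_1)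
      qed simp
      also have "\<dots> = sg i * sg j * cnj (\<Sum>p<d * n. G $$ (\<tau> i, \<tau> p) * x (\<tau> p))"
        by (simp only: cnj_sum sum_distrib_left)
      also have "(\<Sum>p<d * n. G $$ (\<tau> i, \<tau> p) * x (\<tau> p)) = (\<Sum>p<d * n. G $$ (\<tau> i, p) * x p)"
        by (rule sum_\<tau>)
      also have "\<dots> = a * x (\<tau> i)" by (rule Gx[OF \<tau>_less[OF ij(1)]])
      finally show ?thesis using ij False by (simp add: v_def a)
    qed
  qed (use cG cv in auto)
  moreover have "frob2 v > 0"
  proof -
    have "v $$ (d * k + q, 0) \<noteq> 0" using xq by (simp add: v_def)
    hence "frob2 v \<noteq> 0" using frob2_eq_0[of v "d * k + q" 0] xq cv by (metis carrier_matD d_pos)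
    thus ?thesis using frob2_nonneg[of v] by linarith
  qed
  moreover have "v $$ (i, j) = 0" if "i < d * k" "j < d" for i j
    using that x0 \<tau>_less[OF that(1)] mult_block_less[of k n i] k by (simp add: v_def)
  ultimately show ?thesis using that v by blast
qed

lemma conj_hermitian:
  fixes S H :: "complex mat"
  assumes "S \<in> carrier_mat n n" "H \<in> carrier_mat n n" "mat_adjoint H = H"
  shows "mat_adjoint (S * H * mat_adjoint S) = S * H * mat_adjoint S"
  using assms by (simp add: mat_adjoint_mult[of _ n n _ n] assoc_mult_mat[of _ n n _ n _ n])

text \<open>Deflation block by block: a unitary that fixes the first k blocks moves an eigencolumn
  into block k, and this makes block column k of the conjugated matrix a scalar multiple of the unit
  column.\<close>

lemma partial_diagonalization:
  assumes \<beta>: "\<beta> \<noteq> 1" and H: "H \<in> NC n n" "mat_adjoint H = H" and "k \<le> n"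
  shows "\<exists>S\<in>NU n. \<exists>a. \<forall>i<d * n. \<forall>j<d * k.
    (S * H * mat_adjoint S) $$ (i, j) = (if i = j then complex_of_real (a (j div d)) else 0)"
  using \<open>k \<le> n\<close>
proof (induction k)
  case 0
  show ?case by (rule bexI[OF _ NU_one]) auto
next
  case (Suc k)
  hence k: "k < n" "k \<le> n" by auto
  obtain S a where S: "S \<in> NU n" and Sa: "\<And>i j. i < d * n \<Longrightarrow> j < d * k \<Longrightarrow>
    (S * H * mat_adjoint S) $$ (i, j) = (if i = j then complex_of_real (a (j div d)) else 0)"
    using Suc.IH[OF k(2)] by blast
  note cS = NU_D[OF S] and cH = NC_carrier[OF H(1)]
  have cS': "mat_adjoint S \<in> carrier_mat (d * n) (d * n)" using cS by auto
  define G where "G = S * H * mat_adjoint S"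
  have G: "G \<in> NC n n" unfolding G_def using cS(1) H(1) by blast
  have Gh: "mat_adjoint G = G" unfolding G_def by (rule conj_hermitian[OF cS(2) cH H(2)])
  note cG = NC_carrier[OF G]
  have Gd: "i < d * n \<Longrightarrow> j < d * k \<Longrightarrow> G $$ (i, j) = (if i = j then complex_of_real (a (j div d)) else 0)" for i j
    using Sa by (simp add: G_def)
  obtain v ev where v: "v \<in> NC n 1" "frob2 v > 0" "G * v = complex_of_real ev \<cdot>\<^sub>m v"
    "\<And>i j. i < d * k \<Longrightarrow> j < d \<Longrightarrow> v $$ (i, j) = 0"
    using block_eigencolumn[OF \<beta> G Gh k(1)] Gd by (smt (verit))
  have cv: "v \<in> carrier_mat (d * n) d" using NC_carrier[OF v(1)] by simp
  obtain T where T: "T \<in> NU n"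
    "\<And>l W. W \<in> carrier_mat (d * n) l \<Longrightarrow> (\<And>i j. d * k \<le> i \<Longrightarrow> i < d * n \<Longrightarrow> j < l \<Longrightarrow> W $$ (i, j) = 0) \<Longrightarrow> T * W = W"
    "\<And>i j. i < d * k \<Longrightarrow> j < d \<Longrightarrow> (T * v) $$ (i, j) = v $$ (i, j)"
    "\<And>i j. d * Suc k \<le> i \<Longrightarrow> i < d * n \<Longrightarrow> j < d \<Longrightarrow> (T * v) $$ (i, j) = 0"
    using householder[OF v(1) k(1)] by metis
  note cT = NU_D[OF T(1)]
  have cT': "mat_adjoint T \<in> carrier_mat (d * n) (d * n)" using cT by auto
  define w where "w = T * v"
  have w: "w \<in> NC n 1" unfolding w_def using cT(1) v(1) by blast
  have cw: "w \<in> carrier_mat (d * n) d" using NC_carrier[OF w] by simp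
  have wz: "w $$ (i, j) = 0" if "i < d * n" "j < d" "i < d * k \<or> d * Suc k \<le> i" for i j
    using T(3,4) v(4) that unfolding w_def by (metis)
  define G' where "G' = T * G * mat_adjoint T"
  have cG': "G' \<in> carrier_mat (d * n) (d * n)" unfolding G'_def using cT(2) cG cT' by (intro mult_carrier_mat)
  have G'W: "G' * (T * W) = T * (G * W)" if W: "W \<in> carrier_mat (d * n) l" for W l
  proof -
    have "G' * (T * W) = T * (G * (mat_adjoint T * (T * W)))"
      unfolding G'_def using cT cG cT' W
      by (simp add: assoc_mult_mat[of _ "d*n" "d*n" _ "d*n" _ l] mult_carrier_mat[of _ "d*n" "d*n" _ "d*n"] mult_carrier_mat[of _ "d*n" "d*n" _ l])
    also have "mat_adjoint T * (T * W) = mat_adjoint T * T * W"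
      using cT cT' W by (intro assoc_mult_mat[symmetric]) auto
    finally show ?thesis using cT W by simp
  qed
  have G'w: "G' * w = complex_of_real ev \<cdot>\<^sub>m w"
    unfolding w_def G'W[OF cv] v(3) using cT cv by (intro mult_smult_distrib[of _ "d*n" "d*n"]) auto
  define r where "r = frob2 v / d"
  have r: "0 < r" using v(2) by (simp add: r_def)
  have ww: "mat_adjoint w * w = complex_of_real r \<cdot>\<^sub>m 1\<^sub>m d"
    unfolding w_def gram_unitary[OF T(1) cv] r_def by (rule gram_scalar[OF v(1)])
  \<comment> \<open>\<open>w\<close> is supported in block k, so its Gram scalar is that of the
    square block \<open>\<alpha>\<close>. This scalar is nonzero, hence \<open>\<alpha>\<close> is
    invertible.\<close>
  define \<alpha> where "\<alpha> = mat d d (\<lambda>(p, j). w $$ (d * k + p, j))"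
  have c\<alpha>: "\<alpha> \<in> carrier_mat d d" "mat_adjoint \<alpha> \<in> carrier_mat d d" by (auto simp: \<alpha>_def)
  have block_sum: "(\<Sum>p<d * n. f p) = (\<Sum>p<d. f (d * k + p))"
    if f: "\<And>p. p < d * n \<Longrightarrow> p < d * k \<or> d * Suc k \<le> p \<Longrightarrow> f p = 0" for f :: "nat \<Rightarrow> complex"
  proof -
    have "(\<Sum>p<d * n. f p) = sum f {d * k..<d * k + d}"
    proof (intro sum.mono_neutral_right)
      have "d * Suc k \<le> d * n" using k by (intro mult_le_mono2) simp
      thus "{d * k..<d * k + d} \<subseteq> {..<d * n}" by auto
      show "\<forall>i\<in>{..<d * n} - {d * k..<d * k + d}. f i = 0" using f by auto
    qed simp
    thus ?thesis using sum.shift_bounds_nat_ivl[of f 0 "d * k" d] by (simp add: atLeast0LessThan add.commute)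
  qed
  have a1: "mat_adjoint \<alpha> * \<alpha> = complex_of_real r \<cdot>\<^sub>m 1\<^sub>m d"
  proof -
    have "mat_adjoint w * w = mat_adjoint \<alpha> * \<alpha>"
    proof (rule eq_matI)
      fix i j assume "i < dim_row (mat_adjoint \<alpha> * \<alpha>)" "j < dim_col (mat_adjoint \<alpha> * \<alpha>)"
      hence ij: "i < d" "j < d" using c\<alpha> by auto
      have "(mat_adjoint w * w) $$ (i, j) = (\<Sum>p<d * n. cnj (w $$ (p, i)) * w $$ (p, j))"
        using cw ij by (subst index_mult_mat_sum[of _ d "d * n"]) auto
      also have "\<dots> = (\<Sum>p<d. cnj (w $$ (d * k + p, i)) * w $$ (d * k + p, j))"
        by (rule block_sum) (use wz ij in auto)
      also have "\<dots> = (mat_adjoint \<alpha> * \<alpha>) $$ (i, j)"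
        using c\<alpha> ij by (subst index_mult_mat_sum[of _ d d]) (auto simp: \<alpha>_def)
      finally show "(mat_adjoint w * w) $$ (i, j) = (mat_adjoint \<alpha> * \<alpha>) $$ (i, j)" .
    qed (use cw c\<alpha> in auto)
    thus ?thesis using ww by simp
  qed
  have a2: "\<alpha> * (complex_of_real (1 / r) \<cdot>\<^sub>m mat_adjoint \<alpha>) = 1\<^sub>m d"
  proof (rule mat_mult_left_right_inverse[of _ d])
    have "(complex_of_real (1 / r) \<cdot>\<^sub>m mat_adjoint \<alpha>) * \<alpha> = complex_of_real (1 / r) \<cdot>\<^sub>m (mat_adjoint \<alpha> * \<alpha>)"
      by (rule mult_smult_assoc_mat) (use c\<alpha> in auto)
    also have "\<dots> = 1\<^sub>m d" unfolding a1 using r by (intro eq_matI) auto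
    finally show "(complex_of_real (1 / r) \<cdot>\<^sub>m mat_adjoint \<alpha>) * \<alpha> = 1\<^sub>m d" .
  qed (use c\<alpha> in auto)
  \<comment> \<open>The eigenvalue equation for \<open>w\<close> says that block column k of
    \<open>G'\<close> times \<open>\<alpha>\<close> equals \<open>ev\<close> times \<open>w\<close>.
    Multiplying by the inverse \<open>\<gamma>\<close> of \<open>\<alpha>\<close> leaves
    \<open>ev\<close> times the unit block column.\<close>
  have new: "G' $$ (i, d * k + q) = (if i = d * k + q then complex_of_real ev else 0)"
    if i: "i < d * n" and q: "q < d" for i q
  proof -
    define \<gamma> where "\<gamma> = complex_of_real (1 / r) \<cdot>\<^sub>m mat_adjoint \<alpha>"
    have c\<gamma>: "\<gamma> \<in> carrier_mat d d" using c\<alpha> by (simp add: \<gamma>_def)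
    have inv: "(\<Sum>j<d. \<alpha> $$ (p, j) * \<gamma> $$ (j, q)) = (if p = q then 1 else 0)" if p: "p < d" for p
      using a2 index_mult_mat_sum[OF c\<alpha>(1) c\<gamma> p q] p q by (simp add: \<gamma>_def)
    have G'\<alpha>: "(\<Sum>p<d. G' $$ (i, d * k + p) * \<alpha> $$ (p, j)) = complex_of_real ev * w $$ (i, j)" if j: "j < d" for j
    proof -
      have "(\<Sum>p<d. G' $$ (i, d * k + p) * \<alpha> $$ (p, j)) = (\<Sum>p<d. G' $$ (i, d * k + p) * w $$ (d * k + p, j))"
        using j by (intro sum.cong) (auto simp: \<alpha>_def)
      also have "\<dots> = (\<Sum>p<d * n. G' $$ (i, p) * w $$ (p, j))"
        by (rule block_sum[symmetric]) (use wz j in auto)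
      also have "\<dots> = (G' * w) $$ (i, j)" by (rule index_mult_mat_sum[OF cG' cw i j, symmetric])
      finally show ?thesis unfolding G'w using cw i j by simp
    qed
    have "G' $$ (i, d * k + q) = (\<Sum>p<d. G' $$ (i, d * k + p) * (if p = q then 1 else 0))"
      using q by (simp add: if_distrib cong: if_cong)
    also have "\<dots> = (\<Sum>p<d. \<Sum>j<d. G' $$ (i, d * k + p) * (\<alpha> $$ (p, j) * \<gamma> $$ (j, q)))"
      by (intro sum.cong refl) (simp add: inv flip: sum_distrib_left)
    also have "\<dots> = (\<Sum>j<d. \<Sum>p<d. G' $$ (i, d * k + p) * \<alpha> $$ (p, j) * \<gamma> $$ (j, q))"
      by (subst sum.swap) (simp add: mult.assoc)
    also have "\<dots> = (\<Sum>j<d. complex_of_real ev * w $$ (i, j) * \<gamma> $$ (j, q))"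
      by (intro sum.cong refl) (simp add: G'\<alpha> flip: sum_distrib_right)
    also have "\<dots> = complex_of_real ev * (\<Sum>j<d. w $$ (i, j) * \<gamma> $$ (j, q))"
      by (simp add: sum_distrib_left mult.assoc)
    also have "(\<Sum>j<d. w $$ (i, j) * \<gamma> $$ (j, q)) = (if i = d * k + q then 1 else 0)"
    proof (cases "i < d * k \<or> d * Suc k \<le> i")
      case True
      thus ?thesis using wz[OF i] q by (auto intro!: sum.neutral)
    next
      case False
      then obtain p where p: "i = d * k + p" "p < d"
        by (metis add_less_cancel_left le_Suc_ex mult_Suc_right not_le add.commute)
      have "(\<Sum>j<d. w $$ (i, j) * \<gamma> $$ (j, q)) = (\<Sum>j<d. \<alpha> $$ (p, j) * \<gamma> $$ (j, q))"
        using p by (intro sum.cong) (auto simp: \<alpha>_def)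
      thus ?thesis using inv[OF p(2)] p by simp
    qed
    finally show ?thesis by simp
  qed
  \<comment> \<open>\<open>T\<close> fixes the frame of the first k blocks, and also its image under
    \<open>G\<close>, which is supported in the same blocks.\<close>
  have old: "G' $$ (i, j) = (if i = j then complex_of_real (a (j div d)) else 0)"
    if ij: "i < d * n" "j < d * k" for i j
  proof -
    have cE: "E n k \<in> carrier_mat (d * n) (d * k)" by (auto simp: first_columns_def)
    have GE: "G * E n k = first_columns \<beta> k G" using first_columns_eq_mult[OF cG k(2)] by simp
    have cGE: "first_columns \<beta> k G \<in> carrier_mat (d * n) (d * k)" using cG by (auto simp: first_columns_def)
    have TE: "T * E n k = E n k"
      by (rule T(2)[OF cE]) (use mult_block_less[OF k(2)] in \<open>auto simp: first_columns_def\<close>)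
    have "G' * (T * E n k) = T * (G * E n k)" by (rule G'W[OF cE])
    hence "G' * E n k = T * first_columns \<beta> k G" unfolding TE GE .
    also have "\<dots> = first_columns \<beta> k G"
      by (rule T(2)[OF cGE]) (use cG Gd mult_block_less[OF k(2)] in \<open>auto simp: first_columns_def\<close>)
    finally have "first_columns \<beta> k G' = first_columns \<beta> k G"
      using first_columns_eq_mult[OF cG' k(2)] by simp
    hence "first_columns \<beta> k G' $$ (i, j) = first_columns \<beta> k G $$ (i, j)" by simp
    hence "G' $$ (i, j) = G $$ (i, j)" using cG cG' ij by (simp add: first_columns_def)
    thus ?thesis using Gd[OF ij] by simp
  qed
  have "G' = (T * S) * H * mat_adjoint (T * S)"
    unfolding G'_def G_def mat_adjoint_mult[OF cT(2) cS(2)] using cT cS cT' cS' cH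
    by (simp add: assoc_mult_mat[of _ "d*n" "d*n" _ "d*n" _ "d*n"] mult_carrier_mat[of _ "d*n" "d*n" _ "d*n"])
  moreover have "G' $$ (i, j) = (if i = j then complex_of_real ((a(k := ev)) (j div d)) else 0)"
    if ij: "i < d * n" "j < d * Suc k" for i j
  proof (cases "j < d * k")
    case True
    hence "j div d \<noteq> k" by (metis less_mult_imp_div_less mult.commute less_irrefl)
    thus ?thesis using old[OF ij(1) True] by simp
  next
    case False
    then obtain q where q: "j = d * k + q" "q < d"
      using ij by (metis add_less_cancel_left le_Suc_ex mult_Suc_right not_le add.commute)
    thus ?thesis using new[OF ij(1) q(2)] by simp
  qed
  ultimately show ?case using NU_mult[OF T(1) S] by (metis (no_types, lifting))
qed

end

section \<open>Gram determinants and Hermitian spectra\<close>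

lemma mtrace_carrier: "A \<in> carrier_mat n n \<Longrightarrow> mtrace A = (\<Sum>i<n. A $$ (i, i))"
  by (auto simp: mtrace_def)

text \<open>Grouping equal values turns a product over indices into a product over distinct
  eigenvalues with multiplicities, the form used in \<open>number_det\<close>.\<close>

lemma prod_pow_count:
  fixes f :: "nat \<Rightarrow> 'a :: comm_monoid_mult"
  assumes "finite A" "finite B" "a ` A \<subseteq> B"
  shows "(\<Prod>i\<in>A. g (a i)) = (\<Prod>z\<in>B. g z ^ card {i \<in> A. a i = z})"
proof -
  have "(\<Prod>i\<in>A. g (a i)) = (\<Prod>z\<in>B. \<Prod>i\<in>{i \<in> A. a i = z}. g (a i))"
    using assms by (subst prod.group) auto
  also have "\<dots> = (\<Prod>z\<in>B. \<Prod>i\<in>{i \<in> A. a i = z}. g z)" by (intro prod.cong) auto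
  finally show ?thesis by simp
qed

lemma order_linear_prod_power:
  fixes a :: "nat \<Rightarrow> complex"
  shows "Polynomial.order z (\<Prod>i<n. [:- a i, 1:] ^ m) = m * card {i \<in> {..<n}. a i = z}"
proof (induction n)
  case (Suc n)
  have nz: "(\<Prod>i<n. [:- a i, 1:] ^ m) \<noteq> 0" by simp
  have "Polynomial.order z ([:- a n, 1:] ^ m) = (if a n = z then m else 0)"
  proof (cases "a n = z")
    case True
    thus ?thesis using order_power_n_n[of z m] by simp
  next
    case False
    thus ?thesis by (simp add: order_0I)
  qed
  moreover have "{i. i < Suc n \<and> a i = z} = (if a n = z then insert n {i. i < n \<and> a i = z} else {i. i < n \<and> a i = z})"
    by (auto simp: less_Suc_eq)
  ultimately show ?case using Suc nz
    by (subst prod.lessThan_Suc, subst order_mult) auto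
qed simp

context number_system begin

lemma diagonalization:
  assumes \<beta>: "\<beta> \<noteq> 1" and H: "H \<in> NC n n" "mat_adjoint H = H"
  obtains S a where "S \<in> NU n" "\<And>i j. i < d * n \<Longrightarrow> j < d * n \<Longrightarrow>
    (S * H * mat_adjoint S) $$ (i, j) = (if i = j then complex_of_real (a (j div d)) else 0)"
  using partial_diagonalization[OF assms order_refl] by blast

text \<open>Each diagonal scalar is repeated d times, once for every row of its block; this is the
  double degeneracy of quaternion spectra. Nonnegativity holds because the conjugated matrix is
  again a Gram matrix, so \<open>a i\<close> is a sum of squared moduli.\<close>

lemma char_poly_hermitian:
  assumes \<beta>: "\<beta> \<noteq> 1" and V: "V \<in> NC m n"
  obtains a where "\<And>i. i < n \<Longrightarrow> 0 \<le> a i"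
    "char_poly (mat_adjoint V * V) = (\<Prod>i<n. [:- complex_of_real (a i), 1:] ^ d)"
    "Determinant.det (mat_adjoint V * V) = (\<Prod>i<n. complex_of_real (a i) ^ d)"
proof -
  let ?H = "mat_adjoint V * V"
  note cV = NC_carrier[OF V]
  have cV': "mat_adjoint V \<in> carrier_mat (d * n) (d * m)" using cV by auto
  have H: "?H \<in> NC n n" using V by blast
  have Hh: "mat_adjoint ?H = ?H" using mat_adjoint_mult[OF cV' cV] by simp
  note cH = NC_carrier[OF H]
  obtain S a where S: "S \<in> NU n" and diag: "\<And>i j. i < d * n \<Longrightarrow> j < d * n \<Longrightarrow>
    (S * ?H * mat_adjoint S) $$ (i, j) = (if i = j then complex_of_real (a (j div d)) else 0)"
    using diagonalization[OF \<beta> H Hh] by metis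
  note cS = NU_D[OF S]
  have cS': "mat_adjoint S \<in> carrier_mat (d * n) (d * n)" using cS by auto
  let ?G = "S * ?H * mat_adjoint S"
  have cG: "?G \<in> carrier_mat (d * n) (d * n)" by (rule mult_carrier_mat[OF mult_carrier_mat[OF cS(2) cH] cS'])
  have ut: "upper_triangular ?G" using carrier_matD[OF cG] by (intro upper_triangularI) (auto simp: diag simp del: index_mult_mat(1))
  have dm: "diag_mat ?G = map (\<lambda>i. complex_of_real (a (i div d))) [0..<d * n]"
    using carrier_matD[OF cG] by (intro nth_equalityI) (auto simp: diag_mat_def diag simp del: index_mult_mat(1))
  have sim: "similar_mat ?G ?H"
  proof (rule similar_matI)
    show "{?G, ?H, S, mat_adjoint S} \<subseteq> carrier_mat (d * n) (d * n)" using cG cH cS cS' by blast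
    show "S * mat_adjoint S = 1\<^sub>m (d * n)" "mat_adjoint S * S = 1\<^sub>m (d * n)" using cS by simp_all
  qed simp
  have prod_blocks: "(\<Prod>i<d * n. g (a (i div d))) = (\<Prod>i<n. g (a i) ^ d)" for g :: "real \<Rightarrow> 'c :: comm_monoid_mult"
  proof (induction n)
    case (Suc n)
    have "{..<d * Suc n} = {..<d * n} \<union> {d * n..<d * n + d}" by auto
    hence "(\<Prod>r<d * Suc n. g (a (r div d))) = (\<Prod>r<d * n. g (a (r div d))) * (\<Prod>r\<in>{d * n..<d * n + d}. g (a (r div d)))"
      by (simp add: prod.union_disjoint ivl_disj_int)
    also have "(\<Prod>r\<in>{d * n..<d * n + d}. g (a (r div d))) = (\<Prod>r\<in>{d * n..<d * n + d}. g (a n))"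
    proof (intro prod.cong refl)
      fix r assume "r \<in> {d * n..<d * n + d}"
      hence "r div d = n" by (intro div_nat_eqI) (auto simp: mult.commute)
      thus "g (a (r div d)) = g (a n)" by simp
    qed
    finally show ?case using Suc by simp
  qed simp
  have pl: "prod_list (map h [0..<q]) = (\<Prod>i<q. h i)" for h :: "nat \<Rightarrow> 'c :: comm_monoid_mult" and q
    by (induction q) (auto simp: mult.commute)
  have "char_poly ?H = char_poly ?G" using char_poly_similar[OF sim] by simp
  also have "\<dots> = (\<Prod>b\<leftarrow>diag_mat ?G. [:- b, 1:])" by (rule char_poly_upper_triangular[OF cG ut])
  also have "\<dots> = (\<Prod>i<d * n. [:- complex_of_real (a (i div d)), 1:])"
    unfolding dm by (simp add: pl comp_def)
  also have "\<dots> = (\<Prod>i<n. [:- complex_of_real (a i), 1:] ^ d)" by (rule prod_blocks)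
  finally have cp: "char_poly ?H = (\<Prod>i<n. [:- complex_of_real (a i), 1:] ^ d)" .
  have "Determinant.det ?H = Determinant.det ?G" using det_similar[OF sim] by simp
  also have "\<dots> = prod_list (diag_mat ?G)" by (rule det_upper_triangular[OF ut cG])
  also have "\<dots> = (\<Prod>i<d * n. complex_of_real (a (i div d)))" unfolding dm by (simp add: pl)
  also have "\<dots> = (\<Prod>i<n. complex_of_real (a i) ^ d)" by (rule prod_blocks)
  finally have dt: "Determinant.det ?H = (\<Prod>i<n. complex_of_real (a i) ^ d)" .
  have "0 \<le> a i" if i: "i < n" for i
  proof -
    have di: "d * i < d * n" "d * i div d = i" using i by auto
    let ?W = "V * mat_adjoint S"
    have cW: "?W \<in> carrier_mat (d * m) (d * n)" "mat_adjoint ?W \<in> carrier_mat (d * n) (d * m)" using cV cS' by auto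
    have "?G = mat_adjoint ?W * ?W"
      unfolding mat_adjoint_mult[OF cV cS'] using cS(2) cV cV' cS'
      by (simp add: assoc_mult_mat[of _ "d*n" "d*n" _ "d*m" _ "d*n"] assoc_mult_mat[of _ "d*n" "d*m" _ "d*n" _ "d*n"]
          assoc_mult_mat[of _ "d*n" "d*n" _ "d*n" _ "d*n"] mult_carrier_mat[of _ "d*n" "d*m" _ "d*n"])
    hence "complex_of_real (a i) = (mat_adjoint ?W * ?W) $$ (d * i, d * i)"
      using diag[OF di(1,1)] di by simp
    also have "\<dots> = (\<Sum>p<d * m. cnj (?W $$ (p, d * i)) * ?W $$ (p, d * i))"
      unfolding index_mult_mat_sum[OF cW(2,1) di(1,1)] using cW di by (intro sum.cong) (auto simp del: index_mult_mat)
    also have "\<dots> = complex_of_real (\<Sum>p<d * m. (cmod (?W $$ (p, d * i)))\<^sup>2)"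
      unfolding of_real_sum complex_norm_square by (simp add: mult.commute)
    finally have "a i = (\<Sum>p<d * m. (cmod (?W $$ (p, d * i)))\<^sup>2)" by (simp only: of_real_eq_iff)
    thus ?thesis by (simp add: sum_nonneg)
  qed
  thus ?thesis using that cp dt by blast
qed

text \<open>For \<beta> = 4 the order of a root of the characteristic polynomial is twice the number
  of blocks carrying it. The halved exponent in \<open>number_det\<close> thus counts blocks, while
  \<open>D\<close> counts every block twice.\<close>

lemma gram_det_power:
  assumes V: "V \<in> NC n k" and k: "k \<le> n"
  shows "0 \<le> gram_det \<beta> V" "gram_det \<beta> V ^ d = D V"
proof -
  have "0 \<le> gram_det \<beta> V \<and> gram_det \<beta> V ^ d = D V"
  proof (cases "\<beta> = 4")
    case False
    hence "d = 1" by (simp add: block_dim_def)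
    thus ?thesis using False D_real_nonneg[OF assms] by (simp add: gram_det_def number_det_def D_def)
  next
    case True
    hence \<beta>: "\<beta> \<noteq> 1" and d: "d = 2" by (auto simp: block_dim_def)
    let ?H = "mat_adjoint V * V"
    obtain a where a: "\<And>i. i < k \<Longrightarrow> 0 \<le> a i"
      "char_poly ?H = (\<Prod>i<k. [:- complex_of_real (a i), 1:] ^ d)"
      "Determinant.det ?H = (\<Prod>i<k. complex_of_real (a i) ^ d)"
      using char_poly_hermitian[OF \<beta> V] by metis
    have cH: "?H \<in> carrier_mat (d * k) (d * k)" using NC_carrier[OF V] by auto
    have ev: "{z. eigenvalue ?H z} = (\<lambda>i. complex_of_real (a i)) ` {..<k}"
      by (auto simp: eigenvalue_root_char_poly[OF cH] a(2) poly_prod d)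
    have "number_det \<beta> ?H = (\<Prod>z | eigenvalue ?H z. z ^ card {i \<in> {..<k}. complex_of_real (a i) = z})"
      unfolding number_det_def a(2) order_linear_prod_power using True d by (simp del: of_real_eq_iff)
    also have "\<dots> = (\<Prod>i<k. complex_of_real (a i))"
      by (rule prod_pow_count[symmetric, where g = "\<lambda>z. z"]) (auto simp: ev)
    finally have g: "gram_det \<beta> V = (\<Prod>i<k. a i)" by (simp add: gram_det_def flip: of_real_prod)
    have "D V = (\<Prod>i<k. a i) ^ d" unfolding D_def a(3)
      by (simp flip: of_real_power of_real_prod add: prod_power_distrib)
    thus ?thesis using g a(1) by (auto intro!: prod_nonneg)
  qed
  thus "0 \<le> gram_det \<beta> V" "gram_det \<beta> V ^ d = D V" by auto
qed

lemma ln_gram_det: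
  assumes V: "V \<in> NC n k" and k: "k \<le> n"
  shows "ln (gram_det \<beta> V) = ln (D V) / d" "gram_det \<beta> V = 0 \<longleftrightarrow> D V = 0"
  using gram_det_power[OF assms] ln_realpow[of "gram_det \<beta> V" d]
  by (auto simp: zero_less_power zero_power simp flip: gram_det_power(2)[OF assms])

end

text \<open>The number system is instantiated at \<beta> = 2, whose carrier contains every complex
  matrix of the right size. It is applied later in all three cases, since the perturbation of a real
  or quaternion Gram matrix is in particular complex Hermitian.\<close>

lemma hermitian_spectrum:
  fixes H :: "complex mat"
  assumes cH: "H \<in> carrier_mat n n" and Hh: "mat_adjoint H = H"
  obtains a :: "nat \<Rightarrow> real" where "mtrace H = (\<Sum>i<n. complex_of_real (a i))" "frob2 H = (\<Sum>i<n. (a i)\<^sup>2)"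
    "Determinant.det (1\<^sub>m n + H) = (\<Prod>i<n. complex_of_real (1 + a i))"
proof -
  interpret number_system 2 by unfold_locales simp
  have d: "block_dim 2 = 1" by (simp add: block_dim_def)
  have H: "H \<in> number_carrier 2 n n" using cH by (simp add: number_carrier_iff real_structure_def d)
  obtain S a where S: "S \<in> NU n" and diag: "\<And>i j. i < n \<Longrightarrow> j < n \<Longrightarrow>
    (S * H * mat_adjoint S) $$ (i, j) = (if i = j then complex_of_real (a j) else 0)"
    using diagonalization[OF _ H Hh] by (metis d div_by_1 mult_1 numeral_One numeral_eq_iff num.distinct(1))
  have cS: "S \<in> carrier_mat n n" "mat_adjoint S * S = 1\<^sub>m n" "S * mat_adjoint S = 1\<^sub>m n"
    using NU_D[OF S] by (simp_all add: d)
  have cS': "mat_adjoint S \<in> carrier_mat n n" using cS by auto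
  let ?G = "S * H * mat_adjoint S"
  have cG: "?G \<in> carrier_mat n n" using cS(1) cH cS' by (intro mult_carrier_mat)
  have "mtrace ?G = mtrace (mat_adjoint S * (S * H))"
    by (rule mtrace_mult_commute) (use cS cS' cH in auto)
  also have "mat_adjoint S * (S * H) = H"
    using cS cS' cH by (simp flip: assoc_mult_mat[of _ n n _ n _ n])
  finally have tr: "mtrace H = (\<Sum>i<n. complex_of_real (a i))"
    unfolding mtrace_carrier[OF cG] by (simp add: diag)
  have "frob2 H = frob2 ?G" by (rule frob2_unitary_conj[OF cH cS(1,2), symmetric])
  also have "\<dots> = (\<Sum>i<n. \<Sum>j<n. if i = j then (a i)\<^sup>2 else 0)"
    unfolding frob2_def carrier_matD[OF cG]
    by (intro sum.cong refl) (auto simp: diag simp del: index_mult_mat)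
  finally have fr: "frob2 H = (\<Sum>i<n. (a i)\<^sup>2)" by simp
  let ?K = "1\<^sub>m n + ?G"
  have cK: "?K \<in> carrier_mat n n" using cG by simp
  have K: "?K = S * (1\<^sub>m n + H) * mat_adjoint S"
    using cS cS' cH
    by (simp add: mult_add_distrib_mat[OF cS(1) one_carrier_mat cH] add_mult_distrib_mat[of _ n n _ _ n])
  have "Determinant.det ?K = Determinant.det S * Determinant.det (1\<^sub>m n + H) * Determinant.det (mat_adjoint S)"
    unfolding K using cS cS' cH by (subst det_mult[of _ n], simp_all add: det_mult[of _ n])
  also have "\<dots> = Determinant.det (S * mat_adjoint S) * Determinant.det (1\<^sub>m n + H)"
    using cS cS' by (subst det_mult[of _ n]) auto
  finally have "Determinant.det (1\<^sub>m n + H) = Determinant.det ?K" using cS by simp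
  also have "\<dots> = prod_list (diag_mat ?K)"
    by (rule det_upper_triangular[OF _ cK]) (use carrier_matD[OF cG] in \<open>auto intro!: upper_triangularI simp: diag simp del: index_mult_mat(1)\<close>)
  also have "diag_mat ?K = map (\<lambda>i. complex_of_real (1 + a i)) [0..<n]"
    using carrier_matD[OF cG] by (intro nth_equalityI) (auto simp: diag_mat_def diag simp del: index_mult_mat(1))
  also have "prod_list \<dots> = (\<Prod>i<n. complex_of_real (1 + a i))"
    by (induction n) (auto simp: mult.commute)
  finally show ?thesis using that tr fr by blast
qed

section \<open>Unitary invariance of the Gaussian measure\<close>

abbreviation PL :: "'i set \<Rightarrow> ('i \<Rightarrow> real) measure" where
  "PL I \<equiv> PiM I (\<lambda>_. lborel)"

text \<open>Translation of coordinates, restricted to I so that results stay among the extensional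
  functions, the space of the product measure.\<close>

definition padd :: "'i set \<Rightarrow> ('i \<Rightarrow> real) \<Rightarrow> ('i \<Rightarrow> real) \<Rightarrow> 'i \<Rightarrow> real" where
  "padd I x y = (\<lambda>i\<in>I. x i + y i)"

definition pneg :: "'i set \<Rightarrow> ('i \<Rightarrow> real) \<Rightarrow> 'i \<Rightarrow> real" where
  "pneg I x = (\<lambda>i\<in>I. - x i)"

lemma space_PL [simp]: "space (PL I) = extensional I"
  by (auto simp: space_PiM PiE_def)

lemma padd_extensional [simp]: "padd I x y \<in> extensional I" "pneg I x \<in> extensional I"
  by (auto simp: padd_def pneg_def)

interpretation PL: product_sigma_finite "\<lambda>_ :: 'i. lborel :: real measure"
  by unfold_locales

lemma measurable_padd [measurable]:
  assumes "f \<in> measurable M (PL I)" "g \<in> measurable M (PL I)"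
  shows "(\<lambda>x. padd I (f x) (g x)) \<in> measurable M (PL I)"
proof -
  have [measurable]: "(\<lambda>x. f x i) \<in> borel_measurable M" "(\<lambda>x. g x i) \<in> borel_measurable M" if "i \<in> I" for i
    using measurable_compose[OF assms(1) measurable_component_singleton[OF that]]
          measurable_compose[OF assms(2) measurable_component_singleton[OF that]] by simp_all
  show ?thesis unfolding padd_def by (rule measurable_restrict) simp
qed

lemma measurable_pneg [measurable]:
  assumes "f \<in> measurable M (PL I)"
  shows "(\<lambda>x. pneg I (f x)) \<in> measurable M (PL I)"
proof -
  have [measurable]: "(\<lambda>x. f x i) \<in> borel_measurable M" if "i \<in> I" for i
    using measurable_compose[OF assms(1) measurable_component_singleton[OF that]] by simp_all
  show ?thesis unfolding pneg_def by (rule measurable_restrict) simp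
qed

lemma distr_PL_padd:
  assumes I: "finite I" and y: "y \<in> extensional I"
  shows "distr (PL I) (PL I) (\<lambda>x. padd I x y) = PL I"
proof (rule PL.PiM_eqI[OF I])
  have [measurable]: "(\<lambda>x. padd I x y) \<in> measurable (PL I) (PL I)"
    using y by (intro measurable_padd) auto
  fix A :: "'a \<Rightarrow> real set" assume A: "\<And>i. i \<in> I \<Longrightarrow> A i \<in> sets lborel"
  have m: "(\<lambda>x. x + c) \<in> lborel \<rightarrow>\<^sub>M lborel" for c :: real by measurable
  have B: "(\<lambda>t. t + y i) -` A i \<in> sets lborel" if "i \<in> I" for i
    using measurable_sets[OF m[of "y i"] A[OF that]] by simp
  have "emeasure (distr (PL I) (PL I) (\<lambda>x. padd I x y)) (Pi\<^sub>E I A)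
      = emeasure (PL I) ((\<lambda>x. padd I x y) -` Pi\<^sub>E I A \<inter> space (PL I))"
    using A I by (intro emeasure_distr) (auto intro!: sets_PiM_I_finite)
  also have "(\<lambda>x. padd I x y) -` Pi\<^sub>E I A \<inter> space (PL I) = Pi\<^sub>E I (\<lambda>i. (\<lambda>t. t + y i) -` A i)"
    by (auto simp: padd_def PiE_def Pi_def)
  also have "emeasure (PL I) \<dots> = (\<Prod>i\<in>I. emeasure lborel ((\<lambda>t. t + y i) -` A i))"
    using I B by (intro PL.emeasure_PiM) auto
  also have "\<dots> = (\<Prod>i\<in>I. emeasure lborel (A i))"
  proof (rule prod.cong)
    fix i assume i: "i \<in> I"
    have "emeasure lborel (A i) = emeasure (distr lborel borel ((+) (y i))) (A i)" by (simp only: lborel_distr_plus)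
    also have "\<dots> = emeasure lborel ((\<lambda>t. t + y i) -` A i)"
    proof -
      have "(+) (y i) = (\<lambda>t. t + y i)" by (auto simp: add.commute)
      thus ?thesis using A[OF i] by (subst emeasure_distr) auto
    qed
    finally show "emeasure lborel ((\<lambda>t. t + y i) -` A i) = emeasure lborel (A i)" by simp
  qed simp
  finally show "emeasure (distr (PL I) (PL I) (\<lambda>x. padd I x y)) (Pi\<^sub>E I A) = (\<Prod>i\<in>I. emeasure lborel (A i))" .
qed simp

lemma nn_integral_PL_padd:
  assumes I: "finite I" and y: "y \<in> extensional I" and [measurable]: "f \<in> borel_measurable (PL I)"
  shows "(\<integral>\<^sup>+x. f (padd I x y) \<partial>PL I) = (\<integral>\<^sup>+x. f x \<partial>PL I)"
proof -
  have [measurable]: "(\<lambda>x. padd I x y) \<in> measurable (PL I) (PL I)"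
    using y by (intro measurable_padd) auto
  have "(\<integral>\<^sup>+x. f x \<partial>PL I) = (\<integral>\<^sup>+x. f x \<partial>distr (PL I) (PL I) (\<lambda>x. padd I x y))"
    by (simp only: distr_PL_padd[OF I y])
  thus ?thesis by (subst (asm) nn_integral_distr) auto
qed

definition gauss_density :: "'i set \<Rightarrow> real \<Rightarrow> ('i \<Rightarrow> real) \<Rightarrow> ennreal" where
  "gauss_density I \<sigma> x = (\<Prod>i\<in>I. ennreal (normal_density 0 \<sigma> (x i)))"

definition gauss :: "'i set \<Rightarrow> real \<Rightarrow> ('i \<Rightarrow> real) measure" where
  "gauss I \<sigma> = PiM I (\<lambda>_. density lborel (\<lambda>x. ennreal (normal_density 0 \<sigma> x)))"

lemma measurable_gauss_density [measurable]: "gauss_density I \<sigma> \<in> borel_measurable (PL I)"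
  unfolding gauss_density_def by measurable

lemma sets_gauss [measurable_cong]: "sets (gauss I \<sigma>) = sets (PL I)"
  unfolding gauss_def by (intro sets_PiM_cong) auto

lemma space_gauss [simp]: "space (gauss I \<sigma>) = extensional I"
  unfolding gauss_def by (auto simp: space_PiM PiE_def)

lemma prob_space_gauss: "0 < \<sigma> \<Longrightarrow> prob_space (gauss I \<sigma>)"
  unfolding gauss_def by (intro prob_space_PiM prob_space_normal_density)

lemma gauss_eq_density:
  assumes I: "finite I" and \<sigma>: "0 < \<sigma>"
  shows "gauss I \<sigma> = density (PL I) (gauss_density I \<sigma>)"
proof -
  interpret G: product_sigma_finite "\<lambda>_ :: 'a. density lborel (\<lambda>x. ennreal (normal_density 0 \<sigma> x))"
    using prob_space_normal_density[OF \<sigma>, THEN prob_space_imp_sigma_finite]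
    by (simp add: product_sigma_finite_def)
  have "density (PL I) (gauss_density I \<sigma>) = PiM I (\<lambda>_. density lborel (\<lambda>x. ennreal (normal_density 0 \<sigma> x)))"
  proof (rule G.PiM_eqI[OF I])
    show "sets (density (PL I) (gauss_density I \<sigma>)) = sets (PiM I (\<lambda>_. density lborel (\<lambda>x. ennreal (normal_density 0 \<sigma> x))))"
      using sets_gauss[of I \<sigma>] by (simp add: gauss_def)
    fix A :: "'a \<Rightarrow> real set" assume A: "\<And>i. i \<in> I \<Longrightarrow> A i \<in> sets (density lborel (\<lambda>x. ennreal (normal_density 0 \<sigma> x)))"
    have "emeasure (density (PL I) (gauss_density I \<sigma>)) (Pi\<^sub>E I A)
        = (\<integral>\<^sup>+x. gauss_density I \<sigma> x * indicator (Pi\<^sub>E I A) x \<partial>PL I)"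
      using A I by (intro emeasure_density) (auto intro!: sets_PiM_I_finite)
    also have "\<dots> = (\<integral>\<^sup>+x. (\<Prod>i\<in>I. ennreal (normal_density 0 \<sigma> (x i)) * indicator (A i) (x i)) \<partial>PL I)"
    proof (intro nn_integral_cong)
      fix x :: "'a \<Rightarrow> real" assume "x \<in> space (PL I)"
      hence "indicator (Pi\<^sub>E I A) x = (\<Prod>i\<in>I. indicator (A i) (x i) :: ennreal)"
        using I by (auto simp: indicator_def PiE_def Pi_def prod_zero_iff)
      thus "gauss_density I \<sigma> x * indicator (Pi\<^sub>E I A) x = (\<Prod>i\<in>I. ennreal (normal_density 0 \<sigma> (x i)) * indicator (A i) (x i))"
        by (simp add: gauss_density_def prod.distrib)
    qed
    also have "\<dots> = (\<Prod>i\<in>I. \<integral>\<^sup>+t. ennreal (normal_density 0 \<sigma> t) * indicator (A i) t \<partial>lborel)"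
      using I A by (intro PL.product_nn_integral_prod) auto
    also have "\<dots> = (\<Prod>i\<in>I. emeasure (density lborel (\<lambda>x. ennreal (normal_density 0 \<sigma> x))) (A i))"
      using A by (intro prod.cong refl emeasure_density[symmetric]) auto
    finally show "emeasure (density (PL I) (gauss_density I \<sigma>)) (Pi\<^sub>E I A)
      = (\<Prod>i\<in>I. emeasure (density lborel (\<lambda>x. ennreal (normal_density 0 \<sigma> x))) (A i))" .
  qed
  thus ?thesis by (simp add: gauss_def)
qed

lemma nn_integral_gauss:
  assumes "finite I" "0 < \<sigma>" and [measurable]: "f \<in> borel_measurable (PL I)"
  shows "(\<integral>\<^sup>+x. f x \<partial>gauss I \<sigma>) = (\<integral>\<^sup>+x. gauss_density I \<sigma> x * f x \<partial>PL I)"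
  unfolding gauss_eq_density[OF assms(1,2)] by (rule nn_integral_density) auto

lemma nn_integral_gauss_density:
  assumes "finite I" "0 < \<sigma>"
  shows "(\<integral>\<^sup>+x. gauss_density I \<sigma> x \<partial>PL I) = 1"
proof -
  interpret prob_space "gauss I \<sigma>" by (rule prob_space_gauss[OF assms(2)])
  show ?thesis using nn_integral_gauss[OF assms, of "\<lambda>_. 1"] emeasure_space_1 by simp
qed

lemma gauss_density_eq:
  assumes I: "finite I"
  shows "gauss_density I \<sigma> x = ennreal ((1 / sqrt (2 * pi * \<sigma>\<^sup>2)) ^ card I * exp (- (\<Sum>i\<in>I. (x i)\<^sup>2) / (2 * \<sigma>\<^sup>2)))"
proof -
  have "gauss_density I \<sigma> x = ennreal (\<Prod>i\<in>I. normal_density 0 \<sigma> (x i))"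
    unfolding gauss_density_def by (rule prod_ennreal) simp
  also have "(\<Prod>i\<in>I. normal_density 0 \<sigma> (x i)) = (1 / sqrt (2 * pi * \<sigma>\<^sup>2)) ^ card I * exp (- (\<Sum>i\<in>I. (x i)\<^sup>2) / (2 * \<sigma>\<^sup>2))"
  proof -
    have "(\<Sum>i\<in>I. - ((x i)\<^sup>2) / (2 * \<sigma>\<^sup>2)) = - (\<Sum>i\<in>I. (x i)\<^sup>2) / (2 * \<sigma>\<^sup>2)"
      by (simp add: sum_divide_distrib sum_negf)
    hence "exp (- (\<Sum>i\<in>I. (x i)\<^sup>2) / (2 * \<sigma>\<^sup>2)) = (\<Prod>i\<in>I. exp (- ((x i)\<^sup>2) / (2 * \<sigma>\<^sup>2)))"
      using exp_sum[OF I, of "\<lambda>i. - ((x i)\<^sup>2) / (2 * \<sigma>\<^sup>2)"] by simp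
    thus ?thesis by (simp add: normal_density_def prod.distrib prod_dividef power_one_over)
  qed
  finally show ?thesis .
qed

lemma gauss_density_cong_norm:
  assumes "finite I" "(\<Sum>i\<in>I. (x i)\<^sup>2) = (\<Sum>i\<in>I. (y i)\<^sup>2)"
  shows "gauss_density I \<sigma> x = gauss_density I \<sigma> y"
  by (simp add: gauss_density_eq assms)

lemma nn_integral_PL_isometry:
  fixes T T' :: "('i \<Rightarrow> real) \<Rightarrow> 'i \<Rightarrow> real"
  assumes I: "finite I"
    and T [measurable]: "T \<in> measurable (PL I) (PL I)"
    and T'_ext: "\<And>x. x \<in> extensional I \<Longrightarrow> T' x \<in> extensional I"
    and add: "\<And>x y. x \<in> extensional I \<Longrightarrow> y \<in> extensional I \<Longrightarrow> T (padd I x y) = padd I (T x) (T y)"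
    and inv: "\<And>x. x \<in> extensional I \<Longrightarrow> T (T' x) = x"
    and iso: "\<And>x. x \<in> extensional I \<Longrightarrow> (\<Sum>i\<in>I. (T x i)\<^sup>2) = (\<Sum>i\<in>I. (x i)\<^sup>2)"
    and g [measurable]: "g \<in> borel_measurable (PL I)"
  shows "(\<integral>\<^sup>+x. g (T x) \<partial>PL I) = (\<integral>\<^sup>+x. g x \<partial>PL I)"
proof -
  text \<open>This is the uniqueness proof for Haar measure, applied to Lebesgue measure and its image under
    \<open>T\<close>; the normalising constant is read off from the Gaussian weight, which \<open>T\<close> preserves.\<close>
  let ?\<gamma> = "gauss_density I 1 :: ('i \<Rightarrow> real) \<Rightarrow> ennreal"
  interpret S: sigma_finite_measure "PL I" using I by (rule PL.sigma_finite)
  interpret P: pair_sigma_finite "PL I" "PL I" ..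
  have Text: "T x \<in> extensional I" if "x \<in> extensional I" for x
    using measurable_space[OF T, of x] that by simp
  have \<gamma>1: "(\<integral>\<^sup>+x. ?\<gamma> x \<partial>PL I) = 1" by (rule nn_integral_gauss_density[OF I]) simp
  have "(\<integral>\<^sup>+x. g (T x) \<partial>PL I) = (\<integral>\<^sup>+x. ?\<gamma> x \<partial>PL I) * (\<integral>\<^sup>+y. g (T y) \<partial>PL I)"
    by (simp add: \<gamma>1)
  also have "\<dots> = (\<integral>\<^sup>+x. ?\<gamma> x * (\<integral>\<^sup>+y. g (T y) \<partial>PL I) \<partial>PL I)"
    by (rule nn_integral_multc[symmetric]) auto
  \<comment> \<open>Translation invariance with the shift \<open>T' x\<close>, which
    \<open>T\<close> turns by additivity into a shift by \<open>x\<close>.\<close>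
  also have "\<dots> = (\<integral>\<^sup>+x. (\<integral>\<^sup>+y. ?\<gamma> x * g (padd I (T y) x) \<partial>PL I) \<partial>PL I)"
  proof (intro nn_integral_cong)
    fix x assume "x \<in> space (PL I)"
    hence x: "x \<in> extensional I" by simp
    have "(\<integral>\<^sup>+y. g (T y) \<partial>PL I) = (\<integral>\<^sup>+y. g (T (padd I y (T' x))) \<partial>PL I)"
      by (rule nn_integral_PL_padd[OF I T'_ext[OF x], symmetric]) auto
    also have "\<dots> = (\<integral>\<^sup>+y. g (padd I (T y) x) \<partial>PL I)"
      by (intro nn_integral_cong) (simp add: add T'_ext x inv)
    finally show "?\<gamma> x * (\<integral>\<^sup>+y. g (T y) \<partial>PL I) = (\<integral>\<^sup>+y. ?\<gamma> x * g (padd I (T y) x) \<partial>PL I)"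
      using x by (subst nn_integral_cmult) auto
  qed
  also have "\<dots> = (\<integral>\<^sup>+y. (\<integral>\<^sup>+x. ?\<gamma> x * g (padd I (T y) x) \<partial>PL I) \<partial>PL I)"
    by (rule P.Fubini') measurable
  \<comment> \<open>Replacing x by x - T y moves \<open>T\<close> from \<open>g\<close> into the
    Gaussian weight, which is even. After another exchange of integrals the inner integral over y is
    1.\<close>
  also have "\<dots> = (\<integral>\<^sup>+y. (\<integral>\<^sup>+x. ?\<gamma> (padd I (T y) (pneg I x)) * g x \<partial>PL I) \<partial>PL I)"
  proof (rule nn_integral_cong)
    fix y assume "y \<in> space (PL I)"
    hence y: "T y \<in> extensional I" using Text by simp
    have "(\<integral>\<^sup>+x. ?\<gamma> x * g (padd I (T y) x) \<partial>PL I)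
        = (\<integral>\<^sup>+x. ?\<gamma> (padd I x (pneg I (T y))) * g (padd I (T y) (padd I x (pneg I (T y)))) \<partial>PL I)"
      using y by (subst nn_integral_PL_padd[OF I, of "pneg I (T y)" "\<lambda>x. ?\<gamma> x * g (padd I (T y) x)"]) auto
    also have "\<dots> = (\<integral>\<^sup>+x. ?\<gamma> (padd I (T y) (pneg I x)) * g x \<partial>PL I)"
    proof (intro nn_integral_cong)
      fix x assume "x \<in> space (PL I)"
      hence x: "x \<in> extensional I" by simp
      have "padd I (T y) (padd I x (pneg I (T y))) = x"
        using x by (auto simp: padd_def pneg_def fun_eq_iff extensional_def)
      moreover have "?\<gamma> (padd I x (pneg I (T y))) = ?\<gamma> (padd I (T y) (pneg I x))"
        by (rule gauss_density_cong_norm[OF I]) (auto simp: padd_def pneg_def power2_commute intro!: sum.cong)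
      ultimately show "?\<gamma> (padd I x (pneg I (T y))) * g (padd I (T y) (padd I x (pneg I (T y))))
          = ?\<gamma> (padd I (T y) (pneg I x)) * g x" by simp
    qed
    finally show "(\<integral>\<^sup>+x. ?\<gamma> x * g (padd I (T y) x) \<partial>PL I)
        = (\<integral>\<^sup>+x. ?\<gamma> (padd I (T y) (pneg I x)) * g x \<partial>PL I)" .
  qed
  also have "\<dots> = (\<integral>\<^sup>+x. (\<integral>\<^sup>+y. ?\<gamma> (padd I (T y) (pneg I x)) * g x \<partial>PL I) \<partial>PL I)"
    by (rule P.Fubini') measurable
  also have "\<dots> = (\<integral>\<^sup>+x. g x \<partial>PL I)"
  proof (intro nn_integral_cong)
    fix x assume "x \<in> space (PL I)"
    hence x: "x \<in> extensional I" by simp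
    have [measurable]: "(\<lambda>y. padd I (T y) (pneg I x)) \<in> measurable (PL I) (PL I)"
      using x by (intro measurable_padd) auto
    have "(\<integral>\<^sup>+y. ?\<gamma> (padd I (T y) (pneg I x)) \<partial>PL I) = (\<integral>\<^sup>+y. ?\<gamma> (T (padd I y (T' (pneg I x)))) \<partial>PL I)"
      by (intro nn_integral_cong) (simp add: add T'_ext inv)
    also have "\<dots> = (\<integral>\<^sup>+y. ?\<gamma> (T y) \<partial>PL I)"
      by (rule nn_integral_PL_padd[OF I T'_ext]) auto
    also have "\<dots> = (\<integral>\<^sup>+y. ?\<gamma> y \<partial>PL I)"
      by (intro nn_integral_cong gauss_density_cong_norm[OF I] iso) simp
    finally have "(\<integral>\<^sup>+y. ?\<gamma> (padd I (T y) (pneg I x)) \<partial>PL I) = 1" using \<gamma>1 by simp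
    thus "(\<integral>\<^sup>+y. ?\<gamma> (padd I (T y) (pneg I x)) * g x \<partial>PL I) = g x"
      by (subst nn_integral_multc) auto
  qed
  finally show ?thesis .
qed

lemma nn_integral_gauss_isometry:
  fixes T T' :: "('i \<Rightarrow> real) \<Rightarrow> 'i \<Rightarrow> real"
  assumes I: "finite I" and \<sigma>: "0 < \<sigma>"
    and T [measurable]: "T \<in> measurable (PL I) (PL I)"
    and T'_ext: "\<And>x. x \<in> extensional I \<Longrightarrow> T' x \<in> extensional I"
    and add: "\<And>x y. x \<in> extensional I \<Longrightarrow> y \<in> extensional I \<Longrightarrow> T (padd I x y) = padd I (T x) (T y)"
    and inv: "\<And>x. x \<in> extensional I \<Longrightarrow> T (T' x) = x"
    and iso: "\<And>x. x \<in> extensional I \<Longrightarrow> (\<Sum>i\<in>I. (T x i)\<^sup>2) = (\<Sum>i\<in>I. (x i)\<^sup>2)"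
    and g [measurable]: "g \<in> borel_measurable (PL I)"
  shows "(\<integral>\<^sup>+x. g (T x) \<partial>gauss I \<sigma>) = (\<integral>\<^sup>+x. g x \<partial>gauss I \<sigma>)"
proof -
  have "(\<integral>\<^sup>+x. g (T x) \<partial>gauss I \<sigma>) = (\<integral>\<^sup>+x. gauss_density I \<sigma> x * g (T x) \<partial>PL I)"
    by (rule nn_integral_gauss[OF I \<sigma>]) simp
  also have "\<dots> = (\<integral>\<^sup>+x. gauss_density I \<sigma> (T x) * g (T x) \<partial>PL I)"
    by (intro nn_integral_cong arg_cong2[where f = "(*)"] gauss_density_cong_norm[OF I] refl) (simp add: iso)
  also have "\<dots> = (\<integral>\<^sup>+x. gauss_density I \<sigma> x * g x \<partial>PL I)"
    by (rule nn_integral_PL_isometry[OF I T T'_ext add inv iso, where g = "\<lambda>x. gauss_density I \<sigma> x * g x"]) auto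
  also have "\<dots> = (\<integral>\<^sup>+x. g x \<partial>gauss I \<sigma>)"
    by (rule nn_integral_gauss[OF I \<sigma>, symmetric]) simp
  finally show ?thesis .
qed

section \<open>Entrywise measurability of random matrices\<close>

definition mat_measurable :: "'w measure \<Rightarrow> nat \<Rightarrow> nat \<Rightarrow> ('w \<Rightarrow> complex mat) \<Rightarrow> bool" where
  "mat_measurable M n m F \<longleftrightarrow> (\<forall>\<omega>. F \<omega> \<in> carrier_mat n m) \<and>
     (\<forall>i<n. \<forall>j<m. (\<lambda>\<omega>. F \<omega> $$ (i, j)) \<in> borel_measurable M)"

lemma mat_measurable_const: "A \<in> carrier_mat n m \<Longrightarrow> mat_measurable M n m (\<lambda>_. A)"
  by (simp add: mat_measurable_def)

lemma mat_measurable_mult: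
  assumes F: "mat_measurable M n m F" and G: "mat_measurable M m l G"
  shows "mat_measurable M n l (\<lambda>\<omega>. F \<omega> * G \<omega>)"
proof -
  have c: "F \<omega> \<in> carrier_mat n m" "G \<omega> \<in> carrier_mat m l" for \<omega> using F G by (auto simp: mat_measurable_def)
  have "(\<lambda>\<omega>. (F \<omega> * G \<omega>) $$ (i, j)) \<in> borel_measurable M" if "i < n" "j < l" for i j
    unfolding index_mult_mat_sum[OF c that]
    using F G that by (intro borel_measurable_sum borel_measurable_times) (auto simp: mat_measurable_def)
  thus ?thesis using c mult_carrier_mat unfolding mat_measurable_def by blast
qed

lemma mat_measurable_adjoint:
  assumes F: "mat_measurable M n m F"
  shows "mat_measurable M m n (\<lambda>\<omega>. mat_adjoint (F \<omega>))"
proof -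
  have c: "F \<omega> \<in> carrier_mat n m" for \<omega> using F by (auto simp: mat_measurable_def)
  have "(\<lambda>\<omega>. mat_adjoint (F \<omega>) $$ (i, j)) \<in> borel_measurable M" if ij: "i < m" "j < n" for i j
  proof -
    have "mat_adjoint (F \<omega>) $$ (i, j) = cnj (F \<omega> $$ (j, i))" for \<omega>
      using c[of \<omega>] ij by (intro index_mat_adjoint) auto
    moreover have [measurable]: "(\<lambda>\<omega>. F \<omega> $$ (j, i)) \<in> borel_measurable M" using F ij by (auto simp: mat_measurable_def)
    ultimately show ?thesis by (simp add: borel_measurable_continuous_on[OF continuous_on_cnj[OF continuous_on_id]])
  qed
  thus ?thesis using c unfolding mat_measurable_def by auto
qed

lemma mat_measurable_add:
  assumes F: "mat_measurable M n m F" and G: "mat_measurable M n m G"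
  shows "mat_measurable M n m (\<lambda>\<omega>. F \<omega> + G \<omega>)"
proof -
  have c: "F \<omega> \<in> carrier_mat n m" "G \<omega> \<in> carrier_mat n m" for \<omega> using F G by (auto simp: mat_measurable_def)
  have e: "(F \<omega> + G \<omega>) $$ (i, j) = F \<omega> $$ (i, j) + G \<omega> $$ (i, j)" if "i < n" "j < m" for \<omega> i j
    using c[of \<omega>] that by auto
  have "(\<lambda>\<omega>. (F \<omega> + G \<omega>) $$ (i, j)) \<in> borel_measurable M" if "i < n" "j < m" for i j
    unfolding e[OF that] using F G that by (intro borel_measurable_add) (auto simp: mat_measurable_def)
  thus ?thesis using c unfolding mat_measurable_def by auto
qed

lemma mat_measurable_smult:
  assumes F: "mat_measurable M n m F"
  shows "mat_measurable M n m (\<lambda>\<omega>. a \<cdot>\<^sub>m F \<omega>)"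
proof -
  have c: "F \<omega> \<in> carrier_mat n m" for \<omega> using F by (auto simp: mat_measurable_def)
  have e: "(a \<cdot>\<^sub>m F \<omega>) $$ (i, j) = a * F \<omega> $$ (i, j)" if "i < n" "j < m" for \<omega> i j
    using c[of \<omega>] that by auto
  have "(\<lambda>\<omega>. (a \<cdot>\<^sub>m F \<omega>) $$ (i, j)) \<in> borel_measurable M" if "i < n" "j < m" for i j
    unfolding e[OF that] using F that by (intro borel_measurable_times) (auto simp: mat_measurable_def)
  thus ?thesis using c unfolding mat_measurable_def by auto
qed

lemma borel_measurable_det:
  assumes F: "mat_measurable M n n F"
  shows "(\<lambda>\<omega>. Determinant.det (F \<omega>)) \<in> borel_measurable M"
proof -
  have c: "F \<omega> \<in> carrier_mat n n" for \<omega> using F by (auto simp: mat_measurable_def)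
  have "(\<lambda>\<omega>. F \<omega> $$ (i, p i)) \<in> borel_measurable M" if "p permutes {0..<n}" "i \<in> {0..<n}" for i p
  proof -
    have "p i < n" using permutes_in_image[OF that(1), of i] that(2) by auto
    thus ?thesis using F that by (auto simp: mat_measurable_def)
  qed
  thus ?thesis unfolding det_def'[OF c]
    by (intro borel_measurable_sum borel_measurable_times borel_measurable_prod borel_measurable_const) auto
qed

lemma mat_measurable_compose:
  assumes "mat_measurable M n m F" "g \<in> measurable L M"
  shows "mat_measurable L n m (\<lambda>\<omega>. F (g \<omega>))"
  unfolding mat_measurable_def
proof (intro conjI allI impI)
  fix i j assume "i < n" "j < m"
  hence "(\<lambda>\<omega>. F \<omega> $$ (i, j)) \<in> borel_measurable M" using assms(1) by (auto simp: mat_measurable_def)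
  from measurable_compose[OF assms(2) this] show "(\<lambda>\<omega>. F (g \<omega>) $$ (i, j)) \<in> borel_measurable L" .
qed (use assms(1) in \<open>auto simp: mat_measurable_def\<close>)

context number_system begin

lemma borel_measurable_D:
  assumes F: "mat_measurable M n m F"
  shows "(\<lambda>\<omega>. D (F \<omega>)) \<in> borel_measurable M"
  unfolding D_def
  using borel_measurable_det[OF mat_measurable_mult[OF mat_measurable_adjoint[OF F] F]] by measurable

lemma number_block_cong: "(\<And>a. a < \<beta> \<Longrightarrow> q a = q' a) \<Longrightarrow> number_block \<beta> q = number_block \<beta> q'"
  by (cases rule: number_block_cases) auto

lemma number_block_add:
  assumes "p < d" "r < d"
  shows "number_block \<beta> (\<lambda>a. q a + q' a) $$ (p, r) = number_block \<beta> q $$ (p, r) + number_block \<beta> q' $$ (p, r)"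
proof (cases rule: number_block_cases)
  case 1
  thus ?thesis using assms by (simp add: 1(3) mat_of_rows_list_def)
next
  case 2
  thus ?thesis using assms by (simp add: 2(3) mat_of_rows_list_def complex_eq_iff)
next
  case 3
  hence "p = 0 \<or> p = 1" "r = 0 \<or> r = 1" using assms by auto
  thus ?thesis by (auto simp: 3(3) mat_of_rows_list_def complex_eq_iff)
qed

section \<open>Gaussian coordinates and unitary conjugation\<close>

definition ix :: "nat \<Rightarrow> (nat \<times> nat \<times> nat) set" where
  "ix N = {..<N} \<times> {..<N} \<times> {..<\<beta>}"

definition NM :: "nat \<Rightarrow> (nat \<times> nat \<times> nat \<Rightarrow> real) \<Rightarrow> complex mat" where
  "NM N x = number_matrix \<beta> N N (\<lambda>i j a. x (i, j, a))"

lemma finite_ix [simp]: "finite (ix N)" by (simp add: ix_def)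

lemma NM_NC [simp, intro]: "NM N x \<in> NC N N" by (simp add: NM_def number_matrix_NC)

lemma NM_carrier [simp, intro]: "NM N x \<in> carrier_mat (d * N) (d * N)"
  using NC_carrier[OF NM_NC] .

lemma div_d_less: "r < d * N \<Longrightarrow> r div d < N" by (simp add: less_mult_imp_div_less mult.commute)

lemma NM_cong:
  assumes "\<And>t. t \<in> ix N \<Longrightarrow> x t = y t"
  shows "NM N x = NM N y"
proof (rule eq_matI)
  fix i j assume "i < dim_row (NM N y)" "j < dim_col (NM N y)"
  hence ij: "i < d * N" "j < d * N" by (auto simp: NM_def)
  hence "number_block \<beta> (\<lambda>a. x (i div d, j div d, a)) = number_block \<beta> (\<lambda>a. y (i div d, j div d, a))"
    by (intro number_block_cong assms) (simp add: ix_def div_d_less)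
  thus "NM N x $$ (i, j) = NM N y $$ (i, j)" using ij by (simp add: NM_def index_number_matrix)
qed (auto simp: NM_def)

lemma NM_padd: "NM N (padd (ix N) x y) = NM N x + NM N y"
proof -
  have "NM N (padd (ix N) x y) = NM N (\<lambda>t. x t + y t)"
    by (rule NM_cong) (simp add: padd_def)
  also have "\<dots> = NM N x + NM N y"
    by (rule eq_matI) (auto simp: NM_def index_number_matrix number_block_add)
  finally show ?thesis .
qed

lemma frob2_NM: "frob2 (NM N x) = real d * (\<Sum>t\<in>ix N. (x t)\<^sup>2)"
  unfolding NM_def frob2_number_matrix ix_def by (simp add: sum.cartesian_product case_prod_beta)

lemma comps_add:
  assumes "A \<in> NC n m" "B \<in> NC n m" "i < n" "j < m" "a < \<beta>"
  shows "comps (A + B) i j a = comps A i j a + comps B i j a"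
proof -
  have l: "d * i < d * n" "d * j < d * m" using assms by auto
  have "d * j + 1 < d * m" if "2 \<le> a"
  proof -
    have "d = 2" using that assms(5) dyson_index by (auto simp: block_dim_def)
    thus ?thesis using assms(4) by simp
  qed
  thus ?thesis using l NC_carrier[OF assms(1)] NC_carrier[OF assms(2)] by (auto simp: comps_def)
qed

text \<open>Unitary conjugation read in the real coordinates, so that it acts on the space of the
  Gaussian measure.\<close>

definition conj_map :: "nat \<Rightarrow> complex mat \<Rightarrow> (nat \<times> nat \<times> nat \<Rightarrow> real) \<Rightarrow> (nat \<times> nat \<times> nat \<Rightarrow> real)" where
  "conj_map N S x = (\<lambda>(i, j, a)\<in>ix N. comps (S * NM N x * mat_adjoint S) i j a)"

lemma conj_NC: "S \<in> NC n n \<Longrightarrow> A \<in> NC n n \<Longrightarrow> S * A * mat_adjoint S \<in> NC n n"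
  by blast

lemma NM_conj_map:
  assumes S: "S \<in> NC N N"
  shows "NM N (conj_map N S x) = S * NM N x * mat_adjoint S"
proof -
  have "NM N (conj_map N S x) = NM N (\<lambda>(i, j, a). comps (S * NM N x * mat_adjoint S) i j a)"
    by (rule NM_cong) (simp add: conj_map_def)
  also have "\<dots> = S * NM N x * mat_adjoint S"
    unfolding NM_def using NC_number_matrix_comps[OF conj_NC[OF S NM_NC]] by (simp add: NM_def)
  finally show ?thesis .
qed

lemma mat_measurable_NM: "mat_measurable (PL (ix N)) (d * N) (d * N) (NM N)"
proof -
  have "(\<lambda>x. NM N x $$ (i, j)) \<in> borel_measurable (PL (ix N))" if ij: "i < d * N" "j < d * N" for i j
  proof -
    have m: "(\<lambda>x. x (i div d, j div d, a)) \<in> borel_measurable (PL (ix N))" if "a < \<beta>" for a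
      using measurable_component_singleton[of "(i div d, j div d, a)" "ix N" "\<lambda>_. lborel"] that ij
      by (simp add: ix_def div_d_less)
    have mc: "(\<lambda>x. Complex (f x) (g x)) \<in> borel_measurable (PL (ix N))"
      if "f \<in> borel_measurable (PL (ix N))" "g \<in> borel_measurable (PL (ix N))" for f g
      using that unfolding Complex_eq by measurable
    show ?thesis
    proof (cases rule: number_block_cases)
      case 1
      have "(\<lambda>x. NM N x $$ (i, j)) = (\<lambda>x. complex_of_real (x (i div d, j div d, 0)))"
        using ij by (simp add: NM_def index_number_matrix 1(2,3) mat_of_rows_list_def)
      thus ?thesis using m[of 0] 1(1) by (simp add: borel_measurable_of_real)
    next
      case 2
      have "(\<lambda>x. NM N x $$ (i, j)) = (\<lambda>x. Complex (x (i div d, j div d, 0)) (x (i div d, j div d, 1)))"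
        using ij by (simp add: NM_def index_number_matrix 2(2,3) mat_of_rows_list_def)
      moreover have "0 < \<beta>" "1 < \<beta>" using 2(1) by simp_all
      ultimately show ?thesis using mc[OF m m] by simp
    next
      case 3
      have e: "NM N x $$ (i, j) = number_block \<beta> (\<lambda>a. x (i div d, j div d, a)) $$ (i mod d, j mod d)" for x
        using ij by (simp add: NM_def index_number_matrix)
      have "i mod d = 0 \<or> i mod d = 1" "j mod d = 0 \<or> j mod d = 1" using 3(2) by auto
      moreover have b: "0 < \<beta>" "1 < \<beta>" "2 < \<beta>" "3 < \<beta>" using 3(1) by simp_all
      have "(\<lambda>x. - x (i div d, j div d, a)) \<in> borel_measurable (PL (ix N))" if "a < \<beta>" for a
        using m[OF that] by measurable
      note mc[OF m[OF b(1)] m[OF b(2)]] mc[OF m[OF b(3)] m[OF b(4)]] mc[OF this[OF b(3)] m[OF b(4)]] mc[OF m[OF b(1)] this[OF b(2)]]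
      ultimately show ?thesis unfolding e 3(3)
        by (elim disjE) (simp_all add: mat_of_rows_list_def)
    qed
  qed
  thus ?thesis by (simp add: mat_measurable_def)
qed

lemma conj_map_extensional [simp]: "conj_map N S x \<in> extensional (ix N)"
  by (simp add: conj_map_def)

lemma measurable_conj_map:
  assumes S: "S \<in> NC N N"
  shows "conj_map N S \<in> measurable (PL (ix N)) (PL (ix N))"
  unfolding conj_map_def
proof (rule measurable_restrict)
  fix t assume t: "t \<in> ix N"
  obtain i j a where ija: "t = (i, j, a)" by (metis prod_cases3)
  have l: "i < N" "j < N" "a < \<beta>" using t by (auto simp: ija ix_def)
  have dl: "d * i < d * N" "d * j < d * N" using l by auto
  note c = NC_carrier[OF S]
  have "mat_measurable (PL (ix N)) (d * N) (d * N) (\<lambda>x. S * NM N x * mat_adjoint S)"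
    using c by (intro mat_measurable_mult[of _ _ "d * N"] mat_measurable_const mat_measurable_NM) auto
  hence m: "(\<lambda>x. (S * NM N x * mat_adjoint S) $$ (p, q)) \<in> borel_measurable (PL (ix N))" if "p < d * N" "q < d * N" for p q
    using that by (auto simp: mat_measurable_def)
  have m1: "(\<lambda>x. Re ((S * NM N x * mat_adjoint S) $$ (d * i, d * j))) \<in> borel_measurable (PL (ix N))"
    "(\<lambda>x. Im ((S * NM N x * mat_adjoint S) $$ (d * i, d * j))) \<in> borel_measurable (PL (ix N))"
    using m[OF dl] unfolding borel_measurable_complex_iff by auto
  have m2: "(\<lambda>x. Re ((S * NM N x * mat_adjoint S) $$ (d * i, d * j + 1))) \<in> borel_measurable (PL (ix N))"
    "(\<lambda>x. Im ((S * NM N x * mat_adjoint S) $$ (d * i, d * j + 1))) \<in> borel_measurable (PL (ix N))" if "2 \<le> a"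
  proof -
    have "d = 2" using that l(3) dyson_index by (auto simp: block_dim_def)
    hence "d * j + 1 < d * N" using l by simp
    from m[OF dl(1) this] show "(\<lambda>x. Re ((S * NM N x * mat_adjoint S) $$ (d * i, d * j + 1))) \<in> borel_measurable (PL (ix N))"
      "(\<lambda>x. Im ((S * NM N x * mat_adjoint S) $$ (d * i, d * j + 1))) \<in> borel_measurable (PL (ix N))"
      unfolding borel_measurable_complex_iff by auto
  qed
  have "(\<lambda>x. comps (S * NM N x * mat_adjoint S) i j a) \<in> borel_measurable (PL (ix N))"
  proof -
    consider "a = 0" | "a = 1" | "a = 2" | "3 \<le> a" by linarith
    thus ?thesis unfolding comps_def using m1 m2 by cases (simp_all del: index_mult_mat)
  qed
  thus "(\<lambda>x. case t of (i, j, a) \<Rightarrow> comps (S * NM N x * mat_adjoint S) i j a) \<in> PL (ix N) \<rightarrow>\<^sub>M lborel"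
    by (simp add: ija)
qed

lemma comps_number_matrix:
  assumes "i < n" "j < m" and a: "a < \<beta>"
  shows "comps (number_matrix \<beta> n m x) i j a = x i j a"
proof (cases rule: number_block_cases)
  case 1
  have "a = 0" using a 1(1) by simp
  thus ?thesis using assms(1,2) by (simp add: comps_def index_number_matrix mat_of_rows_list_def 1(2,3))
next
  case 2
  have "a = 0 \<or> a = 1" using a 2(1) by auto
  thus ?thesis using assms(1,2) by (auto simp: comps_def index_number_matrix mat_of_rows_list_def 2(2,3))
next
  case 3
  have "a = 0 \<or> a = 1 \<or> a = 2 \<or> a = 3" using a 3(1) by auto
  thus ?thesis using assms(1,2)
    by (auto simp: comps_def index_number_matrix_quaternion[OF 3(2,3)] 3(2))
qed

lemma conj_map_inv:
  assumes S: "S \<in> NU N" and x: "x \<in> extensional (ix N)"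
  shows "conj_map N S (conj_map N (mat_adjoint S) x) = x"
proof
  fix t
  note cS = NU_D[OF S]
  have cS': "mat_adjoint S \<in> carrier_mat (d * N) (d * N)" using cS by auto
  have "S * NM N (conj_map N (mat_adjoint S) x) * mat_adjoint S = S * (mat_adjoint S * NM N x * S) * mat_adjoint S"
    using NM_conj_map[OF NU_D(1)[OF NU_adjoint[OF S]]] by simp
  also have "\<dots> = (S * mat_adjoint S) * NM N x * (S * mat_adjoint S)"
    using cS(2) cS' NM_carrier[of N x]
    by (simp add: assoc_mult_mat[of _ "d*N" "d*N" _ "d*N" _ "d*N"] mult_carrier_mat[of _ "d*N" "d*N" _ "d*N"])
  also have "\<dots> = NM N x" using cS left_mult_one_mat[OF NM_carrier] right_mult_one_mat[OF NM_carrier] by simp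
  finally have e: "S * NM N (conj_map N (mat_adjoint S) x) * mat_adjoint S = NM N x" .
  show "conj_map N S (conj_map N (mat_adjoint S) x) t = x t"
  proof (cases "t \<in> ix N")
    case False
    have "conj_map N S (conj_map N (mat_adjoint S) x) t = undefined"
      using extensional_arb[OF conj_map_extensional False] .
    thus ?thesis using extensional_arb[OF x False] by simp
  next
    case True
    obtain i j a where ija: "t = (i, j, a)" by (metis prod_cases3)
    have l: "i < N" "j < N" "a < \<beta>" using True by (auto simp: ija ix_def)
    have "conj_map N S (conj_map N (mat_adjoint S) x) t = comps (NM N x) i j a"
      unfolding conj_map_def[of N S] e using True by (simp add: ija)
    also have "\<dots> = x t" unfolding NM_def ija by (rule comps_number_matrix[OF l])
    finally show ?thesis .
  qed
qed

text \<open>The perturbed identity with \<epsilon> in place of 1 / c; the limit is taken as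
  \<epsilon> tends to 0.\<close>

definition PY :: "nat \<Rightarrow> real \<Rightarrow> (nat \<times> nat \<times> nat \<Rightarrow> real) \<Rightarrow> complex mat" where
  "PY N \<epsilon> x = 1\<^sub>m (d * N) + complex_of_real \<epsilon> \<cdot>\<^sub>m NM N x"

lemma PY_NC [simp, intro]: "PY N \<epsilon> x \<in> NC N N"
  unfolding PY_def by (intro NC_add NC_smult NC_one NM_NC)

lemma mat_measurable_PY: "mat_measurable (PL (ix N)) (d * N) (d * N) (PY N \<epsilon>)"
  unfolding PY_def by (intro mat_measurable_add mat_measurable_smult mat_measurable_NM mat_measurable_const) simp

text \<open>The identity is fixed by conjugation, so the perturbed identity inherits the invariance
  of the Gaussian matrix.\<close>

lemma PY_conj_map:
  assumes S: "S \<in> NU N"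
  shows "PY N \<epsilon> (conj_map N S x) = S * PY N \<epsilon> x * mat_adjoint S"
proof -
  note cS = NU_D[OF S]
  have cS': "mat_adjoint S \<in> carrier_mat (d * N) (d * N)" using cS by auto
  have cM: "complex_of_real \<epsilon> \<cdot>\<^sub>m NM N x \<in> carrier_mat (d * N) (d * N)" by simp
  have "S * PY N \<epsilon> x = S + complex_of_real \<epsilon> \<cdot>\<^sub>m (S * NM N x)"
    unfolding PY_def using cS(2) mult_add_distrib_mat[OF cS(2) one_carrier_mat cM]
    by (simp add: mult_smult_distrib[OF cS(2) NM_carrier])
  hence "S * PY N \<epsilon> x * mat_adjoint S = (S + complex_of_real \<epsilon> \<cdot>\<^sub>m (S * NM N x)) * mat_adjoint S" by simp
  also have "\<dots> = S * mat_adjoint S + (complex_of_real \<epsilon> \<cdot>\<^sub>m (S * NM N x)) * mat_adjoint S"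
    using cS cS' by (intro add_mult_distrib_mat[of _ "d*N" "d*N"]) auto
  also have "(complex_of_real \<epsilon> \<cdot>\<^sub>m (S * NM N x)) * mat_adjoint S = complex_of_real \<epsilon> \<cdot>\<^sub>m (S * NM N x * mat_adjoint S)"
    using cS cS' by (intro mult_smult_assoc_mat[of _ "d*N" "d*N"]) auto
  finally show ?thesis by (simp add: PY_def NM_conj_map[OF cS(1)] cS(4))
qed

lemma padd_conj_map:
  assumes S: "S \<in> NC N N"
  shows "conj_map N S (padd (ix N) x y) = padd (ix N) (conj_map N S x) (conj_map N S y)"
proof
  fix t
  note c = NC_carrier[OF S]
  have c': "mat_adjoint S \<in> carrier_mat (d * N) (d * N)" using c by auto
  have "S * NM N (padd (ix N) x y) = S * NM N x + S * NM N y"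
    unfolding NM_padd by (rule mult_add_distrib_mat[OF c]) auto
  hence "S * NM N (padd (ix N) x y) * mat_adjoint S = S * NM N x * mat_adjoint S + S * NM N y * mat_adjoint S"
    using add_mult_distrib_mat[OF mult_carrier_mat[OF c NM_carrier] mult_carrier_mat[OF c NM_carrier] c'] by simp
  thus "conj_map N S (padd (ix N) x y) t = padd (ix N) (conj_map N S x) (conj_map N S y) t"
    by (auto simp: conj_map_def padd_def ix_def comps_add[OF conj_NC[OF S NM_NC] conj_NC[OF S NM_NC]]
        simp del: index_mult_mat split: prod.splits)
qed

text \<open>The sum of squared coordinates is the squared Frobenius norm up to the factor d, so
  \<open>conj_map\<close> is an additive isometry of the coordinate space, inverted by conjugation
  with the adjoint.\<close>

lemma nn_integral_gauss_conj:
  assumes \<sigma>: "0 < \<sigma>" and S: "S \<in> NU N" and g: "g \<in> borel_measurable (PL (ix N))"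
  shows "(\<integral>\<^sup>+x. g (conj_map N S x) \<partial>gauss (ix N) \<sigma>) = (\<integral>\<^sup>+x. g x \<partial>gauss (ix N) \<sigma>)"
proof (rule nn_integral_gauss_isometry[OF finite_ix \<sigma> _ _ _ _ _ g, where T' = "conj_map N (mat_adjoint S)"])
  note cS = NU_D[OF S]
  show "conj_map N S \<in> PL (ix N) \<rightarrow>\<^sub>M PL (ix N)" by (rule measurable_conj_map[OF cS(1)])
  show "conj_map N S (padd (ix N) x y) = padd (ix N) (conj_map N S x) (conj_map N S y)" for x y
    by (rule padd_conj_map[OF cS(1)])
  show "conj_map N S (conj_map N (mat_adjoint S) x) = x" if "x \<in> extensional (ix N)" for x
    by (rule conj_map_inv[OF S that])
  show "(\<Sum>i\<in>ix N. (conj_map N S x i)\<^sup>2) = (\<Sum>i\<in>ix N. (x i)\<^sup>2)" for x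
  proof -
    have "frob2 (NM N (conj_map N S x)) = frob2 (NM N x)"
      unfolding NM_conj_map[OF cS(1)] by (rule frob2_unitary_conj[OF NM_carrier cS(2,3)])
    hence "real d * (\<Sum>i\<in>ix N. (conj_map N S x i)\<^sup>2) = real d * (\<Sum>i\<in>ix N. (x i)\<^sup>2)"
      by (simp only: frob2_NM)
    moreover have "real d \<noteq> 0" by (simp add: block_dim_def)
    ultimately show ?thesis by (simp only: mult_cancel_left simp_thms)
  qed
qed auto

text \<open>The law of the volume ratio \<open>D (Y V) / D V\<close> does not depend on \<open>V\<close>; \<open>h\<close> tests this law.\<close>

lemma nn_integral_D_mult:
  fixes h :: "real \<Rightarrow> ennreal"
  assumes \<sigma>: "0 < \<sigma>" and V: "V \<in> NC N k" and k: "k \<le> N"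
    and h: "h \<in> borel_measurable borel" "\<And>a b. 0 \<le> a \<Longrightarrow> 0 \<le> b \<Longrightarrow> h (a * b) = h a * h b"
  shows "(\<integral>\<^sup>+x. h (D (PY N \<epsilon> x * V)) \<partial>gauss (ix N) \<sigma>)
    = (\<integral>\<^sup>+x. h (D (PY N \<epsilon> x * E N k)) \<partial>gauss (ix N) \<sigma>) * h (D V)"
proof -
  obtain S where S: "S \<in> NU N" "\<And>Y. Y \<in> NC N N \<Longrightarrow> D (Y * V) = D (S * Y * mat_adjoint S * E N k) * D V"
    using D_conjugation[OF V k] by blast
  have cE: "E N k \<in> carrier_mat (d * N) (d * k)" by (auto simp: first_columns_def)
  have m [measurable]: "(\<lambda>x. D (PY N \<epsilon> x * E N k)) \<in> borel_measurable (PL (ix N))"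
    by (rule borel_measurable_D[OF mat_measurable_mult[OF mat_measurable_PY mat_measurable_const[OF cE]]])
  note h(1)[measurable]
  have "h (D (PY N \<epsilon> x * V)) = h (D (PY N \<epsilon> (conj_map N S x) * E N k)) * h (D V)" for x
  proof -
    have "PY N \<epsilon> (conj_map N S x) * E N k \<in> NC N k" by (rule NC_mult[OF PY_NC E_NC[OF k]])
    hence "0 \<le> D (PY N \<epsilon> (conj_map N S x) * E N k)" by (rule D_real_nonneg(2)[OF _ k])
    moreover have "D (PY N \<epsilon> x * V) = D (PY N \<epsilon> (conj_map N S x) * E N k) * D V"
      using S(2)[OF PY_NC] PY_conj_map[OF S(1)] by simp
    ultimately show ?thesis using h(2) D_real_nonneg(2)[OF V k] by simp
  qed
  hence "(\<integral>\<^sup>+x. h (D (PY N \<epsilon> x * V)) \<partial>gauss (ix N) \<sigma>)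
      = (\<integral>\<^sup>+x. h (D (PY N \<epsilon> (conj_map N S x) * E N k)) * h (D V) \<partial>gauss (ix N) \<sigma>)" by simp
  also have "\<dots> = (\<integral>\<^sup>+x. h (D (PY N \<epsilon> x * E N k)) * h (D V) \<partial>gauss (ix N) \<sigma>)"
    by (rule nn_integral_gauss_conj[OF \<sigma> S(1), where g = "\<lambda>x. h (D (PY N \<epsilon> x * E N k)) * h (D V)"]) measurable
  also have "\<dots> = (\<integral>\<^sup>+x. h (D (PY N \<epsilon> x * E N k)) \<partial>gauss (ix N) \<sigma>) * h (D V)"
  proof (rule nn_integral_multc)
    have "(\<lambda>x. h (D (PY N \<epsilon> x * E N k))) \<in> borel_measurable (PL (ix N))" by measurable
    thus "(\<lambda>x. h (D (PY N \<epsilon> x * E N k))) \<in> borel_measurable (gauss (ix N) \<sigma>)"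
      using measurable_cong_sets[OF sets_gauss refl] by blast
  qed
  finally show ?thesis .
qed

end

section \<open>Gaussian integrals of negative powers\<close>

text \<open>Powers with the value \<open>\<infinity>\<close> at \<open>0\<close> for negative exponents, which makes \<open>hpow t\<close>
  multiplicative on the nonnegative reals (\<open>0 powr t\<close> is the junk value \<open>0\<close>).\<close>

definition hpow :: "real \<Rightarrow> real \<Rightarrow> ennreal" where
  "hpow t y = (if y = 0 then (if t < 0 then \<infinity> else 0) else ennreal (y powr t))"

lemma measurable_hpow [measurable]: "hpow t \<in> borel_measurable borel"
  unfolding hpow_def by measurable

lemma hpow_mult:
  assumes "0 \<le> a" "0 \<le> b"
  shows "hpow t (a * b) = hpow t a * hpow t b"
  using assms
  by (auto simp: hpow_def powr_mult ennreal_mult ennreal_top_mult ennreal_mult_top)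

lemma hpow_antimono:
  assumes "t < 0" "0 \<le> a" "a \<le> b"
  shows "hpow t b \<le> hpow t a"
  using assms by (auto simp: hpow_def intro!: ennreal_leI powr_mono2')

text \<open>The smallest factor m controls the whole product: the negative power is at most m to the
  power - s * length, hence at most 1 if m \<ge> 1 and at most m to the power - r otherwise. Many
  coinciding zeros are thereby reduced to single zeros with the exponent r.\<close>

lemma hpow_prod_list_le:
  fixes s r :: real
  assumes "0 < s" "s * length bs \<le> r" "\<And>b. b \<in> set bs \<Longrightarrow> 0 \<le> b"
  shows "hpow (- s) (\<Prod>b\<leftarrow>bs. b) \<le> 1 + (\<Sum>b\<leftarrow>bs. hpow (- r) b)"
proof (cases "0 \<in> set bs")
  case True
  have "0 < length bs" using True by auto
  hence "0 < r" using assms(1,2) by (metis less_le_trans mult_pos_pos of_nat_0_less_iff)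
  hence "hpow (- r) 0 = \<infinity>" by (simp add: hpow_def)
  hence "(\<Sum>b\<leftarrow>bs. hpow (- r) b) = \<infinity>" using True by (induction bs) auto
  thus ?thesis by simp
next
  case False
  hence pos: "0 < b" if "b \<in> set bs" for b using assms(3)[OF that] that by (metis less_eq_real_def)
  show ?thesis
  proof (cases "bs = []")
    case True
    thus ?thesis by (simp add: hpow_def)
  next
    case ne: False
    define m where "m = Min (set bs)"
    have m: "m \<in> set bs" "\<And>b. b \<in> set bs \<Longrightarrow> m \<le> b" using ne by (auto simp: m_def)
    have m0: "0 < m" using pos m by blast
    have prodpos: "(\<Prod>b\<leftarrow>cs. b) > 0" if "set cs \<subseteq> set bs" for cs using that pos by (induction cs) auto
    have le: "(\<Prod>b\<leftarrow>cs. b) powr (- s) \<le> (m powr (- s)) ^ length cs" if "set cs \<subseteq> set bs" for cs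
      using that
    proof (induction cs)
      case (Cons c cs)
      have "c powr (- s) \<le> m powr (- s)" using Cons.prems m m0 assms(1) by (intro powr_mono2') auto
      moreover have "(\<Prod>b\<leftarrow>cs. b) powr (- s) \<le> (m powr (- s)) ^ length cs" using Cons by auto
      moreover have "0 < c" using Cons.prems pos by auto
      ultimately show ?case using prodpos[of cs] Cons.prems by (simp add: powr_mult mult_mono)
    qed simp
    have "hpow (- s) (\<Prod>b\<leftarrow>bs. b) \<le> ennreal ((m powr (- s)) ^ length bs)"
      using prodpos[of bs] le[of bs] False by (auto simp: hpow_def intro!: ennreal_leI)
    also have "(m powr (- s)) ^ length bs = m powr (- (s * length bs))"
      using m0 by (simp add: powr_powr flip: powr_realpow)
    also have "ennreal (m powr (- (s * length bs))) \<le> 1 + hpow (- r) m"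
    proof (cases "m \<le> 1")
      case True
      hence "m powr (- (s * length bs)) \<le> m powr (- r)" using assms(2) m0 by (intro powr_mono') auto
      thus ?thesis using m0 by (auto simp: hpow_def add_increasing intro!: ennreal_leI)
    next
      case False
      hence "m powr (- (s * length bs)) \<le> 1" using assms(1) powr_mono[of "- (s * length bs)" 0 m] by auto
      thus ?thesis by (simp add: ennreal_le_1 add_increasing2)
    qed
    also have "hpow (- r) m \<le> (\<Sum>b\<leftarrow>bs. hpow (- r) b)"
      using m(1) by (induction bs) (auto simp: add_increasing add_increasing2)
    finally show ?thesis by (simp add: add_mono)
  qed
qed

text \<open>Where the distance to b exceeds 1 the integrand is at most 1; on either side of b the
  singularity contributes at most the integral of v to the power - 1 / 2 over the unit interval,
  which is 2. Hence 5 = 1 + 2 + 2, uniformly in b.\<close>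

lemma nn_integral_hpow_half:
  "(\<integral>\<^sup>+t. hpow (- (1/2)) \<bar>t - b\<bar> * indicator {0..1} t \<partial>lborel) \<le> 5"
proof -
  have I: "(\<integral>\<^sup>+v. ennreal (v powr (- (1/2))) * indicator {0..1} v \<partial>lborel) = 2"
  proof -
    have "((\<lambda>x::real. x powr (- (1/2))) has_integral (1 powr (- (1/2) + 1) / (- (1/2) + 1))) {0..1}"
      by (rule has_integral_powr_from_0) auto
    hence "(\<integral>\<^sup>+v. ennreal (v powr (- (1/2))) * indicator {0..1::real} v \<partial>lborel) = ennreal (1 powr (- (1/2) + 1) / (- (1/2) + 1))"
      by (intro nn_integral_has_integral_lebesgue') auto
    thus ?thesis by simp
  qed
  have I': "(\<integral>\<^sup>+v. ennreal (v powr (- (1/2))) * indicator {0..1} v \<partial>lborel)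
      = (\<integral>\<^sup>+t. ennreal ((c * t + e) powr (- (1/2))) * indicator {0..1} (c * t + e) \<partial>lborel)"
    if "c = 1 \<or> c = -1" for c e :: real
    using that by (subst nn_integral_real_affine[where c = c and t = e]) (auto simp: add.commute)
  have "(\<integral>\<^sup>+t. hpow (- (1/2)) \<bar>t - b\<bar> * indicator {0..1} t \<partial>lborel)
      \<le> (\<integral>\<^sup>+t. indicator {0..1} t + (ennreal ((1 * t + - b) powr (- (1/2))) * indicator {0..1} (1 * t + - b)
          + ennreal ((- 1 * t + b) powr (- (1/2))) * indicator {0..1} (- 1 * t + b)) \<partial>lborel)"
  proof (rule nn_integral_mono_AE)
    have "AE t in lborel. t \<noteq> b" by (rule AE_lborel_singleton)
    thus "AE t in lborel. hpow (- (1/2)) \<bar>t - b\<bar> * indicator {0..1} t \<le>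
        indicator {0..1} t + (ennreal ((1 * t + - b) powr (- (1/2))) * indicator {0..1} (1 * t + - b)
          + ennreal ((- 1 * t + b) powr (- (1/2))) * indicator {0..1} (- 1 * t + b))"
    proof eventually_elim
      case (elim t)
      show ?case
      proof (cases "1 < \<bar>t - b\<bar>")
        case True
        hence "hpow (- (1/2)) \<bar>t - b\<bar> \<le> 1"
          using powr_mono[of "- (1/2)" 0 "\<bar>t - b\<bar>"] by (auto simp: hpow_def ennreal_le_1)
        thus ?thesis by (auto simp: indicator_def add_increasing2)
      next
        case False
        show ?thesis
        proof (cases "b < t")
          case True
          thus ?thesis using False by (auto simp: hpow_def indicator_def add_increasing)
        next
          case False': False
          hence "\<bar>t - b\<bar> = - t + b" using elim by auto
          thus ?thesis using False elim False' by (auto simp: hpow_def indicator_def add_increasing)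
        qed
      qed
    qed
  qed
  also have "\<dots> = 1 + (2 + 2)"
    using I'[of 1 "- b"] I'[of "-1" b] I by (simp add: nn_integral_add)
  also have "\<dots> = 5" by simp
  finally show ?thesis .
qed

text \<open>A point of the real line is at least as far from a complex root as from the real part of
  that root, so only real singularities have to be integrated; rescaling by \<epsilon> produces the
  factor on the right.\<close>

lemma nn_integral_hpow_linear:
  assumes \<epsilon>: "0 < \<epsilon>"
  shows "(\<integral>\<^sup>+t. hpow (- (1/2)) (cmod (complex_of_real (\<epsilon> * t) - a)) * indicator {0..1} t \<partial>lborel)
    \<le> 5 * ennreal (\<epsilon> powr (- (1/2)))"
proof -
  have "hpow (- (1/2)) (cmod (complex_of_real (\<epsilon> * t) - a)) \<le> ennreal (\<epsilon> powr (- (1/2))) * hpow (- (1/2)) \<bar>t - Re a / \<epsilon>\<bar>" for t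
  proof -
    have "\<epsilon> * \<bar>t - Re a / \<epsilon>\<bar> = \<bar>\<epsilon> * t - Re a\<bar>" using \<epsilon> by (auto simp: abs_mult_pos' abs_if field_simps)
    also have "\<dots> \<le> cmod (complex_of_real (\<epsilon> * t) - a)" using abs_Re_le_cmod[of "complex_of_real (\<epsilon> * t) - a"] by simp
    finally have "hpow (- (1/2)) (cmod (complex_of_real (\<epsilon> * t) - a)) \<le> hpow (- (1/2)) (\<epsilon> * \<bar>t - Re a / \<epsilon>\<bar>)"
      using \<epsilon> by (intro hpow_antimono) auto
    also have "\<dots> = hpow (- (1/2)) \<epsilon> * hpow (- (1/2)) \<bar>t - Re a / \<epsilon>\<bar>" using \<epsilon> by (intro hpow_mult) auto
    finally show ?thesis using \<epsilon> by (simp add: hpow_def)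
  qed
  hence "(\<integral>\<^sup>+t. hpow (- (1/2)) (cmod (complex_of_real (\<epsilon> * t) - a)) * indicator {0..1} t \<partial>lborel)
     \<le> (\<integral>\<^sup>+t. ennreal (\<epsilon> powr (- (1/2))) * (hpow (- (1/2)) \<bar>t - Re a / \<epsilon>\<bar> * indicator {0..1} t) \<partial>lborel)"
    by (intro nn_integral_mono) (auto simp: indicator_def)
  also have "\<dots> = ennreal (\<epsilon> powr (- (1/2))) * (\<integral>\<^sup>+t. hpow (- (1/2)) \<bar>t - Re a / \<epsilon>\<bar> * indicator {0..1} t \<partial>lborel)"
    by (rule nn_integral_cmult) measurable
  also have "\<dots> \<le> ennreal (\<epsilon> powr (- (1/2))) * 5"
    by (intro mult_left_mono nn_integral_hpow_half) simp
  finally show ?thesis by (simp add: mult.commute)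
qed

text \<open>The exponent is half of that in the Gaussian density, so density times weight is, up to
  a constant, the density of variance 2 \<sigma>^2. The weight therefore has finite expectation, and
  it dominates all powers of the radius.\<close>

definition gexp :: "'i set \<Rightarrow> real \<Rightarrow> ('i \<Rightarrow> real) \<Rightarrow> real" where
  "gexp I \<sigma> x = exp ((\<Sum>i\<in>I. (x i)\<^sup>2) / (4 * \<sigma>\<^sup>2))"

lemma gauss_density_gexp:
  assumes I: "finite I" and \<sigma>: "0 < \<sigma>"
  shows "gauss_density I \<sigma> x * ennreal (gexp I \<sigma> x) = ennreal (sqrt 2 ^ card I) * gauss_density I (sqrt 2 * \<sigma>) x"
proof -
  have "1 / sqrt (2 * pi * \<sigma>\<^sup>2) = sqrt 2 * (1 / sqrt (2 * pi * (sqrt 2 * \<sigma>)\<^sup>2))"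
  proof -
    have "2 * pi * (sqrt 2 * \<sigma>)\<^sup>2 = 2 * (2 * pi * \<sigma>\<^sup>2)" by (simp add: power_mult_distrib)
    hence "sqrt (2 * pi * (sqrt 2 * \<sigma>)\<^sup>2) = sqrt 2 * sqrt (2 * pi * \<sigma>\<^sup>2)" by (simp only: real_sqrt_mult[of 2])
    thus ?thesis by simp
  qed
  hence "(1 / sqrt (2 * pi * \<sigma>\<^sup>2)) ^ card I = sqrt 2 ^ card I * (1 / sqrt (2 * pi * (sqrt 2 * \<sigma>)\<^sup>2)) ^ card I"
    by (metis power_mult_distrib)
  moreover have "exp (- (\<Sum>i\<in>I. (x i)\<^sup>2) / (2 * \<sigma>\<^sup>2)) * gexp I \<sigma> x = exp (- (\<Sum>i\<in>I. (x i)\<^sup>2) / (2 * (sqrt 2 * \<sigma>)\<^sup>2))"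
    using \<sigma> unfolding gexp_def by (simp add: power_mult_distrib flip: exp_add)
  ultimately have "(1 / sqrt (2 * pi * \<sigma>\<^sup>2)) ^ card I * exp (- (\<Sum>i\<in>I. (x i)\<^sup>2) / (2 * \<sigma>\<^sup>2)) * gexp I \<sigma> x
     = sqrt 2 ^ card I * ((1 / sqrt (2 * pi * (sqrt 2 * \<sigma>)\<^sup>2)) ^ card I * exp (- (\<Sum>i\<in>I. (x i)\<^sup>2) / (2 * (sqrt 2 * \<sigma>)\<^sup>2)))"
    by (simp only: mult.assoc)
  thus ?thesis unfolding gauss_density_eq[OF I] gexp_def by (simp flip: ennreal_mult'')
qed

lemma measurable_gexp [measurable]: "gexp I \<sigma> \<in> borel_measurable (PL I)"
proof -
  have [measurable]: "(\<lambda>x. x i) \<in> borel_measurable (PL I)" if "i \<in> I" for i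
    using measurable_component_singleton[OF that, of "\<lambda>_. lborel"] by simp
  show ?thesis unfolding gexp_def by measurable
qed

lemma nn_integral_gexp:
  assumes I: "finite I" and \<sigma>: "0 < \<sigma>"
  shows "(\<integral>\<^sup>+x. ennreal (gexp I \<sigma> x) \<partial>gauss I \<sigma>) = ennreal (sqrt 2 ^ card I)"
proof -
  have "(\<integral>\<^sup>+x. ennreal (gexp I \<sigma> x) \<partial>gauss I \<sigma>) = (\<integral>\<^sup>+x. gauss_density I \<sigma> x * ennreal (gexp I \<sigma> x) \<partial>PL I)"
    by (rule nn_integral_gauss[OF I \<sigma>]) measurable
  also have "\<dots> = ennreal (sqrt 2 ^ card I) * (\<integral>\<^sup>+x. gauss_density I (sqrt 2 * \<sigma>) x \<partial>PL I)"
    unfolding gauss_density_gexp[OF I \<sigma>] by (rule nn_integral_cmult) measurable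
  also have "(\<integral>\<^sup>+x. gauss_density I (sqrt 2 * \<sigma>) x \<partial>PL I) = 1"
    using \<sigma> by (intro nn_integral_gauss_density[OF I]) simp
  finally show ?thesis by simp
qed

text \<open>Averages over a segment control the Gaussian integral: moving by \<open>t u\<close> with \<open>t \<le> 1\<close> costs at
  most a constant factor and a wider Gaussian.\<close>

lemma nn_integral_gauss_segment:
  assumes I: "finite I" and \<sigma>: "0 < \<sigma>" and u: "u \<in> extensional I"
    and F [measurable]: "F \<in> borel_measurable (PL I)"
    and B: "\<And>x. x \<in> extensional I \<Longrightarrow>
      (\<integral>\<^sup>+t. F (padd I x (\<lambda>i\<in>I. t * u i)) * indicator {0..1} t \<partial>lborel) \<le> B"
  shows "(\<integral>\<^sup>+x. F x \<partial>gauss I \<sigma>) \<le> ennreal (sqrt 2 ^ card I * exp ((\<Sum>i\<in>I. (u i)\<^sup>2) / (2 * \<sigma>\<^sup>2))) * B"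
proof -
  let ?c = "ennreal (sqrt 2 ^ card I * exp ((\<Sum>i\<in>I. (u i)\<^sup>2) / (2 * \<sigma>\<^sup>2)))"
  let ?\<gamma> = "gauss_density I \<sigma>" and ?\<gamma>' = "gauss_density I (sqrt 2 * \<sigma>)"
  let ?s = "\<lambda>x t. padd I x (\<lambda>i\<in>I. t * u i)"
  interpret S: sigma_finite_measure "PL I" using I by (rule PL.sigma_finite)
  interpret P: pair_sigma_finite "PL I" "lborel :: real measure" ..
  have [measurable]: "(\<lambda>p. ?s (fst p) (snd p)) \<in> measurable (PL I \<Otimes>\<^sub>M lborel) (PL I)"
    by (intro measurable_padd measurable_restrict) measurable
  have [measurable]: "(\<lambda>x. ?s x t) \<in> measurable (PL I) (PL I)" for t
    by (intro measurable_padd measurable_restrict) measurable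
  have \<gamma>: "?\<gamma> (?s x t) \<le> ?c * ?\<gamma>' x" if t: "0 \<le> t" "t \<le> 1" for x t
  proof -
    \<comment> \<open>Half of the squared length survives the shift. This half is what doubles the
      variance, and the loss depends on \<open>u\<close> only, which gives the constant
      factor.\<close>
    have "(x i)\<^sup>2 / 2 - (u i)\<^sup>2 \<le> (x i + t * u i)\<^sup>2" for i
    proof -
      have "0 \<le> (x i + 2 * (t * u i))\<^sup>2 / 2" by simp
      also have "\<dots> = (x i + t * u i)\<^sup>2 - (x i)\<^sup>2 / 2 + (t * u i)\<^sup>2" by (simp add: power2_eq_square algebra_simps add_divide_distrib)
      also have "(t * u i)\<^sup>2 \<le> (u i)\<^sup>2" using t by (simp add: power_mult_distrib mult_left_le_one_le power_le_one)
      finally show ?thesis by simp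
    qed
    hence "(\<Sum>i\<in>I. (x i)\<^sup>2 / 2 - (u i)\<^sup>2) \<le> (\<Sum>i\<in>I. (?s x t i)\<^sup>2)"
      by (intro sum_mono) (auto simp: padd_def)
    hence "(\<Sum>i\<in>I. (x i)\<^sup>2) / 2 - (\<Sum>i\<in>I. (u i)\<^sup>2) \<le> (\<Sum>i\<in>I. (?s x t i)\<^sup>2)"
      by (simp add: sum_subtractf sum_divide_distrib)
    hence "- (\<Sum>i\<in>I. (?s x t i)\<^sup>2) / (2 * \<sigma>\<^sup>2) \<le> - ((\<Sum>i\<in>I. (x i)\<^sup>2) / 2 - (\<Sum>i\<in>I. (u i)\<^sup>2)) / (2 * \<sigma>\<^sup>2)"
      using \<sigma> by (intro divide_right_mono) auto
    also have "\<dots> = - (\<Sum>i\<in>I. (x i)\<^sup>2) / (2 * \<sigma>\<^sup>2) + (\<Sum>i\<in>I. (x i)\<^sup>2) / (4 * \<sigma>\<^sup>2) + (\<Sum>i\<in>I. (u i)\<^sup>2) / (2 * \<sigma>\<^sup>2)"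
      using \<sigma> by (simp add: field_simps)
    finally have "exp (- (\<Sum>i\<in>I. (?s x t i)\<^sup>2) / (2 * \<sigma>\<^sup>2))
       \<le> exp (- (\<Sum>i\<in>I. (x i)\<^sup>2) / (2 * \<sigma>\<^sup>2)) * gexp I \<sigma> x * exp ((\<Sum>i\<in>I. (u i)\<^sup>2) / (2 * \<sigma>\<^sup>2))"
      unfolding gexp_def exp_add[symmetric] by (simp only: exp_le_cancel_iff)
    hence "?\<gamma> (?s x t) \<le> ?\<gamma> x * ennreal (gexp I \<sigma> x) * ennreal (exp ((\<Sum>i\<in>I. (u i)\<^sup>2) / (2 * \<sigma>\<^sup>2)))"
      unfolding gauss_density_eq[OF I]
      by (simp add: gexp_def mult.assoc mult_left_mono flip: ennreal_mult'')
    also have "\<dots> = ?c * ?\<gamma>' x"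
      unfolding gauss_density_gexp[OF I \<sigma>] by (simp add: ennreal_mult mult_ac)
    finally show ?thesis .
  qed
  have "(\<integral>\<^sup>+x. F x \<partial>gauss I \<sigma>) = (\<integral>\<^sup>+x. ?\<gamma> x * F x \<partial>PL I)" by (rule nn_integral_gauss[OF I \<sigma>]) measurable
  \<comment> \<open>The unit interval has measure 1, so an average over t may be inserted. For each
    t the inner integral is translated by t u, and the order of integration is exchanged
    afterwards.\<close>
  also have "\<dots> = (\<integral>\<^sup>+t. (\<integral>\<^sup>+x. ?\<gamma> x * F x \<partial>PL I) * indicator {0..1::real} t \<partial>lborel)"
    by (subst nn_integral_cmult) auto
  also have "\<dots> \<le> (\<integral>\<^sup>+t. (\<integral>\<^sup>+x. ?c * (?\<gamma>' x * (F (?s x t) * indicator {0..1} t)) \<partial>PL I) \<partial>lborel)"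
  proof (rule nn_integral_mono)
    fix t :: real
    show "(\<integral>\<^sup>+x. ?\<gamma> x * F x \<partial>PL I) * indicator {0..1::real} t
       \<le> (\<integral>\<^sup>+x. ?c * (?\<gamma>' x * (F (?s x t) * indicator {0..1} t)) \<partial>PL I)"
    proof (cases "0 \<le> t \<and> t \<le> 1")
      case True
      have "(\<integral>\<^sup>+x. ?\<gamma> x * F x \<partial>PL I) = (\<integral>\<^sup>+x. ?\<gamma> (?s x t) * F (?s x t) \<partial>PL I)"
        by (rule nn_integral_PL_padd[OF I, symmetric, where f = "\<lambda>x. ?\<gamma> x * F x"]) auto
      also have "\<dots> \<le> (\<integral>\<^sup>+x. ?c * ?\<gamma>' x * F (?s x t) \<partial>PL I)"
        using \<gamma> True by (intro nn_integral_mono mult_right_mono) auto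
      finally show ?thesis using True by (simp add: mult.assoc)
    qed auto
  qed
  also have "\<dots> = (\<integral>\<^sup>+x. (\<integral>\<^sup>+t. ?c * (?\<gamma>' x * (F (?s x t) * indicator {0..1} t)) \<partial>lborel) \<partial>PL I)"
    by (rule P.Fubini') (simp add: case_prod_beta, measurable)
  also have "\<dots> \<le> (\<integral>\<^sup>+x. ?c * B * ?\<gamma>' x \<partial>PL I)"
  proof (rule nn_integral_mono)
    fix x assume "x \<in> space (PL I)"
    hence x: "x \<in> extensional I" by simp
    have [measurable]: "(\<lambda>t. ?s x t) \<in> measurable lborel (PL I)"
      by (intro measurable_padd measurable_restrict) (use x in auto)
    have Ft [measurable]: "(\<lambda>t. F (?s x t) * indicator {0..1} t) \<in> borel_measurable lborel" by measurable
    have "(\<integral>\<^sup>+t. ?c * (?\<gamma>' x * (F (?s x t) * indicator {0..1} t)) \<partial>lborel)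
        = ?c * (\<integral>\<^sup>+t. ?\<gamma>' x * (F (?s x t) * indicator {0..1} t) \<partial>lborel)"
      by (rule nn_integral_cmult) (rule borel_measurable_times_ennreal[OF _ Ft], simp)
    also have "(\<integral>\<^sup>+t. ?\<gamma>' x * (F (?s x t) * indicator {0..1} t) \<partial>lborel)
        = ?\<gamma>' x * (\<integral>\<^sup>+t. F (?s x t) * indicator {0..1} t \<partial>lborel)"
      by (rule nn_integral_cmult[OF Ft])
    also have "?c * (?\<gamma>' x * (\<integral>\<^sup>+t. F (?s x t) * indicator {0..1} t \<partial>lborel)) \<le> ?c * (?\<gamma>' x * B)"
      by (intro mult_left_mono B x) auto
    also have "?c * (?\<gamma>' x * B) = ?c * B * ?\<gamma>' x" by (simp only: mult_ac)
    finally show "(\<integral>\<^sup>+t. ?c * (?\<gamma>' x * (F (?s x t) * indicator {0..1} t)) \<partial>lborel) \<le> ?c * B * ?\<gamma>' x" .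
  qed
  also have "\<dots> = ?c * B * (\<integral>\<^sup>+x. ?\<gamma>' x \<partial>PL I)" by (rule nn_integral_cmult) measurable
  also have "(\<integral>\<^sup>+x. ?\<gamma>' x \<partial>PL I) = 1" using \<sigma> by (intro nn_integral_gauss_density[OF I]) simp
  finally show ?thesis by simp
qed

section \<open>Frobenius norm inequalities and determinants of quadratic pencils\<close>

definition fnorm :: "complex mat \<Rightarrow> real" where
  "fnorm A = sqrt (frob2 A)"

lemma fnorm_nonneg [simp]: "0 \<le> fnorm A" by (simp add: fnorm_def)

lemma fnorm_power2: "(fnorm A)\<^sup>2 = frob2 A" by (simp add: fnorm_def)

lemma fnorm_L2: "fnorm A = L2_set (\<lambda>(i, j). cmod (A $$ (i, j))) ({..<dim_row A} \<times> {..<dim_col A})"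
  unfolding fnorm_def frob2_def L2_set_def by (simp add: sum.cartesian_product case_prod_beta)

lemma fnorm_add:
  assumes "A \<in> carrier_mat n m" "B \<in> carrier_mat n m"
  shows "fnorm (A + B) \<le> fnorm A + fnorm B"
proof -
  let ?S = "{..<n} \<times> {..<m}"
  have "fnorm (A + B) = L2_set (\<lambda>(i, j). cmod (A $$ (i, j) + B $$ (i, j))) ?S"
    unfolding fnorm_L2 using assms by (auto intro!: L2_set_cong)
  also have "\<dots> \<le> L2_set (\<lambda>p. (case p of (i, j) \<Rightarrow> cmod (A $$ (i, j))) + (case p of (i, j) \<Rightarrow> cmod (B $$ (i, j)))) ?S"
    by (rule L2_set_mono) (auto intro: norm_triangle_ineq)
  also have "\<dots> \<le> L2_set (\<lambda>(i, j). cmod (A $$ (i, j))) ?S + L2_set (\<lambda>(i, j). cmod (B $$ (i, j))) ?S"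
    by (rule L2_set_triangle_ineq)
  also have "\<dots> = fnorm A + fnorm B" unfolding fnorm_L2 using assms by auto
  finally show ?thesis .
qed

lemma fnorm_smult: "fnorm (c \<cdot>\<^sub>m A) = cmod c * fnorm A"
proof -
  have "frob2 (c \<cdot>\<^sub>m A) = (cmod c)\<^sup>2 * frob2 A"
    unfolding frob2_def by (simp add: norm_mult power_mult_distrib sum_distrib_left)
  thus ?thesis by (simp add: fnorm_def real_sqrt_mult)
qed

lemma fnorm_adjoint: "fnorm (mat_adjoint A) = fnorm A"
proof -
  have "frob2 (mat_adjoint A) = frob2 A"
    unfolding frob2_def by (subst sum.swap) simp
  thus ?thesis by (simp add: fnorm_def)
qed

lemma fnorm_mult:
  assumes A: "A \<in> carrier_mat n m" and B: "B \<in> carrier_mat m l"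
  shows "fnorm (A * B) \<le> fnorm A * fnorm B"
proof -
  have "(cmod ((A * B) $$ (i, j)))\<^sup>2 \<le> (\<Sum>p<m. (cmod (A $$ (i, p)))\<^sup>2) * (\<Sum>p<m. (cmod (B $$ (p, j)))\<^sup>2)"
    if ij: "i < n" "j < l" for i j
  proof -
    have "cmod ((A * B) $$ (i, j)) \<le> (\<Sum>p<m. cmod (A $$ (i, p)) * cmod (B $$ (p, j)))"
      unfolding index_mult_mat_sum[OF A B ij] by (rule order_trans[OF norm_sum]) (simp add: norm_mult)
    hence "(cmod ((A * B) $$ (i, j)))\<^sup>2 \<le> (\<Sum>p<m. cmod (A $$ (i, p)) * cmod (B $$ (p, j)))\<^sup>2"
      by (rule power_mono) simp
    also have "\<dots> \<le> (\<Sum>p<m. (cmod (A $$ (i, p)))\<^sup>2) * (\<Sum>p<m. (cmod (B $$ (p, j)))\<^sup>2)"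
      by (rule Cauchy_Schwarz_ineq_sum)
    finally show ?thesis .
  qed
  hence "(\<Sum>i<n. \<Sum>j<l. (cmod ((A * B) $$ (i, j)))\<^sup>2)
      \<le> (\<Sum>i<n. \<Sum>j<l. (\<Sum>p<m. (cmod (A $$ (i, p)))\<^sup>2) * (\<Sum>p<m. (cmod (B $$ (p, j)))\<^sup>2))"
    by (intro sum_mono) auto
  also have "\<dots> = (\<Sum>i<n. \<Sum>p<m. (cmod (A $$ (i, p)))\<^sup>2) * (\<Sum>j<l. \<Sum>p<m. (cmod (B $$ (p, j)))\<^sup>2)"
    by (simp add: sum_product)
  also have "(\<Sum>j<l. \<Sum>p<m. (cmod (B $$ (p, j)))\<^sup>2) = (\<Sum>p<m. \<Sum>j<l. (cmod (B $$ (p, j)))\<^sup>2)" by (rule sum.swap)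
  finally have "frob2 (A * B) \<le> frob2 A * frob2 B"
    unfolding frob2_def using A B by (simp del: index_mult_mat(1))
  thus ?thesis by (simp add: fnorm_def real_sqrt_mult flip: real_sqrt_mult)
qed

text \<open>Companion linearization: the determinant of the pencil is the characteristic polynomial
  of the block matrix \<open>K\<close> of size 2 n, which splits into linear factors over the
  complex numbers.\<close>

lemma det_quadratic_pencil:
  fixes H W :: "complex mat"
  assumes H: "H \<in> carrier_mat n n" and W: "W \<in> carrier_mat n n"
  obtains as where "length as = 2 * n"
    "\<And>z. Determinant.det (z\<^sup>2 \<cdot>\<^sub>m 1\<^sub>m n + z \<cdot>\<^sub>m H + W) = (\<Prod>a\<leftarrow>as. z - a)"
proof -
  define K where "K = four_block_mat (- H) (- W) (1\<^sub>m n) (0\<^sub>m n n)"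
  have K: "K \<in> carrier_mat (n + n) (n + n)" using H by (simp add: K_def)
  obtain as where as: "char_poly K = (\<Prod>a\<leftarrow>as. [:- a, 1:])" "length as = n + n"
    using char_poly_factorized[OF K] by blast
  have "Determinant.det (z\<^sup>2 \<cdot>\<^sub>m 1\<^sub>m n + z \<cdot>\<^sub>m H + W) = (\<Prod>a\<leftarrow>as. z - a)" for z
  proof -
    let ?A = "z \<cdot>\<^sub>m 1\<^sub>m n + H" and ?D = "z \<cdot>\<^sub>m 1\<^sub>m n :: complex mat"
    have "(\<Prod>a\<leftarrow>as. z - a) = poly (char_poly K) z"
      unfolding as by (simp add: poly_prod_list comp_def)
    also have "\<dots> = Determinant.det (- (char_matrix K z))" by (rule char_poly_matrix[OF K])
    also have "- (char_matrix K z) = four_block_mat ?A W (- 1\<^sub>m n) ?D"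
      using H W by (intro eq_matI) (auto simp: char_matrix_def K_def)
    also have "Determinant.det \<dots> = Determinant.det (?A * ?D - W * (- 1\<^sub>m n))"
      using H W by (intro det_four_block_mat) (auto simp: mult_smult_distrib[of _ n n])
    also have "W * (- 1\<^sub>m n) = - W" using W by simp
    also have "?A * ?D = z \<cdot>\<^sub>m ?A" using H mult_smult_distrib[of ?A n n "1\<^sub>m n" n z] by simp
    also have "z \<cdot>\<^sub>m ?A - (- W) = z\<^sup>2 \<cdot>\<^sub>m 1\<^sub>m n + z \<cdot>\<^sub>m H + W"
      using H W by (intro eq_matI) (auto simp: power2_eq_square algebra_simps)
    finally show ?thesis by simp
  qed
  thus ?thesis using as(2) by (intro that[of as]) auto
qed

context number_system begin

lemma d_eq_0 [simp]: "(d = 0) = False"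
  by (simp add: block_dim_def)

text \<open>The columns of the standard frame are orthonormal, so the Gram matrix of the shifted
  frame is a monic quadratic pencil in t. Its determinant is nonnegative for real t, hence equal to
  the product of the moduli of the linear factors.\<close>

lemma D_shift:
  assumes Y: "Y \<in> NC N N" and k: "k \<le> N"
  obtains as where "length as = 2 * (d * k)"
    "\<And>t. D ((Y + complex_of_real t \<cdot>\<^sub>m 1\<^sub>m (d * N)) * E N k) = (\<Prod>a\<leftarrow>as. cmod (complex_of_real t - a))"
proof -
  have cE: "E N k \<in> carrier_mat (d * N) (d * k)" by (auto simp: first_columns_def)
  note cY = NC_carrier[OF Y]
  define Z where "Z = Y * E N k"
  have cZ: "Z \<in> carrier_mat (d * N) (d * k)" using cY cE by (simp add: Z_def)
  let ?H = "mat_adjoint Z * E N k + mat_adjoint (E N k) * Z"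
  have cA: "mat_adjoint Z \<in> carrier_mat (d * k) (d * N)" "mat_adjoint (E N k) \<in> carrier_mat (d * k) (d * N)"
    using cZ cE by auto
  have cH: "?H \<in> carrier_mat (d * k) (d * k)" "mat_adjoint Z * Z \<in> carrier_mat (d * k) (d * k)"
    using cA cZ cE by auto
  obtain as where as: "length as = 2 * (d * k)"
    "\<And>z. Determinant.det (z\<^sup>2 \<cdot>\<^sub>m 1\<^sub>m (d * k) + z \<cdot>\<^sub>m ?H + mat_adjoint Z * Z) = (\<Prod>a\<leftarrow>as. z - a)"
    using det_quadratic_pencil[OF cH] by metis
  have "D ((Y + complex_of_real t \<cdot>\<^sub>m 1\<^sub>m (d * N)) * E N k) = (\<Prod>a\<leftarrow>as. cmod (complex_of_real t - a))" for t
  proof -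
    let ?t = "complex_of_real t"
    let ?V = "(Y + ?t \<cdot>\<^sub>m 1\<^sub>m (d * N)) * E N k"
    have V: "?V \<in> NC N k" using Y E_NC[OF k] by (intro NC_mult NC_add NC_smult) auto
    have Ve: "?V = Z + ?t \<cdot>\<^sub>m E N k"
      unfolding Z_def using cY cE by (simp add: add_mult_distrib_mat[of _ "d*N" "d*N"] mult_smult_assoc_mat[of _ "d*N" "d*N"])
    have tE: "?t \<cdot>\<^sub>m E N k \<in> carrier_mat (d * N) (d * k)" "?t \<cdot>\<^sub>m mat_adjoint (E N k) \<in> carrier_mat (d * k) (d * N)" using cE by auto
    have "mat_adjoint ?V * ?V = (mat_adjoint Z + ?t \<cdot>\<^sub>m mat_adjoint (E N k)) * (Z + ?t \<cdot>\<^sub>m E N k)"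
      unfolding Ve using cZ tE by (simp add: mat_adjoint_add mat_adjoint_smult)
    also have "\<dots> = mat_adjoint Z * (Z + ?t \<cdot>\<^sub>m E N k) + ?t \<cdot>\<^sub>m mat_adjoint (E N k) * (Z + ?t \<cdot>\<^sub>m E N k)"
      using cA cZ tE by (intro add_mult_distrib_mat[of _ "d*k" "d*N" _ _ "d*k"]) auto
    also have "\<dots> = (mat_adjoint Z * Z + mat_adjoint Z * (?t \<cdot>\<^sub>m E N k))
        + (?t \<cdot>\<^sub>m mat_adjoint (E N k) * Z + ?t \<cdot>\<^sub>m mat_adjoint (E N k) * (?t \<cdot>\<^sub>m E N k))"
      using cA cZ tE by (simp add: mult_add_distrib_mat[of _ "d*k" "d*N" _ "d*k"])
    also have "mat_adjoint Z * (?t \<cdot>\<^sub>m E N k) = ?t \<cdot>\<^sub>m (mat_adjoint Z * E N k)" using cA(1) cE by (rule mult_smult_distrib)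
    also have "?t \<cdot>\<^sub>m mat_adjoint (E N k) * Z = ?t \<cdot>\<^sub>m (mat_adjoint (E N k) * Z)" using cA(2) cZ by (rule mult_smult_assoc_mat)
    also have "?t \<cdot>\<^sub>m mat_adjoint (E N k) * (?t \<cdot>\<^sub>m E N k) = ?t \<cdot>\<^sub>m (?t \<cdot>\<^sub>m 1\<^sub>m (d * k))"
      using mult_smult_distrib[OF tE(2) cE] mult_smult_assoc_mat[OF cA(2) cE] adjoint_E_E[OF k] by simp
    also have "(mat_adjoint Z * Z + ?t \<cdot>\<^sub>m (mat_adjoint Z * E N k)) + (?t \<cdot>\<^sub>m (mat_adjoint (E N k) * Z) + ?t \<cdot>\<^sub>m (?t \<cdot>\<^sub>m 1\<^sub>m (d * k)))
       = ?t\<^sup>2 \<cdot>\<^sub>m 1\<^sub>m (d * k) + ?t \<cdot>\<^sub>m ?H + mat_adjoint Z * Z" (is "?L = ?R")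
    proof -
      have gen: "(A + ?t \<cdot>\<^sub>m B) + (?t \<cdot>\<^sub>m C + ?t \<cdot>\<^sub>m (?t \<cdot>\<^sub>m 1\<^sub>m n)) = ?t\<^sup>2 \<cdot>\<^sub>m 1\<^sub>m n + ?t \<cdot>\<^sub>m (B + C) + A"
        if "A \<in> carrier_mat n n" "B \<in> carrier_mat n n" "C \<in> carrier_mat n n" for A B C :: "complex mat" and n
        using that by (intro eq_matI) (auto simp: power2_eq_square algebra_simps)
      show ?thesis by (rule gen) (use cA cZ cE in auto)
    qed
    finally have "complex_of_real (D ?V) = (\<Prod>a\<leftarrow>as. ?t - a)"
      using D_real_nonneg(1)[OF V k] as(2) by simp
    hence "cmod (complex_of_real (D ?V)) = cmod (\<Prod>a\<leftarrow>as. ?t - a)" by simp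
    also have "cmod (\<Prod>a\<leftarrow>as. ?t - a) = (\<Prod>a\<leftarrow>as. cmod (?t - a))" by (induction as) (auto simp: norm_mult)
    finally show ?thesis using D_real_nonneg(2)[OF V k] by simp
  qed
  thus ?thesis using that as(1) by blast
qed

text \<open>The coordinates of the identity matrix, the direction of the segments.\<close>

definition diag_dir :: "nat \<Rightarrow> nat \<times> nat \<times> nat \<Rightarrow> real" where
  "diag_dir N = (\<lambda>(i, j, a)\<in>ix N. if i = j \<and> a = 0 then 1 else 0)"

lemma NM_diag_dir: "NM N (\<lambda>i\<in>ix N. t * diag_dir N i) = complex_of_real t \<cdot>\<^sub>m 1\<^sub>m (d * N)"
proof -
  have "NM N (\<lambda>i\<in>ix N. t * diag_dir N i) = NM N (\<lambda>(i, j, a). if i = j \<and> a = 0 then t else 0)"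
    by (rule NM_cong) (auto simp: diag_dir_def)
  also have "\<dots> = NM N (\<lambda>(i, j, a). comps (complex_of_real t \<cdot>\<^sub>m 1\<^sub>m (d * N)) i j a)"
  proof (rule NM_cong)
    fix s assume s: "s \<in> ix N"
    obtain i j a where ija: "s = (i, j, a)" by (metis prod_cases3)
    have l: "i < N" "j < N" "a < \<beta>" using s by (auto simp: ija ix_def)
    have "d * i < d * N" "d * j < d * N" using l by auto
    moreover have "d = 2 \<and> Suc (d * j) < d * N" if "2 \<le> a"
    proof -
      have "d = 2" using that l(3) dyson_index by (auto simp: block_dim_def)
      thus ?thesis using l(2) by simp
    qed
    moreover have "2 * i \<noteq> Suc (2 * j)" by presburger
    ultimately have "comps (complex_of_real t \<cdot>\<^sub>m 1\<^sub>m (d * N)) i j a = (if i = j \<and> a = 0 then t else 0)"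
      by (cases "2 \<le> a") (auto simp: comps_def)
    thus "(case s of (i, j, a) \<Rightarrow> if i = j \<and> a = 0 then t else 0) = (case s of (i, j, a) \<Rightarrow> comps (complex_of_real t \<cdot>\<^sub>m 1\<^sub>m (d * N)) i j a)"
      by (simp add: ija)
  qed
  also have "\<dots> = complex_of_real t \<cdot>\<^sub>m 1\<^sub>m (d * N)"
    unfolding NM_def using NC_number_matrix_comps[OF NC_smult[OF NC_one, of t N]] by simp
  finally show ?thesis .
qed

lemma PY_shift:
  "PY N \<epsilon> (padd (ix N) x (\<lambda>i\<in>ix N. t * diag_dir N i)) = PY N \<epsilon> x + complex_of_real (\<epsilon> * t) \<cdot>\<^sub>m 1\<^sub>m (d * N)"
  unfolding PY_def NM_padd NM_diag_dir
  by (rule eq_matI) (auto simp: NM_def algebra_simps)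

text \<open>Along a segment \<open>D\<close> has 2 d k linear factors, and their exponents must add
  up to at most 1 / 2, the power whose singularity was integrated above. The added 4 keeps the
  exponent positive and bounded for k = 0 as well.\<close>

definition neg_exp :: "nat \<Rightarrow> real" where
  "neg_exp k = 1 / (4 * real (d * k) + 4)"

lemma neg_exp_pos: "0 < neg_exp k" "neg_exp k \<le> 1 / 4"
proof -
  have "0 < 4 * real (d * k) + 4" by (intro add_nonneg_pos) auto
  thus "0 < neg_exp k" by (simp add: neg_exp_def)
  show "neg_exp k \<le> 1 / 4" unfolding neg_exp_def by (rule frac_le) auto
qed

lemma measurable_D_PY [measurable]:
  "V \<in> carrier_mat (d * N) m \<Longrightarrow> (\<lambda>x. D (PY N \<epsilon> x * V)) \<in> borel_measurable (PL (ix N))"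
  by (rule borel_measurable_D[OF mat_measurable_mult[OF mat_measurable_PY mat_measurable_const]])

lemma E_carrier [simp]: "E n k \<in> carrier_mat (d * n) (d * k)"
  by (auto simp: first_columns_def)

text \<open>Along the segment in the direction of the identity matrix, \<open>D\<close> is the modulus of a polynomial
  with leading coefficient a power of \<open>\<epsilon>\<close>, so the singularity of \<open>D powr - s\<close> is integrable.\<close>

lemma negative_moment:
  assumes \<sigma>: "0 < \<sigma>" and k: "k \<le> N"
  obtains C :: real where "0 \<le> C" "\<And>\<epsilon>. 0 < \<epsilon> \<Longrightarrow>
    (\<integral>\<^sup>+x. hpow (- neg_exp k) (D (PY N \<epsilon> x * E N k)) \<partial>gauss (ix N) \<sigma>) \<le> ennreal (C * (1 + \<epsilon> powr (- (1/2))))"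
proof -
  let ?C1 = "sqrt 2 ^ card (ix N) * exp ((\<Sum>i\<in>ix N. (diag_dir N i)\<^sup>2) / (2 * \<sigma>\<^sup>2))"
  let ?m = "2 * (d * k)"
  have "(\<integral>\<^sup>+x. hpow (- neg_exp k) (D (PY N \<epsilon> x * E N k)) \<partial>gauss (ix N) \<sigma>) \<le> ennreal (?C1 * ((1 + 5 * real ?m) * (1 + \<epsilon> powr (- (1/2)))))"
    if \<epsilon>: "0 < \<epsilon>" for \<epsilon> :: real
  proof -
    have "(\<integral>\<^sup>+x. hpow (- neg_exp k) (D (PY N \<epsilon> x * E N k)) \<partial>gauss (ix N) \<sigma>)
        \<le> ennreal ?C1 * (1 + of_nat ?m * (5 * ennreal (\<epsilon> powr (- (1/2)))))"
    proof (rule nn_integral_gauss_segment[OF finite_ix \<sigma>])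
      show "diag_dir N \<in> extensional (ix N)" by (simp add: diag_dir_def)
      have "(\<lambda>x. D (PY N \<epsilon> x * E N k)) \<in> borel_measurable (PL (ix N))" by (rule measurable_D_PY[OF E_carrier])
      thus "(\<lambda>x. hpow (- neg_exp k) (D (PY N \<epsilon> x * E N k))) \<in> borel_measurable (PL (ix N))" by measurable
      fix x :: "nat \<times> nat \<times> nat \<Rightarrow> real" assume x: "x \<in> extensional (ix N)"
      obtain as where as: "length as = ?m"
        "\<And>t. D ((PY N \<epsilon> x + complex_of_real t \<cdot>\<^sub>m 1\<^sub>m (d * N)) * E N k) = (\<Prod>a\<leftarrow>as. cmod (complex_of_real t - a))"
        using D_shift[OF PY_NC k] by metis
      have "hpow (- neg_exp k) (D (PY N \<epsilon> (padd (ix N) x (\<lambda>i\<in>ix N. t * diag_dir N i)) * E N k))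
         \<le> 1 + (\<Sum>a\<leftarrow>as. hpow (- (1/2)) (cmod (complex_of_real (\<epsilon> * t) - a)))" for t
      proof -
        have "neg_exp k * length (map (\<lambda>a. cmod (complex_of_real (\<epsilon> * t) - a)) as) \<le> 1 / 2"
        proof -
          have "0 < 4 * real (d * k) + 4" by (intro add_nonneg_pos) auto
          thus ?thesis by (simp add: neg_exp_def as(1) pos_divide_le_eq del: of_nat_mult)
        qed
        moreover have "0 \<le> b" if "b \<in> set (map (\<lambda>a. cmod (complex_of_real (\<epsilon> * t) - a)) as)" for b
          using that by auto
        ultimately have "hpow (- neg_exp k) (\<Prod>b\<leftarrow>map (\<lambda>a. cmod (complex_of_real (\<epsilon> * t) - a)) as. b)
            \<le> 1 + (\<Sum>b\<leftarrow>map (\<lambda>a. cmod (complex_of_real (\<epsilon> * t) - a)) as. hpow (- (1/2)) b)"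
          by (rule hpow_prod_list_le[OF neg_exp_pos(1)])
        thus ?thesis unfolding PY_shift as(2) by (simp add: comp_def)
      qed
      hence "(\<integral>\<^sup>+t. hpow (- neg_exp k) (D (PY N \<epsilon> (padd (ix N) x (\<lambda>i\<in>ix N. t * diag_dir N i)) * E N k)) * indicator {0..1} t \<partial>lborel)
        \<le> (\<integral>\<^sup>+t. (1 + (\<Sum>a\<leftarrow>as. hpow (- (1/2)) (cmod (complex_of_real (\<epsilon> * t) - a)))) * indicator {0..1} t \<partial>lborel)"
        by (intro nn_integral_mono mult_right_mono) auto
      \<comment> \<open>Each root contributes at most 5 times \<epsilon> to the power - 1 / 2,
        wherever it lies, so the bound is uniform in the base point of the segment.\<close>
      also have "\<dots> \<le> 1 + of_nat (length as) * (5 * ennreal (\<epsilon> powr (- (1/2))))"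
      proof (induction as)
        case Nil
        show ?case by simp
      next
        case (Cons a as)
        have "(\<integral>\<^sup>+t. (1 + (\<Sum>a\<leftarrow>a # as. hpow (- (1/2)) (cmod (complex_of_real (\<epsilon> * t) - a)))) * indicator {0..1} t \<partial>lborel)
          = (\<integral>\<^sup>+t. hpow (- (1/2)) (cmod (complex_of_real (\<epsilon> * t) - a)) * indicator {0..1} t
             + (1 + (\<Sum>a\<leftarrow>as. hpow (- (1/2)) (cmod (complex_of_real (\<epsilon> * t) - a)))) * indicator {0..1} t \<partial>lborel)"
          by (intro nn_integral_cong) (simp add: indicator_def add_ac)
        also have "\<dots> = (\<integral>\<^sup>+t. hpow (- (1/2)) (cmod (complex_of_real (\<epsilon> * t) - a)) * indicator {0..1} t \<partial>lborel)
           + (\<integral>\<^sup>+t. (1 + (\<Sum>a\<leftarrow>as. hpow (- (1/2)) (cmod (complex_of_real (\<epsilon> * t) - a)))) * indicator {0..1} t \<partial>lborel)"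
        proof (rule nn_integral_add)
          have "(\<lambda>t. \<Sum>a\<leftarrow>as. hpow (- (1/2)) (cmod (complex_of_real (\<epsilon> * t) - a))) \<in> borel_measurable lborel"
            by (induction as) simp_all
          thus "(\<lambda>t. (1 + (\<Sum>a\<leftarrow>as. hpow (- (1/2)) (cmod (complex_of_real (\<epsilon> * t) - a)))) * indicator {0..1} t) \<in> borel_measurable lborel"
            by measurable
        qed measurable
        also have "\<dots> \<le> 5 * ennreal (\<epsilon> powr (- (1/2))) + (1 + of_nat (length as) * (5 * ennreal (\<epsilon> powr (- (1/2)))))"
          by (intro add_mono nn_integral_hpow_linear \<epsilon> Cons)
        also have "\<dots> = 1 + of_nat (length (a # as)) * (5 * ennreal (\<epsilon> powr (- (1/2))))"
          by (simp add: algebra_simps)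
        finally show ?case .
      qed
      finally show "(\<integral>\<^sup>+t. hpow (- neg_exp k) (D (PY N \<epsilon> (padd (ix N) x (\<lambda>i\<in>ix N. t * diag_dir N i)) * E N k)) * indicator {0..1} t \<partial>lborel)
        \<le> 1 + of_nat ?m * (5 * ennreal (\<epsilon> powr (- (1/2))))" unfolding as(1) .
    qed
    also have "1 + of_nat ?m * (5 * ennreal (\<epsilon> powr (- (1/2)))) = ennreal (1 + real ?m * (5 * \<epsilon> powr (- (1/2))))"
      by (simp add: ennreal_plus ennreal_mult ennreal_of_nat_eq_real_of_nat del: of_nat_mult)
    also have "ennreal ?C1 * \<dots> = ennreal (?C1 * (1 + real ?m * (5 * \<epsilon> powr (- (1/2)))))"
      by (simp add: ennreal_mult)
    also have "\<dots> \<le> ennreal (?C1 * ((1 + 5 * real ?m) * (1 + \<epsilon> powr (- (1/2)))))"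
      by (intro ennreal_leI mult_left_mono) (auto simp: algebra_simps)
    finally show ?thesis .
  qed
  thus ?thesis using that[of "?C1 * (1 + 5 * real ?m)"] by (simp add: mult.assoc)
qed

end

section \<open>Second-order expansion of the logarithm\<close>

text \<open>The remainder vanishes at 0 and has derivative x^2 / (1 + x), which is at most 2 a^2
  between - |a| and |a|; the mean value inequality supplies the third power.\<close>

lemma ln_one_plus_third_order:
  fixes a :: real
  assumes "\<bar>a\<bar> \<le> 1 / 2"
  shows "\<bar>ln (1 + a) - a + a\<^sup>2 / 2\<bar> \<le> 2 * \<bar>a\<bar> ^ 3"
proof -
  let ?g = "\<lambda>x::real. ln (1 + x) - x + x\<^sup>2 / 2"
  have der: "(?g has_real_derivative x\<^sup>2 / (1 + x)) (at x)" if "\<bar>x\<bar> \<le> 1 / 2" for x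
    using that by (auto intro!: derivative_eq_intros simp: field_simps power2_eq_square)
  have bound: "\<bar>x\<^sup>2 / (1 + x)\<bar> \<le> 2 * \<bar>a\<bar>\<^sup>2" if "\<bar>x\<bar> \<le> \<bar>a\<bar>" for x
  proof -
    have "1 / 2 \<le> 1 + x" using that assms by auto
    hence "\<bar>x\<^sup>2 / (1 + x)\<bar> = x\<^sup>2 / (1 + x)" by simp
    moreover have "x\<^sup>2 / (1 + x) \<le> x\<^sup>2 / (1 / 2)" using \<open>1 / 2 \<le> 1 + x\<close> by (intro frac_le) simp_all
    ultimately have "\<bar>x\<^sup>2 / (1 + x)\<bar> \<le> x\<^sup>2 / (1 / 2)" by (simp only:)
    also have "\<dots> \<le> 2 * \<bar>a\<bar>\<^sup>2" using that abs_le_square_iff[of x a] by simp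
    finally show ?thesis .
  qed
  let ?S = "{- \<bar>a\<bar>..\<bar>a\<bar>}"
  have S: "\<bar>x\<bar> \<le> \<bar>a\<bar>" if "x \<in> ?S" for x using that by (simp add: abs_le_iff)
  have "norm (?g a - ?g 0) \<le> 2 * \<bar>a\<bar>\<^sup>2 * norm (a - 0)"
  proof (rule field_differentiable_bound[where S = ?S and f = ?g and f' = "\<lambda>x. x\<^sup>2 / (1 + x)" and B = "2 * \<bar>a\<bar>\<^sup>2" and x = a and y = 0])
    show "(?g has_field_derivative x\<^sup>2 / (1 + x)) (at x within ?S)" if "x \<in> ?S" for x
    proof (rule has_field_derivative_at_within, rule der)
      show "\<bar>x\<bar> \<le> 1 / 2" using S[OF that] assms by linarith
    qed
    show "norm (x\<^sup>2 / (1 + x)) \<le> 2 * \<bar>a\<bar>\<^sup>2" if "x \<in> ?S" for x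
      using bound[OF S[OF that]] by (simp only: real_norm_def)
    show "convex ?S" by (rule convex_real_interval)
    show "a \<in> ?S" by (cases "0 \<le> a") auto
    show "0 \<in> ?S" by simp
  qed
  thus ?thesis by (simp add: power3_eq_cube power2_eq_square)
qed

definition rad :: "'i set \<Rightarrow> ('i \<Rightarrow> real) \<Rightarrow> real" where
  "rad I x = sqrt (\<Sum>i\<in>I. (x i)\<^sup>2)"

lemma rad_nonneg [simp]: "0 \<le> rad I x" by (simp add: rad_def sum_nonneg)

lemma rad_power2: "(rad I x)\<^sup>2 = (\<Sum>i\<in>I. (x i)\<^sup>2)" by (simp add: rad_def sum_nonneg)

lemma measurable_rad [measurable]: "rad I \<in> borel_measurable (PL I)"
proof -
  have [measurable]: "(\<lambda>x. x i) \<in> borel_measurable (PL I)" if "i \<in> I" for i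
    using measurable_component_singleton[OF that, of "\<lambda>_. lborel"] by simp
  show ?thesis unfolding rad_def by measurable
qed

text \<open>Let z be the exponent of \<open>gexp\<close>. The inequality (1 + z / p)^p \<le> exp z
  bounds the radius to the power 2 p by a multiple of \<open>gexp\<close>, and the p-th power is at
  most 1 plus its own square.\<close>

lemma power_le_gexp:
  assumes \<sigma>: "0 < \<sigma>"
  shows "(rad I x) ^ p \<le> (1 + (real p * (4 * \<sigma>\<^sup>2)) ^ p) * gexp I \<sigma> x"
proof (cases "p = 0")
  case True
  have "1 \<le> gexp I \<sigma> x" by (simp add: gexp_def sum_nonneg)
  thus ?thesis using True by simp
next
  case False
  define z where "z = (rad I x)\<^sup>2 / (4 * \<sigma>\<^sup>2)"
  have z: "0 \<le> z" "gexp I \<sigma> x = exp z" "(rad I x)\<^sup>2 = z * (4 * \<sigma>\<^sup>2)"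
    using \<sigma> by (simp_all add: z_def gexp_def rad_power2 sum_nonneg)
  have "(z / p) ^ p \<le> (1 + z / p) ^ p" using z(1) by (intro power_mono) auto
  also have "\<dots> \<le> exp z" using z(1) False by (intro exp_ge_one_plus_x_over_n_power_n) auto
  finally have "(z / p) ^ p \<le> exp z" .
  hence "(p * (4 * \<sigma>\<^sup>2)) ^ p * (z / p) ^ p \<le> (p * (4 * \<sigma>\<^sup>2)) ^ p * exp z" by (intro mult_left_mono) auto
  also have "(p * (4 * \<sigma>\<^sup>2)) ^ p * (z / p) ^ p = ((rad I x)\<^sup>2) ^ p"
  proof -
    have "(p * (4 * \<sigma>\<^sup>2)) * (z / p) = (rad I x)\<^sup>2" using False unfolding z(3) by simp
    thus ?thesis by (simp only: power_mult_distrib[symmetric])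
  qed
  also have "((rad I x)\<^sup>2) ^ p = (rad I x) ^ p * (rad I x) ^ p" by (simp add: power2_eq_square power_mult_distrib)
  finally have a: "(rad I x) ^ p * (rad I x) ^ p \<le> (p * (4 * \<sigma>\<^sup>2)) ^ p * exp z" .
  have "(rad I x) ^ p \<le> 1 + (rad I x) ^ p * (rad I x) ^ p"
    using sum_squares_bound[of 1 "(rad I x) ^ p"] zero_le_power[OF rad_nonneg, of I x p] unfolding power2_eq_square by linarith
  also have "\<dots> \<le> exp z + (p * (4 * \<sigma>\<^sup>2)) ^ p * exp z" using a z(1) by (intro add_mono) auto
  finally show ?thesis by (simp add: z(2) algebra_simps)
qed

lemma moment_rad:
  assumes I: "finite I" and \<sigma>: "0 < \<sigma>"
  shows "(\<integral>\<^sup>+x. ennreal ((rad I x) ^ p) \<partial>gauss I \<sigma>) \<le> ennreal ((1 + (real p * (4 * \<sigma>\<^sup>2)) ^ p) * sqrt 2 ^ card I)"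
proof -
  have "(\<integral>\<^sup>+x. ennreal ((rad I x) ^ p) \<partial>gauss I \<sigma>)
      \<le> (\<integral>\<^sup>+x. ennreal (1 + (real p * (4 * \<sigma>\<^sup>2)) ^ p) * ennreal (gexp I \<sigma> x) \<partial>gauss I \<sigma>)"
    by (intro nn_integral_mono) (simp add: gexp_def ennreal_mult'[symmetric] power_le_gexp[OF \<sigma>, unfolded gexp_def] del: ennreal_plus)
  also have "\<dots> = ennreal (1 + (real p * (4 * \<sigma>\<^sup>2)) ^ p) * (\<integral>\<^sup>+x. ennreal (gexp I \<sigma> x) \<partial>gauss I \<sigma>)"
    by (rule nn_integral_cmult) measurable
  also have "\<dots> = ennreal ((1 + (real p * (4 * \<sigma>\<^sup>2)) ^ p) * sqrt 2 ^ card I)"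
    unfolding nn_integral_gexp[OF I \<sigma>] by (rule ennreal_mult'[symmetric]) simp
  finally show ?thesis .
qed

context number_system begin

text \<open>With B = X E the Gram matrix of (1 + \<epsilon> X) E is 1 + \<epsilon> H + \<epsilon>^2
  W. The four definitions are B, the linear part H, the quadratic part W, and the total
  perturbation.\<close>

definition EB where "EB N k x = NM N x * E N k"
definition EH where "EH N k x = mat_adjoint (EB N k x) * E N k + mat_adjoint (E N k) * EB N k x"
definition EW where "EW N k x = mat_adjoint (EB N k x) * EB N k x"
definition EM where "EM N k \<epsilon> x = complex_of_real \<epsilon> \<cdot>\<^sub>m EH N k x + complex_of_real (\<epsilon>\<^sup>2) \<cdot>\<^sub>m EW N k x"

lemma EB_carrier [simp]: "EB N k x \<in> carrier_mat (d * N) (d * k)"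
  unfolding EB_def using mult_carrier_mat[OF NM_carrier E_carrier] .

lemma EH_carrier [simp]: "EH N k x \<in> carrier_mat (d * k) (d * k)"
  unfolding EH_def
  by (intro add_carrier_mat mult_carrier_mat[OF mat_adjoint_carrier[OF E_carrier] EB_carrier])

lemma EW_carrier [simp]: "EW N k x \<in> carrier_mat (d * k) (d * k)"
  unfolding EW_def by (rule mult_carrier_mat[OF mat_adjoint_carrier[OF EB_carrier] EB_carrier])

lemma EM_carrier [simp]: "EM N k \<epsilon> x \<in> carrier_mat (d * k) (d * k)"
  unfolding EM_def by (intro add_carrier_mat smult_carrier_mat EW_carrier)

lemma gram_EM:
  assumes k: "k \<le> N"
  shows "mat_adjoint (PY N \<epsilon> x * E N k) * (PY N \<epsilon> x * E N k) = 1\<^sub>m (d * k) + EM N k \<epsilon> x"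
proof -
  let ?e = "complex_of_real \<epsilon>" and ?B = "EB N k x" and ?E = "E N k"
  have V: "PY N \<epsilon> x * ?E = ?E + ?e \<cdot>\<^sub>m ?B"
  proof -
    have "PY N \<epsilon> x * ?E = 1\<^sub>m (d * N) * ?E + (?e \<cdot>\<^sub>m NM N x) * ?E"
      unfolding PY_def by (rule add_mult_distrib_mat[OF one_carrier_mat smult_carrier_mat[OF NM_carrier] E_carrier])
    also have "(?e \<cdot>\<^sub>m NM N x) * ?E = ?e \<cdot>\<^sub>m (NM N x * ?E)" by (rule mult_smult_assoc_mat[OF NM_carrier E_carrier])
    also have "1\<^sub>m (d * N) * ?E = ?E" by (rule left_mult_one_mat[OF E_carrier])
    finally show ?thesis unfolding EB_def .
  qed
  note cE = E_carrier[where n = N and k = k] and cB = EB_carrier[of N k x]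
  note cE' = mat_adjoint_carrier[OF cE] and cB' = mat_adjoint_carrier[OF cB]
  have eB: "?e \<cdot>\<^sub>m ?B \<in> carrier_mat (d * N) (d * k)" "?e \<cdot>\<^sub>m mat_adjoint ?B \<in> carrier_mat (d * k) (d * N)"
    using cB cB' by simp_all
  have "mat_adjoint (?E + ?e \<cdot>\<^sub>m ?B) * (?E + ?e \<cdot>\<^sub>m ?B) = (mat_adjoint ?E + ?e \<cdot>\<^sub>m mat_adjoint ?B) * (?E + ?e \<cdot>\<^sub>m ?B)"
    using mat_adjoint_add[OF cE eB(1)] by (simp add: mat_adjoint_smult)
  also have "\<dots> = mat_adjoint ?E * (?E + ?e \<cdot>\<^sub>m ?B) + ?e \<cdot>\<^sub>m mat_adjoint ?B * (?E + ?e \<cdot>\<^sub>m ?B)"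
    by (rule add_mult_distrib_mat[OF cE' eB(2) add_carrier_mat[OF eB(1)]])
  also have "\<dots> = (mat_adjoint ?E * ?E + mat_adjoint ?E * (?e \<cdot>\<^sub>m ?B)) + (?e \<cdot>\<^sub>m mat_adjoint ?B * ?E + ?e \<cdot>\<^sub>m mat_adjoint ?B * (?e \<cdot>\<^sub>m ?B))"
    by (simp only: mult_add_distrib_mat[OF cE' cE eB(1)] mult_add_distrib_mat[OF eB(2) cE eB(1)])
  also have "mat_adjoint ?E * (?e \<cdot>\<^sub>m ?B) = ?e \<cdot>\<^sub>m (mat_adjoint ?E * ?B)" by (rule mult_smult_distrib[OF cE' cB])
  also have "?e \<cdot>\<^sub>m mat_adjoint ?B * ?E = ?e \<cdot>\<^sub>m (mat_adjoint ?B * ?E)" by (rule mult_smult_assoc_mat[OF cB' cE])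
  also have "?e \<cdot>\<^sub>m mat_adjoint ?B * (?e \<cdot>\<^sub>m ?B) = ?e \<cdot>\<^sub>m (?e \<cdot>\<^sub>m (mat_adjoint ?B * ?B))"
    using mult_smult_assoc_mat[OF cB' eB(1), of ?e] mult_smult_distrib[OF cB' cB, of ?e] by simp
  also have "(mat_adjoint ?E * ?E + ?e \<cdot>\<^sub>m (mat_adjoint ?E * ?B)) + (?e \<cdot>\<^sub>m (mat_adjoint ?B * ?E) + ?e \<cdot>\<^sub>m (?e \<cdot>\<^sub>m (mat_adjoint ?B * ?B)))
     = mat_adjoint ?E * ?E + EM N k \<epsilon> x"
  proof -
    have gen: "(A + ?e \<cdot>\<^sub>m P) + (?e \<cdot>\<^sub>m Q + ?e \<cdot>\<^sub>m (?e \<cdot>\<^sub>m R)) = A + (?e \<cdot>\<^sub>m (Q + P) + complex_of_real (\<epsilon>\<^sup>2) \<cdot>\<^sub>m R)"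
      if "A \<in> carrier_mat n n" "P \<in> carrier_mat n n" "Q \<in> carrier_mat n n" "R \<in> carrier_mat n n" for A P Q R :: "complex mat" and n
      using that by (intro eq_matI) (auto simp: power2_eq_square algebra_simps)
    show ?thesis unfolding EM_def EH_def EW_def
      by (rule gen[OF mult_carrier_mat[OF cE' cE] mult_carrier_mat[OF cE' cB] mult_carrier_mat[OF cB' cE] mult_carrier_mat[OF cB' cB]])
  qed
  finally show ?thesis unfolding V adjoint_E_E[OF k] .
qed

lemma EH_hermitian: "mat_adjoint (EH N k x) = EH N k x"
proof -
  note cE = E_carrier[where n = N and k = k] and cB = EB_carrier[of N k x]
  note cE' = mat_adjoint_carrier[OF cE] and cB' = mat_adjoint_carrier[OF cB]
  have "mat_adjoint (EH N k x) = mat_adjoint (mat_adjoint (EB N k x) * E N k) + mat_adjoint (mat_adjoint (E N k) * EB N k x)"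
    unfolding EH_def by (rule mat_adjoint_add[OF mult_carrier_mat[OF cB' cE] mult_carrier_mat[OF cE' cB]])
  also have "\<dots> = mat_adjoint (E N k) * EB N k x + mat_adjoint (EB N k x) * E N k"
    by (simp only: mat_adjoint_mult[OF cB' cE] mat_adjoint_mult[OF cE' cB] mat_adjoint_adjoint)
  also have "\<dots> = EH N k x" unfolding EH_def
    by (rule comm_add_mat[OF mult_carrier_mat[OF cE' cB] mult_carrier_mat[OF cB' cE]])
  finally show ?thesis .
qed

lemma EM_hermitian: "mat_adjoint (EM N k \<epsilon> x) = EM N k \<epsilon> x"
proof -
  note cB = EB_carrier[of N k x]
  note cB' = mat_adjoint_carrier[OF cB]
  have "mat_adjoint (EW N k x) = EW N k x" unfolding EW_def by (simp add: mat_adjoint_mult[OF cB' cB])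
  thus ?thesis unfolding EM_def
    using mat_adjoint_add[OF smult_carrier_mat[OF EH_carrier[of N k x]] smult_carrier_mat[OF EW_carrier[of N k x]]]
    by (simp add: mat_adjoint_smult EH_hermitian)
qed

text \<open>One constant for all estimates: with r the radius and L this constant, H has norm at
  most 2 L r and W at most (L r)^2. It combines the factor sqrt d between norm and radius with the
  squared norm d k of the standard frame; for B the norm of the frame is generously replaced by its
  square.\<close>

definition EL :: "nat \<Rightarrow> real" where "EL k = real (d * k) * sqrt (real d)"

lemma EL_nonneg [simp]: "0 \<le> EL k" by (simp add: EL_def)

lemma fnorm_E: "k \<le> N \<Longrightarrow> (fnorm (E N k))\<^sup>2 = real (d * k)"
proof -
  assume k: "k \<le> N"
  have "complex_of_real (frob2 (E N k)) = mtrace (1\<^sub>m (d * k))" by (simp only: frob2_eq_trace adjoint_E_E[OF k])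
  also have "\<dots> = complex_of_real (real (d * k))" by (simp add: mtrace_def)
  finally show ?thesis by (simp only: of_real_eq_iff fnorm_power2)
qed

lemma fnorm_NM: "fnorm (NM N x) = sqrt (real d) * rad (ix N) x"
  by (simp add: fnorm_def rad_def frob2_NM real_sqrt_mult)

lemma fnorm_EB_le: "fnorm (EB N k x) \<le> sqrt (real d) * rad (ix N) x * fnorm (E N k)"
  unfolding EB_def fnorm_NM[symmetric] by (rule fnorm_mult[OF NM_carrier E_carrier])

lemma fnorm_EH_le:
  assumes k: "k \<le> N"
  shows "fnorm (EH N k x) \<le> 2 * (EL k * rad (ix N) x)"
proof -
  note cE = E_carrier[where n = N and k = k] and cB = EB_carrier[of N k x]
  note cE' = mat_adjoint_carrier[OF cE] and cB' = mat_adjoint_carrier[OF cB]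
  have "fnorm (EH N k x) \<le> fnorm (mat_adjoint (EB N k x) * E N k) + fnorm (mat_adjoint (E N k) * EB N k x)"
    unfolding EH_def by (rule fnorm_add[OF mult_carrier_mat[OF cB' cE] mult_carrier_mat[OF cE' cB]])
  also have "\<dots> \<le> fnorm (EB N k x) * fnorm (E N k) + fnorm (E N k) * fnorm (EB N k x)"
    using add_mono[OF fnorm_mult[OF cB' cE] fnorm_mult[OF cE' cB]] by (simp only: fnorm_adjoint)
  also have "\<dots> = 2 * (fnorm (EB N k x) * fnorm (E N k))" by simp
  also have "\<dots> \<le> 2 * ((sqrt (real d) * rad (ix N) x * fnorm (E N k)) * fnorm (E N k))"
    by (intro mult_left_mono mult_right_mono fnorm_EB_le) auto
  also have "\<dots> = 2 * (sqrt (real d) * rad (ix N) x * (fnorm (E N k))\<^sup>2)" by (simp add: power2_eq_square)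
  finally show ?thesis unfolding fnorm_E[OF k] EL_def by (simp add: mult_ac)
qed

lemma frob2_EB_le:
  assumes k: "k \<le> N"
  shows "frob2 (EB N k x) \<le> (EL k * rad (ix N) x)\<^sup>2"
proof -
  have "frob2 (EB N k x) = (fnorm (EB N k x))\<^sup>2" by (simp add: fnorm_power2)
  also have "\<dots> \<le> (sqrt (real d) * rad (ix N) x * fnorm (E N k))\<^sup>2" by (intro power_mono fnorm_EB_le) simp
  also have "\<dots> = real d * (rad (ix N) x)\<^sup>2 * real (d * k)" by (simp add: power_mult_distrib fnorm_E[OF k])
  also have "\<dots> \<le> real d * (rad (ix N) x)\<^sup>2 * (real (d * k))\<^sup>2"
  proof (intro mult_left_mono)
    have "d * k \<le> (d * k)\<^sup>2" by (metis le_square power2_eq_square)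
    thus "real (d * k) \<le> (real (d * k))\<^sup>2" by (metis of_nat_le_iff of_nat_power)
  qed auto
  also have "\<dots> = (EL k * rad (ix N) x)\<^sup>2" by (simp add: EL_def power_mult_distrib)
  finally show ?thesis .
qed

lemma fnorm_EW_le:
  assumes k: "k \<le> N"
  shows "fnorm (EW N k x) \<le> (EL k * rad (ix N) x)\<^sup>2"
proof -
  have "fnorm (EW N k x) \<le> fnorm (EB N k x) * fnorm (EB N k x)"
    unfolding EW_def using fnorm_mult[OF mat_adjoint_carrier[OF EB_carrier[of N k x]] EB_carrier[of N k x]] by (simp add: fnorm_adjoint)
  also have "\<dots> = frob2 (EB N k x)" by (simp add: fnorm_power2[symmetric] power2_eq_square)
  also note frob2_EB_le[OF k]
  finally show ?thesis .
qed

text \<open>The size q of the perturbation, in which all error terms are expressed: the norm of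
  \<open>EM\<close> is at most 2 q + q^2 = (1 + q)^2 - 1. Its smallness decides whether the
  logarithm may be expanded.\<close>

definition eq_rad :: "nat \<Rightarrow> nat \<Rightarrow> real \<Rightarrow> (nat \<times> nat \<times> nat \<Rightarrow> real) \<Rightarrow> real" where
  "eq_rad N k \<epsilon> x = \<epsilon> * (EL k * rad (ix N) x)"

lemma eq_rad_nonneg [simp]: "0 \<le> \<epsilon> \<Longrightarrow> 0 \<le> eq_rad N k \<epsilon> x" by (simp add: eq_rad_def)

lemma fnorm_EM_le:
  assumes k: "k \<le> N" and \<epsilon>: "0 \<le> \<epsilon>"
  shows "fnorm (EM N k \<epsilon> x) \<le> 2 * eq_rad N k \<epsilon> x + (eq_rad N k \<epsilon> x)\<^sup>2"
    "\<bar>frob2 (EM N k \<epsilon> x) - \<epsilon>\<^sup>2 * frob2 (EH N k x)\<bar> \<le> (eq_rad N k \<epsilon> x)\<^sup>2 * (4 * eq_rad N k \<epsilon> x + (eq_rad N k \<epsilon> x)\<^sup>2)"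
proof -
  let ?q = "eq_rad N k \<epsilon> x"
  let ?H = "complex_of_real \<epsilon> \<cdot>\<^sub>m EH N k x" and ?W = "complex_of_real (\<epsilon>\<^sup>2) \<cdot>\<^sub>m EW N k x"
  have cH: "?H \<in> carrier_mat (d * k) (d * k)" "?W \<in> carrier_mat (d * k) (d * k)" by (simp_all add: smult_carrier_mat)
  have h: "fnorm ?H = \<epsilon> * fnorm (EH N k x)" using \<epsilon> by (simp add: fnorm_smult)
  have h2: "fnorm ?H \<le> 2 * ?q" unfolding h
    using mult_left_mono[OF fnorm_EH_le[OF k] \<epsilon>, of x] by (simp add: eq_rad_def mult_ac)
  have "fnorm ?W = \<epsilon>\<^sup>2 * fnorm (EW N k x)" by (simp add: fnorm_smult norm_power)
  also have "\<dots> \<le> \<epsilon>\<^sup>2 * (EL k * rad (ix N) x)\<^sup>2" by (intro mult_left_mono fnorm_EW_le[OF k]) simp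
  finally have w: "fnorm ?W \<le> ?q\<^sup>2" by (simp add: eq_rad_def power_mult_distrib)
  have M: "fnorm (EM N k \<epsilon> x) \<le> fnorm ?H + fnorm ?W" unfolding EM_def by (rule fnorm_add[OF cH])
  show M2: "fnorm (EM N k \<epsilon> x) \<le> 2 * ?q + ?q\<^sup>2" using M h2 w by simp
  have "fnorm ?H \<le> fnorm (EM N k \<epsilon> x) + fnorm ((- 1) \<cdot>\<^sub>m ?W)"
  proof -
    have "?H = EM N k \<epsilon> x + (- 1) \<cdot>\<^sub>m ?W" unfolding EM_def using carrier_matD[OF EH_carrier[of N k x]] carrier_matD[OF EW_carrier[of N k x]] by (intro eq_matI) auto
    thus ?thesis using fnorm_add[OF EM_carrier smult_carrier_mat[OF cH(2)], of N \<epsilon> x "- 1"] by simp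
  qed
  also have "fnorm ((- 1) \<cdot>\<^sub>m ?W) = fnorm ?W" by (simp only: fnorm_smult) simp
  finally have diff: "\<bar>fnorm (EM N k \<epsilon> x) - fnorm ?H\<bar> \<le> ?q\<^sup>2" using M w by linarith
  have "\<epsilon>\<^sup>2 * frob2 (EH N k x) = (fnorm ?H)\<^sup>2" unfolding h by (simp add: power_mult_distrib fnorm_power2)
  hence "\<bar>frob2 (EM N k \<epsilon> x) - \<epsilon>\<^sup>2 * frob2 (EH N k x)\<bar> = \<bar>(fnorm (EM N k \<epsilon> x))\<^sup>2 - (fnorm ?H)\<^sup>2\<bar>"
    by (simp add: fnorm_power2)
  also have "\<dots> = \<bar>fnorm (EM N k \<epsilon> x) - fnorm ?H\<bar> * (fnorm (EM N k \<epsilon> x) + fnorm ?H)"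
    by (simp add: power2_eq_square square_diff_square_factored abs_mult mult.commute)
  also have "\<dots> \<le> ?q\<^sup>2 * (4 * ?q + ?q\<^sup>2)"
    using M2 h2 by (intro mult_mono diff) (auto simp: add_increasing)
  finally show "\<bar>frob2 (EM N k \<epsilon> x) - \<epsilon>\<^sup>2 * frob2 (EH N k x)\<bar> \<le> ?q\<^sup>2 * (4 * ?q + ?q\<^sup>2)" .
qed

lemma D_eigenvalues:
  assumes k: "k \<le> N"
  obtains a :: "nat \<Rightarrow> real" where "D (PY N \<epsilon> x * E N k) = (\<Prod>i<d * k. 1 + a i)"
    "\<And>i. i < d * k \<Longrightarrow> \<bar>a i\<bar> \<le> fnorm (EM N k \<epsilon> x)"
    "mtrace (EM N k \<epsilon> x) = complex_of_real (\<Sum>i<d * k. a i)" "frob2 (EM N k \<epsilon> x) = (\<Sum>i<d * k. (a i)\<^sup>2)"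
proof -
  obtain a where a: "mtrace (EM N k \<epsilon> x) = (\<Sum>i<d * k. complex_of_real (a i))" "frob2 (EM N k \<epsilon> x) = (\<Sum>i<d * k. (a i)\<^sup>2)"
    "Determinant.det (1\<^sub>m (d * k) + EM N k \<epsilon> x) = (\<Prod>i<d * k. complex_of_real (1 + a i))"
    using hermitian_spectrum[OF EM_carrier EM_hermitian] by metis
  have "D (PY N \<epsilon> x * E N k) = (\<Prod>i<d * k. 1 + a i)"
    unfolding D_def gram_EM[OF k] a(3) of_real_prod[symmetric] by (rule Re_complex_of_real)
  moreover have "\<bar>a i\<bar> \<le> fnorm (EM N k \<epsilon> x)" if "i < d * k" for i
  proof -
    have "(a i)\<^sup>2 \<le> (\<Sum>i<d * k. (a i)\<^sup>2)" using that by (intro member_le_sum) auto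
    thus ?thesis unfolding fnorm_def a(2) by (metis real_sqrt_abs real_sqrt_le_iff)
  qed
  ultimately show ?thesis using that a(1,2) by simp
qed

text \<open>Every eigenvalue of \<open>EM\<close> is at most (1 + q)^2 - 1 in modulus, so each of
  the d k factors of \<open>D\<close> is at most (1 + q)^2.\<close>

lemma D_upper_bound:
  assumes k: "k \<le> N" and \<epsilon>: "0 \<le> \<epsilon>"
  shows "D (PY N \<epsilon> x * E N k) \<le> (1 + eq_rad N k \<epsilon> x) ^ (2 * (d * k))"
proof -
  obtain a where a: "D (PY N \<epsilon> x * E N k) = (\<Prod>i<d * k. 1 + a i)"
    "\<And>i. i < d * k \<Longrightarrow> \<bar>a i\<bar> \<le> fnorm (EM N k \<epsilon> x)"
    using D_eigenvalues[OF k] by metis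
  have "D (PY N \<epsilon> x * E N k) \<le> \<bar>\<Prod>i<d * k. 1 + a i\<bar>" unfolding a by simp
  also have "\<dots> = (\<Prod>i<d * k. \<bar>1 + a i\<bar>)" by (simp add: abs_prod)
  also have "\<dots> \<le> (\<Prod>i<d * k. (1 + eq_rad N k \<epsilon> x)\<^sup>2)"
  proof (rule prod_mono, safe)
    fix i assume "i < d * k"
    from a(2)[OF this] fnorm_EM_le(1)[OF k \<epsilon>, of x]
    have "\<bar>a i\<bar> \<le> 2 * eq_rad N k \<epsilon> x + (eq_rad N k \<epsilon> x)\<^sup>2" by linarith
    thus "\<bar>1 + a i\<bar> \<le> (1 + eq_rad N k \<epsilon> x)\<^sup>2" by (simp add: power2_sum)
  qed simp
  finally show ?thesis by (simp add: power_mult)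
qed

text \<open>The Taylor polynomial of the log determinant through order \<epsilon>^2: the trace of
  \<open>EM\<close> minus half the trace of the square of \<epsilon> H. The traces of W and H^2
  appear as squared Frobenius norms, the latter because H is Hermitian.\<close>

definition EQ :: "nat \<Rightarrow> nat \<Rightarrow> real \<Rightarrow> (nat \<times> nat \<times> nat \<Rightarrow> real) \<Rightarrow> real" where
  "EQ N k \<epsilon> x = \<epsilon> * Re (mtrace (EH N k x)) + \<epsilon>\<^sup>2 * (frob2 (EB N k x) - frob2 (EH N k x) / 2)"

lemma mtrace_EM: "Re (mtrace (EM N k \<epsilon> x)) = \<epsilon> * Re (mtrace (EH N k x)) + \<epsilon>\<^sup>2 * frob2 (EB N k x)"
proof -
  have "mtrace (EM N k \<epsilon> x) = complex_of_real \<epsilon> * mtrace (EH N k x) + complex_of_real (\<epsilon>\<^sup>2) * mtrace (EW N k x)"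
    unfolding mtrace_carrier[OF EM_carrier] mtrace_carrier[OF EH_carrier] mtrace_carrier[OF EW_carrier]
    unfolding EM_def using carrier_matD[OF EH_carrier[of N k x]] carrier_matD[OF EW_carrier[of N k x]]
    by (simp add: sum.distrib sum_distrib_left)
  also have "mtrace (EW N k x) = complex_of_real (frob2 (EB N k x))" unfolding EW_def by (rule frob2_eq_trace[symmetric])
  finally show ?thesis by simp
qed

text \<open>For q \<le> 1 / 8 the eigenvalues of \<open>EM\<close> are at most 3 q \<le> 1 / 2 in
  modulus, so the logarithm is expanded eigenvalue by eigenvalue, each with error 2 (3 q)^3 = 54
  q^3. The 5 / 2 comes from replacing the squared norm of \<open>EM\<close> by that of \<epsilon> H,
  an error of at most 5 q^3 that enters halved.\<close>

lemma ln_D_expansion_good: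
  assumes k: "k \<le> N" and \<epsilon>: "0 \<le> \<epsilon>" and q: "eq_rad N k \<epsilon> x \<le> 1 / 8"
  shows "\<bar>ln (D (PY N \<epsilon> x * E N k)) - EQ N k \<epsilon> x\<bar> \<le> (54 * real (d * k) + 5 / 2) * (eq_rad N k \<epsilon> x) ^ 3"
proof -
  let ?q = "eq_rad N k \<epsilon> x" and ?m = "fnorm (EM N k \<epsilon> x)"
  obtain a where a: "D (PY N \<epsilon> x * E N k) = (\<Prod>i<d * k. 1 + a i)"
    "\<And>i. i < d * k \<Longrightarrow> \<bar>a i\<bar> \<le> ?m"
    "mtrace (EM N k \<epsilon> x) = complex_of_real (\<Sum>i<d * k. a i)" "frob2 (EM N k \<epsilon> x) = (\<Sum>i<d * k. (a i)\<^sup>2)"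
    using D_eigenvalues[OF k] by metis
  have q0: "0 \<le> ?q" using \<epsilon> by simp
  have q2: "?q\<^sup>2 \<le> ?q" using q q0 by (simp add: power2_eq_square mult_left_le_one_le)
  have m: "?m \<le> 3 * ?q" using fnorm_EM_le(1)[OF k \<epsilon>, of x] q2 by linarith
  have half: "\<bar>a i\<bar> \<le> 1 / 2" if "i < d * k" for i using a(2)[OF that] m q by linarith
  have "ln (D (PY N \<epsilon> x * E N k)) = (\<Sum>i<d * k. ln (1 + a i))"
  proof -
    have "1 + a i \<noteq> 0" if "i < d * k" for i using half[OF that] by linarith
    thus ?thesis unfolding a(1) by (intro ln_prod) auto
  qed
  hence "ln (D (PY N \<epsilon> x * E N k)) - (\<Sum>i<d * k. a i) + (\<Sum>i<d * k. (a i)\<^sup>2) / 2 = (\<Sum>i<d * k. ln (1 + a i) - a i + (a i)\<^sup>2 / 2)"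
    by (simp add: sum.distrib sum_subtractf sum_divide_distrib)
  also have "\<bar>\<dots>\<bar> \<le> (\<Sum>i<d * k. 2 * (3 * ?q) ^ 3)"
  proof (rule order_trans[OF sum_abs], rule sum_mono)
    fix i assume "i \<in> {..<d * k}"
    hence i: "i < d * k" by simp
    have "\<bar>a i\<bar> ^ 3 \<le> (3 * ?q) ^ 3" using a(2)[OF i] m by (intro power_mono) auto
    thus "\<bar>ln (1 + a i) - a i + (a i)\<^sup>2 / 2\<bar> \<le> 2 * (3 * ?q) ^ 3"
      using ln_one_plus_third_order[OF half[OF i]] by linarith
  qed
  also have "\<dots> = 54 * real (d * k) * ?q ^ 3" by (simp add: power_mult_distrib)
  finally have 1: "\<bar>ln (D (PY N \<epsilon> x * E N k)) - Re (mtrace (EM N k \<epsilon> x)) + frob2 (EM N k \<epsilon> x) / 2\<bar> \<le> 54 * real (d * k) * ?q ^ 3"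
    by (simp add: a(3,4))
  have "?q\<^sup>2 * (4 * ?q + ?q\<^sup>2) \<le> ?q\<^sup>2 * (4 * ?q + ?q)" using q2 by (intro mult_left_mono) auto
  also have "\<dots> = 5 * ?q ^ 3" by (simp add: power3_eq_cube power2_eq_square)
  finally have 2: "\<bar>frob2 (EM N k \<epsilon> x) - \<epsilon>\<^sup>2 * frob2 (EH N k x)\<bar> \<le> 5 * ?q ^ 3"
    using fnorm_EM_le(2)[OF k \<epsilon>, of x] by linarith
  have e: "EQ N k \<epsilon> x = Re (mtrace (EM N k \<epsilon> x)) - \<epsilon>\<^sup>2 * frob2 (EH N k x) / 2"
    unfolding EQ_def mtrace_EM by (simp add: algebra_simps)
  show ?thesis using 1 2 unfolding e by (simp add: algebra_simps abs_le_iff) 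
qed

text \<open>This crude bound serves for large perturbations, where the Taylor polynomial
  approximates nothing and is estimated on its own.\<close>

lemma EQ_bound:
  assumes k: "k \<le> N" and \<epsilon>: "0 \<le> \<epsilon>"
  shows "\<bar>EQ N k \<epsilon> x\<bar> \<le> 2 * real (d * k) * eq_rad N k \<epsilon> x + 3 * (eq_rad N k \<epsilon> x)\<^sup>2"
proof -
  let ?q = "eq_rad N k \<epsilon> x"
  have "\<bar>Re (mtrace (EH N k x))\<bar> \<le> real (d * k) * fnorm (EH N k x)"
  proof -
    obtain a where a: "mtrace (EH N k x) = (\<Sum>i<d * k. complex_of_real (a i))" "frob2 (EH N k x) = (\<Sum>i<d * k. (a i)\<^sup>2)"
      using hermitian_spectrum[OF EH_carrier EH_hermitian] by metis
    have "\<bar>Re (mtrace (EH N k x))\<bar> \<le> (\<Sum>i<d * k. \<bar>a i\<bar>)" unfolding a(1) by (simp add: sum_abs)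
    also have "\<dots> \<le> (\<Sum>i<d * k. fnorm (EH N k x))"
    proof (rule sum_mono)
      fix i assume "i \<in> {..<d * k}"
      hence "(a i)\<^sup>2 \<le> (\<Sum>i<d * k. (a i)\<^sup>2)" by (intro member_le_sum) auto
      thus "\<bar>a i\<bar> \<le> fnorm (EH N k x)" unfolding fnorm_def a(2) by (metis real_sqrt_abs real_sqrt_le_iff)
    qed
    finally show ?thesis by simp
  qed
  also have "\<dots> \<le> real (d * k) * (2 * (EL k * rad (ix N) x))" by (intro mult_left_mono fnorm_EH_le[OF k]) simp
  finally have "\<epsilon> * \<bar>Re (mtrace (EH N k x))\<bar> \<le> \<epsilon> * (real (d * k) * (2 * (EL k * rad (ix N) x)))" using \<epsilon> by (rule mult_left_mono)
  hence 1: "\<bar>\<epsilon> * Re (mtrace (EH N k x))\<bar> \<le> 2 * real (d * k) * ?q" using \<epsilon> by (simp add: eq_rad_def abs_mult mult_ac)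
  have "frob2 (EH N k x) = (fnorm (EH N k x))\<^sup>2" by (simp add: fnorm_power2)
  also have "\<dots> \<le> (2 * (EL k * rad (ix N) x))\<^sup>2" by (intro power_mono fnorm_EH_le[OF k]) simp
  finally have "frob2 (EH N k x) \<le> 4 * (EL k * rad (ix N) x)\<^sup>2" by (simp add: power_mult_distrib)
  hence "\<bar>frob2 (EB N k x) - frob2 (EH N k x) / 2\<bar> \<le> 3 * (EL k * rad (ix N) x)\<^sup>2"
    using frob2_EB_le[OF k, of x] frob2_nonneg[of "EB N k x"] frob2_nonneg[of "EH N k x"] by linarith
  hence "\<epsilon>\<^sup>2 * \<bar>frob2 (EB N k x) - frob2 (EH N k x) / 2\<bar> \<le> \<epsilon>\<^sup>2 * (3 * (EL k * rad (ix N) x)\<^sup>2)" by (intro mult_left_mono) auto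
  hence 2: "\<bar>\<epsilon>\<^sup>2 * (frob2 (EB N k x) - frob2 (EH N k x) / 2)\<bar> \<le> 3 * ?q\<^sup>2" by (simp add: eq_rad_def abs_mult power_mult_distrib)
  show ?thesis unfolding EQ_def using 1 2 by linarith
qed

end

section \<open>Elementary inequalities for logarithms and powers\<close>

lemma exp_abs_ln_le:
  fixes y s :: real
  assumes "0 < y"
  shows "exp (s * \<bar>ln y\<bar>) \<le> y powr s + y powr (- s)"
proof (cases "0 \<le> ln y")
  case True
  thus ?thesis using assms by (simp add: powr_def)
next
  case False
  thus ?thesis using assms by (simp add: powr_def)
qed

lemma powr_le_one_plus:
  fixes y s :: real
  assumes "0 < y" "0 \<le> s" "s \<le> 1"
  shows "y powr s \<le> 1 + y"
proof (cases "1 \<le> y")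
  case True
  hence "y powr s \<le> y powr 1" using assms by (intro powr_mono) auto
  thus ?thesis using assms by simp
next
  case False
  hence "y powr s \<le> 1" using assms by (intro powr_le1) auto
  thus ?thesis using assms by simp
qed

text \<open>Half of the exponent s absorbs the square, by w^2 / 2 \<le> exp w with w = s / 2 * |ln
  y|. The other half is left for the exponential factor on the left, which arises as a Taylor
  remainder.\<close>

lemma ln_square_le:
  fixes y s :: real
  assumes y: "0 < y" and s: "0 < s" "s \<le> 1"
  shows "(ln y)\<^sup>2 * exp (s / 2 * \<bar>ln y\<bar>) \<le> 8 / s\<^sup>2 * (1 + y + y powr (- s))"
proof -
  let ?w = "s / 2 * \<bar>ln y\<bar>"
  have w: "0 \<le> ?w" using s by simp
  have "?w\<^sup>2 / 2 \<le> exp ?w" using exp_lower_Taylor_quadratic[OF w] w by linarith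
  hence "(ln y)\<^sup>2 \<le> 8 / s\<^sup>2 * exp ?w" using s by (simp add: power_mult_distrib power_divide field_simps)
  hence "(ln y)\<^sup>2 * exp ?w \<le> 8 / s\<^sup>2 * exp ?w * exp ?w" by (intro mult_right_mono) auto
  also have "\<dots> = 8 / s\<^sup>2 * exp (s * \<bar>ln y\<bar>)" by (simp flip: exp_add)
  also have "\<dots> \<le> 8 / s\<^sup>2 * (1 + y + y powr (- s))"
    using exp_abs_ln_le[OF y, of s] powr_le_one_plus[OF y, of s] s by (intro mult_left_mono) auto
  finally show ?thesis .
qed

text \<open>Taylor's formula in t at 0, with the remainder bounded uniformly for small t of either
  sign. Moments with exponent near 0 are thus controlled by those with exponents 1 and - s.\<close>

lemma powr_le_quadratic:
  fixes y s t :: real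
  assumes y: "0 < y" and s: "0 < s" "s \<le> 1" and t: "\<bar>t\<bar> \<le> s / 2"
  shows "y powr t \<le> 1 + t * ln y + t\<^sup>2 * (8 / s\<^sup>2 * (1 + y + y powr (- s)))"
proof -
  obtain u where u: "\<bar>u\<bar> \<le> \<bar>t * ln y\<bar>" "exp (t * ln y) = (\<Sum>m<2. (t * ln y) ^ m / fact m) + exp u / fact 2 * (t * ln y) ^ 2"
    using Maclaurin_exp_le[of "t * ln y" 2] by blast
  have "u \<le> \<bar>t\<bar> * \<bar>ln y\<bar>" using u(1) by (simp add: abs_mult)
  also have "\<dots> \<le> s / 2 * \<bar>ln y\<bar>" using t by (intro mult_right_mono) auto
  finally have "exp u \<le> exp (s / 2 * \<bar>ln y\<bar>)" by simp
  hence "(ln y)\<^sup>2 * exp u \<le> (ln y)\<^sup>2 * exp (s / 2 * \<bar>ln y\<bar>)" by (intro mult_left_mono) auto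
  also note ln_square_le[OF y s]
  finally have a: "t\<^sup>2 * ((ln y)\<^sup>2 * exp u) \<le> t\<^sup>2 * (8 / s\<^sup>2 * (1 + y + y powr (- s)))" by (intro mult_left_mono) auto
  have "y powr t = 1 + t * ln y + t\<^sup>2 * ((ln y)\<^sup>2 * exp u) / 2"
    using y u(2) by (simp add: powr_def numeral_2_eq_2 power_mult_distrib)
  also have "\<dots> \<le> 1 + t * ln y + t\<^sup>2 * ((ln y)\<^sup>2 * exp u)" by simp
  finally show ?thesis using a by linarith
qed

text \<open>Weighted arithmetic-geometric mean. With w = \<epsilon>^4 it treats the region where the
  expansion fails: the logarithm is traded for its square with a small weight, plus a large constant
  that only has to be paid on a rare event.\<close>

lemma abs_le_weighted_square:
  fixes u :: real
  assumes "0 < w"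
  shows "\<bar>u\<bar> \<le> w * u\<^sup>2 + 1 / w"
proof -
  have "0 \<le> (w * \<bar>u\<bar> - 1 / 2)\<^sup>2" by simp
  hence "w * \<bar>u\<bar> \<le> w * (w * u\<^sup>2) + 1" by (simp add: power2_eq_square algebra_simps)
  also have "\<dots> = w * (w * u\<^sup>2 + 1 / w)" using assms by (simp add: algebra_simps)
  finally show ?thesis using assms by simp
qed

section \<open>Moments of the one-step determinant\<close>

context number_system begin

definition DE where "DE N k \<epsilon> x = D (PY N \<epsilon> x * E N k)"

lemma DE_nonneg: "k \<le> N \<Longrightarrow> 0 \<le> DE N k \<epsilon> x"
  unfolding DE_def by (rule D_real_nonneg(2)[OF NC_mult[OF PY_NC E_NC]])

lemma measurable_DE [measurable]: "DE N k \<epsilon> \<in> borel_measurable (PL (ix N))"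
  unfolding DE_def by (rule measurable_D_PY[OF E_carrier])

text \<open>By \<open>D_upper_bound\<close> the determinant is at most a polynomial in the Gaussian
  radius, all of whose moments are finite.\<close>

lemma positive_moment:
  assumes \<sigma>: "0 < \<sigma>" and k: "k \<le> N"
  obtains C :: real where "0 \<le> C" "\<And>\<epsilon>. 0 \<le> \<epsilon> \<Longrightarrow>
    (\<integral>\<^sup>+x. ennreal (DE N k \<epsilon> x) \<partial>gauss (ix N) \<sigma>) \<le> ennreal (C * (1 + \<epsilon> ^ (2 * (d * k))))"
proof -
  interpret G: prob_space "gauss (ix N) \<sigma>" by (rule prob_space_gauss[OF \<sigma>])
  define p where "p = 2 * (d * k)"
  define m where "m = (1 + (real p * (4 * \<sigma>\<^sup>2)) ^ p) * sqrt 2 ^ card (ix N)"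
  have m: "0 \<le> m" by (simp add: m_def)
  have "(\<integral>\<^sup>+x. ennreal (DE N k \<epsilon> x) \<partial>gauss (ix N) \<sigma>) \<le> ennreal (2 ^ p * (1 + EL k ^ p * m) * (1 + \<epsilon> ^ p))"
    if \<epsilon>: "0 \<le> \<epsilon>" for \<epsilon> :: real
  proof -
    have "DE N k \<epsilon> x \<le> 2 ^ p + 2 ^ p * (\<epsilon> * EL k) ^ p * rad (ix N) x ^ p" for x
    proof -
      let ?q = "eq_rad N k \<epsilon> x"
      have q: "0 \<le> ?q" using \<epsilon> by simp
      have "DE N k \<epsilon> x \<le> (1 + ?q) ^ p" unfolding DE_def p_def by (rule D_upper_bound[OF k \<epsilon>])
      also have "\<dots> \<le> (2 * max 1 ?q) ^ p" using q by (intro power_mono) auto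
      also have "\<dots> \<le> 2 ^ p * (1 + ?q ^ p)" using q by (auto simp: power_mult_distrib max_def)
      also have "\<dots> = 2 ^ p + 2 ^ p * (\<epsilon> * EL k) ^ p * rad (ix N) x ^ p"
        by (simp add: eq_rad_def algebra_simps power_mult_distrib)
      finally show ?thesis .
    qed
    hence "(\<integral>\<^sup>+x. ennreal (DE N k \<epsilon> x) \<partial>gauss (ix N) \<sigma>)
        \<le> (\<integral>\<^sup>+x. ennreal (2 ^ p) + ennreal (2 ^ p * (\<epsilon> * EL k) ^ p) * ennreal (rad (ix N) x ^ p) \<partial>gauss (ix N) \<sigma>)"
      using \<epsilon> by (intro nn_integral_mono) (simp flip: ennreal_mult ennreal_plus add: ennreal_leI)
    also have "\<dots> = ennreal (2 ^ p) + ennreal (2 ^ p * (\<epsilon> * EL k) ^ p) * (\<integral>\<^sup>+x. ennreal (rad (ix N) x ^ p) \<partial>gauss (ix N) \<sigma>)"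
      using G.emeasure_space_1 by (subst nn_integral_add; (subst nn_integral_cmult)?) auto
    also have "\<dots> \<le> ennreal (2 ^ p) + ennreal (2 ^ p * (\<epsilon> * EL k) ^ p) * ennreal m"
      unfolding m_def by (intro add_left_mono mult_left_mono moment_rad[OF finite_ix \<sigma>]) simp
    also have "\<dots> = ennreal (2 ^ p + 2 ^ p * (\<epsilon> * EL k) ^ p * m)" using m \<epsilon> by (simp add: ennreal_mult ennreal_plus)
    also have "\<dots> \<le> ennreal (2 ^ p * (1 + EL k ^ p * m) * (1 + \<epsilon> ^ p))"
      using m \<epsilon> by (intro ennreal_leI) (simp add: algebra_simps power_mult_distrib)
    finally show ?thesis .
  qed
  moreover have "0 \<le> 2 ^ p * (1 + EL k ^ p * m)" using m by simp
  ultimately show ?thesis using that[of "2 ^ p * (1 + EL k ^ p * m)"] by (simp add: p_def)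
qed

lemma DE_integrability:
  assumes \<sigma>: "0 < \<sigma>" and k: "k \<le> N" and \<epsilon>: "0 < \<epsilon>"
  shows "AE x in gauss (ix N) \<sigma>. 0 < DE N k \<epsilon> x"
    and "integrable (gauss (ix N) \<sigma>) (DE N k \<epsilon>)"
    and "integrable (gauss (ix N) \<sigma>) (\<lambda>x. DE N k \<epsilon> x powr (- neg_exp k))"
    and "integrable (gauss (ix N) \<sigma>) (\<lambda>x. (ln (DE N k \<epsilon> x))\<^sup>2)"
    and "integrable (gauss (ix N) \<sigma>) (\<lambda>x. ln (DE N k \<epsilon> x))"
proof -
  let ?\<Gamma> = "gauss (ix N) \<sigma>" and ?s = "neg_exp k"
  interpret G: prob_space ?\<Gamma> by (rule prob_space_gauss[OF \<sigma>])
  have s: "0 < ?s" "?s \<le> 1" using neg_exp_pos[of k] by auto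
  have mDE [measurable]: "DE N k \<epsilon> \<in> borel_measurable ?\<Gamma>" by measurable
  obtain C where C: "\<And>\<epsilon>. 0 < \<epsilon> \<Longrightarrow> (\<integral>\<^sup>+x. hpow (- ?s) (DE N k \<epsilon> x) \<partial>?\<Gamma>) \<le> ennreal (C * (1 + \<epsilon> powr (- (1/2))))"
    using negative_moment[OF \<sigma> k] unfolding DE_def by metis
  have fin: "(\<integral>\<^sup>+x. hpow (- ?s) (DE N k \<epsilon> x) \<partial>?\<Gamma>) < \<infinity>"
    using C[OF \<epsilon>] by (rule order.strict_trans1) simp
  \<comment> \<open>For a negative exponent \<open>hpow\<close> is infinite at 0, so its finite
    integral excludes a vanishing determinant almost everywhere.\<close>
  have "AE x in ?\<Gamma>. hpow (- ?s) (DE N k \<epsilon> x) \<noteq> \<infinity>"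
    using fin by (intro nn_integral_PInf_AE) auto
  thus pos: "AE x in ?\<Gamma>. 0 < DE N k \<epsilon> x"
  proof eventually_elim
    case (elim x)
    hence "DE N k \<epsilon> x \<noteq> 0" using s by (auto simp: hpow_def)
    thus ?case using DE_nonneg[OF k, of \<epsilon> x] by linarith
  qed
  obtain C' where C': "\<And>\<epsilon>. 0 \<le> \<epsilon> \<Longrightarrow> (\<integral>\<^sup>+x. ennreal (DE N k \<epsilon> x) \<partial>?\<Gamma>) \<le> ennreal (C' * (1 + \<epsilon> ^ (2 * (d * k))))"
    using positive_moment[OF \<sigma> k] by metis
  show i1: "integrable ?\<Gamma> (DE N k \<epsilon>)"
  proof (rule integrableI_nonneg)
    show "(\<integral>\<^sup>+x. ennreal (DE N k \<epsilon> x) \<partial>?\<Gamma>) < \<infinity>"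
      using C'[of \<epsilon>] \<epsilon> by (intro order.strict_trans1[OF C']) auto
  qed (auto simp: DE_nonneg[OF k])
  show i2: "integrable ?\<Gamma> (\<lambda>x. DE N k \<epsilon> x powr (- ?s))"
  proof (rule integrableI_nonneg)
    have "(\<integral>\<^sup>+x. ennreal (DE N k \<epsilon> x powr (- ?s)) \<partial>?\<Gamma>) \<le> (\<integral>\<^sup>+x. hpow (- ?s) (DE N k \<epsilon> x) \<partial>?\<Gamma>)"
      by (intro nn_integral_mono) (auto simp: hpow_def)
    thus "(\<integral>\<^sup>+x. ennreal (DE N k \<epsilon> x powr (- ?s)) \<partial>?\<Gamma>) < \<infinity>" using fin by (rule order.strict_trans1)
  qed auto
  show i3: "integrable ?\<Gamma> (\<lambda>x. (ln (DE N k \<epsilon> x))\<^sup>2)"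
  proof (rule Bochner_Integration.integrable_bound)
    show "integrable ?\<Gamma> (\<lambda>x. 8 / ?s\<^sup>2 * (1 + DE N k \<epsilon> x + DE N k \<epsilon> x powr (- ?s)))"
      using i1 i2 by auto
    show "AE x in ?\<Gamma>. norm ((ln (DE N k \<epsilon> x))\<^sup>2) \<le> norm (8 / ?s\<^sup>2 * (1 + DE N k \<epsilon> x + DE N k \<epsilon> x powr (- ?s)))"
      using pos
    proof eventually_elim
      case (elim x)
      have "(ln (DE N k \<epsilon> x))\<^sup>2 * 1 \<le> (ln (DE N k \<epsilon> x))\<^sup>2 * exp (?s / 2 * \<bar>ln (DE N k \<epsilon> x)\<bar>)"
        using s by (intro mult_left_mono) auto
      also note ln_square_le[OF elim s]
      finally have h: "(ln (DE N k \<epsilon> x))\<^sup>2 \<le> 8 / ?s\<^sup>2 * (1 + DE N k \<epsilon> x + DE N k \<epsilon> x powr (- ?s))" by simp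
      show ?case unfolding real_norm_def abs_power2 by (rule order_trans[OF h abs_ge_self])
    qed
  qed measurable
  show "integrable ?\<Gamma> (\<lambda>x. ln (DE N k \<epsilon> x))"
  proof (rule Bochner_Integration.integrable_bound)
    show "integrable ?\<Gamma> (\<lambda>x. (ln (DE N k \<epsilon> x))\<^sup>2 + 1)" using i3 by auto
    show "AE x in ?\<Gamma>. norm (ln (DE N k \<epsilon> x)) \<le> norm ((ln (DE N k \<epsilon> x))\<^sup>2 + 1)"
      using abs_le_weighted_square[of 1] by simp
  qed measurable
qed

text \<open>Integrating the quadratic bound for the power gives 1 + t L + t^2 K, and 1 + z \<le> exp
  z. The linear coefficient is the mean logarithm, so small exponents of either sign detect
  deviations from the rate L.\<close>

lemma hpow_moment_bound:
  assumes \<sigma>: "0 < \<sigma>" and k: "k \<le> N" and \<epsilon>: "0 < \<epsilon>"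
  defines "L \<equiv> (\<integral>x. ln (DE N k \<epsilon> x) \<partial>gauss (ix N) \<sigma>)"
  obtains K :: real where "0 \<le> K" "\<And>t. t \<noteq> 0 \<Longrightarrow> \<bar>t\<bar> \<le> neg_exp k / 2 \<Longrightarrow>
    (\<integral>\<^sup>+x. hpow t (DE N k \<epsilon> x) \<partial>gauss (ix N) \<sigma>) \<le> ennreal (exp (t * L + t\<^sup>2 * K))"
proof -
  let ?\<Gamma> = "gauss (ix N) \<sigma>" and ?s = "neg_exp k"
  interpret G: prob_space ?\<Gamma> by (rule prob_space_gauss[OF \<sigma>])
  have s: "0 < ?s" "?s \<le> 1" using neg_exp_pos[of k] by auto
  note int = DE_integrability[OF \<sigma> k \<epsilon>]
  let ?g = "\<lambda>x. 8 / ?s\<^sup>2 * (1 + DE N k \<epsilon> x + DE N k \<epsilon> x powr (- ?s))"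
  have g: "integrable ?\<Gamma> ?g" using int by auto
  define K where "K = (\<integral>x. ?g x \<partial>?\<Gamma>)"
  have g0: "0 \<le> ?g x" for x using DE_nonneg[OF k, of \<epsilon> x] by simp
  have K: "0 \<le> K" unfolding K_def using g0 by (intro integral_nonneg_AE) simp
  have "(\<integral>\<^sup>+x. hpow t (DE N k \<epsilon> x) \<partial>?\<Gamma>) \<le> ennreal (exp (t * L + t\<^sup>2 * K))" if t: "t \<noteq> 0" "\<bar>t\<bar> \<le> ?s / 2" for t
  proof -
    let ?f = "\<lambda>x. 1 + t * ln (DE N k \<epsilon> x) + t\<^sup>2 * ?g x"
    have f: "integrable ?\<Gamma> ?f" using int g by auto
    have le: "AE x in ?\<Gamma>. hpow t (DE N k \<epsilon> x) \<le> ennreal (?f x)" "AE x in ?\<Gamma>. 0 \<le> ?f x"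
    proof -
      have "AE x in ?\<Gamma>. DE N k \<epsilon> x powr t \<le> ?f x \<and> 0 < DE N k \<epsilon> x"
        using int(1) by eventually_elim (use powr_le_quadratic[OF _ s t(2)] in auto)
      note ae = this
      from ae show "AE x in ?\<Gamma>. hpow t (DE N k \<epsilon> x) \<le> ennreal (?f x)"
        by eventually_elim (simp add: hpow_def ennreal_leI)
      from ae show "AE x in ?\<Gamma>. 0 \<le> ?f x"
        by eventually_elim (rule order_trans[OF powr_ge_zero], erule conjunct1)
    qed
    have "(\<integral>\<^sup>+x. hpow t (DE N k \<epsilon> x) \<partial>?\<Gamma>) \<le> (\<integral>\<^sup>+x. ennreal (?f x) \<partial>?\<Gamma>)"
      by (rule nn_integral_mono_AE[OF le(1)])
    also have "\<dots> = ennreal (\<integral>x. ?f x \<partial>?\<Gamma>)" by (rule nn_integral_eq_integral[OF f le(2)])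
    also have "(\<integral>x. ?f x \<partial>?\<Gamma>) = 1 + t * L + t\<^sup>2 * K"
      using int g G.prob_space by (simp add: L_def K_def)
    also have "ennreal \<dots> \<le> ennreal (exp (t * L + t\<^sup>2 * K))"
      using exp_ge_add_one_self[of "t * L + t\<^sup>2 * K"] by (intro ennreal_leI) (simp add: add.assoc)
    finally show ?thesis .
  qed
  thus ?thesis using that K by blast
qed

text \<open>If q \<le> 1 / 8 the expansion applies. Otherwise 1 \<le> 8 q, and powers of q may be
  raised freely: \<open>EQ\<close> is bounded by a multiple of q^3, and the constant 1 /
  \<epsilon>^4 from the weighted square is at most (8 q)^7 / \<epsilon>^4, which is of order
  \<epsilon>^3. This explains the exponent 7 = 3 + 4.\<close>

lemma ln_D_expansion_pointwise:
  assumes k: "k \<le> N" and \<epsilon>: "0 < \<epsilon>"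
  shows "\<bar>ln (DE N k \<epsilon> x) - EQ N k \<epsilon> x\<bar>
    \<le> \<epsilon> ^ 3 * ((128 * real (d * k) + 24) * EL k ^ 3 * rad (ix N) x ^ 3 + (8 * EL k) ^ 7 * rad (ix N) x ^ 7)
      + \<epsilon> ^ 4 * (ln (DE N k \<epsilon> x))\<^sup>2"
proof -
  let ?q = "eq_rad N k \<epsilon> x" and ?r = "rad (ix N) x"
  have q: "0 \<le> ?q" using \<epsilon> by simp
  have q3: "\<epsilon> ^ 3 * (c * EL k ^ 3 * ?r ^ 3) = c * ?q ^ 3" for c
    by (simp add: eq_rad_def power_mult_distrib)
  have r: "0 \<le> (8 * EL k) ^ 7 * ?r ^ 7" by simp
  show ?thesis
  proof (cases "?q \<le> 1 / 8")
    case True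
    have "\<bar>ln (DE N k \<epsilon> x) - EQ N k \<epsilon> x\<bar> \<le> (54 * real (d * k) + 5 / 2) * ?q ^ 3"
      unfolding DE_def by (rule ln_D_expansion_good[OF k _ True]) (use \<epsilon> in simp)
    also have "\<dots> \<le> (128 * real (d * k) + 24) * ?q ^ 3" using q by (intro mult_right_mono) auto
    also have "\<dots> \<le> \<epsilon> ^ 3 * ((128 * real (d * k) + 24) * EL k ^ 3 * ?r ^ 3 + (8 * EL k) ^ 7 * ?r ^ 7)"
      unfolding distrib_left q3 using r \<epsilon> by simp
    also have "\<dots> \<le> \<dots> + \<epsilon> ^ 4 * (ln (DE N k \<epsilon> x))\<^sup>2" using \<epsilon> by simp
    finally show ?thesis .
  next
    case False
    hence q8: "1 \<le> 8 * ?q" by simp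
    have "?q * 1 \<le> ?q * (8 * ?q)\<^sup>2" using q q8 by (intro mult_left_mono one_le_power) auto
    hence a: "?q \<le> 64 * ?q ^ 3" by (simp add: power2_eq_square power3_eq_cube)
    have "?q\<^sup>2 * 1 \<le> ?q\<^sup>2 * (8 * ?q)" using q8 by (intro mult_left_mono) auto
    hence b: "?q\<^sup>2 \<le> 8 * ?q ^ 3" by (simp add: power2_eq_square power3_eq_cube)
    have "\<bar>EQ N k \<epsilon> x\<bar> \<le> 2 * real (d * k) * ?q + 3 * ?q\<^sup>2" by (rule EQ_bound[OF k]) (use \<epsilon> in simp)
    also have "\<dots> \<le> 2 * real (d * k) * (64 * ?q ^ 3) + 3 * (8 * ?q ^ 3)" using a b by (intro add_mono mult_left_mono) auto
    also have "\<dots> = (128 * real (d * k) + 24) * ?q ^ 3" by (simp add: algebra_simps)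
    finally have 1: "\<bar>EQ N k \<epsilon> x\<bar> \<le> (128 * real (d * k) + 24) * ?q ^ 3" .
    have "1 / \<epsilon> ^ 4 * 1 \<le> 1 / \<epsilon> ^ 4 * (8 * ?q) ^ 7" using q8 \<epsilon> by (intro mult_left_mono one_le_power) auto
    also have "\<dots> = \<epsilon> ^ 3 * ((8 * EL k) ^ 7 * ?r ^ 7)"
    proof -
      have "\<epsilon> ^ 7 = \<epsilon> ^ 4 * \<epsilon> ^ 3" by (simp flip: power_add)
      moreover have "1 / a * (a * b) = b" if "a \<noteq> 0" for a b :: real using that by simp
      hence "1 / \<epsilon> ^ 4 * (\<epsilon> ^ 4 * \<epsilon> ^ 3) = \<epsilon> ^ 3" using \<epsilon> by (metis less_irrefl power_not_zero)
      ultimately have e: "1 / \<epsilon> ^ 4 * \<epsilon> ^ 7 = \<epsilon> ^ 3" by (simp only:)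
      have "1 / \<epsilon> ^ 4 * (8 * ?q) ^ 7 = 1 / \<epsilon> ^ 4 * \<epsilon> ^ 7 * ((8 * EL k) ^ 7 * ?r ^ 7)"
        by (simp add: eq_rad_def power_mult_distrib)
      thus ?thesis unfolding e .
    qed
    finally have 2: "1 / \<epsilon> ^ 4 \<le> \<epsilon> ^ 3 * ((8 * EL k) ^ 7 * ?r ^ 7)" by simp
    have 3: "\<bar>ln (DE N k \<epsilon> x)\<bar> \<le> \<epsilon> ^ 4 * (ln (DE N k \<epsilon> x))\<^sup>2 + 1 / \<epsilon> ^ 4"
      using \<epsilon> by (intro abs_le_weighted_square) simp
    show ?thesis unfolding distrib_left q3 using 1 2 3 by linarith
  qed
qed

text \<open>By the negative moment the second moment of the logarithm grows at most like \<epsilon>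
  to the power - 1 / 2. Its weight \<epsilon>^4 brings it below order \<epsilon>^3, the order of the
  other terms.\<close>

lemma ln_D_expansion:
  assumes \<sigma>: "0 < \<sigma>" and k: "k \<le> N"
  obtains C :: real where "0 \<le> C" "\<And>\<epsilon>. 0 < \<epsilon> \<Longrightarrow> \<epsilon> \<le> 1 \<Longrightarrow>
    (\<integral>\<^sup>+x. ennreal \<bar>ln (DE N k \<epsilon> x) - EQ N k \<epsilon> x\<bar> \<partial>gauss (ix N) \<sigma>) \<le> ennreal (C * \<epsilon> ^ 3)"
proof -
  let ?\<Gamma> = "gauss (ix N) \<sigma>" and ?s = "neg_exp k"
  interpret G: prob_space ?\<Gamma> by (rule prob_space_gauss[OF \<sigma>])
  have s: "0 < ?s" "?s \<le> 1" using neg_exp_pos[of k] by auto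
  obtain C1 where C1: "0 \<le> C1" "\<And>\<epsilon>. 0 < \<epsilon> \<Longrightarrow> (\<integral>\<^sup>+x. hpow (- ?s) (DE N k \<epsilon> x) \<partial>?\<Gamma>) \<le> ennreal (C1 * (1 + \<epsilon> powr (- (1/2))))"
    using negative_moment[OF \<sigma> k] unfolding DE_def by metis
  obtain C2 where C2: "0 \<le> C2" "\<And>\<epsilon>. 0 \<le> \<epsilon> \<Longrightarrow> (\<integral>\<^sup>+x. ennreal (DE N k \<epsilon> x) \<partial>?\<Gamma>) \<le> ennreal (C2 * (1 + \<epsilon> ^ (2 * (d * k))))"
    using positive_moment[OF \<sigma> k] by metis
  define m where "m p = (1 + (real p * (4 * \<sigma>\<^sup>2)) ^ p) * sqrt 2 ^ card (ix N)" for p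
  have m: "0 \<le> m p" "(\<integral>\<^sup>+x. ennreal (rad (ix N) x ^ p) \<partial>?\<Gamma>) \<le> ennreal (m p)" for p
    using moment_rad[OF finite_ix \<sigma>] by (simp_all add: m_def)
  define A3 where "A3 = (128 * real (d * k) + 24) * EL k ^ 3"
  define A7 where "A7 = (8 * EL k) ^ 7"
  have A: "0 \<le> A3" "0 \<le> A7" by (simp_all add: A3_def A7_def)
  define c where "c = 8 / ?s\<^sup>2"
  have c: "0 \<le> c" by (simp add: c_def)
  let ?C = "A3 * m 3 + A7 * m 7 + c * (1 + 2 * C2 + 2 * C1)"
  have "(\<integral>\<^sup>+x. ennreal \<bar>ln (DE N k \<epsilon> x) - EQ N k \<epsilon> x\<bar> \<partial>?\<Gamma>) \<le> ennreal (?C * \<epsilon> ^ 3)"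
    if \<epsilon>: "0 < \<epsilon>" "\<epsilon> \<le> 1" for \<epsilon> :: real
  proof -
    have mDE [measurable]: "DE N k \<epsilon> \<in> borel_measurable ?\<Gamma>" by measurable
    have mr [measurable]: "rad (ix N) \<in> borel_measurable ?\<Gamma>" by measurable
    \<comment> \<open>Where the determinant vanishes the left side is 0, by the default value of
      \<open>ln\<close>.\<close>
    have sq: "ennreal ((ln (DE N k \<epsilon> x))\<^sup>2) \<le> ennreal c * (1 + ennreal (DE N k \<epsilon> x) + hpow (- ?s) (DE N k \<epsilon> x))" for x
    proof (cases "DE N k \<epsilon> x = 0")
      case True
      thus ?thesis by simp
    next
      case False
      hence p: "0 < DE N k \<epsilon> x" using DE_nonneg[OF k, of \<epsilon> x] by linarith
      have "(ln (DE N k \<epsilon> x))\<^sup>2 * 1 \<le> (ln (DE N k \<epsilon> x))\<^sup>2 * exp (?s / 2 * \<bar>ln (DE N k \<epsilon> x)\<bar>)"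
        using s by (intro mult_left_mono) auto
      also note ln_square_le[OF p s]
      finally have "(ln (DE N k \<epsilon> x))\<^sup>2 \<le> c * (1 + DE N k \<epsilon> x + DE N k \<epsilon> x powr (- ?s))" by (simp add: c_def)
      hence "ennreal ((ln (DE N k \<epsilon> x))\<^sup>2) \<le> ennreal (c * (1 + DE N k \<epsilon> x + DE N k \<epsilon> x powr (- ?s)))" by (rule ennreal_leI)
      also have "\<dots> = ennreal c * (1 + ennreal (DE N k \<epsilon> x) + hpow (- ?s) (DE N k \<epsilon> x))"
        using p c by (simp add: ennreal_mult ennreal_plus hpow_def)
      finally show ?thesis .
    qed
    have "ennreal \<bar>ln (DE N k \<epsilon> x) - EQ N k \<epsilon> x\<bar>
       \<le> ennreal (\<epsilon> ^ 3 * A3) * ennreal (rad (ix N) x ^ 3) + ennreal (\<epsilon> ^ 3 * A7) * ennreal (rad (ix N) x ^ 7)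
         + ennreal (\<epsilon> ^ 4 * c) * (1 + ennreal (DE N k \<epsilon> x) + hpow (- ?s) (DE N k \<epsilon> x))" for x
    proof -
      have "ennreal \<bar>ln (DE N k \<epsilon> x) - EQ N k \<epsilon> x\<bar>
         \<le> ennreal (\<epsilon> ^ 3 * A3 * rad (ix N) x ^ 3 + \<epsilon> ^ 3 * A7 * rad (ix N) x ^ 7 + \<epsilon> ^ 4 * (ln (DE N k \<epsilon> x))\<^sup>2)"
        using ln_D_expansion_pointwise[OF k \<epsilon>(1), of x] by (intro ennreal_leI) (simp add: A3_def A7_def algebra_simps)
      also have "\<dots> = ennreal (\<epsilon> ^ 3 * A3) * ennreal (rad (ix N) x ^ 3) + ennreal (\<epsilon> ^ 3 * A7) * ennreal (rad (ix N) x ^ 7)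
         + ennreal (\<epsilon> ^ 4) * ennreal ((ln (DE N k \<epsilon> x))\<^sup>2)"
        using \<epsilon> A by (simp add: ennreal_mult ennreal_plus)
      also have "\<dots> \<le> ennreal (\<epsilon> ^ 3 * A3) * ennreal (rad (ix N) x ^ 3) + ennreal (\<epsilon> ^ 3 * A7) * ennreal (rad (ix N) x ^ 7)
         + ennreal (\<epsilon> ^ 4) * (ennreal c * (1 + ennreal (DE N k \<epsilon> x) + hpow (- ?s) (DE N k \<epsilon> x)))"
        by (intro add_left_mono mult_left_mono sq) simp
      finally show ?thesis using \<epsilon> c by (simp add: ennreal_mult mult.assoc)
    qed
    hence "(\<integral>\<^sup>+x. ennreal \<bar>ln (DE N k \<epsilon> x) - EQ N k \<epsilon> x\<bar> \<partial>?\<Gamma>)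
      \<le> (\<integral>\<^sup>+x. ennreal (\<epsilon> ^ 3 * A3) * ennreal (rad (ix N) x ^ 3) + ennreal (\<epsilon> ^ 3 * A7) * ennreal (rad (ix N) x ^ 7)
         + ennreal (\<epsilon> ^ 4 * c) * (1 + ennreal (DE N k \<epsilon> x) + hpow (- ?s) (DE N k \<epsilon> x)) \<partial>?\<Gamma>)"
      by (intro nn_integral_mono)
    also have "\<dots> = ennreal (\<epsilon> ^ 3 * A3) * (\<integral>\<^sup>+x. ennreal (rad (ix N) x ^ 3) \<partial>?\<Gamma>)
         + ennreal (\<epsilon> ^ 3 * A7) * (\<integral>\<^sup>+x. ennreal (rad (ix N) x ^ 7) \<partial>?\<Gamma>)
         + ennreal (\<epsilon> ^ 4 * c) * (1 + (\<integral>\<^sup>+x. ennreal (DE N k \<epsilon> x) \<partial>?\<Gamma>) + (\<integral>\<^sup>+x. hpow (- ?s) (DE N k \<epsilon> x) \<partial>?\<Gamma>))"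
      using G.emeasure_space_1 by (simp add: nn_integral_add nn_integral_cmult)
    also have "\<dots> \<le> ennreal (\<epsilon> ^ 3 * A3) * ennreal (m 3) + ennreal (\<epsilon> ^ 3 * A7) * ennreal (m 7)
         + ennreal (\<epsilon> ^ 4 * c) * (1 + ennreal (C2 * (1 + \<epsilon> ^ (2 * (d * k)))) + ennreal (C1 * (1 + \<epsilon> powr (- (1/2)))))"
      using \<epsilon> by (intro add_mono mult_left_mono m C1 C2) auto
    also have "\<dots> = ennreal (\<epsilon> ^ 3 * A3 * m 3 + \<epsilon> ^ 3 * A7 * m 7
         + \<epsilon> ^ 4 * c * (1 + C2 * (1 + \<epsilon> ^ (2 * (d * k))) + C1 * (1 + \<epsilon> powr (- (1/2)))))"
      using \<epsilon> A m(1) c C1(1) C2(1) by (simp add: ennreal_mult ennreal_plus)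
    also have "\<dots> \<le> ennreal (?C * \<epsilon> ^ 3)"
    proof (rule ennreal_leI)
      have e1: "\<epsilon> ^ (2 * (d * k)) \<le> 1" using \<epsilon> by (intro power_le_one) auto
      have e2: "\<epsilon> * \<epsilon> powr (- (1/2)) \<le> 1"
      proof -
        have "\<epsilon> * \<epsilon> powr (- (1/2)) = \<epsilon> powr (1 + - (1/2))" using \<epsilon> by (simp only: powr_add) simp
        also have "\<dots> \<le> 1" using \<epsilon> by (intro powr_le1) auto
        finally show ?thesis .
      qed
      have "\<epsilon> * (1 + C2 * (1 + \<epsilon> ^ (2 * (d * k))) + C1 * (1 + \<epsilon> powr (- (1/2))))
        = \<epsilon> * 1 + C2 * (\<epsilon> * (1 + \<epsilon> ^ (2 * (d * k)))) + C1 * (\<epsilon> + \<epsilon> * \<epsilon> powr (- (1/2)))"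
        by (simp add: algebra_simps)
      also have "\<dots> \<le> 1 * 1 + C2 * (1 * (1 + 1)) + C1 * (1 + 1)"
        using \<epsilon> e1 e2 C1(1) C2(1) by (intro add_mono mult_mono mult_left_mono) auto
      finally have "c * (\<epsilon> * (1 + C2 * (1 + \<epsilon> ^ (2 * (d * k))) + C1 * (1 + \<epsilon> powr (- (1/2))))) \<le> c * (1 + 2 * C2 + 2 * C1)"
        using c by (intro mult_left_mono) auto
      hence "\<epsilon> ^ 3 * (c * (\<epsilon> * (1 + C2 * (1 + \<epsilon> ^ (2 * (d * k))) + C1 * (1 + \<epsilon> powr (- (1/2)))))) \<le> \<epsilon> ^ 3 * (c * (1 + 2 * C2 + 2 * C1))"
        by (rule mult_left_mono) (use \<epsilon> in simp)
      moreover have "\<epsilon> ^ 4 = \<epsilon> ^ 3 * \<epsilon>" by (simp add: power_numeral_reduce)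
      ultimately show "\<epsilon> ^ 3 * A3 * m 3 + \<epsilon> ^ 3 * A7 * m 7
         + \<epsilon> ^ 4 * c * (1 + C2 * (1 + \<epsilon> ^ (2 * (d * k))) + C1 * (1 + \<epsilon> powr (- (1/2)))) \<le> ?C * \<epsilon> ^ 3"
        by (simp only: distrib_left distrib_right mult_ac add_ac) 
    qed
    finally show ?thesis .
  qed
  moreover have "0 \<le> ?C" using A m(1) c C1(1) C2(1) by simp
  ultimately show ?thesis using that by blast
qed

end

section \<open>Growth of a fixed frame\<close>

lemma left_product_cong: "(\<And>l. l < m \<Longrightarrow> A l = B l) \<Longrightarrow> left_product n A m = left_product n B m"
  by (induction m) auto

lemma mat_measurable_left_product:
  assumes "\<And>l. l < m \<Longrightarrow> mat_measurable M n n (F l)"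
  shows "mat_measurable M n n (\<lambda>\<omega>. left_product n (\<lambda>l. F l \<omega>) m)"
  using assms
proof (induction m)
  case 0
  show ?case by (simp add: mat_measurable_const)
next
  case (Suc m)
  from mat_measurable_mult[of M n n "F m" n, OF Suc.prems[OF lessI] Suc.IH[OF Suc.prems[OF less_SucI]]]
  show ?case by simp
qed

text \<open>Borel-Cantelli through expectations: the sum of all \<open>Z m\<close> has a finite
  integral, so it is finite almost everywhere and its terms tend to 0.\<close>

lemma summable_decay_AE:
  fixes Z :: "nat \<Rightarrow> 'a \<Rightarrow> ennreal"
  assumes Z [measurable]: "\<And>m. Z m \<in> borel_measurable M"
    and le: "\<And>m. (\<integral>\<^sup>+\<omega>. Z m \<omega> \<partial>M) \<le> ennreal (C * r ^ m)" and r: "0 \<le> C" "0 \<le> r" "r < 1"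
  shows "AE \<omega> in M. eventually (\<lambda>m. Z m \<omega> < 1) sequentially"
proof -
  have "(\<integral>\<^sup>+\<omega>. (\<Sum>m. Z m \<omega>) \<partial>M) = (\<Sum>m. \<integral>\<^sup>+\<omega>. Z m \<omega> \<partial>M)" by (rule nn_integral_suminf) measurable
  also have "\<dots> \<le> (\<Sum>m. ennreal (C * r ^ m))" by (intro suminf_le le) auto
  also have "\<dots> = ennreal (\<Sum>m. C * r ^ m)" using r by (intro suminf_ennreal2) (auto intro!: summable_mult summable_geometric)
  finally have "(\<integral>\<^sup>+\<omega>. (\<Sum>m. Z m \<omega>) \<partial>M) \<noteq> \<infinity>" by (auto simp: top_unique)
  hence "AE \<omega> in M. (\<Sum>m. Z m \<omega>) \<noteq> \<infinity>" by (intro nn_integral_PInf_AE) auto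
  thus ?thesis
  proof eventually_elim
    case (elim \<omega>)
    have fin: "Z m \<omega> \<noteq> \<infinity>" for m
    proof -
      have "Z m \<omega> \<le> (\<Sum>m. Z m \<omega>)" using sum_le_suminf[of "\<lambda>m. Z m \<omega>" "{m}"] by simp
      thus ?thesis using elim by (metis infinity_ennreal_def neq_top_trans)
    qed
    define z where "z m = enn2real (Z m \<omega>)" for m
    have z: "Z m \<omega> = ennreal (z m)" "0 \<le> z m" for m using fin[of m] by (simp_all add: z_def less_top)
    have "summable z" using elim by (intro summable_suminf_not_top) (auto simp: z)
    hence "z \<longlonglongrightarrow> 0" by (rule summable_LIMSEQ_zero)
    hence "eventually (\<lambda>m. z m < 1) sequentially" by (rule order_tendstoD) simp
    thus ?case by eventually_elim (simp add: z ennreal_less_one_iff)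
  qed
qed

section \<open>The matrix random walk driven by independent copies\<close>

locale gaussian_matrices = number_system \<beta> + prob_space M for \<beta> :: nat and M :: "'w measure" +
  fixes N :: nat and \<sigma> :: real and X :: "nat \<Rightarrow> 'w \<Rightarrow> nat \<Rightarrow> nat \<Rightarrow> nat \<Rightarrow> real"
  assumes N_pos: "1 \<le> N" and \<sigma>_pos: "0 < \<sigma>" and iid: "iid_gaussian_matrices M \<beta> N \<sigma> X"
begin

definition XV :: "nat \<Rightarrow> 'w \<Rightarrow> nat \<times> nat \<times> nat \<Rightarrow> real" where
  "XV m \<omega> = (\<lambda>(i, j, a)\<in>ix N. X m \<omega> i j a)"

lemma indep_X: "indep_vars (\<lambda>_. borel) (\<lambda>(m, i, j, a) \<omega>. X m \<omega> i j a) (UNIV \<times> ix N)"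
  using iid by (simp add: iid_gaussian_matrices_def ix_def)

lemma rv_X: "t \<in> ix N \<Longrightarrow> (\<lambda>\<omega>. XV m \<omega> t) \<in> borel_measurable M"
  using indep_X by (auto simp: indep_vars_def XV_def ix_def)

lemma distributed_X:
  "t \<in> ix N \<Longrightarrow> distributed M lborel (\<lambda>\<omega>. XV m \<omega> t) (\<lambda>x. ennreal (normal_density 0 \<sigma> x))"
  using iid by (auto simp: iid_gaussian_matrices_def XV_def ix_def)

lemma indep_XV: "indep_vars (\<lambda>_. borel) (\<lambda>p \<omega>. XV (fst p) \<omega> (snd p)) (UNIV \<times> ix N)"
  using indep_X by (rule indep_vars_cong[THEN iffD1, rotated -1]) (auto simp: XV_def)

lemma indep_XV_fixed: "indep_vars (\<lambda>_. borel) (\<lambda>t \<omega>. XV m \<omega> t) (ix N)"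
proof -
  have "indep_vars (\<lambda>t. PiM {(m, t)} (\<lambda>_. borel)) (\<lambda>t \<omega>. restrict (\<lambda>p. XV (fst p) \<omega> (snd p)) {(m, t)}) (ix N)"
    by (rule indep_vars_restrict[OF indep_XV]) (auto simp: disjoint_family_on_def)
  hence "indep_vars (\<lambda>_. borel) (\<lambda>t \<omega>. (restrict (\<lambda>p. XV (fst p) \<omega> (snd p)) {(m, t)}) (m, t)) (ix N)"
    by (rule indep_vars_compose2) (auto intro: measurable_component_singleton)
  thus ?thesis by simp
qed

lemma ix_nonempty: "ix N \<noteq> {}"
proof -
  have "(0, 0, 0) \<in> ix N" using N_pos dyson_index by (auto simp: ix_def)
  thus ?thesis by blast
qed

lemma measurable_XV [measurable]: "XV m \<in> measurable M (PL (ix N))"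
proof -
  have "(\<lambda>\<omega>. \<lambda>t\<in>ix N. XV m \<omega> t) \<in> measurable M (PL (ix N))"
    by (rule measurable_restrict) (use rv_X in simp)
  moreover have "(\<lambda>\<omega>. \<lambda>t\<in>ix N. XV m \<omega> t) = XV m"
    by (auto simp: fun_eq_iff XV_def)
  ultimately show ?thesis by simp
qed

lemma distr_XV: "distr M (PL (ix N)) (XV m) = gauss (ix N) \<sigma>"
proof -
  have r: "(\<lambda>\<omega>. \<lambda>t\<in>ix N. XV m \<omega> t) = XV m" by (auto simp: fun_eq_iff XV_def)
  have "distr M (PL (ix N)) (XV m) = distr M (PiM (ix N) (\<lambda>_. borel)) (\<lambda>\<omega>. \<lambda>t\<in>ix N. XV m \<omega> t)"
    unfolding r by (rule distr_cong) (auto intro!: sets_PiM_cong)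
  also have "\<dots> = PiM (ix N) (\<lambda>t. distr M borel (\<lambda>\<omega>. XV m \<omega> t))"
    using indep_XV_fixed rv_X by (subst (asm) indep_vars_iff_distr_eq_PiM'[OF ix_nonempty]) auto
  also have "\<dots> = PiM (ix N) (\<lambda>t. density lborel (\<lambda>x. ennreal (normal_density 0 \<sigma> x)))"
  proof (rule PiM_cong[OF refl])
    fix t assume "t \<in> ix N"
    have "distr M borel (\<lambda>\<omega>. XV m \<omega> t) = distr M lborel (\<lambda>\<omega>. XV m \<omega> t)" by (rule distr_cong) auto
    thus "distr M borel (\<lambda>\<omega>. XV m \<omega> t) = density lborel (\<lambda>x. ennreal (normal_density 0 \<sigma> x))"
      using distributed_distr_eq_density[OF distributed_X[OF \<open>t \<in> ix N\<close>]] by simp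
  qed
  finally show ?thesis by (simp add: gauss_def)
qed

lemma nn_integral_XV:
  "f \<in> borel_measurable (PL (ix N)) \<Longrightarrow> (\<integral>\<^sup>+\<omega>. f (XV m \<omega>) \<partial>M) = (\<integral>\<^sup>+x. f x \<partial>gauss (ix N) \<sigma>)"
  unfolding distr_XV[symmetric, of m] by (rule nn_integral_distr[symmetric]) auto

lemma integral_XV:
  fixes f :: "_ \<Rightarrow> real"
  assumes "f \<in> borel_measurable (PL (ix N))"
  shows "(\<integral>\<omega>. f (XV m \<omega>) \<partial>M) = (\<integral>x. f x \<partial>gauss (ix N) \<sigma>)"
    "integrable M (\<lambda>\<omega>. f (XV m \<omega>)) \<longleftrightarrow> integrable (gauss (ix N) \<sigma>) f"
  unfolding distr_XV[symmetric, of m] using assms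
  by (simp_all add: integral_distr integrable_distr_eq)

definition walk :: "real \<Rightarrow> nat \<Rightarrow> 'w \<Rightarrow> complex mat" where
  "walk \<epsilon> m \<omega> = left_product (d * N) (\<lambda>l. PY N \<epsilon> (XV l \<omega>)) m"

lemma walk_Suc: "walk \<epsilon> (Suc m) \<omega> = PY N \<epsilon> (XV m \<omega>) * walk \<epsilon> m \<omega>"
  by (simp add: walk_def)

lemma left_product_NC: "(\<And>l. A l \<in> NC N N) \<Longrightarrow> left_product (d * N) A m \<in> NC N N"
  by (induction m) auto

lemma walk_NC [simp, intro]: "walk \<epsilon> m \<omega> \<in> NC N N"
  unfolding walk_def by (rule left_product_NC) simp

text \<open>The earlier factors are independent of factor m. Conditioning on them by Fubini leaves a
  deterministic frame, and since the law of the volume ratio does not depend on the frame, the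
  one-step moment factors out.\<close>

lemma walk_step:
  fixes h :: "real \<Rightarrow> ennreal"
  assumes V: "V \<in> NC N k" and k: "k \<le> N"
    and h [measurable]: "h \<in> borel_measurable borel"
    and h_mult: "\<And>a b. 0 \<le> a \<Longrightarrow> 0 \<le> b \<Longrightarrow> h (a * b) = h a * h b"
  shows "(\<integral>\<^sup>+\<omega>. h (D (walk \<epsilon> (Suc m) \<omega> * V)) \<partial>M)
    = (\<integral>\<^sup>+x. h (DE N k \<epsilon> x) \<partial>gauss (ix N) \<sigma>) * (\<integral>\<^sup>+\<omega>. h (D (walk \<epsilon> m \<omega> * V)) \<partial>M)"
proof -
  let ?\<phi> = "\<integral>\<^sup>+x. h (DE N k \<epsilon> x) \<partial>gauss (ix N) \<sigma>"
  let ?x = "\<lambda>p \<omega>. XV (fst p) \<omega> (snd p)"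
  define A where "A = {..<m} \<times> ix N"
  define B where "B = {m} \<times> ix N"
  let ?SA = "PiM A (\<lambda>_. borel :: real measure)" and ?SB = "PiM B (\<lambda>_. borel :: real measure)"
  define past where "past \<omega> = restrict (\<lambda>p. ?x p \<omega>) A" for \<omega>
  define cur where "cur \<omega> = restrict (\<lambda>p. ?x p \<omega>) B" for \<omega>
  have "A \<inter> B = {}" "A \<subseteq> UNIV \<times> ix N" "B \<subseteq> UNIV \<times> ix N" by (auto simp: A_def B_def)
  from indep_var_restrict[OF indep_XV this] have ind: "indep_var ?SA past ?SB cur"
    unfolding past_def cur_def .
  hence mp [measurable]: "past \<in> measurable M ?SA" and mc [measurable]: "cur \<in> measurable M ?SB"
    and joint: "distr M ?SA past \<Otimes>\<^sub>M distr M ?SB cur = distr M (?SA \<Otimes>\<^sub>M ?SB) (\<lambda>\<omega>. (past \<omega>, cur \<omega>))"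
    by (auto simp: indep_var_distribution_eq)
  \<comment> \<open>The past product and the current factor as functions of their own coordinates,
    to be integrated against the two marginal laws.\<close>
  define P where "P p = left_product (d * N) (\<lambda>l. PY N \<epsilon> (\<lambda>t\<in>ix N. p (l, t))) m" for p :: "nat \<times> nat \<times> nat \<times> nat \<Rightarrow> real"
  define C where "C q = PY N \<epsilon> (\<lambda>t\<in>ix N. q (m, t))" for q :: "nat \<times> nat \<times> nat \<times> nat \<Rightarrow> real"
  have P_past: "P (past \<omega>) = walk \<epsilon> m \<omega>" for \<omega>
    unfolding P_def walk_def
    by (intro left_product_cong arg_cong[where f = "PY N \<epsilon>"]) (auto simp: past_def A_def XV_def fun_eq_iff)
  have C_cur: "C (cur \<omega>) = PY N \<epsilon> (XV m \<omega>)" for \<omega>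
    unfolding C_def by (intro arg_cong[where f = "PY N \<epsilon>"]) (auto simp: cur_def B_def XV_def fun_eq_iff)
  have P_NC: "P p \<in> NC N N" for p unfolding P_def by (rule left_product_NC) simp
  have slice: "(\<lambda>p. \<lambda>t\<in>ix N. p (l, t)) \<in> measurable (PiM J (\<lambda>_. borel)) (PL (ix N))" if "{l} \<times> ix N \<subseteq> J" for l J
  proof (rule measurable_restrict)
    fix t assume "t \<in> ix N"
    hence "(l, t) \<in> J" using that by auto
    from measurable_component_singleton[OF this, of "\<lambda>_. borel"]
    show "(\<lambda>p. p (l, t)) \<in> PiM J (\<lambda>_. borel) \<rightarrow>\<^sub>M lborel" by simp
  qed
  have mP: "mat_measurable ?SA (d * N) (d * N) P"
    unfolding P_def
    by (intro mat_measurable_left_product mat_measurable_compose[OF mat_measurable_PY slice]) (auto simp: A_def)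
  have mC: "mat_measurable ?SB (d * N) (d * N) C"
    unfolding C_def by (rule mat_measurable_compose[OF mat_measurable_PY slice]) (auto simp: B_def)
  note cV = NC_carrier[OF V]
  let ?F = "\<lambda>(p, q). h (D (C q * (P p * V)))"
  have mF [measurable]: "?F \<in> borel_measurable (?SA \<Otimes>\<^sub>M ?SB)"
  proof -
    have "mat_measurable (?SA \<Otimes>\<^sub>M ?SB) (d * N) (d * k) (\<lambda>z. C (snd z) * (P (fst z) * V))"
      by (intro mat_measurable_mult[OF mat_measurable_compose[OF mC measurable_snd]]
          mat_measurable_mult[OF mat_measurable_compose[OF mP measurable_fst]] mat_measurable_const cV)
    from borel_measurable_D[OF this] show ?thesis by (simp add: case_prod_beta)
  qed
  have mPV [measurable]: "(\<lambda>p. h (D (P p * V))) \<in> borel_measurable ?SA"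
    using borel_measurable_D[OF mat_measurable_mult[OF mP mat_measurable_const[OF cV]]] by measurable
  interpret SB: prob_space "distr M ?SB cur" by (rule prob_space_distr) simp
  have "(\<integral>\<^sup>+\<omega>. h (D (walk \<epsilon> (Suc m) \<omega> * V)) \<partial>M) = (\<integral>\<^sup>+\<omega>. ?F (past \<omega>, cur \<omega>) \<partial>M)"
  proof (rule nn_integral_cong)
    fix \<omega>
    have "walk \<epsilon> (Suc m) \<omega> * V = C (cur \<omega>) * (P (past \<omega>) * V)"
      unfolding walk_Suc C_cur P_past
      using assoc_mult_mat[OF NC_carrier[OF PY_NC] NC_carrier[OF walk_NC] cV] .
    thus "h (D (walk \<epsilon> (Suc m) \<omega> * V)) = ?F (past \<omega>, cur \<omega>)" by simp
  qed
  also have "\<dots> = (\<integral>\<^sup>+z. ?F z \<partial>distr M (?SA \<Otimes>\<^sub>M ?SB) (\<lambda>\<omega>. (past \<omega>, cur \<omega>)))"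
    by (rule nn_integral_distr[symmetric]) measurable
  also have "\<dots> = (\<integral>\<^sup>+z. ?F z \<partial>(distr M ?SA past \<Otimes>\<^sub>M distr M ?SB cur))" by (simp only: joint)
  also have "\<dots> = (\<integral>\<^sup>+p. (\<integral>\<^sup>+q. ?F (p, q) \<partial>distr M ?SB cur) \<partial>distr M ?SA past)"
    by (rule SB.nn_integral_fst[symmetric]) measurable
  also have "\<dots> = (\<integral>\<^sup>+p. ?\<phi> * h (D (P p * V)) \<partial>distr M ?SA past)"
  proof (rule nn_integral_cong)
    fix p assume "p \<in> space (distr M ?SA past)"
    hence p: "p \<in> space ?SA" by simp
    have PV: "P p * V \<in> NC N k" by (rule NC_mult[OF P_NC V])
    have "(\<integral>\<^sup>+q. ?F (p, q) \<partial>distr M ?SB cur) = (\<integral>\<^sup>+\<omega>. ?F (p, cur \<omega>) \<partial>M)"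
      by (rule nn_integral_distr) (use p in measurable)
    also have "\<dots> = (\<integral>\<^sup>+\<omega>. h (D (PY N \<epsilon> (XV m \<omega>) * (P p * V))) \<partial>M)" by (simp add: C_cur)
    also have "\<dots> = (\<integral>\<^sup>+x. h (D (PY N \<epsilon> x * (P p * V))) \<partial>gauss (ix N) \<sigma>)"
      by (rule nn_integral_XV) (rule measurable_compose[OF measurable_D_PY[OF NC_carrier[OF PV]] h])
    also have "\<dots> = ?\<phi> * h (D (P p * V))"
      unfolding DE_def by (rule nn_integral_D_mult[OF \<sigma>_pos PV k h h_mult])
    finally show "(\<integral>\<^sup>+q. ?F (p, q) \<partial>distr M ?SB cur) = ?\<phi> * h (D (P p * V))" .
  qed
  also have "\<dots> = ?\<phi> * (\<integral>\<^sup>+p. h (D (P p * V)) \<partial>distr M ?SA past)"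
    by (rule nn_integral_cmult) measurable
  also have "(\<integral>\<^sup>+p. h (D (P p * V)) \<partial>distr M ?SA past) = (\<integral>\<^sup>+\<omega>. h (D (walk \<epsilon> m \<omega> * V)) \<partial>M)"
    by (subst nn_integral_distr) (auto simp: P_past)
  finally show ?thesis .
qed

lemma walk_moment:
  assumes V: "V \<in> NC N k" and k: "k \<le> N"
    and h: "h \<in> borel_measurable borel" "\<And>a b. 0 \<le> a \<Longrightarrow> 0 \<le> b \<Longrightarrow> h (a * b) = h a * h b"
  shows "(\<integral>\<^sup>+\<omega>. h (D (walk \<epsilon> m \<omega> * V)) \<partial>M) = (\<integral>\<^sup>+x. h (DE N k \<epsilon> x) \<partial>gauss (ix N) \<sigma>) ^ m * h (D V)"
proof (induction m)
  case 0
  show ?case using NC_carrier[OF V] by (simp add: walk_def emeasure_space_1)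
next
  case (Suc m)
  have "(\<integral>\<^sup>+\<omega>. h (D (walk \<epsilon> (Suc m) \<omega> * V)) \<partial>M)
    = (\<integral>\<^sup>+x. h (DE N k \<epsilon> x) \<partial>gauss (ix N) \<sigma>) * (\<integral>\<^sup>+\<omega>. h (D (walk \<epsilon> m \<omega> * V)) \<partial>M)"
    by (rule walk_step[OF V k h])
  thus ?case by (simp only: Suc power_Suc mult.assoc)
qed

lemma measurable_walk:
  assumes V: "V \<in> carrier_mat (d * N) q"
  shows "(\<lambda>\<omega>. D (walk \<epsilon> m \<omega> * V)) \<in> borel_measurable M"
proof -
  have "mat_measurable M (d * N) (d * N) (walk \<epsilon> m)"
    unfolding walk_def by (intro mat_measurable_left_product mat_measurable_compose[OF mat_measurable_PY measurable_XV])
  from borel_measurable_D[OF mat_measurable_mult[OF this mat_measurable_const[OF V]]] show ?thesis .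
qed

text \<open>The almost sure growth of ln \<open>D\<close> per step; the Lyapunov sum is this number
  divided by 2 d.\<close>

definition drift :: "nat \<Rightarrow> real \<Rightarrow> real" where
  "drift k \<epsilon> = (\<integral>x. ln (DE N k \<epsilon> x) \<partial>gauss (ix N) \<sigma>)"

text \<open>The normalized moments with exponents u and - u decay geometrically in m; the first
  controls deviations upwards, the second deviations downwards. The second needs a nonzero initial
  volume, since otherwise the moment is infinite from the start.\<close>

lemma walk_chernoff:
  assumes V: "V \<in> NC N k" and k: "k \<le> N" and \<epsilon>: "0 < \<epsilon>" and \<delta>: "0 < \<delta>"
  obtains u where "0 < u"
    "AE \<omega> in M. eventually (\<lambda>m. hpow u (D (walk \<epsilon> m \<omega> * V)) * ennreal (exp (- (real m * (u * (drift k \<epsilon> + \<delta>))))) < 1) sequentially"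
    "D V \<noteq> 0 \<Longrightarrow> AE \<omega> in M. eventually (\<lambda>m. hpow (- u) (D (walk \<epsilon> m \<omega> * V)) * ennreal (exp (real m * (u * (drift k \<epsilon> - \<delta>)))) < 1) sequentially"
proof -
  let ?L = "drift k \<epsilon>"
  obtain K where K: "0 \<le> K" "\<And>t. t \<noteq> 0 \<Longrightarrow> \<bar>t\<bar> \<le> neg_exp k / 2 \<Longrightarrow>
    (\<integral>\<^sup>+x. hpow t (DE N k \<epsilon> x) \<partial>gauss (ix N) \<sigma>) \<le> ennreal (exp (t * ?L + t\<^sup>2 * K))"
    using hpow_moment_bound[OF \<sigma>_pos k \<epsilon>] unfolding drift_def by metis
  \<comment> \<open>Small enough for the moment bound, and such that u K < \<delta>: the quadratic
    error u^2 K then loses against the gain u \<delta>, which makes the ratio \<open>r\<close> below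
    smaller than 1. Adding 1 to K avoids a division by 0.\<close>
  define u where "u = min (neg_exp k / 2) (\<delta> / (2 * (K + 1)))"
  have "0 < 2 * (K + 1)" using K(1) by simp
  hence "0 < \<delta> / (2 * (K + 1))" using \<delta> by (rule divide_pos_pos[rotated])
  hence u: "0 < u" "u \<le> neg_exp k / 2" unfolding u_def
    using neg_exp_pos(1)[of k] by (simp only: min_less_iff_conj, simp) (rule min.cobounded1)
  have "u * (K + 1) \<le> \<delta> / (2 * (K + 1)) * (K + 1)" using K(1) by (intro mult_right_mono) (auto simp: u_def)
  also have "\<dots> = \<delta> / 2" using K(1) by (simp add: field_simps)
  finally have uK: "u * K < \<delta>" using u \<delta> by (simp add: distrib_left)
  define r where "r = exp (u * (u * K - \<delta>))"
  have r: "0 \<le> r" "r < 1" using u uK by (simp_all add: r_def mult_pos_neg)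
  have *: "AE \<omega> in M. eventually (\<lambda>m. hpow t (D (walk \<epsilon> m \<omega> * V)) * ennreal (exp (- (real m * (t * ?L + u * \<delta>)))) < 1) sequentially"
    if t: "t = u \<or> t = - u" and fin: "hpow t (D V) \<noteq> \<infinity>" for t
  proof (rule summable_decay_AE)
    have t': "t \<noteq> 0" "\<bar>t\<bar> \<le> neg_exp k / 2" "t\<^sup>2 = u * u" using t u by (auto simp: power2_eq_square)
    show m: "(\<lambda>\<omega>. hpow t (D (walk \<epsilon> m \<omega> * V)) * ennreal (exp (- (real m * (t * ?L + u * \<delta>))))) \<in> borel_measurable M" for m
      using measurable_walk[OF NC_carrier[OF V]] by measurable
    show "(\<integral>\<^sup>+\<omega>. hpow t (D (walk \<epsilon> m \<omega> * V)) * ennreal (exp (- (real m * (t * ?L + u * \<delta>)))) \<partial>M) \<le> ennreal (enn2real (hpow t (D V)) * r ^ m)" for m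
    proof -
      have "(\<integral>\<^sup>+\<omega>. hpow t (D (walk \<epsilon> m \<omega> * V)) * ennreal (exp (- (real m * (t * ?L + u * \<delta>)))) \<partial>M)
        = (\<integral>\<^sup>+\<omega>. hpow t (D (walk \<epsilon> m \<omega> * V)) \<partial>M) * ennreal (exp (- (real m * (t * ?L + u * \<delta>))))"
        using measurable_walk[OF NC_carrier[OF V]] by (intro nn_integral_multc) measurable
      also have "(\<integral>\<^sup>+\<omega>. hpow t (D (walk \<epsilon> m \<omega> * V)) \<partial>M) = (\<integral>\<^sup>+x. hpow t (DE N k \<epsilon> x) \<partial>gauss (ix N) \<sigma>) ^ m * hpow t (D V)"
        by (rule walk_moment[OF V k measurable_hpow hpow_mult])
      also have "\<dots> * ennreal (exp (- (real m * (t * ?L + u * \<delta>))))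
        \<le> ennreal (exp (t * ?L + t\<^sup>2 * K)) ^ m * hpow t (D V) * ennreal (exp (- (real m * (t * ?L + u * \<delta>))))"
        by (intro mult_right_mono power_mono_ennreal K(2) t') auto
      also have "\<dots> = hpow t (D V) * ennreal (exp (t * ?L + t\<^sup>2 * K) ^ m * exp (- (real m * (t * ?L + u * \<delta>))))"
        by (simp add: ennreal_power ennreal_mult mult_ac)
      also have "exp (t * ?L + t\<^sup>2 * K) ^ m * exp (- (real m * (t * ?L + u * \<delta>))) = r ^ m"
        unfolding r_def exp_of_nat_mult[symmetric] exp_add[symmetric] t'(3) by (simp add: algebra_simps)
      also have "hpow t (D V) = ennreal (enn2real (hpow t (D V)))" using fin by (simp add: less_top)
      also have "ennreal (enn2real (hpow t (D V))) * ennreal (r ^ m) = ennreal (enn2real (hpow t (D V)) * r ^ m)"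
        by (rule ennreal_mult''[symmetric]) (use r in simp)
      finally show ?thesis .
    qed
  qed (use r in auto)
  have "hpow u (D V) \<noteq> \<infinity>" using u by (auto simp: hpow_def)
  from *[OF _ this] have 1: "AE \<omega> in M. eventually (\<lambda>m. hpow u (D (walk \<epsilon> m \<omega> * V)) * ennreal (exp (- (real m * (u * (?L + \<delta>))))) < 1) sequentially"
    by (simp add: distrib_left)
  have 2: "AE \<omega> in M. eventually (\<lambda>m. hpow (- u) (D (walk \<epsilon> m \<omega> * V)) * ennreal (exp (real m * (u * (?L - \<delta>)))) < 1) sequentially" if "D V \<noteq> 0"
  proof -
    have "hpow (- u) (D V) \<noteq> \<infinity>" using that by (simp add: hpow_def)
    from *[OF _ this] show ?thesis by (simp add: algebra_simps)
  qed
  show ?thesis by (rule that[OF u(1) 1 2])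
qed

lemma walk_upper:
  assumes V: "V \<in> NC N k" and k: "k \<le> N" and \<epsilon>: "0 < \<epsilon>" and \<delta>: "0 < \<delta>"
  shows "AE \<omega> in M. eventually (\<lambda>m. D (walk \<epsilon> m \<omega> * V) \<le> exp (real m * (drift k \<epsilon> + \<delta>))) sequentially"
proof -
  obtain u where u: "0 < u"
    "AE \<omega> in M. eventually (\<lambda>m. hpow u (D (walk \<epsilon> m \<omega> * V)) * ennreal (exp (- (real m * (u * (drift k \<epsilon> + \<delta>))))) < 1) sequentially"
    by (rule walk_chernoff[OF V k \<epsilon> \<delta>]) (rule that)
  from u(2) show ?thesis
  proof eventually_elim
    case (elim \<omega>)
    thus ?case
    proof eventually_elim
      case (elim m)
      let ?y = "D (walk \<epsilon> m \<omega> * V)" and ?c = "real m * (drift k \<epsilon> + \<delta>)"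
      have y: "0 \<le> ?y" by (rule D_real_nonneg(2)[OF NC_mult[OF walk_NC V] k])
      show ?case
      proof (cases "?y = 0")
        case False
        hence "0 < ?y" using y by simp
        hence "ennreal (?y powr u * exp (- (u * ?c))) < 1" using elim by (simp add: hpow_def ennreal_mult mult_ac)
        hence "?y powr u * exp (- (u * ?c)) < 1" by (simp add: ennreal_less_one_iff)
        hence "exp (u * ln ?y - u * ?c) < exp 0" using \<open>0 < ?y\<close> by (simp add: powr_def exp_diff exp_minus divide_inverse)
        hence "u * (ln ?y - ?c) < 0" unfolding exp_less_cancel_iff by (simp add: algebra_simps)
        hence "ln ?y < ?c" using u(1) by (simp add: mult_less_0_iff)
        thus ?thesis using \<open>0 < ?y\<close> by (metis exp_less_cancel_iff exp_ln less_imp_le)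
      qed simp
    qed
  qed
qed

lemma walk_lower:
  assumes V: "V \<in> NC N k" and k: "k \<le> N" and \<epsilon>: "0 < \<epsilon>" and \<delta>: "0 < \<delta>" and DV: "D V \<noteq> 0"
  shows "AE \<omega> in M. eventually (\<lambda>m. exp (real m * (drift k \<epsilon> - \<delta>)) \<le> D (walk \<epsilon> m \<omega> * V)) sequentially"
proof -
  obtain u where u: "0 < u"
    "AE \<omega> in M. eventually (\<lambda>m. hpow (- u) (D (walk \<epsilon> m \<omega> * V)) * ennreal (exp (real m * (u * (drift k \<epsilon> - \<delta>)))) < 1) sequentially"
  proof (rule walk_chernoff[OF V k \<epsilon> \<delta>])
    fix u assume u: "0 < u" and "D V \<noteq> 0 \<Longrightarrow>
      AE \<omega> in M. eventually (\<lambda>m. hpow (- u) (D (walk \<epsilon> m \<omega> * V)) * ennreal (exp (real m * (u * (drift k \<epsilon> - \<delta>)))) < 1) sequentially"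
    from that[OF u this(2)[OF DV]] show ?thesis .
  qed
  from u(2) show ?thesis
  proof eventually_elim
    case (elim \<omega>)
    thus ?case
    proof eventually_elim
      case (elim m)
      let ?y = "D (walk \<epsilon> m \<omega> * V)" and ?c = "real m * (drift k \<epsilon> - \<delta>)"
      have y: "0 \<le> ?y" by (rule D_real_nonneg(2)[OF NC_mult[OF walk_NC V] k])
      \<comment> \<open>A vanishing volume would make the negative power infinite, contrary to the
        bound by 1.\<close>
      have "?y \<noteq> 0"
      proof
        assume "?y = 0"
        hence "hpow (- u) ?y = \<infinity>" using u(1) by (simp add: hpow_def)
        thus False using elim by (simp add: ennreal_top_mult)
      qed
      hence yp: "0 < ?y" using y by simp
      hence "ennreal (?y powr (- u) * exp (u * ?c)) < 1" using elim by (simp add: hpow_def ennreal_mult mult_ac)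
      hence "?y powr (- u) * exp (u * ?c) < 1" by (simp add: ennreal_less_one_iff)
      hence "exp (- u * ln ?y + u * ?c) < exp 0" using yp by (simp add: powr_def flip: exp_add)
      hence "0 < u * (ln ?y - ?c)" unfolding exp_less_cancel_iff by (simp add: algebra_simps)
      hence "?c < ln ?y" using u(1) by (simp add: zero_less_mult_iff)
      thus ?case using yp by (metis exp_less_cancel_iff exp_ln less_imp_le)
    qed
  qed
qed

end

section \<open>Growth of all frames\<close>

text \<open>Induction on n: divide q minus its value at the new node a = n + 1 by the linear factor
  at a. The nodes 0, ..., n have distance at least 1 from a, so at them the quotient is bounded by
  values of q. The constant depends on t and n, but not on q.\<close>

lemma poly_interpolation_bound:
  fixes t :: complex
  shows "\<exists>C\<ge>0. \<forall>q. degree q \<le> n \<longrightarrow> cmod (poly q t) \<le> C * (\<Sum>i\<le>n. cmod (poly q (of_nat i)))"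
proof (induction n)
  case 0
  have "cmod (poly q t) \<le> 1 * (\<Sum>i\<le>0. cmod (poly q (of_nat i)))" if "degree q \<le> 0" for q
  proof -
    have "degree q = 0" using that by simp
    then obtain c where "q = [:c:]" by (rule degree_eq_zeroE)
    thus ?thesis by simp
  qed
  thus ?case by (intro exI[of _ 1]) auto
next
  case (Suc n)
  then obtain C where C: "0 \<le> C" "\<And>q. degree q \<le> n \<Longrightarrow> cmod (poly q t) \<le> C * (\<Sum>i\<le>n. cmod (poly q (of_nat i)))"
    by blast
  define a :: complex where "a = of_nat (Suc n)"
  define K where "K = cmod (t - a) * C"
  have K: "0 \<le> K" using C by (simp add: K_def)
  have "cmod (poly q t) \<le> (1 + K + K * (n + 1)) * (\<Sum>i\<le>Suc n. cmod (poly q (of_nat i)))"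
    if q: "degree q \<le> Suc n" for q
  proof -
    let ?S = "\<Sum>i\<le>Suc n. cmod (poly q (of_nat i))"
    have "poly (q - [:poly q a:]) a = 0" by simp
    then obtain r where r: "q - [:poly q a:] = [:- a, 1:] * r" unfolding poly_eq_0_iff_dvd dvd_def by blast
    have "degree r \<le> n"
    proof (cases "r = 0")
      case False
      hence "degree (q - [:poly q a:]) = Suc (degree r)" unfolding r by (subst degree_mult_eq) auto
      moreover have "degree (q - [:poly q a:]) \<le> Suc n" using q by (intro degree_diff_le) auto
      ultimately show ?thesis by simp
    qed simp
    have e: "poly q z = poly q a + (z - a) * poly r z" for z
      using arg_cong[OF r, of "\<lambda>p. poly p z"] by (simp add: algebra_simps)
    have qa: "cmod (poly q a) \<le> ?S" unfolding a_def by (rule member_le_sum[of "Suc n"]) auto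
    have ri: "cmod (poly r (of_nat i)) \<le> cmod (poly q (of_nat i)) + cmod (poly q a)" if "i \<le> n" for i
    proof -
      have "1 \<le> real (Suc n) - real i" using that by simp
      also have "\<dots> \<le> cmod (of_nat i - a)"
        using complex_Re_le_cmod[of "a - of_nat i"] by (simp add: a_def norm_minus_commute)
      finally have "cmod (poly r (of_nat i)) * 1 \<le> cmod (poly r (of_nat i)) * cmod (of_nat i - a)"
        by (intro mult_left_mono) auto
      also have "\<dots> = cmod (poly q (of_nat i) - poly q a)" using e[of "of_nat i"] by (simp add: norm_mult mult.commute)
      also have "\<dots> \<le> cmod (poly q (of_nat i)) + cmod (poly q a)" by (rule norm_triangle_ineq4)
      finally show ?thesis by simp
    qed
    have "(\<Sum>i\<le>n. cmod (poly r (of_nat i))) \<le> (\<Sum>i\<le>n. cmod (poly q (of_nat i)) + cmod (poly q a))"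
      by (intro sum_mono ri) simp
    also have "\<dots> \<le> ?S + (n + 1) * ?S"
      using qa by (simp add: sum.distrib add_mono mult_left_mono add_increasing2 sum_nonneg del: sum.atMost_Suc)
    finally have rs: "(\<Sum>i\<le>n. cmod (poly r (of_nat i))) \<le> ?S + (n + 1) * ?S" .
    have "cmod (poly q t) \<le> cmod (poly q a) + cmod (t - a) * cmod (poly r t)"
      using e[of t] norm_triangle_ineq[of "poly q a" "(t - a) * poly r t"] by (simp add: norm_mult)
    also have "\<dots> \<le> ?S + cmod (t - a) * (C * (\<Sum>i\<le>n. cmod (poly r (of_nat i))))"
      by (intro add_mono mult_left_mono C(2) qa \<open>degree r \<le> n\<close>) simp
    also have "\<dots> = ?S + K * (\<Sum>i\<le>n. cmod (poly r (of_nat i)))" by (simp add: K_def)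
    also have "\<dots> \<le> ?S + K * (?S + (n + 1) * ?S)" by (intro add_left_mono mult_left_mono rs K)
    also have "\<dots> = (1 + K + K * (n + 1)) * ?S" by (simp add: algebra_simps)
    finally show ?thesis .
  qed
  moreover have "0 \<le> 1 + K + K * (n + 1)" using K by simp
  ultimately show ?case by blast
qed

definition polyfun :: "nat \<Rightarrow> (real \<Rightarrow> complex) \<Rightarrow> bool" where
  "polyfun n f \<longleftrightarrow> (\<exists>q. degree q \<le> n \<and> (\<forall>t. f t = poly q (complex_of_real t)))"

text \<open>The coordinates are replaced by integer nodes one at a time. The order of quantifiers is
  essential: C and G are chosen before p, so the same finite grid serves the volume polynomials of
  all times m.\<close>

lemma grid_interpolation_bound:
  fixes v :: "'j \<Rightarrow> real"
  assumes "finite J"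
  shows "\<exists>C\<ge>0. \<exists>G. finite G \<and> (\<forall>g\<in>G. (\<forall>j\<in>J. g j \<in> \<nat>) \<and> (\<forall>j. j \<notin> J \<longrightarrow> g j = v j)) \<and>
    (\<forall>p :: ('j \<Rightarrow> real) \<Rightarrow> complex. (\<forall>j\<in>J. \<forall>w. polyfun n (\<lambda>t. p (w(j := t)))) \<longrightarrow>
       cmod (p v) \<le> C * (\<Sum>g\<in>G. cmod (p g)))"
  using assms
proof (induction J)
  case empty
  show ?case by (intro exI[of _ 1] conjI exI[of _ "{v}"]) auto
next
  case (insert j J)
  obtain C G where C: "0 \<le> C" and G: "finite G" "\<And>g. g \<in> G \<Longrightarrow> (\<forall>j\<in>J. g j \<in> \<nat>) \<and> (\<forall>j. j \<notin> J \<longrightarrow> g j = v j)"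
    and p: "\<And>p :: ('j \<Rightarrow> real) \<Rightarrow> complex. \<forall>j\<in>J. \<forall>w. polyfun n (\<lambda>t. p (w(j := t))) \<Longrightarrow> cmod (p v) \<le> C * (\<Sum>g\<in>G. cmod (p g))"
    using insert.IH by blast
  obtain C1 where C1: "0 \<le> C1"
    "\<And>q. degree q \<le> n \<Longrightarrow> cmod (poly q (complex_of_real (v j))) \<le> C1 * (\<Sum>i\<le>n. cmod (poly q (of_nat i)))"
    using poly_interpolation_bound[of n "complex_of_real (v j)"] by blast
  \<comment> \<open>The old grid points agree with \<open>v\<close> in coordinate j; interpolation
    in that coordinate replaces its value by the nodes 0, ..., n.\<close>
  define G' where "G' = (\<lambda>(g, i). g(j := real i)) ` (G \<times> {..n})"
  have G': "finite G'" using G(1) by (simp add: G'_def)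
  have "\<forall>g\<in>G'. (\<forall>i\<in>insert j J. g i \<in> \<nat>) \<and> (\<forall>i. i \<notin> insert j J \<longrightarrow> g i = v i)"
    using G(2) by (auto simp: G'_def)
  moreover have "cmod (p v) \<le> (C * (card G * (C1 * (n + 1)))) * (\<Sum>g\<in>G'. cmod (p g))"
    if pf: "\<forall>i\<in>insert j J. \<forall>w. polyfun n (\<lambda>t. p (w(i := t)))" for p :: "('j \<Rightarrow> real) \<Rightarrow> complex"
  proof -
    let ?S = "\<Sum>g\<in>G'. cmod (p g)"
    have "cmod (p g) \<le> C1 * ((n + 1) * ?S)" if g: "g \<in> G" for g
    proof -
      obtain q where q: "degree q \<le> n" "\<And>t. p (g(j := t)) = poly q (complex_of_real t)"
      proof -
        have "polyfun n (\<lambda>t. p (g(j := t)))" using pf by blast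
        thus ?thesis using that unfolding polyfun_def by blast
      qed
      have "g j = v j" using G(2)[OF g] insert.hyps(2) by blast
      hence "p g = poly q (complex_of_real (v j))" using q(2)[of "v j"] by (metis fun_upd_triv)
      hence "cmod (p g) \<le> C1 * (\<Sum>i\<le>n. cmod (poly q (of_nat i)))" using C1(2)[OF q(1)] by simp
      also have "(\<Sum>i\<le>n. cmod (poly q (of_nat i))) = (\<Sum>i\<le>n. cmod (p (g(j := real i))))" by (simp add: q(2))
      also have "C1 * \<dots> \<le> C1 * (\<Sum>i\<le>n. ?S)"
      proof (intro mult_left_mono sum_mono C1(1))
        fix i assume "i \<in> {..n}"
        hence "g(j := real i) \<in> G'" using g by (force simp: G'_def)
        from member_le_sum[where f = "\<lambda>g. cmod (p g)", OF this _ G']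
        show "cmod (p (g(j := real i))) \<le> ?S" by simp
      qed
      finally show ?thesis by simp
    qed
    hence "(\<Sum>g\<in>G. cmod (p g)) \<le> (\<Sum>g\<in>G. C1 * ((n + 1) * ?S))" by (rule sum_mono)
    hence "C * (\<Sum>g\<in>G. cmod (p g)) \<le> C * (\<Sum>g\<in>G. C1 * ((n + 1) * ?S))" using C by (rule mult_left_mono)
    moreover have "cmod (p v) \<le> C * (\<Sum>g\<in>G. cmod (p g))" using pf by (intro p) auto
    ultimately show ?thesis by (simp add: mult_ac)
  qed
  moreover have "0 \<le> C * (card G * (C1 * (n + 1)))" using C C1 by simp
  ultimately show ?case using G' by blast
qed

text \<open>A real t is unaffected by conjugation, so the entries of the Gram matrix are quadratic
  polynomials in t. The degree bound for the determinant is the same whatever A and B are.\<close>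

lemma polyfun_det_gram_affine:
  fixes A B :: "complex mat"
  assumes A: "A \<in> carrier_mat n m" and B: "B \<in> carrier_mat n m"
  shows "polyfun (2 * m) (\<lambda>t. Determinant.det (mat_adjoint (A + complex_of_real t \<cdot>\<^sub>m B) * (A + complex_of_real t \<cdot>\<^sub>m B)))"
proof -
  define Q where "Q i j = (\<Sum>p<n. [:cnj (A $$ (p, i)), cnj (B $$ (p, i)):] * [:A $$ (p, j), B $$ (p, j):])" for i j
  have dQ: "degree (Q i j) \<le> 2" for i j
    unfolding Q_def
  proof (rule degree_sum_le)
    fix p
    show "degree ([:cnj (A $$ (p, i)), cnj (B $$ (p, i)):] * [:A $$ (p, j), B $$ (p, j):]) \<le> 2"
      by (rule order_trans[OF degree_mult_le]) (simp add: add_mono[of _ 1 _ 1, simplified])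
  qed simp
  define q where "q = Determinant.det (mat m m (\<lambda>(i, j). Q i j))"
  have "degree q \<le> 2 * m"
    unfolding q_def by (rule degree_det_le) (use dQ in auto)
  moreover have "Determinant.det (mat_adjoint (A + complex_of_real t \<cdot>\<^sub>m B) * (A + complex_of_real t \<cdot>\<^sub>m B)) = poly q (complex_of_real t)" for t
  proof -
    let ?V = "A + complex_of_real t \<cdot>\<^sub>m B"
    have cV: "?V \<in> carrier_mat n m" using A B by simp
    have ev: "comm_ring_hom (\<lambda>p :: complex poly. poly p (complex_of_real t))" by unfold_locales auto
    have "mat_adjoint ?V * ?V = map_mat (\<lambda>p. poly p (complex_of_real t)) (mat m m (\<lambda>(i, j). Q i j))"
    proof (rule eq_matI)
      fix i j assume "i < dim_row (map_mat (\<lambda>p. poly p (complex_of_real t)) (mat m m (\<lambda>(i, j). Q i j)))"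
        "j < dim_col (map_mat (\<lambda>p. poly p (complex_of_real t)) (mat m m (\<lambda>(i, j). Q i j)))"
      hence ij: "i < m" "j < m" by auto
      have "(mat_adjoint ?V * ?V) $$ (i, j) = (\<Sum>p<n. mat_adjoint ?V $$ (i, p) * ?V $$ (p, j))"
        by (rule index_mult_mat_sum[OF mat_adjoint_carrier[OF cV] cV ij])
      also have "\<dots> = (\<Sum>p<n. (cnj (A $$ (p, i)) + complex_of_real t * cnj (B $$ (p, i))) * (A $$ (p, j) + complex_of_real t * B $$ (p, j)))"
        using A B ij by (intro sum.cong) auto
      also have "\<dots> = poly (Q i j) (complex_of_real t)" unfolding Q_def poly_sum poly_mult by simp
      finally show "(mat_adjoint ?V * ?V) $$ (i, j) = map_mat (\<lambda>p. poly p (complex_of_real t)) (mat m m (\<lambda>(i, j). Q i j)) $$ (i, j)"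
        using ij by simp
    qed (use cV in auto)
    thus ?thesis unfolding q_def using comm_ring_hom.hom_det[OF ev] by simp
  qed
  ultimately show ?thesis unfolding polyfun_def by blast
qed

section \<open>Real coordinates of frames and logarithmic volumes\<close>

context number_system begin

lemma number_block_scale:
  assumes "p < d" "r < d"
  shows "number_block \<beta> (\<lambda>a. t * q a) $$ (p, r) = complex_of_real t * number_block \<beta> q $$ (p, r)"
proof (cases rule: number_block_cases)
  case 1
  thus ?thesis using assms by (simp add: 1(3) mat_of_rows_list_def)
next
  case 2
  thus ?thesis using assms by (simp add: 2(3) mat_of_rows_list_def complex_eq_iff)
next
  case 3
  hence "p = 0 \<or> p = 1" "r = 0 \<or> r = 1" using assms by auto
  thus ?thesis by (auto simp: 3(3) mat_of_rows_list_def complex_eq_iff)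
qed

definition VM :: "nat \<Rightarrow> nat \<Rightarrow> (nat \<times> nat \<times> nat \<Rightarrow> real) \<Rightarrow> complex mat" where
  "VM n m v = number_matrix \<beta> n m (\<lambda>i j a. v (i, j, a))"

lemma VM_NC [simp, intro]: "VM n m v \<in> NC n m"
  by (simp add: VM_def number_matrix_NC)

lemma VM_cong:
  assumes "\<And>t. t \<in> {..<n} \<times> {..<m} \<times> {..<\<beta>} \<Longrightarrow> x t = y t"
  shows "VM n m x = VM n m y"
proof (rule eq_matI)
  fix i j assume "i < dim_row (VM n m y)" "j < dim_col (VM n m y)"
  hence ij: "i < d * n" "j < d * m" by (auto simp: VM_def)
  hence "number_block \<beta> (\<lambda>a. x (i div d, j div d, a)) = number_block \<beta> (\<lambda>a. y (i div d, j div d, a))"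
    by (intro number_block_cong assms) (simp add: div_d_less)
  thus "VM n m x $$ (i, j) = VM n m y $$ (i, j)" using ij by (simp add: VM_def index_number_matrix)
qed (auto simp: VM_def)

lemma VM_upd: "VM n m (v(s := t)) = VM n m (v(s := 0)) + complex_of_real t \<cdot>\<^sub>m VM n m (\<lambda>u. if u = s then 1 else 0)"
proof -
  have "v(s := t) = (\<lambda>u. (v(s := 0)) u + t * (if u = s then 1 else 0))" by auto
  hence "VM n m (v(s := t)) = VM n m (\<lambda>u. (v(s := 0)) u + t * (if u = s then 1 else 0))" by simp
  also have "\<dots> = VM n m (v(s := 0)) + complex_of_real t \<cdot>\<^sub>m VM n m (\<lambda>u. if u = s then 1 else 0)"
    by (rule eq_matI) (auto simp: VM_def index_number_matrix number_block_add number_block_scale simp del: fun_upd_apply)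
  finally show ?thesis .
qed

lemma polyfun_D:
  assumes P: "P \<in> carrier_mat q (d * n)"
  shows "polyfun (2 * (d * m)) (\<lambda>t. Determinant.det (mat_adjoint (P * VM n m (v(s := t))) * (P * VM n m (v(s := t)))))"
proof -
  let ?A = "VM n m (v(s := 0))" and ?B = "VM n m (\<lambda>u. if u = s then 1 else 0)"
  note c = NC_carrier[OF VM_NC, of n m]
  have e: "P * VM n m (v(s := t)) = P * ?A + complex_of_real t \<cdot>\<^sub>m (P * ?B)" for t
    unfolding VM_upd[of n m v s t] mult_add_distrib_mat[OF P c smult_carrier_mat[OF c]]
    using mult_smult_distrib[OF P c] by simp
  let ?g = "\<lambda>W. Determinant.det (mat_adjoint W * W)"
  obtain q where q: "degree q \<le> 2 * (d * m)" "\<And>t. ?g (P * ?A + complex_of_real t \<cdot>\<^sub>m (P * ?B)) = poly q (complex_of_real t)"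
    using polyfun_det_gram_affine[OF mult_carrier_mat[OF P c] mult_carrier_mat[OF P c]] unfolding polyfun_def by blast
  have "?g (P * VM n m (v(s := t))) = poly q (complex_of_real t)" for t
    using arg_cong[OF e, of ?g t] q(2)[of t] by (rule trans)
  with q(1) show ?thesis unfolding polyfun_def by blast
qed

text \<open>The factor 2 comes from the square root in \<open>Vol\<close>, and d from
  \<open>D\<close> being the d-th power of \<open>gram_det\<close>.\<close>

lemma ext_ln_Vol:
  assumes W: "W \<in> NC n k" and k: "k \<le> n"
  shows "ext_ln (Vol \<beta> W) = (if D W = 0 then - \<infinity> else ereal (ln (D W) / (2 * real d)))"
proof (cases "D W = 0")
  case True
  thus ?thesis using ln_gram_det(2)[OF W k] by (simp add: ext_ln_def Vol_def)
next
  case False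
  hence "gram_det \<beta> W \<noteq> 0" using ln_gram_det(2)[OF W k] by simp
  hence "0 < gram_det \<beta> W" using gram_det_power(1)[OF W k] by simp
  hence "ln (Vol \<beta> W) = ln (D W) / (2 * real d)"
    using ln_gram_det(1)[OF W k] by (simp add: Vol_def ln_sqrt)
  thus ?thesis using False \<open>0 < gram_det \<beta> W\<close> by (simp add: ext_ln_def Vol_def)
qed

lemma ext_ln_Vol_le:
  assumes W: "W \<in> NC n k" and k: "k \<le> n" and m: "0 < m" and le: "D W \<le> exp (real m * y)"
  shows "ext_ln (Vol \<beta> W) / ereal (real m) \<le> ereal (y / (2 * real d))"
proof (cases "D W = 0")
  case True
  thus ?thesis using m by (simp add: ext_ln_Vol[OF W k])
next
  case False
  hence "0 < D W" using D_real_nonneg(2)[OF W k] by simp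
  hence "ln (D W) \<le> real m * y" using le by (metis exp_gt_zero ln_exp ln_le_cancel_iff)
  hence "ln (D W) / (2 * real d) / real m \<le> y / (2 * real d)" using m d_pos by (simp add: divide_simps mult_ac del: d_pos)
  thus ?thesis using False m by (simp add: ext_ln_Vol[OF W k])
qed

lemma ext_ln_Vol_ge:
  assumes W: "W \<in> NC n k" and k: "k \<le> n" and m: "0 < m" and le: "exp (real m * y) \<le> D W"
  shows "ereal (y / (2 * real d)) \<le> ext_ln (Vol \<beta> W) / ereal (real m)"
proof -
  have "0 < D W" using le exp_gt_zero less_le_trans by blast
  hence "real m * y \<le> ln (D W)" using le by (metis exp_gt_zero ln_exp ln_le_cancel_iff)
  hence "y / (2 * real d) \<le> ln (D W) / (2 * real d) / real m" using m d_pos by (simp add: divide_simps mult_ac del: d_pos)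
  thus ?thesis using \<open>0 < D W\<close> m by (simp add: ext_ln_Vol[OF W k])
qed

lemma independent_columns_E:
  assumes k: "k \<le> N"
  shows "independent_columns \<beta> k (E N k)"
  unfolding independent_columns_def
proof (intro ballI impI)
  fix a assume a: "a \<in> NC k 1" and z: "E N k * a = 0\<^sub>m (dim_row (E N k)) d"
  have ca: "a \<in> carrier_mat (d * k) d" using NC_carrier[OF a] by simp
  note cE = E_carrier[where n = N and k = k]
  have "a = mat_adjoint (E N k) * E N k * a" using ca by (simp add: adjoint_E_E[OF k])
  also have "\<dots> = mat_adjoint (E N k) * (E N k * a)" by (rule assoc_mult_mat[OF mat_adjoint_carrier[OF cE] cE ca])
  also have "\<dots> = 0\<^sub>m (d * k) d" unfolding z using carrier_matD[OF cE] by simp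
  finally show "a = 0\<^sub>m (d * k) d" .
qed

end

context gaussian_matrices begin

text \<open>Frames with natural coordinates and tolerances 1 / (i + 1) are countably many, so one
  null set serves them all. For an arbitrary frame the interpolation bound is applied at every time
  m with the same constant and the same grid.\<close>

lemma walk_upper_all:
  assumes k: "k \<le> N" and \<epsilon>: "0 < \<epsilon>"
  shows "AE \<omega> in M. \<forall>V\<in>NC N k. \<forall>\<delta>>0. eventually (\<lambda>m. D (walk \<epsilon> m \<omega> * V) \<le> exp (real m * (drift k \<epsilon> + \<delta>))) sequentially"
proof -
  define J where "J = {..<N} \<times> {..<k} \<times> {..<\<beta>}"
  define Gr where "Gr = (\<lambda>f. VM N k (\<lambda>t. real (f t))) ` (PiE J (\<lambda>_. UNIV :: nat set))"
  have "countable Gr" unfolding Gr_def by (intro countable_image countable_PiE) (auto simp: J_def)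
  moreover have "AE \<omega> in M. \<forall>i. eventually (\<lambda>m. D (walk \<epsilon> m \<omega> * g) \<le> exp (real m * (drift k \<epsilon> + 1 / real (Suc i)))) sequentially"
    if "g \<in> Gr" for g
  proof -
    have "g \<in> NC N k" using that by (auto simp: Gr_def)
    thus ?thesis by (subst AE_all_countable) (auto intro!: walk_upper k \<epsilon>)
  qed
  ultimately have "AE \<omega> in M. \<forall>g\<in>Gr. \<forall>i. eventually (\<lambda>m. D (walk \<epsilon> m \<omega> * g) \<le> exp (real m * (drift k \<epsilon> + 1 / real (Suc i)))) sequentially"
    by (subst AE_ball_countable) auto
  thus ?thesis
  proof eventually_elim
    case (elim \<omega>)
    show ?case
    proof (intro ballI allI impI)
      fix V and \<delta> :: real assume V: "V \<in> NC N k" and \<delta>: "0 < \<delta>"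
      obtain i where i: "1 / real (Suc i) < \<delta>" using \<delta> by (metis reals_Archimedean inverse_eq_divide)
      define v where "v = (\<lambda>(i, j, a). comps V i j a)"
      have Vv: "V = VM N k v" using NC_number_matrix_comps[OF V] by (simp add: VM_def v_def)
      have "finite J" by (simp add: J_def)
      from grid_interpolation_bound[OF this, of v "2 * (d * k)"]
      obtain C G where C: "0 \<le> C" and G: "finite G" "\<And>g. g \<in> G \<Longrightarrow> \<forall>j\<in>J. g j \<in> \<nat>"
        and ip: "\<And>p :: (nat \<times> nat \<times> nat \<Rightarrow> real) \<Rightarrow> complex. \<forall>j\<in>J. \<forall>w. polyfun (2 * (d * k)) (\<lambda>t. p (w(j := t)))
            \<Longrightarrow> cmod (p v) \<le> C * (\<Sum>g\<in>G. cmod (p g))"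
        by blast
      have GGr: "VM N k g \<in> Gr" if g: "g \<in> G" for g
      proof -
        have "\<forall>t\<in>J. \<exists>n. g t = real n" using G(2)[OF g] by (auto simp: Nats_def)
        then obtain f where f: "\<And>t. t \<in> J \<Longrightarrow> g t = real (f t)" by metis
        have "VM N k g = VM N k (\<lambda>t. real (restrict f J t))" by (rule VM_cong) (simp add: f flip: J_def)
        thus ?thesis unfolding Gr_def by (rule image_eqI[where x = "restrict f J"]) simp
      qed
      have bound: "D (walk \<epsilon> m \<omega> * V) \<le> C * (\<Sum>g\<in>G. D (walk \<epsilon> m \<omega> * VM N k g))" for m
      proof -
        let ?p = "\<lambda>w. Determinant.det (mat_adjoint (walk \<epsilon> m \<omega> * VM N k w) * (walk \<epsilon> m \<omega> * VM N k w))"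
        have pD: "?p w = complex_of_real (D (walk \<epsilon> m \<omega> * VM N k w))" "0 \<le> D (walk \<epsilon> m \<omega> * VM N k w)" for w
          using D_real_nonneg[OF NC_mult[OF walk_NC VM_NC] k] by auto
        have "cmod (?p v) \<le> C * (\<Sum>g\<in>G. cmod (?p g))"
          by (rule ip) (use polyfun_D[OF NC_carrier[OF walk_NC]] in blast)
        thus ?thesis unfolding pD(1) Vv using pD(2) by simp
      qed
      \<comment> \<open>A constant factor does not affect exponential rates: it is absorbed by the
        gap \<delta> - 1 / (i + 1) in the exponent once m is large.\<close>
      define B where "B = C * real (card G)"
      have ev1: "eventually (\<lambda>m. \<forall>g\<in>G. D (walk \<epsilon> m \<omega> * VM N k g) \<le> exp (real m * (drift k \<epsilon> + 1 / real (Suc i)))) sequentially"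
        using G(1) elim GGr by (intro eventually_ball_finite) auto
      have ev2: "eventually (\<lambda>m. B \<le> exp (real m * (\<delta> - 1 / real (Suc i)))) sequentially"
      proof -
        have "filterlim (\<lambda>m. exp (real m * (\<delta> - 1 / real (Suc i)))) at_top sequentially"
          using i by (intro filterlim_compose[OF exp_at_top] filterlim_at_top_mult_tendsto_pos[where c = "\<delta> - 1 / real (Suc i)"]
            filterlim_real_sequentially) (auto simp: mult.commute)
        thus ?thesis by (simp add: filterlim_at_top)
      qed
      from ev1 ev2 show "eventually (\<lambda>m. D (walk \<epsilon> m \<omega> * V) \<le> exp (real m * (drift k \<epsilon> + \<delta>))) sequentially"
      proof eventually_elim
        case (elim m)
        have "D (walk \<epsilon> m \<omega> * V) \<le> C * (\<Sum>g\<in>G. exp (real m * (drift k \<epsilon> + 1 / real (Suc i))))"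
          using elim(1) C by (intro order_trans[OF bound] mult_left_mono sum_mono) auto
        also have "\<dots> = B * exp (real m * (drift k \<epsilon> + 1 / real (Suc i)))" by (simp add: B_def)
        also have "\<dots> \<le> exp (real m * (\<delta> - 1 / real (Suc i))) * exp (real m * (drift k \<epsilon> + 1 / real (Suc i)))"
          using elim(2) by (intro mult_right_mono) auto
        also have "\<dots> = exp (real m * (drift k \<epsilon> + \<delta>))" by (simp add: algebra_simps flip: exp_add)
        finally show ?case .
      qed
    qed
  qed
qed

text \<open>The upper bound for all frames limits every growth rate that exists. The standard frame
  has an actual limit, by the lower bound for this one frame, and so the supremum is attained
  there.\<close>

lemma Sup_growth_rates:
  assumes k: "k \<le> N" and \<epsilon>: "0 < \<epsilon>"
  shows "AE \<omega> in M. Sup (growth_rates \<beta> N (\<lambda>m. PY N \<epsilon> (XV m \<omega>)) k) = ereal (drift k \<epsilon> / (2 * real d))"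
proof -
  let ?L = "drift k \<epsilon>" and ?l = "drift k \<epsilon> / (2 * real d)"
  have EN: "E N k \<in> NC N k" by (rule E_NC[OF k])
  have DE: "D (E N k) \<noteq> 0" by (simp add: D_def adjoint_E_E[OF k])
  have "AE \<omega> in M. \<forall>i. eventually (\<lambda>m. exp (real m * (?L - 1 / real (Suc i))) \<le> D (walk \<epsilon> m \<omega> * E N k)) sequentially"
    by (subst AE_all_countable) (auto intro!: walk_lower EN k \<epsilon> DE)
  with walk_upper_all[OF assms] show ?thesis
  proof eventually_elim
    case (elim \<omega>)
    let ?f = "\<lambda>V m. ext_ln (Vol \<beta> (walk \<epsilon> m \<omega> * V)) / ereal (real m)"
    have up: "eventually (\<lambda>m. ?f V m \<le> ereal ((?L + \<delta>) / (2 * real d))) sequentially" if "V \<in> NC N k" "0 < \<delta>" for V \<delta>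
    proof -
      have "eventually (\<lambda>m. D (walk \<epsilon> m \<omega> * V) \<le> exp (real m * (?L + \<delta>))) sequentially" using elim(1) that by blast
      with eventually_gt_at_top[of 0] show ?thesis
        by eventually_elim (rule ext_ln_Vol_le[OF NC_mult[OF walk_NC that(1)] k])
    qed
    have lo: "eventually (\<lambda>m. ereal ((?L - 1 / real (Suc i)) / (2 * real d)) \<le> ?f (E N k) m) sequentially" for i
    proof -
      have "eventually (\<lambda>m. exp (real m * (?L - 1 / real (Suc i))) \<le> D (walk \<epsilon> m \<omega> * E N k)) sequentially" using elim(2) by blast
      with eventually_gt_at_top[of 0] show ?thesis
        by eventually_elim (rule ext_ln_Vol_ge[OF NC_mult[OF walk_NC EN] k])
    qed
    have up': "eventually (\<lambda>m. ?f V m < b) sequentially" if V: "V \<in> NC N k" and b: "ereal ?l < b" for V b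
    proof -
      obtain r where r: "ereal ?l < ereal r" "ereal r < b" using ereal_dense2[OF b] by blast
      have "0 < (r - ?l) * (2 * real d)" using r(1) by simp
      from up[OF V this] have "eventually (\<lambda>m. ?f V m \<le> ereal r) sequentially"
        by (simp add: field_simps)
      thus ?thesis using r(2) by (auto elim: eventually_mono intro: le_less_trans)
    qed
    have lo': "eventually (\<lambda>m. b < ?f (E N k) m) sequentially" if b: "b < ereal ?l" for b
    proof -
      obtain r where r: "b < ereal r" "ereal r < ereal ?l" using ereal_dense2[OF b] by blast
      have "0 < (?l - r) * (2 * real d)" using r(2) by simp
      then obtain i where i: "1 / real (Suc i) < (?l - r) * (2 * real d)" by (metis reals_Archimedean inverse_eq_divide)
      moreover have "r < (y - e) / z" if "e < (y / z - r) * z" "0 < z" for e y z :: real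
      proof -
        have "e / z < y / z - r" using that by (simp only: pos_divide_less_eq)
        thus ?thesis by (simp add: diff_divide_distrib)
      qed
      ultimately have "r < (?L - 1 / real (Suc i)) / (2 * real d)" by simp
      hence "b < ereal ((?L - 1 / real (Suc i)) / (2 * real d))" using r(1) by (metis less_ereal.simps(1) less_trans)
      with lo[of i] show ?thesis by (auto elim: eventually_mono intro: less_le_trans)
    qed
    have lim: "?f (E N k) \<longlonglongrightarrow> ereal ?l"
      by (rule order_tendstoI) (use up'[OF EN] lo' in auto)
    have le: "L \<le> ereal ?l" if V: "V \<in> NC N k" and L: "?f V \<longlonglongrightarrow> L" for V L
    proof (rule dense_ge)
      fix b assume "ereal ?l < b"
      from up'[OF V this] have "eventually (\<lambda>m. ?f V m \<le> b) sequentially" by eventually_elim simp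
      thus "L \<le> b" using L by (intro tendsto_upperbound[of "?f V" L sequentially]) auto
    qed
    have gr: "growth_rates \<beta> N (\<lambda>m. PY N \<epsilon> (XV m \<omega>)) k = {L. \<exists>V\<in>NC N k. independent_columns \<beta> k V \<and> ?f V \<longlonglongrightarrow> L}"
      by (simp add: growth_rates_def walk_def)
    show ?case
    proof (rule antisym)
      show "Sup (growth_rates \<beta> N (\<lambda>m. PY N \<epsilon> (XV m \<omega>)) k) \<le> ereal ?l"
        unfolding gr using le by (intro Sup_least) blast
      show "ereal ?l \<le> Sup (growth_rates \<beta> N (\<lambda>m. PY N \<epsilon> (XV m \<omega>)) k)"
        unfolding gr using lim EN independent_columns_E[OF k] by (intro Sup_upper) blast
    qed
  qed
qed

section \<open>Lyapunov sums and the expected log determinant\<close>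

lemma perturbed_identity_XV: "perturbed_identity \<beta> N c (X m \<omega>) = PY N (1 / c) (XV m \<omega>)"
proof -
  have "number_matrix \<beta> N N (X m \<omega>) = NM N (\<lambda>(i, j, a). X m \<omega> i j a)" by (simp add: NM_def)
  also have "\<dots> = NM N (XV m \<omega>)" by (rule NM_cong) (auto simp: XV_def)
  finally show ?thesis by (simp add: perturbed_identity_def PY_def)
qed

lemma lyapunov_sum_eq:
  assumes k: "k \<le> N" and c: "0 < c"
  shows "lyapunov_sum M \<beta> N (\<lambda>m \<omega>. perturbed_identity \<beta> N c (X m \<omega>)) k = drift k (1 / c) / (2 * real d)"
  unfolding lyapunov_sum_def perturbed_identity_XV
proof (rule the_equality)
  have "0 < 1 / c" using c by simp
  note S = Sup_growth_rates[OF k this]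
  show "AE \<omega> in M. Sup (growth_rates \<beta> N (\<lambda>m. PY N (1 / c) (XV m \<omega>)) k) = ereal (drift k (1 / c) / (2 * real d))"
    by (rule S)
  fix l assume "AE \<omega> in M. Sup (growth_rates \<beta> N (\<lambda>m. PY N (1 / c) (XV m \<omega>)) k) = ereal l"
  \<comment> \<open>Two constants that agree almost surely on a probability space are equal, which
    gives uniqueness for the \<open>THE\<close> in \<open>lyapunov_sum\<close>.\<close>
  with S have "AE \<omega> in M. l = drift k (1 / c) / (2 * real d)" by eventually_elim simp
  thus "l = drift k (1 / c) / (2 * real d)" by simp
qed

text \<open>The empty frame has determinant 1, so the telescoping sum of the exponents starts from
  0.\<close>

lemma drift_0: "drift 0 \<epsilon> = 0"
proof -
  have "DE N 0 \<epsilon> x = 1" for x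
  proof -
    have "PY N \<epsilon> x * E N 0 \<in> carrier_mat (d * N) (d * 0)" using NC_carrier[OF NC_mult[OF PY_NC E_NC]] by blast
    from mult_carrier_mat[OF mat_adjoint_carrier[OF this] this] show ?thesis by (simp add: DE_def D_def)
  qed
  thus ?thesis by (simp add: drift_def)
qed

lemma sum_lyapunov_exponents:
  assumes k: "k \<le> N" and c: "0 < c"
  shows "(\<Sum>i=1..k. lyapunov_exponent M \<beta> N (\<lambda>m \<omega>. perturbed_identity \<beta> N c (X m \<omega>)) i) = drift k (1 / c) / (2 * real d)"
proof -
  let ?s = "lyapunov_sum M \<beta> N (\<lambda>m \<omega>. perturbed_identity \<beta> N c (X m \<omega>))"
  have "(\<Sum>i=1..k. ?s i - ?s (i - 1)) = ?s k - ?s 0" by (induction k) auto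
  thus ?thesis unfolding lyapunov_exponent_def using lyapunov_sum_eq[OF k c] lyapunov_sum_eq[of 0, OF _ c] drift_0 by simp
qed

lemma ln_gram_det_first_columns:
  assumes k: "k \<le> N" and c: "0 < c"
  shows "integrable M (\<lambda>\<omega>. ln (gram_det \<beta> (first_columns \<beta> k (perturbed_identity \<beta> N c (X m \<omega>)))))"
    "(\<integral>\<omega>. ln (gram_det \<beta> (first_columns \<beta> k (perturbed_identity \<beta> N c (X m \<omega>)))) \<partial>M) = drift k (1 / c) / real d"
proof -
  have e: "ln (gram_det \<beta> (first_columns \<beta> k (perturbed_identity \<beta> N c (X m \<omega>)))) = ln (DE N k (1 / c) (XV m \<omega>)) / real d" for \<omega>
    unfolding perturbed_identity_XV first_columns_eq_mult[OF NC_carrier[OF PY_NC] k] DE_def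
    by (rule ln_gram_det(1)[OF NC_mult[OF PY_NC E_NC[OF k]] k])
  have m: "(\<lambda>x. ln (DE N k (1 / c) x)) \<in> borel_measurable (PL (ix N))" by measurable
  have "integrable M (\<lambda>\<omega>. ln (DE N k (1 / c) (XV m \<omega>)))"
    unfolding integral_XV(2)[OF m] using c by (intro DE_integrability(5)[OF \<sigma>_pos k]) simp
  thus "integrable M (\<lambda>\<omega>. ln (gram_det \<beta> (first_columns \<beta> k (perturbed_identity \<beta> N c (X m \<omega>)))))"
    unfolding e by (rule integrable_divide)
  show "(\<integral>\<omega>. ln (gram_det \<beta> (first_columns \<beta> k (perturbed_identity \<beta> N c (X m \<omega>)))) \<partial>M) = drift k (1 / c) / real d"
    unfolding e using integral_XV(1)[OF m, of m] by (simp add: drift_def)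
qed

end

section \<open>The expected second-order term\<close>

context number_system begin

text \<open>The sign that component a of a number acquires under conjugation.\<close>

definition csg :: "nat \<Rightarrow> real" where
  "csg a = (if a = 0 then 1 else -1)"

lemma mat_adjoint_number_matrix:
  "mat_adjoint (number_matrix \<beta> n m x) = number_matrix \<beta> m n (\<lambda>i j a. csg a * x j i a)"
proof (rule eq_matI)
  fix i j assume "i < dim_row (number_matrix \<beta> m n (\<lambda>i j a. csg a * x j i a))"
    "j < dim_col (number_matrix \<beta> m n (\<lambda>i j a. csg a * x j i a))"
  hence ij: "i < d * m" "j < d * n" by auto
  have "mat_adjoint (number_matrix \<beta> n m x) $$ (i, j) = cnj (number_matrix \<beta> n m x $$ (j, i))"
    using ij by (intro index_mat_adjoint) auto
  also have "\<dots> = number_matrix \<beta> m n (\<lambda>i j a. csg a * x j i a) $$ (i, j)"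
  proof (cases rule: number_block_cases)
    case 1
    show ?thesis using ij by (simp add: index_number_matrix 1(2,3) mat_of_rows_list_def csg_def)
  next
    case 2
    show ?thesis using ij by (simp add: index_number_matrix 2(2,3) mat_of_rows_list_def csg_def complex_eq_iff)
  next
    case 3
    note ix = index_number_matrix_quaternion[OF 3(2,3)]
    show ?thesis
      using ij by (cases i rule: parity_cases; cases j rule: parity_cases)
        (simp_all add: ix 3(2) complex_eq_iff csg_def)
  qed
  finally show "mat_adjoint (number_matrix \<beta> n m x) $$ (i, j) = number_matrix \<beta> m n (\<lambda>i j a. csg a * x j i a) $$ (i, j)" .
qed auto

lemma first_columns_number_matrix:
  assumes "k \<le> m"
  shows "first_columns \<beta> k (number_matrix \<beta> n m x) = number_matrix \<beta> n k x"
  by (rule eq_matI) (use mult_block_less[OF assms] in \<open>auto simp: first_columns_def index_number_matrix\<close>)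

lemma number_matrix_mult_E:
  assumes "k \<le> m"
  shows "number_matrix \<beta> n m x * E m k = number_matrix \<beta> n k x"
  using first_columns_eq_mult[OF number_matrix_carrier assms] first_columns_number_matrix[OF assms] by simp

lemma EB_eq: "k \<le> N \<Longrightarrow> EB N k x = number_matrix \<beta> N k (\<lambda>i j a. x (i, j, a))"
  unfolding EB_def NM_def by (rule number_matrix_mult_E)

text \<open>H is the sum of X and its adjoint, cut down to the first k block rows and
  columns.\<close>

lemma EH_eq:
  assumes k: "k \<le> N"
  shows "EH N k x = number_matrix \<beta> k k (\<lambda>i j a. csg a * x (j, i, a) + x (i, j, a))"
proof -
  have 1: "mat_adjoint (EB N k x) * E N k = number_matrix \<beta> k k (\<lambda>i j a. csg a * x (j, i, a))"
    unfolding EB_eq[OF k] mat_adjoint_number_matrix by (rule number_matrix_mult_E[OF k])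
  have "mat_adjoint (E N k) * EB N k x = mat_adjoint (mat_adjoint (EB N k x) * E N k)"
    by (simp only: mat_adjoint_mult[OF mat_adjoint_carrier[OF EB_carrier] E_carrier] mat_adjoint_adjoint)
  also have "\<dots> = number_matrix \<beta> k k (\<lambda>i j a. csg a * (csg a * x (i, j, a)))"
    unfolding 1 by (rule mat_adjoint_number_matrix)
  also have "\<dots> = number_matrix \<beta> k k (\<lambda>i j a. x (i, j, a))"
  proof -
    have "csg a * (csg a * y) = y" for a and y :: real by (simp add: csg_def)
    thus ?thesis by (simp only:)
  qed
  finally have 2: "mat_adjoint (E N k) * EB N k x = number_matrix \<beta> k k (\<lambda>i j a. x (i, j, a))" .
  show ?thesis unfolding EH_def 1 2
    by (rule eq_matI) (auto simp: index_number_matrix number_block_add)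
qed

lemma mtrace_number_matrix: "Re (mtrace (number_matrix \<beta> n n y)) = real d * (\<Sum>i<n. y i i 0)"
proof -
  have b: "Re (number_block \<beta> q $$ (p, p)) = q 0" if "p < d" for p q
  proof (cases rule: number_block_cases)
    case 1
    thus ?thesis using that by (simp add: 1(3) mat_of_rows_list_def)
  next
    case 2
    thus ?thesis using that by (simp add: 2(3) mat_of_rows_list_def)
  next
    case 3
    hence "p = 0 \<or> p = 1" using that by auto
    thus ?thesis by (auto simp: 3(3) mat_of_rows_list_def)
  qed
  have "Re (mtrace (number_matrix \<beta> n n y)) = (\<Sum>i<n. \<Sum>p<d. Re (number_matrix \<beta> n n y $$ (d * i + p, d * i + p)))"
    unfolding mtrace_carrier[OF number_matrix_carrier] Re_sum by (rule sum_blocks)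
  also have "\<dots> = (\<Sum>i<n. \<Sum>p<d. y i i 0)"
  proof (intro sum.cong refl)
    fix i p assume "i \<in> {..<n}" "p \<in> {..<d}"
    hence ip: "i < n" "p < d" by auto
    hence "d * i + p < d * Suc i" by simp
    also have "d * Suc i \<le> d * n" using ip by (intro mult_le_mono2) simp
    finally show "Re (number_matrix \<beta> n n y $$ (d * i + p, d * i + p)) = y i i 0"
      using ip b[OF ip(2)] by (simp add: index_number_matrix)
  qed
  finally show ?thesis by (simp add: sum_distrib_left)
qed

lemma EQ_eq:
  assumes k: "k \<le> N"
  shows "EQ N k \<epsilon> x = \<epsilon> * (real d * (\<Sum>i<k. 2 * x (i, i, 0)))
    + \<epsilon>\<^sup>2 * (real d * (\<Sum>i<N. \<Sum>j<k. \<Sum>a<\<beta>. (x (i, j, a))\<^sup>2)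
      - real d * (\<Sum>i<k. \<Sum>j<k. \<Sum>a<\<beta>. (csg a * x (j, i, a) + x (i, j, a))\<^sup>2) / 2)"
  unfolding EQ_def EH_eq[OF k] EB_eq[OF k] frob2_number_matrix mtrace_number_matrix by (simp add: csg_def)

end

context gaussian_matrices begin

lemma component_moments:
  assumes t: "t \<in> ix N"
  shows "integrable M (\<lambda>\<omega>. XV m \<omega> t)" "expectation (\<lambda>\<omega>. XV m \<omega> t) = 0"
    "integrable M (\<lambda>\<omega>. (XV m \<omega> t)\<^sup>2)" "expectation (\<lambda>\<omega>. (XV m \<omega> t)\<^sup>2) = \<sigma>\<^sup>2"
proof -
  note dist = distributed_X[OF t, of m]
  have i: "integrable lborel (\<lambda>x. normal_density 0 \<sigma> x * x ^ p)" for p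
    using integrable_normal_moment[OF \<sigma>_pos, of 0 p] by simp
  show "integrable M (\<lambda>\<omega>. XV m \<omega> t)"
    using distributed_integrable[OF dist, of "\<lambda>x. x"] i[of 1] by simp
  show e: "expectation (\<lambda>\<omega>. XV m \<omega> t) = 0"
    by (rule normal_distributed_expectation[OF \<sigma>_pos dist])
  show "integrable M (\<lambda>\<omega>. (XV m \<omega> t)\<^sup>2)"
    using distributed_integrable[OF dist, of "\<lambda>x. x\<^sup>2"] i[of 2] by simp
  show "expectation (\<lambda>\<omega>. (XV m \<omega> t)\<^sup>2) = \<sigma>\<^sup>2"
    using normal_distributed_variance[OF \<sigma>_pos dist] by (simp add: e)
qed

lemma component_uncorrelated:
  assumes s: "s \<in> ix N" and t: "t \<in> ix N" and "s \<noteq> t"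
  shows "integrable M (\<lambda>\<omega>. XV m \<omega> s * XV m \<omega> t)" "expectation (\<lambda>\<omega>. XV m \<omega> s * XV m \<omega> t) = 0"
proof -
  have ind: "indep_vars (\<lambda>_. borel) (\<lambda>t \<omega>. XV m \<omega> t) {s, t}"
    by (rule indep_vars_subset[OF indep_XV_fixed]) (use s t in simp)
  have fin: "finite {s, t}" by simp
  have int: "integrable M (\<lambda>\<omega>. XV m \<omega> i)" if "i \<in> {s, t}" for i
    by (rule component_moments(1)) (use that s t in auto)
  show "integrable M (\<lambda>\<omega>. XV m \<omega> s * XV m \<omega> t)"
    using indep_vars_integrable[OF fin ind int] \<open>s \<noteq> t\<close> by simp
  show "expectation (\<lambda>\<omega>. XV m \<omega> s * XV m \<omega> t) = 0"
    using indep_vars_lebesgue_integral[OF fin ind int] \<open>s \<noteq> t\<close> component_moments(2)[OF s, of m] by simp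
qed

text \<open>On the diagonal the real component doubles and the others cancel, giving 4 \<sigma>^2 or
  0. Off the diagonal two independent components are added up to sign, and the mixed term has mean
  0.\<close>

lemma hermitian_part_moment:
  assumes ij: "i < N" "j < N" "a < \<beta>"
  shows "integrable M (\<lambda>\<omega>. (csg a * XV m \<omega> (j, i, a) + XV m \<omega> (i, j, a))\<^sup>2)"
    "expectation (\<lambda>\<omega>. (csg a * XV m \<omega> (j, i, a) + XV m \<omega> (i, j, a))\<^sup>2)
      = (if i = j then if a = 0 then 4 * \<sigma>\<^sup>2 else 0 else 2 * \<sigma>\<^sup>2)"
proof -
  have t: "(i, j, a) \<in> ix N" "(j, i, a) \<in> ix N" using ij by (auto simp: ix_def)
  have "integrable M (\<lambda>\<omega>. (csg a * XV m \<omega> (j, i, a) + XV m \<omega> (i, j, a))\<^sup>2) \<and>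
    expectation (\<lambda>\<omega>. (csg a * XV m \<omega> (j, i, a) + XV m \<omega> (i, j, a))\<^sup>2)
      = (if i = j then if a = 0 then 4 * \<sigma>\<^sup>2 else 0 else 2 * \<sigma>\<^sup>2)"
  proof (cases "i = j")
    case True
    have "(csg a * XV m \<omega> (j, i, a) + XV m \<omega> (i, j, a))\<^sup>2 = (if a = 0 then 4 else 0) * (XV m \<omega> (i, j, a))\<^sup>2" for \<omega>
      using True by (auto simp: csg_def power2_eq_square)
    thus ?thesis using component_moments(3,4)[OF t(1), of m] True by simp
  next
    case False
    have e: "(csg a * XV m \<omega> (j, i, a) + XV m \<omega> (i, j, a))\<^sup>2
      = (XV m \<omega> (j, i, a))\<^sup>2 + (2 * csg a * (XV m \<omega> (j, i, a) * XV m \<omega> (i, j, a)) + (XV m \<omega> (i, j, a))\<^sup>2)" for \<omega>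
      by (simp add: csg_def power2_eq_square algebra_simps)
    have "(j, i, a) \<noteq> (i, j, a)" using False by simp
    note u = component_uncorrelated[OF t(2,1) this, of m]
    note m = component_moments(3,4)[OF t(1), of m] component_moments(3,4)[OF t(2), of m]
    have i: "integrable M (\<lambda>\<omega>. 2 * csg a * (XV m \<omega> (j, i, a) * XV m \<omega> (i, j, a)))"
      using u(1) by (rule integrable_mult_right)
    show ?thesis unfolding e using m u i False by simp
  qed
  thus "integrable M (\<lambda>\<omega>. (csg a * XV m \<omega> (j, i, a) + XV m \<omega> (i, j, a))\<^sup>2)"
    "expectation (\<lambda>\<omega>. (csg a * XV m \<omega> (j, i, a) + XV m \<omega> (i, j, a))\<^sup>2)
      = (if i = j then if a = 0 then 4 * \<sigma>\<^sup>2 else 0 else 2 * \<sigma>\<^sup>2)" by auto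
qed

text \<open>The linear term has mean 0. In units of d \<sigma>^2, the mean squared norm of B is N k
  \<beta>, and half that of H is k^2 \<beta> + k (2 - \<beta>); their difference is k (\<beta> (N -
  k + 1) - 2).\<close>

lemma expectation_EQ:
  assumes k: "k \<le> N"
  shows "integrable M (\<lambda>\<omega>. EQ N k \<epsilon> (XV m \<omega>))"
    "expectation (\<lambda>\<omega>. EQ N k \<epsilon> (XV m \<omega>)) = \<epsilon>\<^sup>2 * real d * \<sigma>\<^sup>2 * real k * (real \<beta> * (real N - real k + 1) - 2)"
proof -
  have \<beta>: "0 < \<beta>" using dyson_index by auto
  have i1: "integrable M (\<lambda>\<omega>. 2 * XV m \<omega> (i, i, 0))" "expectation (\<lambda>\<omega>. 2 * XV m \<omega> (i, i, 0)) = 0" if "i < k" for i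
  proof -
    have "(i, i, 0) \<in> ix N" using that k \<beta> by (auto simp: ix_def)
    from component_moments(1,2)[OF this, of m]
    show "integrable M (\<lambda>\<omega>. 2 * XV m \<omega> (i, i, 0))" "expectation (\<lambda>\<omega>. 2 * XV m \<omega> (i, i, 0)) = 0" by auto
  qed
  have i2: "integrable M (\<lambda>\<omega>. (XV m \<omega> (i, j, a))\<^sup>2)" "expectation (\<lambda>\<omega>. (XV m \<omega> (i, j, a))\<^sup>2) = \<sigma>\<^sup>2"
    if "i < N" "j < k" "a < \<beta>" for i j a
  proof -
    have "(i, j, a) \<in> ix N" using that k by (auto simp: ix_def)
    from component_moments(3,4)[OF this, of m]
    show "integrable M (\<lambda>\<omega>. (XV m \<omega> (i, j, a))\<^sup>2)" "expectation (\<lambda>\<omega>. (XV m \<omega> (i, j, a))\<^sup>2) = \<sigma>\<^sup>2" by auto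
  qed
  let ?T = "\<lambda>\<omega>. \<Sum>i<k. 2 * XV m \<omega> (i, i, 0)"
  let ?B = "\<lambda>\<omega>. \<Sum>i<N. \<Sum>j<k. \<Sum>a<\<beta>. (XV m \<omega> (i, j, a))\<^sup>2"
  let ?H = "\<lambda>\<omega>. \<Sum>i<k. \<Sum>j<k. \<Sum>a<\<beta>. (csg a * XV m \<omega> (j, i, a) + XV m \<omega> (i, j, a))\<^sup>2"
  note h = hermitian_part_moment[of _ _ _ m]
  have T: "integrable M ?T" "expectation ?T = 0"
    using i1 by (auto simp: Bochner_Integration.integral_sum)
  have B: "integrable M ?B" using i2(1) by (intro Bochner_Integration.integrable_sum) auto
  have "expectation ?B = (\<Sum>i<N. \<Sum>j<k. \<Sum>a<\<beta>. \<sigma>\<^sup>2)"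
  proof -
    have "expectation ?B = (\<Sum>i<N. expectation (\<lambda>\<omega>. \<Sum>j<k. \<Sum>a<\<beta>. (XV m \<omega> (i, j, a))\<^sup>2))"
      by (intro Bochner_Integration.integral_sum Bochner_Integration.integrable_sum i2(1)) auto
    also have "\<dots> = (\<Sum>i<N. \<Sum>j<k. expectation (\<lambda>\<omega>. \<Sum>a<\<beta>. (XV m \<omega> (i, j, a))\<^sup>2))"
      by (intro sum.cong refl Bochner_Integration.integral_sum Bochner_Integration.integrable_sum i2(1)) auto
    also have "\<dots> = (\<Sum>i<N. \<Sum>j<k. \<Sum>a<\<beta>. expectation (\<lambda>\<omega>. (XV m \<omega> (i, j, a))\<^sup>2))"
      by (intro sum.cong refl Bochner_Integration.integral_sum i2(1)) auto
    also have "\<dots> = (\<Sum>i<N. \<Sum>j<k. \<Sum>a<\<beta>. \<sigma>\<^sup>2)"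
      by (intro sum.cong refl i2(2)) auto
    finally show ?thesis .
  qed
  hence B2: "expectation ?B = real N * real k * real \<beta> * \<sigma>\<^sup>2" by simp
  have H: "integrable M ?H" using k by (intro Bochner_Integration.integrable_sum h(1)) auto
  have "expectation ?H = (\<Sum>i<k. \<Sum>j<k. \<Sum>a<\<beta>. if i = j then if a = 0 then 4 * \<sigma>\<^sup>2 else 0 else 2 * \<sigma>\<^sup>2)"
  proof -
    have "expectation ?H = (\<Sum>i<k. expectation (\<lambda>\<omega>. \<Sum>j<k. \<Sum>a<\<beta>. (csg a * XV m \<omega> (j, i, a) + XV m \<omega> (i, j, a))\<^sup>2))"
      using k by (intro Bochner_Integration.integral_sum Bochner_Integration.integrable_sum h(1)) auto
    also have "\<dots> = (\<Sum>i<k. \<Sum>j<k. expectation (\<lambda>\<omega>. \<Sum>a<\<beta>. (csg a * XV m \<omega> (j, i, a) + XV m \<omega> (i, j, a))\<^sup>2))"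
      using k by (intro sum.cong refl Bochner_Integration.integral_sum Bochner_Integration.integrable_sum h(1)) auto
    also have "\<dots> = (\<Sum>i<k. \<Sum>j<k. \<Sum>a<\<beta>. expectation (\<lambda>\<omega>. (csg a * XV m \<omega> (j, i, a) + XV m \<omega> (i, j, a))\<^sup>2))"
      using k by (intro sum.cong refl Bochner_Integration.integral_sum h(1)) auto
    also have "\<dots> = (\<Sum>i<k. \<Sum>j<k. \<Sum>a<\<beta>. if i = j then if a = 0 then 4 * \<sigma>\<^sup>2 else 0 else 2 * \<sigma>\<^sup>2)"
      using k by (intro sum.cong refl h(2)) auto
    finally show ?thesis .
  qed
  also have "\<dots> = (\<Sum>i<k. \<Sum>j<k. 2 * real \<beta> * \<sigma>\<^sup>2 + (if i = j then 4 * \<sigma>\<^sup>2 - 2 * real \<beta> * \<sigma>\<^sup>2 else 0))"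
    using \<beta> by (intro sum.cong refl) auto
  also have "\<dots> = real k * (real k * (2 * real \<beta> * \<sigma>\<^sup>2)) + real k * (4 * \<sigma>\<^sup>2 - 2 * real \<beta> * \<sigma>\<^sup>2)"
    by (simp add: sum.distrib distrib_left)
  finally have H2: "expectation ?H = real k * (real k * (2 * real \<beta> * \<sigma>\<^sup>2)) + real k * (4 * \<sigma>\<^sup>2 - 2 * real \<beta> * \<sigma>\<^sup>2)" .
  show "integrable M (\<lambda>\<omega>. EQ N k \<epsilon> (XV m \<omega>))"
    unfolding EQ_eq[OF k]
    by (intro Bochner_Integration.integrable_add Bochner_Integration.integrable_diff integrable_mult_right integrable_divide T B H)
  have "expectation (\<lambda>\<omega>. EQ N k \<epsilon> (XV m \<omega>))
    = \<epsilon> * (real d * expectation ?T) + \<epsilon>\<^sup>2 * (real d * expectation ?B - real d * expectation ?H / 2)"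
    unfolding EQ_eq[OF k] using T(1) B H by simp
  also have "\<dots> = \<epsilon>\<^sup>2 * real d * \<sigma>\<^sup>2 * real k * (real \<beta> * (real N - real k + 1) - 2)"
    unfolding T(2) B2 H2 by (simp add: field_simps)
  finally show "expectation (\<lambda>\<omega>. EQ N k \<epsilon> (XV m \<omega>)) = \<epsilon>\<^sup>2 * real d * \<sigma>\<^sup>2 * real k * (real \<beta> * (real N - real k + 1) - 2)" .
qed

lemma drift_expansion:
  assumes k: "k \<le> N"
  obtains C where "0 \<le> C" "\<And>\<epsilon>. 0 < \<epsilon> \<Longrightarrow> \<epsilon> \<le> 1 \<Longrightarrow>
    \<bar>drift k \<epsilon> - \<epsilon>\<^sup>2 * real d * \<sigma>\<^sup>2 * real k * (real \<beta> * (real N - real k + 1) - 2)\<bar> \<le> C * \<epsilon> ^ 3"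
proof -
  let ?\<Gamma> = "gauss (ix N) \<sigma>"
  obtain C where C: "0 \<le> C" "\<And>\<epsilon>. 0 < \<epsilon> \<Longrightarrow> \<epsilon> \<le> 1 \<Longrightarrow>
    (\<integral>\<^sup>+x. ennreal \<bar>ln (DE N k \<epsilon> x) - EQ N k \<epsilon> x\<bar> \<partial>?\<Gamma>) \<le> ennreal (C * \<epsilon> ^ 3)"
  proof (rule ln_D_expansion[OF \<sigma>_pos k], goal_cases)
    case (1 C)
    show ?case by (rule 1(1)[OF 1(2,3)])
  qed
  have "\<bar>drift k \<epsilon> - \<epsilon>\<^sup>2 * real d * \<sigma>\<^sup>2 * real k * (real \<beta> * (real N - real k + 1) - 2)\<bar> \<le> C * \<epsilon> ^ 3"
    if \<epsilon>: "0 < \<epsilon>" "\<epsilon> \<le> 1" for \<epsilon>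
  proof -
    have cm: "(\<lambda>x. x t) \<in> borel_measurable (PL (ix N))" if "t \<in> ix N" for t
      using measurable_component_singleton[OF that, of "\<lambda>_. lborel"] by simp
    have mEQ: "EQ N k \<epsilon> \<in> borel_measurable (PL (ix N))"
    proof -
      have \<beta>: "0 < \<beta>" using dyson_index by auto
      have c: "(\<lambda>x. x (i, j, a)) \<in> borel_measurable (PL (ix N))" if "i < N" "j < N" "a < \<beta>" for i j a
        using that by (intro cm) (simp add: ix_def)
      have "(\<lambda>x. \<epsilon> * (real d * (\<Sum>i<k. 2 * x (i, i, 0)))
        + \<epsilon>\<^sup>2 * (real d * (\<Sum>i<N. \<Sum>j<k. \<Sum>a<\<beta>. (x (i, j, a))\<^sup>2)
        - real d * (\<Sum>i<k. \<Sum>j<k. \<Sum>a<\<beta>. (csg a * x (j, i, a) + x (i, j, a))\<^sup>2) / 2)) \<in> borel_measurable (PL (ix N))"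
        using k \<beta> by (intro borel_measurable_add borel_measurable_diff borel_measurable_times borel_measurable_divide
          borel_measurable_const borel_measurable_sum borel_measurable_power c) auto
      thus ?thesis unfolding EQ_eq[OF k, abs_def] .
    qed
    have iEQ: "integrable ?\<Gamma> (EQ N k \<epsilon>)" using expectation_EQ(1)[OF k, of \<epsilon> 0] unfolding integral_XV(2)[OF mEQ] .
    have eEQ: "(\<integral>x. EQ N k \<epsilon> x \<partial>?\<Gamma>) = \<epsilon>\<^sup>2 * real d * \<sigma>\<^sup>2 * real k * (real \<beta> * (real N - real k + 1) - 2)"
      using expectation_EQ(2)[OF k, of \<epsilon> 0] integral_XV(1)[OF mEQ, of 0] by simp
    note iD = DE_integrability(5)[OF \<sigma>_pos k \<epsilon>(1)]
    have iDEQ: "integrable ?\<Gamma> (\<lambda>x. ln (DE N k \<epsilon> x) - EQ N k \<epsilon> x)" using iD iEQ by (rule Bochner_Integration.integrable_diff)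
    have "\<bar>drift k \<epsilon> - (\<integral>x. EQ N k \<epsilon> x \<partial>?\<Gamma>)\<bar> = \<bar>\<integral>x. ln (DE N k \<epsilon> x) - EQ N k \<epsilon> x \<partial>?\<Gamma>\<bar>"
      unfolding drift_def using iD iEQ by simp
    also have "\<dots> \<le> (\<integral>x. \<bar>ln (DE N k \<epsilon> x) - EQ N k \<epsilon> x\<bar> \<partial>?\<Gamma>)" by (rule integral_abs_bound)
    also have "\<dots> \<le> C * \<epsilon> ^ 3"
    proof -
      have "ennreal (\<integral>x. \<bar>ln (DE N k \<epsilon> x) - EQ N k \<epsilon> x\<bar> \<partial>?\<Gamma>) = (\<integral>\<^sup>+x. ennreal \<bar>ln (DE N k \<epsilon> x) - EQ N k \<epsilon> x\<bar> \<partial>?\<Gamma>)"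
        using iDEQ by (intro nn_integral_eq_integral[symmetric] integrable_abs) auto
      also have "\<dots> \<le> ennreal (C * \<epsilon> ^ 3)" by (rule C(2)[OF \<epsilon>])
      finally show ?thesis using C(1) \<epsilon> by (simp add: ennreal_le_iff)
    qed
    finally show ?thesis unfolding eEQ .
  qed
  from that[OF C(1) this] show ?thesis .
qed

end

theorem mainTheorem10:
  fixes M :: "'w measure"
    and X :: "nat \<Rightarrow> 'w \<Rightarrow> nat \<Rightarrow> nat \<Rightarrow> nat \<Rightarrow> real"
    and \<beta> N k :: nat
    and \<sigma> :: real
    and Y :: "real \<Rightarrow> nat \<Rightarrow> 'w \<Rightarrow> complex mat"
    and \<mu> :: "real \<Rightarrow> nat \<Rightarrow> real"
  assumes "\<beta> \<in> {1, 2, 4}" and "1 \<le> N" and "0 < \<sigma>"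
    and "iid_gaussian_matrices M \<beta> N \<sigma> X"
    and "1 \<le> k" and "k \<le> N"
  defines "Y \<equiv> \<lambda>c m \<omega>. perturbed_identity \<beta> N c (X m \<omega>)"
    and "\<mu> \<equiv> \<lambda>c. lyapunov_exponent M \<beta> N (Y c)"
  shows "(\<forall>c>0.
            integrable M (\<lambda>\<omega>. ln (gram_det \<beta> (first_columns \<beta> k (Y c 0 \<omega>)))) \<and>
            (\<Sum>i=1..k. \<mu> c i)
              = 1/2 * (\<integral>\<omega>. ln (gram_det \<beta> (first_columns \<beta> k (Y c 0 \<omega>))) \<partial>M)) \<and>
         (\<lambda>c. (\<Sum>i=1..k. \<mu> c i)
            - \<sigma>\<^sup>2 * real k * (real \<beta> * (real N - real k + 1) / 2 - 1) / c\<^sup>2)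
           \<in> o[at_top](\<lambda>c. 1 / c\<^sup>2)"
proof -
  interpret prob_space M using assms(4) by (simp add: iid_gaussian_matrices_def)
  interpret gaussian_matrices \<beta> M N \<sigma> X by unfold_locales (use assms in auto)
  have sum_\<mu>: "(\<Sum>i=1..k. \<mu> c i) = drift k (1 / c) / (2 * real d)" if "0 < c" for c
    unfolding \<mu>_def Y_def by (rule sum_lyapunov_exponents[OF \<open>k \<le> N\<close> that])
  have "integrable M (\<lambda>\<omega>. ln (gram_det \<beta> (first_columns \<beta> k (Y c 0 \<omega>)))) \<and>
      (\<Sum>i=1..k. \<mu> c i) = 1/2 * (\<integral>\<omega>. ln (gram_det \<beta> (first_columns \<beta> k (Y c 0 \<omega>))) \<partial>M)"
    if c: "0 < c" for c
    unfolding sum_\<mu>[OF c] unfolding Y_def using ln_gram_det_first_columns[OF \<open>k \<le> N\<close> c, of 0] by simp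
  moreover have "(\<lambda>c. (\<Sum>i=1..k. \<mu> c i) - \<sigma>\<^sup>2 * real k * (real \<beta> * (real N - real k + 1) / 2 - 1) / c\<^sup>2)
      \<in> o[at_top](\<lambda>c. 1 / c\<^sup>2)"
  proof (rule landau_o.smallI)
    fix e :: real assume e: "0 < e"
    obtain C where C: "0 \<le> C" "\<And>\<epsilon>. 0 < \<epsilon> \<Longrightarrow> \<epsilon> \<le> 1 \<Longrightarrow>
      \<bar>drift k \<epsilon> - \<epsilon>\<^sup>2 * real d * \<sigma>\<^sup>2 * real k * (real \<beta> * (real N - real k + 1) - 2)\<bar> \<le> C * \<epsilon> ^ 3"
    proof (rule drift_expansion[OF \<open>k \<le> N\<close>], goal_cases)
      case (1 C)
      show ?case by (rule 1(1)[OF 1(2,3)])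
    qed
    have dpos: "0 < real d" by simp
    \<comment> \<open>Dividing the drift by 2 d cancels d and halves \<beta> (N - k + 1) - 2, which
      gives the coefficient of the theorem.\<close>
    have rescale: "x / (2 * z) - s * l * (B / 2 - 1) / c\<^sup>2 = (x - (1 / c)\<^sup>2 * z * s * l * (B - 2)) / (2 * z)"
      if "0 < z" for x z s l B c :: real
    proof -
      have "(1 / c)\<^sup>2 * z * s * l * (B - 2) = 2 * z * (s * l * (B / 2 - 1) / c\<^sup>2)"
        by (simp add: power_one_over algebra_simps)
      thus ?thesis using that by (simp add: diff_divide_distrib)
    qed
    \<comment> \<open>The error is C / (2 d) times 1 / c^3, at most e / c^2 as soon as c \<ge> C /
      (2 d e); the condition c \<ge> 1 puts \<epsilon> = 1 / c into the range of the
      expansion.\<close>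
    show "\<forall>\<^sub>F c in at_top. norm ((\<Sum>i=1..k. \<mu> c i) - \<sigma>\<^sup>2 * real k * (real \<beta> * (real N - real k + 1) / 2 - 1) / c\<^sup>2)
        \<le> e * norm (1 / c\<^sup>2 :: real)"
      using eventually_ge_at_top[of "max 1 (C / (2 * real d) / e)"]
    proof eventually_elim
      case (elim c)
      hence c: "1 \<le> c" "C / (2 * real d) / e \<le> c" by auto
      let ?\<epsilon> = "1 / c" and ?A = "real \<beta> * (real N - real k + 1) - 2"
      have "drift k ?\<epsilon> / (2 * real d) - \<sigma>\<^sup>2 * real k * (real \<beta> * (real N - real k + 1) / 2 - 1) / c\<^sup>2
        = (drift k ?\<epsilon> - ?\<epsilon>\<^sup>2 * real d * \<sigma>\<^sup>2 * real k * ?A) / (2 * real d)"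
        by (rule rescale[OF dpos])
      also have "\<bar>\<dots>\<bar> = \<bar>drift k ?\<epsilon> - ?\<epsilon>\<^sup>2 * real d * \<sigma>\<^sup>2 * real k * ?A\<bar> / (2 * real d)" by simp
      also have "\<dots> \<le> C * ?\<epsilon> ^ 3 / (2 * real d)"
        using c(1) by (intro divide_right_mono C(2)) auto
      also have "\<dots> = C / (2 * real d) * ?\<epsilon> * (1 / c\<^sup>2)" by (simp add: power3_eq_cube power2_eq_square)
      also have "\<dots> \<le> e * (1 / c\<^sup>2)"
      proof (rule mult_right_mono)
        have "C / (2 * real d) \<le> e * c" using c(2) e by (simp only: pos_divide_le_eq mult.commute)
        thus "C / (2 * real d) * ?\<epsilon> \<le> e" using c(1) by (simp add: pos_divide_le_eq mult_ac)
      qed simp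
      finally show ?case using sum_\<mu>[of c] c(1) by simp
    qed
  qed
  ultimately show ?thesis by blast
qed

end
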